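(* Let ${\bf b}=({\bf b}^1,0,1,{\bf b}^2)$ and ${\bf b}'=({\bf b}^1,1,0,{\bf b}^2)$ be adjacent $0^m1^n$-sequences. Then: (1) the restriction of $\mathcal R^u:\widetilde{\mathbb T}_{\mathbb U}\to\widetilde{\mathbb T}_{\mathbb U}'$ gives an isomorphism $\mathcal R^u:\ddot{\mathbb T}_{\mathbb U}\to\ddot{\mathbb T}_{\mathbb U}'$; (2) the canonical bases of $\widehat{\mathbb T}_{\mathbb U}$ and $\widehat{\mathbb T}_{\mathbb U}'$ lie in $\ddot{\mathbb T}_{\mathbb U}$ and $\ddot{\mathbb T}_{\mathbb U}'$, respectively; (3) $\mathcal R^u(U_f)=U'_{f^{\mathbb U}}$, $\mathcal R^u(\mathtt T_f)=\mathtt T'_{f^{\mathbb U}}$, and $\mathcal R^u(T^{\bf b}_f)=T^{{\bf b}'}_{f^{\mathbb U}}$ for all $f\in\mathbb Z^{m+n}$.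
   Context: **Quantum group.** Let $q$ be an indeterminate; $\overline{\phantom{x}}$ is the automorphism of $\mathbb{Q}(q)$ with $\overline{q}=q^{-1}$. $U_q(\mathfrak{gl}_\infty)$ is the $\mathbb{Q}(q)$-algebra generated by $E_a,F_a,K_a^{\pm1}$ ($a\in\mathbb{Z}$) with relations: the $K_a$ commute; $K_aE_bK_a^{-1}=q^{\delta_{a,b}-\delta_{a,b+1}}E_b$; $K_aF_bK_a^{-1}=q^{\delta_{a,b+1}-\delta_{a,b}}F_b$; $E_aF_b-F_bE_a=\delta_{a,b}(K_{a,a+1}-K_{a+1,a})/(q-q^{-1})$, where $K_{a,b}=K_aK_b^{-1}$; $E_a^2E_b+E_bE_a^2=(q+q^{-1})E_aE_bE_a$ if $|a-b|=1$, $E_aE_b=E_bE_a$ if $|a-b|>1$, and the same for the $F$'s. Its bar involution is the anti-linear ring automorphism fixing $E_a,F_a$ and sending $K_a\mapsto K_a^{-1}$. Comultiplication: $\Delta(E_a)=1\otimes E_a+E_a\otimes K_{a+1,a}$, $\Delta(F_a)=F_a\otimes1+K_{a,a+1}\otimes F_a$, $\Delta(K_a)=K_a\otimes K_a$. $\mathbb V$ has basis $\{v_a\}_{a\in\mathbb Z}$ with $K_av_b=q^{\delta_{ab}}v_b$, $E_av_b=\delta_{a+1,b}v_a$, $F_av_b=\delta_{a,b}v_{a+1}$; $\mathbb W$ has basis $\{w_a\}_{a\in\mathbb Z}$ with $K_aw_b=q^{-\delta_{ab}}w_b$, $E_aw_b=\delta_{a,b}w_{a+1}$, $F_aw_b=\delta_{a+1,b}w_a$.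 **Fock space.** A $0^m1^n$-sequence is ${\bf b}=(b_1,\dots,b_{m+n})$ with $m$ entries $0$ and $n$ entries $1$. $\mathbb T^{\bf b}=\mathbb V^{b_1}\otimes\cdots\otimes\mathbb V^{b_{m+n}}$ with $\mathbb V^0=\mathbb V$, $\mathbb V^1=\mathbb W$. For $f\in\mathbb Z^{m+n}$ (functions $[m+n]=\{1,\dots,m+n\}\to\mathbb Z$) let $M^{\bf b}_f$ be the tensor of basis vectors whose $i$-th factor is $v_{f(i)}$ if $b_i=0$, $w_{f(i)}$ if $b_i=1$. Put $\sharp_{\bf b}(f,a,j)=\sum_{i\ge j,\,f(i)\le a}(-1)^{b_i}$. Bruhat order: $g\preceq_{\bf b}f$ iff $\sharp_{\bf b}(g,a,j)\le\sharp_{\bf b}(f,a,j)$ for all $a\in\mathbb Z$, $j\in[m+n]$, with equality for $j=1$. The $A$-completion $\widetilde{\mathbb T}^{\bf b}$ consists of all formal, possibly infinite, linear combinations of the $M^{\bf b}_f$; the $B$-completion $\widehat{\mathbb T}^{\bf b}\subseteq\widetilde{\mathbb T}^{\bf b}$ is the span of elements $M^{\bf b}_f+\sum_{g\prec_{\bf b}f}r_gM^{\bf b}_g$ (possibly infinite sums). **Bar map.** For $k\ge1$ let $U_k$ be the subalgebra generated by $E_a,F_a,K_a^{\pm1},K_{a+1}^{\pm1}$, $-k\le a\le k-1$, with positive and negative parts $U_k^\pm$, and let $\Theta^{(k)}=\sum_\mu\Theta^{(k)}_\mu$, $\Theta^{(k)}_\mu\in U^+_{k,\mu}\otimes U^-_{k,-\mu}$,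 be its quasi-$\mathcal R$-matrix: the unique such formal sum with $\Theta^{(k)}_0=1\otimes1$ and $\Delta(u)\Theta^{(k)}=\Theta^{(k)}\,\overline{\Delta(\overline u)}$ for all $u\in U_k$. On the span of the $M_f^{\bf b}$ with all $|f(i)|\le k$ define an anti-linear map $\psi^{(k)}$ inductively: it fixes basis vectors of a single tensor factor, and $\psi^{(k)}(x\otimes y)=\Theta^{(k)}(\psi^{(k)}(x)\otimes y)$ for $y$ a basis vector of the last factor. For each $f$ the coefficients of $\psi^{(\ell)}(M_f^{\bf b})$ stabilize as $\ell\to\infty$; the limit is $\overline{M^{\bf b}_f}=M^{\bf b}_f+\sum_{g\prec_{\bf b}f}r_{gf}(q)M_g^{\bf b}$, $r_{gf}\in\mathbb Z[q,q^{-1}]$. It extends to an anti-linear involution of $\widehat{\mathbb T}^{\bf b}$ (intervals of $\preceq_{\bf b}$ are finite). **Canonical basis.** $T^{\bf b}_f=M^{\bf b}_f+\sum_{g\prec_{\bf b}f}t^{\bf b}_{gf}(q)M^{\bf b}_g$ is the unique bar-invariant element of $\widehat{\mathbb T}^{\bf b}$ of this form with all $t^{\bf b}_{gf}\in q\mathbb Z[q]$. **Adjacent sequences.** In ${\bf b}=({\bf b}^1,0,1,{\bf b}^2)$, ${\bf b}'=({\bf b}^1,1,0,{\bf b}^2)$ the exchanged entries are in positions $\kappa,\kappa+1$. For $f\in\mathbb Z^{m+n}$, $f\cdot\tau$ is $f$ with the values at $\kappa$ and $\kappa+1$ interchanged; if $f(\kappa)=f(\kappa+1)$, then $f^{\uparrow}$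 (resp. $f^{\downarrow}$) is $f$ with both values at $\kappa,\kappa+1$ increased (resp. decreased) by $1$. Set $f^{\mathbb L}=f^{\mathbb U}=f\cdot\tau$ if $f(\kappa)\ne f(\kappa+1)$, and $f^{\mathbb L}=f^\uparrow$, $f^{\mathbb U}=f^\downarrow$ if $f(\kappa)=f(\kappa+1)$. **The spaces.** Let $U_f=M^{\bf b}_f+qM^{\bf b}_{f^{\downarrow}}$ if $f(\kappa)=f(\kappa+1)$ and $U_f=M^{\bf b}_f$ otherwise; let $U'_f=M^{{\bf b}'}_f+qM^{{\bf b}'}_{f^{\uparrow}}$ if $f(\kappa)=f(\kappa+1)$ and $U'_f=M^{{\bf b}'}_f$ otherwise. (In positions $\kappa,\kappa+1$ one uses the canonical basis of $\mathbb V\widehat\otimes\mathbb W$, resp. $\mathbb W\widehat\otimes\mathbb V$, spanning $U_q(\mathfrak{gl}_\infty)$-modules $\mathbb U$, resp. $\mathbb U'$.) $\mathbb T_{\mathbb U}$ and $\mathbb T_{\mathbb U}'$ are the $\mathbb Q(q)$-spans of $\{U_f\}$ and $\{U'_f\}$. Their $A$-completions $\widetilde{\mathbb T}_{\mathbb U},\widetilde{\mathbb T}'_{\mathbb U}$ are the spaces of all formal, possibly infinite, combinations of the $U_f$, resp. $U'_f$. The $B$-completion $\widehat{\mathbb T}_{\mathbb U}$ is spanned by elements $U_f+\sum_{g\prec_{\bf b}f}d_gU_g$, and $\widehat{\mathbb T}'_{\mathbb U}$ by elements $U'_f+\sum_{g\prec_{{\bf b}'}f}d_gU'_g$ (possibly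 infinite sums). One has $\widehat{\mathbb T}_{\mathbb U}\subseteq\widehat{\mathbb T}^{\bf b}$, $\widehat{\mathbb T}'_{\mathbb U}\subseteq\widehat{\mathbb T}^{{\bf b}'}$, stable under the bar involutions. The canonical basis of $\widehat{\mathbb T}_{\mathbb U}$ consists of the unique bar-invariant elements $\mathtt T_f=U_f+\sum_{g\prec_{\bf b}f}\check t_{gf}(q)U_g$ with $\check t_{gf}\in q\mathbb Z[q]$; the canonical basis $\{\mathtt T'_f\}$ of $\widehat{\mathbb T}'_{\mathbb U}$ is defined in the same way with $U'$ and $\prec_{{\bf b}'}$. **$C$-completions.** $\ddot{\mathbb T}_{\mathbb U}\subseteq\widetilde{\mathbb T}_{\mathbb U}$ is spanned by the (possibly infinite) sums $U_f+\sum_g r_gU_g$ over $g$ with $g\prec_{\bf b}f$ and $g^{\mathbb U}\prec_{{\bf b}'}f^{\mathbb U}$; $\ddot{\mathbb T}'_{\mathbb U}\subseteq\widetilde{\mathbb T}'_{\mathbb U}$ is spanned by the sums $U'_f+\sum_g r_gU'_g$ over $g$ with $g\prec_{{\bf b}'}f$ and $g^{\mathbb L}\prec_{\bf b}f^{\mathbb L}$ ($r_g\in\mathbb Q(q)$). **The map $\mathcal R^u$.** $\mathcal R^u:\mathbb T_{\mathbb U}\to\mathbb T'_{\mathbb U}$ is the $\mathbb Q(q)$-linear map $U_f\mapsto U'_{f^{\mathbb U}}$ (an isomorphism of $U_q(\mathfrak{gl}_\infty)$-modules), extended continuously to $\widetilde{\mathbb T}_{\mathbb U}\to\widetilde{\mathbb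 T}'_{\mathbb U}$. *)

theory Defs
  imports
    "HOL-Library.Poly_Mapping"
    "HOL-Library.Product_Plus"
    "HOL-Library.Function_Algebras"
    "HOL-Computational_Algebra.Computational_Algebra"
    "HOL-Computational_Algebra.Field_as_Ring"
begin

section \<open>The field \<open>\<rat>(q)\<close>\<close>

type_synonym qfield = "rat poly fract"

definition qq :: qfield where
  "qq = Fract [:0, 1:] 1"

definition eval_inv :: "rat poly \<Rightarrow> qfield" where
  "eval_inv p = poly (map_poly (\<lambda>c. Fract [:c:] 1) p) (inverse qq)"

text \<open>The automorphism \<open>q \<mapsto> q\<^sup>-\<^sup>1\<close>: substitute \<open>inverse qq\<close> in numerator and denominator.\<close>

definition qbar :: "qfield \<Rightarrow> qfield" where
  "qbar x = (case quot_of_fract x of (p, r) \<Rightarrow> eval_inv p / eval_inv r)"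

definition qZq :: "qfield set" where
  "qZq = {qq * Fract (map_poly rat_of_int p) 1 | p :: int poly. True}"


section \<open>Free algebras and tensor products\<close>

text \<open>Lists form a monoid under concatenation, so that \<open>'g list \<Rightarrow>\<^sub>0 qfield\<close> with the convolution
  product is the free associative algebra (tensor algebra) on \<open>'g\<close>, and
  \<open>('g list \<times> 'g list) \<Rightarrow>\<^sub>0 qfield\<close> is the tensor product of two copies of it, with
  \<open>(a \<otimes> b)(c \<otimes> d) = ac \<otimes> bd\<close>.\<close>

instantiation list :: (type) monoid_add
begin

definition zero_list_def: "0 = []"
definition plus_list_def: "xs + ys = xs @ ys"

instance
  by standard (simp_all add: zero_list_def plus_list_def)

end

definition cst :: "qfield \<Rightarrow> ('k::monoid_add \<Rightarrow>\<^sub>0 qfield)" where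
  "cst c = Poly_Mapping.single 0 c"

text \<open>The linear, resp. anti-linear, map with prescribed values on the basis.\<close>

definition lin_ext :: "('k \<Rightarrow> ('l::monoid_add \<Rightarrow>\<^sub>0 qfield)) \<Rightarrow> ('k \<Rightarrow>\<^sub>0 qfield) \<Rightarrow> ('l \<Rightarrow>\<^sub>0 qfield)" where
  "lin_ext F x = (\<Sum>k\<in>Poly_Mapping.keys x. cst (Poly_Mapping.lookup x k) * F k)"

definition antilin_ext :: "('k \<Rightarrow> ('l::monoid_add \<Rightarrow>\<^sub>0 qfield)) \<Rightarrow> ('k \<Rightarrow>\<^sub>0 qfield) \<Rightarrow> ('l \<Rightarrow>\<^sub>0 qfield)" where
  "antilin_ext F x = (\<Sum>k\<in>Poly_Mapping.keys x. cst (qbar (Poly_Mapping.lookup x k)) * F k)"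

definition tens ::
    "('k \<Rightarrow>\<^sub>0 qfield) \<Rightarrow> ('l \<Rightarrow>\<^sub>0 qfield) \<Rightarrow> ('k::monoid_add \<times> 'l::monoid_add \<Rightarrow>\<^sub>0 qfield)" where
  "tens x y = lin_ext (\<lambda>k. lin_ext (\<lambda>l. Poly_Mapping.single (k, l) 1) y) x"

inductive_set two_sided_ideal :: "'r::ring_1 set \<Rightarrow> 'r set" for R :: "'r set" where
  gen: "r \<in> R \<Longrightarrow> r \<in> two_sided_ideal R"
| zero: "0 \<in> two_sided_ideal R"
| add: "x \<in> two_sided_ideal R \<Longrightarrow> y \<in> two_sided_ideal R \<Longrightarrow> x + y \<in> two_sided_ideal R"
| mult_left: "x \<in> two_sided_ideal R \<Longrightarrow> r * x \<in> two_sided_ideal R"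
| mult_right: "x \<in> two_sided_ideal R \<Longrightarrow> x * r \<in> two_sided_ideal R"


section \<open>The quantum group\<close>

text \<open>\<open>U\<^sub>q(gl\<^sub>\<infinity>)\<close> is the free algebra on the letters below modulo the ideal generated by
  \<open>uq_rels\<close>; its elements are handled through representatives in the free algebra, equality
  being congruence modulo the ideal.\<close>

datatype gen = gE int | gF int | gK int | gKinv int

type_synonym free = "gen list \<Rightarrow>\<^sub>0 qfield"
type_synonym free2 = "gen list \<times> gen list \<Rightarrow>\<^sub>0 qfield"

definition xE :: "int \<Rightarrow> free" where "xE a = Poly_Mapping.single [gE a] 1"
definition xF :: "int \<Rightarrow> free" where "xF a = Poly_Mapping.single [gF a] 1"
definition xK :: "int \<Rightarrow> free" where "xK a = Poly_Mapping.single [gK a] 1"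
definition xKinv :: "int \<Rightarrow> free" where "xKinv a = Poly_Mapping.single [gKinv a] 1"

definition xKK :: "int \<Rightarrow> int \<Rightarrow> free" where
  "xKK a b = xK a * xKinv b"

definition uq_rels :: "free set" where
  "uq_rels =
     {xK a * xKinv a - 1 | a. True} \<union>
     {xKinv a * xK a - 1 | a. True} \<union>
     {xK a * xK b - xK b * xK a | a b. True} \<union>
     {xK a * xE b * xKinv a - cst (qq powi (of_bool (a = b) - of_bool (a = b + 1))) * xE b | a b. True} \<union>
     {xK a * xF b * xKinv a - cst (qq powi (of_bool (a = b + 1) - of_bool (a = b))) * xF b | a b. True} \<union>
     {xE a * xF b - xF b * xE a
        - cst (of_bool (a = b) / (qq - inverse qq)) * (xKK a (a + 1) - xKK (a + 1) a) | a b. True} \<union>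
     {xE a * xE a * xE b + xE b * xE a * xE a - cst (qq + inverse qq) * (xE a * xE b * xE a) | a b. \<bar>a - b\<bar> = 1} \<union>
     {xE a * xE b - xE b * xE a | a b. \<bar>a - b\<bar> > 1} \<union>
     {xF a * xF a * xF b + xF b * xF a * xF a - cst (qq + inverse qq) * (xF a * xF b * xF a) | a b. \<bar>a - b\<bar> = 1} \<union>
     {xF a * xF b - xF b * xF a | a b. \<bar>a - b\<bar> > 1}"

text \<open>\<open>U \<otimes> U\<close> is \<open>free2\<close> modulo the following ideal (for \<open>U = A/I\<close> one has
  \<open>U \<otimes> U = (A \<otimes> A)/(I \<otimes> A + A \<otimes> I)\<close>).\<close>

definition uq2_ideal :: "free2 set" where
  "uq2_ideal = two_sided_ideal ({tens r 1 | r. r \<in> uq_rels} \<union> {tens 1 r | r. r \<in> uq_rels})"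

fun comult_gen :: "gen \<Rightarrow> free2" where
  "comult_gen (gE a) = tens 1 (xE a) + tens (xE a) (xKK (a + 1) a)"
| "comult_gen (gF a) = tens (xF a) 1 + tens (xKK a (a + 1)) (xF a)"
| "comult_gen (gK a) = tens (xK a) (xK a)"
| "comult_gen (gKinv a) = tens (xKinv a) (xKinv a)"

definition comult :: "free \<Rightarrow> free2" where
  "comult = lin_ext (\<lambda>w. prod_list (map comult_gen w))"

fun bar_gen :: "gen \<Rightarrow> gen" where
  "bar_gen (gE a) = gE a"
| "bar_gen (gF a) = gF a"
| "bar_gen (gK a) = gKinv a"
| "bar_gen (gKinv a) = gK a"

definition bar_free :: "free \<Rightarrow> free" where
  "bar_free = antilin_ext (\<lambda>w. Poly_Mapping.single (map bar_gen w) 1)"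

definition bar_free2 :: "free2 \<Rightarrow> free2" where
  "bar_free2 = antilin_ext (\<lambda>(w, v). Poly_Mapping.single (map bar_gen w, map bar_gen v) 1)"


section \<open>The quasi-R-matrix\<close>

text \<open>Weights are written in the coordinates of the \<open>\<epsilon>\<^sub>c\<close>; the simple root of \<open>E\<^sub>a\<close> is
  \<open>\<epsilon>\<^sub>a - \<epsilon>\<^sub>a\<^sub>+\<^sub>1\<close>.\<close>

fun wt_gen :: "gen \<Rightarrow> int \<Rightarrow> int" where
  "wt_gen (gE a) = (\<lambda>c. of_bool (c = a) - of_bool (c = a + 1))"
| "wt_gen (gF a) = (\<lambda>c. of_bool (c = a + 1) - of_bool (c = a))"
| "wt_gen (gK a) = (\<lambda>c. 0)"
| "wt_gen (gKinv a) = (\<lambda>c. 0)"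

definition wt :: "gen list \<Rightarrow> int \<Rightarrow> int" where
  "wt w = (\<lambda>c. \<Sum>g\<leftarrow>w. wt_gen g c)"

definition bidegree_part :: "(int \<Rightarrow> int) \<Rightarrow> (int \<Rightarrow> int) \<Rightarrow> free2 \<Rightarrow> free2" where
  "bidegree_part l n = lin_ext (\<lambda>(w, v). if wt w = l \<and> wt v = n then Poly_Mapping.single (w, v) 1 else 0)"

definition pos_letters :: "nat \<Rightarrow> gen set" where
  "pos_letters k = {gE a | a. - int k \<le> a \<and> a \<le> int k - 1}"

definition neg_letters :: "nat \<Rightarrow> gen set" where
  "neg_letters k = {gF a | a. - int k \<le> a \<and> a \<le> int k - 1}"

definition letters :: "nat \<Rightarrow> gen set" where
  "letters k = pos_letters k \<union> neg_letters k
     \<union> {gK a | a. - int k \<le> a \<and> a \<le> int k} \<union> {gKinv a | a. - int k \<le> a \<and> a \<le> int k}"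

text \<open>The family \<open>\<Theta>\<^sub>\<mu>\<close> stands for the formal sum \<open>\<Sum>\<^sub>\<mu> \<Theta>\<^sub>\<mu>\<close>. Formal sums live in the product of the
  bigraded pieces of \<open>U \<otimes> U\<close>, so the intertwining identity is read off in every bidegree
  \<open>(l, n)\<close>, where only finitely many \<open>\<mu>\<close> contribute.\<close>

definition is_quasi_R :: "nat \<Rightarrow> ((int \<Rightarrow> int) \<Rightarrow> free2) \<Rightarrow> bool" where
  "is_quasi_R k \<Theta> \<longleftrightarrow>
     (\<forall>\<mu>. \<forall>(w, v) \<in> Poly_Mapping.keys (\<Theta> \<mu>).
        set w \<subseteq> pos_letters k \<and> wt w = \<mu> \<and> set v \<subseteq> neg_letters k \<and> wt v = - \<mu>) \<and>
     \<Theta> 0 = 1 \<and>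
     (\<forall>u :: free. (\<forall>w \<in> Poly_Mapping.keys u. set w \<subseteq> letters k) \<longrightarrow>
        (\<forall>l n.
          Sum_any (\<lambda>\<mu>. bidegree_part l n (comult u * \<Theta> \<mu>))
          - Sum_any (\<lambda>\<mu>. bidegree_part l n (\<Theta> \<mu> * bar_free2 (comult (bar_free u)))) \<in> uq2_ideal))"

text \<open>Unique modulo \<open>uq2_ideal\<close>; the choice is that of representatives.\<close>

definition quasi_R :: "nat \<Rightarrow> (int \<Rightarrow> int) \<Rightarrow> free2" where
  "quasi_R k = (SOME \<Theta>. is_quasi_R k \<Theta>)"


section \<open>Fock spaces\<close>

text \<open>The basis vector \<open>M\<^sub>f\<close> is \<open>Poly_Mapping.single f 1\<close> with \<open>f\<close> the list of the values
  \<open>f(1), \<dots>, f(m+n)\<close> (so that positions are counted from 0), and the tensor product of vectors is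
  the convolution product. An entry 0 (resp. 1) of a sequence denotes a factor \<open>\<V>\<close> (resp. \<open>\<W>\<close>).\<close>

type_synonym vec = "int list \<Rightarrow>\<^sub>0 qfield"

definition is_01_seq :: "nat \<Rightarrow> nat \<Rightarrow> nat list \<Rightarrow> bool" where
  "is_01_seq m n b \<longleftrightarrow> set b \<subseteq> {0, 1} \<and> count_list b 0 = m \<and> count_list b 1 = n"

fun act_V :: "gen \<Rightarrow> int \<Rightarrow> vec" where
  "act_V (gE a) b = (if b = a + 1 then Poly_Mapping.single [a] 1 else 0)"
| "act_V (gF a) b = (if b = a then Poly_Mapping.single [a + 1] 1 else 0)"
| "act_V (gK a) b = Poly_Mapping.single [b] (qq powi of_bool (a = b))"
| "act_V (gKinv a) b = Poly_Mapping.single [b] (qq powi (- of_bool (a = b)))"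

fun act_W :: "gen \<Rightarrow> int \<Rightarrow> vec" where
  "act_W (gE a) b = (if b = a then Poly_Mapping.single [a + 1] 1 else 0)"
| "act_W (gF a) b = (if b = a + 1 then Poly_Mapping.single [a] 1 else 0)"
| "act_W (gK a) b = Poly_Mapping.single [b] (qq powi (- of_bool (a = b)))"
| "act_W (gKinv a) b = Poly_Mapping.single [b] (qq powi of_bool (a = b))"

definition act_factor :: "nat \<Rightarrow> gen \<Rightarrow> int list \<Rightarrow> vec" where
  "act_factor s g f = (if s = 0 then act_V g (hd f) else act_W g (hd f))"

text \<open>Below, \<open>A g f\<close> is the image of the basis vector indexed by \<open>f\<close> under the generator \<open>g\<close>.\<close>

definition act_word :: "(gen \<Rightarrow> int list \<Rightarrow> vec) \<Rightarrow> gen list \<Rightarrow> vec \<Rightarrow> vec" where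
  "act_word A w x = foldr (\<lambda>g. lin_ext (A g)) w x"

definition act_tens ::
    "(gen \<Rightarrow> int list \<Rightarrow> vec) \<Rightarrow> (gen \<Rightarrow> int list \<Rightarrow> vec) \<Rightarrow> free2 \<Rightarrow> vec \<Rightarrow> vec \<Rightarrow> vec" where
  "act_tens A B t x y = lin_ext (\<lambda>(w, v). act_word A w x * act_word B v y) t"

text \<open>The action on \<open>\<T>\<^sup>b\<close>, splitting off the last factor by comultiplication. Only nonempty
  sequences are meaningful.\<close>

function act_gen :: "nat list \<Rightarrow> gen \<Rightarrow> int list \<Rightarrow> vec" where
  "act_gen b g f =
     (if length b \<le> 1 then act_factor (hd b) g f
      else act_tens (act_gen (butlast b)) (act_factor (last b)) (comult_gen g)
             (Poly_Mapping.single (butlast f) 1) (Poly_Mapping.single [last f] 1))"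
  by auto
termination
  by (relation "measure (\<lambda>(b, _, _). length b)") auto

declare act_gen.simps [simp del]

text \<open>\<open>\<psi>\<^sup>(\<^sup>k\<^sup>)(M\<^sub>f)\<close>. The sum over the weights has only finitely many nonzero terms, because only
  finitely many \<open>\<Theta>\<^sub>\<mu>\<close> act nontrivially on the last factor.\<close>

function psi :: "nat \<Rightarrow> nat list \<Rightarrow> int list \<Rightarrow> vec" where
  "psi k b f =
     (if length b \<le> 1 then Poly_Mapping.single f 1
      else Sum_any (\<lambda>\<mu>. act_tens (act_gen (butlast b)) (act_factor (last b)) (quasi_R k \<mu>)
             (psi k (butlast b) (butlast f)) (Poly_Mapping.single [last f] 1)))"
  by auto
termination
  by (relation "measure (\<lambda>(_, b, _). length b)") auto

declare psi.simps [simp del]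

text \<open>The coefficient of \<open>M\<^sub>g\<close> in the bar conjugate of \<open>M\<^sub>f\<close>: the stable value of the
  coefficients of \<open>\<psi>\<^sup>(\<^sup>l\<^sup>)(M\<^sub>f)\<close>.\<close>

definition bar_coeff :: "nat list \<Rightarrow> int list \<Rightarrow> int list \<Rightarrow> qfield" where
  "bar_coeff b f g = (THE c. \<forall>\<^sub>F l in sequentially. Poly_Mapping.lookup (psi l b f) g = c)"


section \<open>Bruhat order and completions\<close>

text \<open>As positions are counted from 0, \<open>j\<close> ranges over \<open>0, \<dots>, m+n-1\<close>.\<close>

definition sharp :: "nat list \<Rightarrow> int list \<Rightarrow> int \<Rightarrow> nat \<Rightarrow> int" where
  "sharp b f a j = (\<Sum>i | j \<le> i \<and> i < length b \<and> f ! i \<le> a. (-1) ^ (b ! i))"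

definition bruhat_le :: "nat list \<Rightarrow> int list \<Rightarrow> int list \<Rightarrow> bool" where
  "bruhat_le b g f \<longleftrightarrow> length g = length b \<and> length f = length b \<and>
     (\<forall>a. \<forall>j < length b. sharp b g a j \<le> sharp b f a j) \<and>
     (\<forall>a. sharp b g a 0 = sharp b f a 0)"

definition bruhat_less :: "nat list \<Rightarrow> int list \<Rightarrow> int list \<Rightarrow> bool" where
  "bruhat_less b g f \<longleftrightarrow> bruhat_le b g f \<and> g \<noteq> f"

text \<open>A formal, possibly infinite, combination of a family indexed by \<open>\<int>\<^sup>m\<^sup>+\<^sup>n\<close> is its coefficient
  function, extended by 0 to lists of other lengths.\<close>

type_synonym fvec = "int list \<Rightarrow> qfield"

global_interpretation fvec: vector_space "\<lambda>(c :: qfield) (x :: fvec) f. c * x f"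
  by standard (auto simp: fun_eq_iff algebra_simps)

definition unit_fvec :: "int list \<Rightarrow> fvec" where
  "unit_fvec f = (\<lambda>g. of_bool (g = f))"

definition A_completion :: "nat \<Rightarrow> fvec set" where
  "A_completion r = {x. \<forall>f. x f \<noteq> 0 \<longrightarrow> length f = r}"

definition unitriangular :: "(int list \<Rightarrow> int list \<Rightarrow> bool) \<Rightarrow> int list \<Rightarrow> fvec set" where
  "unitriangular R f = {x. x f = 1 \<and> (\<forall>g. x g \<noteq> 0 \<longrightarrow> g = f \<or> R g f)}"

definition completion :: "nat \<Rightarrow> (int list \<Rightarrow> int list \<Rightarrow> bool) \<Rightarrow> fvec set" where
  "completion r R = fvec.span (\<Union>f\<in>{f. length f = r}. unitriangular R f)"

text \<open>In the coordinates of the \<open>M\<^sub>f\<close>, the following is the B-completion of \<open>\<T>\<^sup>b\<close>; in the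
  coordinates of the \<open>U\<^sub>f\<close> (resp. \<open>U'\<^sub>f\<close>) it is the B-completion of \<open>\<T>\<^sub>\<U>\<close> (resp. \<open>\<T>'\<^sub>\<U>\<close>).\<close>

definition B_completion :: "nat list \<Rightarrow> fvec set" where
  "B_completion b = completion (length b) (bruhat_less b)"

text \<open>The continuous linear map sending the \<open>f\<close>-th basis vector to \<open>F f\<close>, for families \<open>F\<close> for
  which every coefficient of the image is a finite sum.\<close>

definition cont_ext :: "(int list \<Rightarrow> fvec) \<Rightarrow> fvec \<Rightarrow> fvec" where
  "cont_ext F x = (\<lambda>g. Sum_any (\<lambda>f. x f * F f g))"

definition bar_T :: "nat list \<Rightarrow> fvec \<Rightarrow> fvec" where
  "bar_T b x = (\<lambda>g. Sum_any (\<lambda>f. qbar (x f) * bar_coeff b f g))"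

definition canon_T :: "nat list \<Rightarrow> int list \<Rightarrow> fvec" where
  "canon_T b f = (THE x. x \<in> unitriangular (bruhat_less b) f \<and>
     (\<forall>g. g \<noteq> f \<longrightarrow> x g \<in> qZq) \<and> bar_T b x = x)"


section \<open>Adjacent sequences\<close>

text \<open>The exchanged entries sit in the positions \<open>\<kappa>\<close> and \<open>\<kappa> + 1\<close>, counted from 0.\<close>

definition swap_at :: "nat \<Rightarrow> int list \<Rightarrow> int list" where
  "swap_at \<kappa> f = f[\<kappa> := f ! (\<kappa> + 1), \<kappa> + 1 := f ! \<kappa>]"

definition up :: "nat \<Rightarrow> int list \<Rightarrow> int list" where
  "up \<kappa> f = f[\<kappa> := f ! \<kappa> + 1, \<kappa> + 1 := f ! (\<kappa> + 1) + 1]"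

definition down :: "nat \<Rightarrow> int list \<Rightarrow> int list" where
  "down \<kappa> f = f[\<kappa> := f ! \<kappa> - 1, \<kappa> + 1 := f ! (\<kappa> + 1) - 1]"

definition fL :: "nat \<Rightarrow> int list \<Rightarrow> int list" where
  "fL \<kappa> f = (if f ! \<kappa> = f ! (\<kappa> + 1) then up \<kappa> f else swap_at \<kappa> f)"

definition fU :: "nat \<Rightarrow> int list \<Rightarrow> int list" where
  "fU \<kappa> f = (if f ! \<kappa> = f ! (\<kappa> + 1) then down \<kappa> f else swap_at \<kappa> f)"

text \<open>\<open>U\<^sub>f\<close> and \<open>U'\<^sub>f\<close> in the coordinates of the \<open>M\<^sup>b\<^sub>g\<close>, resp. of the \<open>M\<close> attached to the
  second sequence.\<close>

definition U_vec :: "nat \<Rightarrow> int list \<Rightarrow> fvec" where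
  "U_vec \<kappa> f = (if f ! \<kappa> = f ! (\<kappa> + 1)
     then (\<lambda>g. unit_fvec f g + qq * unit_fvec (down \<kappa> f) g) else unit_fvec f)"

definition U'_vec :: "nat \<Rightarrow> int list \<Rightarrow> fvec" where
  "U'_vec \<kappa> f = (if f ! \<kappa> = f ! (\<kappa> + 1)
     then (\<lambda>g. unit_fvec f g + qq * unit_fvec (up \<kappa> f) g) else unit_fvec f)"

text \<open>Elements of \<open>\<T>\<^sub>\<U>\<close> and its completions are given by their coordinates with respect to the
  \<open>U\<^sub>f\<close>, so that \<open>U\<^sub>f\<close> itself is \<open>unit_fvec f\<close>; likewise for the primed spaces. The maps below
  express such a combination through the \<open>M\<^sub>g\<close>. They have a kernel on the A-completion but are
  injective on the B-completion, and there they are the inclusions into the B-completions of the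
  Fock spaces.\<close>

definition expand_U :: "nat \<Rightarrow> fvec \<Rightarrow> fvec" where
  "expand_U \<kappa> = cont_ext (U_vec \<kappa>)"

definition expand_U' :: "nat \<Rightarrow> fvec \<Rightarrow> fvec" where
  "expand_U' \<kappa> = cont_ext (U'_vec \<kappa>)"

definition coord_U :: "nat list \<Rightarrow> nat \<Rightarrow> fvec \<Rightarrow> fvec" where
  "coord_U b \<kappa> = inv_into (B_completion b) (expand_U \<kappa>)"

definition coord_U' :: "nat list \<Rightarrow> nat \<Rightarrow> fvec \<Rightarrow> fvec" where
  "coord_U' b' \<kappa> = inv_into (B_completion b') (expand_U' \<kappa>)"

definition canon_U :: "nat list \<Rightarrow> nat \<Rightarrow> int list \<Rightarrow> fvec" where
  "canon_U b \<kappa> f = (THE x. x \<in> unitriangular (bruhat_less b) f \<and>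
     (\<forall>g. g \<noteq> f \<longrightarrow> x g \<in> qZq) \<and> bar_T b (expand_U \<kappa> x) = expand_U \<kappa> x)"

definition canon_U' :: "nat list \<Rightarrow> nat \<Rightarrow> int list \<Rightarrow> fvec" where
  "canon_U' b' \<kappa> f = (THE x. x \<in> unitriangular (bruhat_less b') f \<and>
     (\<forall>g. g \<noteq> f \<longrightarrow> x g \<in> qZq) \<and> bar_T b' (expand_U' \<kappa> x) = expand_U' \<kappa> x)"

definition C_completion_U :: "nat list \<Rightarrow> nat list \<Rightarrow> nat \<Rightarrow> fvec set" where
  "C_completion_U b b' \<kappa> = completion (length b)
     (\<lambda>g f. bruhat_less b g f \<and> bruhat_less b' (fU \<kappa> g) (fU \<kappa> f))"

definition C_completion_U' :: "nat list \<Rightarrow> nat list \<Rightarrow> nat \<Rightarrow> fvec set" where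
  "C_completion_U' b b' \<kappa> = completion (length b')
     (\<lambda>g f. bruhat_less b' g f \<and> bruhat_less b (fL \<kappa> g) (fL \<kappa> f))"

definition R_u :: "nat \<Rightarrow> fvec \<Rightarrow> fvec" where
  "R_u \<kappa> = cont_ext (\<lambda>f. unit_fvec (fU \<kappa> f))"

definition linear_iso_on :: "fvec set \<Rightarrow> fvec set \<Rightarrow> (fvec \<Rightarrow> fvec) \<Rightarrow> bool" where
  "linear_iso_on X Y \<phi> \<longleftrightarrow> fvec.subspace X \<and> fvec.subspace Y \<and> bij_betw \<phi> X Y \<and>
     (\<forall>x\<in>X. \<forall>y\<in>X. \<phi> (x + y) = \<phi> x + \<phi> y) \<and>
     (\<forall>c. \<forall>x\<in>X. \<phi> (\<lambda>f. c * x f) = (\<lambda>f. c * \<phi> x f))"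

end

theory Submission
 imports Defs
begin

text \<open>The quasi-R-matrix is obtained as a product of \<open>q\<close>-exponentials of root vectors. It makes
 \<open>\<psi>\<^sup>(\<^sup>k\<^sup>)\<close> commute with the action of \<open>U\<^sub>k\<close>, and a map which is unitriangular for the Bruhat order and
 commutes with the \<open>E\<^sub>r\<close> is already determined by this: its coefficients are found recursively by
 moving the last index with \<open>E\<^sub>r\<close>. Hence \<open>\<psi>\<^sup>(\<^sup>k\<^sup>)\<close> stabilizes, is an involution with coefficients in
 \<open>\<int>[q,q\<^sup>-\<^sup>1]\<close>, and is independent of the bracketing of the tensor factors. With the bracketing
 \<open>b\<^sup>1, (0, 1), b\<^sup>2\<close>, the isomorphism \<open>U\<^sub>f \<mapsto> U'\<^sub>h\<close>, \<open>h = f\<^sup>U\<close>, transports the bar map of \<open>b\<close> to that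
 of \<open>b'\<close>. So the bar map in these coordinates is unitriangular for both orders at once, and Lusztig's
 lemma for the common refinement \<open>g \<preceq> f \<and> g\<^sup>U \<preceq>' f\<^sup>U\<close> yields elements which are canonical on both
 sides.\<close>

section \<open>Quantum root vectors\<close>

text \<open>\<open>quasi_R\<close> is a choice known only through its defining property, so the
  explicit product serves existence alone; afterwards only the bidegrees of its terms, the value 1
  at weight 0 and the intertwining identity are used. Infinite products make sense because they are
  formed in power series whose variable marks the letters E of the first and F of the second tensor
  factor. One exponential is taken per column of root vectors, so a generator has to be moved past
  whole column sums only. The bracketing of tensor factors is changed without any coproduct formula
  for the quasi-R-matrix. The obstacle in comparing the two sequences is that a single M_f is an
  infinite alternating sum of U's, so the isomorphism has no finite matrix in the M-bases. It is
  therefore carried as a linear relation, the span of the pairs of corresponding U's, which is shown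
  to be stable under the generators, the quasi-R-matrix and the bar maps. Coordinates are recovered
  along chains of shifted indices; such a chain leaves every Bruhat lower set, which makes the
  alternating sums finite.\<close>

lemma qq_nonzero [simp]: "qq \<noteq> 0"
 by (simp add: qq_def Zero_fract_def eq_fract)

lemma qq_transcendental: "qq * qq + 1 \<noteq> 0" "qq * qq - 1 \<noteq> 0"
proof -
 have "coeff ([:0, 0, 1:] + 1 :: rat poly) 2 = 1" "coeff ([:0, 0, 1:] - 1 :: rat poly) 2 = 1"
  by (simp_all add: numeral_2_eq_2)
 then have "[:0, 0, 1:] + 1 \<noteq> (0 :: rat poly)" "[:0, 0, 1:] - 1 \<noteq> (0 :: rat poly)"
  by fastforce+
 then show "qq * qq + 1 \<noteq> 0" "qq * qq - 1 \<noteq> 0"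
  by (simp_all add: qq_def Zero_fract_def One_fract_def eq_fract)
qed

locale qalg =
 fixes cs :: "qfield => 'r::ring_1"
 assumes cs_add: "cs (a + b) = cs a + cs b"
  and cs_mult: "cs (a * b) = cs a * cs b"
  and cs_1 [simp]: "cs 1 = 1"
  and cs_comm: "x * cs a = cs a * x"
begin

lemma cs_0 [simp]: "cs 0 = 0"
 using cs_add[of 0 0] by simp

lemma cs_uminus: "cs (- a) = - cs a"
 by (metis cs_add cs_0 add.right_inverse add_eq_0_iff)

lemma cs_diff: "cs (a - b) = cs a - cs b"
 by (metis cs_add diff_add_cancel add_diff_cancel_right')

lemma cs_cancel: "a \<noteq> 0 ==> cs a * x = 0 ==> x = 0"
 by (metis cs_1 cs_mult left_inverse mult.assoc mult_1 mult_zero_right)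

text \<open>Powers of q are kept as operators \<open>sq n\<close>, so that the simplifier pulls them
  out of products and adds exponents; identities between monomials then reduce to comparing
  exponents.\<close>

definition sq :: "int => 'r => 'r" where
 "sq n x = cs (qq powi n) * x"

lemma sq_add: "sq n (x + y) = sq n x + sq n y"
 and sq_diff: "sq n (x - y) = sq n x - sq n y"
 and sq_uminus: "sq n (- x) = - sq n x"
 and sq_zero: "sq n 0 = 0"
 and sq_0: "sq 0 x = x"
 and sq_sq: "sq m (sq n x) = sq (m + n) x"
 and sq_mult_left: "sq n x * y = sq n (x * y)"
 and sq_sum: "sq n (sum f A) = (\<Sum>i\<in>A. sq n (f i))"
 by (simp_all add: sq_def distrib_left right_diff_distrib power_int_add cs_mult mult.assoc sum_distrib_left)

lemma sq_mult_right: "x * sq n y = sq n (x * y)"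
 unfolding sq_def mult.assoc[symmetric] cs_comm ..

lemmas sq_simps = sq_add sq_diff sq_uminus sq_zero sq_0 sq_sq sq_mult_left sq_mult_right

lemma sq_cancel_plus: "sq m x + sq (m + 2) x = 0 ==> x = 0"
proof -
 assume "sq m x + sq (m + 2) x = 0"
 then have "cs (qq powi m * (qq * qq + 1)) * x = 0"
  by (simp add: sq_def cs_add[symmetric] distrib_right[symmetric] power_int_add
    power2_eq_square algebra_simps)
 moreover have "qq powi m * (qq * qq + 1) \<noteq> 0"
  by (intro no_zero_divisors power_int_not_zero disjI1 qq_nonzero qq_transcendental)
 ultimately show ?thesis by (rule cs_cancel[rotated])
qed

text \<open>Companion of a commutation rule for right-nested products. A rule and its companion
  together sort monomials into a normal form; this is how the noncommutative identities below are
  checked.\<close>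

lemma comm_left: "(x::'r) * y = y * x ==> x * (y * z) = y * (x * z)"
 unfolding mult.assoc[symmetric] by simp

lemma qcomm_left: "x * y = sq n (y * x) ==> x * (y * z) = sq n (y * (x * z))"
 unfolding mult.assoc[symmetric] sq_mult_left[symmetric] by simp

definition br :: "'r => 'r => 'r" where
 "br x y = x * y - sq (-1) (y * x)"

lemma br_comm:
 assumes "b * x = x * b" "b * y = y * b"
 shows "b * br x y = br x y * b"
 unfolding br_def
 by (simp add: algebra_simps sq_simps assms comm_left[OF assms(1)] comm_left[OF assms(2)])

lemma br_assoc: "a * c = c * a ==> br (br a b) c = br a (br b c)"
 unfolding br_def by (simp add: algebra_simps sq_simps comm_left)

lemma br_qcomm:
 assumes "e * x = x * e" "y * x = sq n (x * y)"
 shows "br e y * x = sq n (x * br e y)"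
 unfolding br_def
 by (simp add: algebra_simps sq_simps assms comm_left[OF assms(1)] qcomm_left[OF assms(2)])

text \<open>The quantum Serre relation, with the coefficient \<open>q + q^-1\<close> split so that
  only \<open>sq\<close> occurs.\<close>

definition serre_rel :: "'r => 'r => bool" where
 "serre_rel b x \<longleftrightarrow> b * b * x + x * b * b = sq 1 (b * x * b) + sq (-1) (b * x * b)"

lemma serre_rel_br_left:
 assumes "serre_rel b x" "b * a = a * b"
 shows "serre_rel b (br a x)"
proof -
 have "br a (b * b * x + x * b * b) = br a (sq 1 (b * x * b) + sq (-1) (b * x * b))"
  using assms(1) by (simp add: serre_rel_def)
 then show ?thesis
  unfolding serre_rel_def br_def by (simp add: algebra_simps sq_simps assms(2) comm_left[OF assms(2)])
qed

lemma serre_rel_br_right: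
 assumes "serre_rel b x" "b * a = a * b"
 shows "serre_rel b (br x a)"
proof -
 have "br (b * b * x + x * b * b) a = br (sq 1 (b * x * b) + sq (-1) (b * x * b)) a"
  using assms(1) by (simp add: serre_rel_def)
 then show ?thesis
  unfolding serre_rel_def br_def
  by (simp add: algebra_simps sq_simps assms(2)[symmetric] comm_left[OF assms(2)[symmetric]])
qed

text \<open>Expanding both sides gives exactly the Serre relation, which is thus read as
  q-commutation with a q-commutator.\<close>

lemma serre_rel_first:
 assumes "serre_rel b x"
 shows "b * br b x = sq 1 (br b x * b)"
 using assms unfolding serre_rel_def br_def by (simp add: algebra_simps sq_simps)

lemma serre_rel_last:
 assumes "serre_rel b x"
 shows "b * br x b = sq (-1) (br x b * b)"
proof -
 have "sq (-1) (b * b * x + x * b * b) = sq (-1) (sq 1 (b * x * b) + sq (-1) (b * x * b))"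
  using assms by (simp add: serre_rel_def)
 then show ?thesis
  unfolding br_def by (simp add: algebra_simps sq_simps)
qed

text \<open>The commutator is shown to be annihilated by \<open>1 + q\<^sup>-\<^sup>2\<close>.\<close>

lemma serre_rel_middle:
 assumes "serre_rel b a" "serre_rel b c" and ac: "a * c = c * a"
 shows "b * br a (br b c) = br a (br b c) * b"
proof -
 define t v x where "t = br b c" and "v = br a b" and "x = br a t"
 have x: "x = br v c" unfolding x_def t_def v_def using br_assoc[OF ac] by simp
 have bv: "b * v = sq (-1) (v * b)" unfolding v_def by (rule serre_rel_last) fact
 have bt: "b * t = sq 1 (t * b)" unfolding t_def by (rule serre_rel_first) fact
 have bc: "b * c = t + sq (-1) (c * b)" unfolding t_def br_def by simp
 have bc': "b * (c * z) = t * z + sq (-1) (c * (b * z))" for z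
  unfolding mult.assoc[symmetric] bc distrib_right sq_mult_left ..
 \<comment> \<open>Moving b through x in the form \<open>br v c\<close>, and expanding x in the form
   \<open>br a t\<close>, gives two expressions involving the commutator of v and t; eliminating it
   leaves \<open>(1 + q^-2) (b x - x b) = 0\<close>.\<close>
 have 1: "b * x = sq (-2) (x * b) + sq (-1) (v * t) - sq (-1) (t * v)"
  unfolding x br_def[of v] by (simp add: algebra_simps sq_simps bv qcomm_left[OF bv] bc bc')
 have 2: "v * t - t * v = sq 1 (x * b) - sq (-1) (b * x)"
  unfolding x_def v_def br_def[of a]
  by (simp add: algebra_simps sq_simps bt qcomm_left[OF bt])
 have "sq (-1) (v * t - t * v) = sq (-1) (sq 1 (x * b) - sq (-1) (b * x))"
  using 2 by simp
 then have 3: "sq (-1) (v * t) - sq (-1) (t * v) = x * b - sq (-2) (b * x)"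
  by (simp add: sq_simps)
 have "b * x = sq (-2) (x * b) + (sq (-1) (v * t) - sq (-1) (t * v))"
  using 1 by simp
 then have "sq (-2) (b * x - x * b) + sq (-2 + 2) (b * x - x * b) = 0"
  unfolding 3 by (simp add: algebra_simps sq_simps)
 then have "b * x - x * b = 0" by (rule sq_cancel_plus)
 then show ?thesis by (simp add: x_def t_def)
qed

text \<open>Applying \<open>u \<mapsto> a u - q\<^sup>-\<^sup>2 u a\<close> to the Serre relation polarizes it in \<open>y\<close>; applying
 \<open>u \<mapsto> a u - u a\<close> to the result gives the Serre relation for \<open>[a, y]\<close>.\<close>

lemma serre_rel_polarize:
 assumes S: "g * y * y + y * y * g = sq 1 (y * g * y) + sq (-1) (y * g * y)"
  and ag: "a * g = g * a" and x: "x = br a y"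
  and ax: "a * x = sq 1 (x * a)" and yx: "y * x = sq (-1) (x * y)"
 shows "g * y * x + y * x * g = x * g * y + sq (-1) (y * g * x)"
  and "g * x * x + x * x * g = sq 1 (x * g * x) + sq (-1) (x * g * x)"
proof -
 have ay: "a * y = x + sq (-1) (y * a)" unfolding x br_def by simp
 have ay': "a * (y * z) = x * z + sq (-1) (y * (a * z))" for z
  unfolding mult.assoc[symmetric] ay distrib_right sq_mult_left ..
 define l where "l n u = a * u - sq n (u * a)" for n u
 have "l (-2) (g * y * y + y * y * g) = l (-2) (sq 1 (y * g * y) + sq (-1) (y * g * y))"
  using S by simp
 then have eq: "g * (x * y) + sq (-2) (g * (x * y)) + x * (y * g) + sq (-2) (x * (y * g))
   = sq 1 (x * (g * y)) + sq (-1) (x * (g * y)) + y * (g * x) + sq (-2) (y * (g * x))"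
  unfolding l_def
  by (simp add: algebra_simps sq_simps ay ay' ag comm_left[OF ag] yx qcomm_left[OF yx])
 define p where "p = g * (x * y) + x * (y * g) - sq 1 (x * (g * y)) - y * (g * x)"
 have "sq (-2) p + sq (-2 + 2) p = 0"
  unfolding p_def using eq by (simp add: algebra_simps sq_simps)
 then have "p = 0" by (rule sq_cancel_plus)
 then have "sq (-1) p = 0" by (simp add: sq_zero)
 then show P: "g * y * x + y * x * g = x * g * y + sq (-1) (y * g * x)"
  unfolding p_def by (simp add: algebra_simps sq_simps yx qcomm_left[OF yx])
 have "l 0 (g * y * x + y * x * g) = l 0 (x * g * y + sq (-1) (y * g * x))"
  using P by simp
 then show "g * x * x + x * x * g = sq 1 (x * g * x) + sq (-1) (x * g * x)"
  unfolding l_def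
  by (simp add: algebra_simps sq_simps ay ay' ax qcomm_left[OF ax] ag comm_left[OF ag])
qed

text \<open>The polarized relation is linear in y, so bracketing it with an element that commutes
  with g and z changes y alone.\<close>

lemma serre_rel_polarize_step:
 assumes "g * z * y + z * y * g = y * g * z + sq (-1) (z * g * y)"
  and ag: "a * g = g * a" and az: "a * z = z * a"
 shows "g * z * br a y + z * br a y * g = br a y * g * z + sq (-1) (z * g * br a y)"
proof -
 have "br a (g * z * y + z * y * g) = br a (y * g * z + sq (-1) (z * g * y))"
  using assms(1) by simp
 then show ?thesis
  unfolding br_def
  by (simp add: algebra_simps sq_simps ag comm_left[OF ag] az comm_left[OF az])
qed

end

locale q_serre = qalg cs for cs :: "qfield => 'r::ring_1" +
 fixes E :: "nat => 'r"
 assumes far: "i + 2 \<le> j ==> E i * E j = E j * E i"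
  and serre: "serre_rel (E i) (E (Suc i))"
  and serre': "serre_rel (E (Suc i)) (E i)"
begin

text \<open>The root vector for the sum of the simple roots i, ..., i + d, grown at its right end;
  by \<open>rv_shift\<close> it may be grown at its left end as well.\<close>

fun rv :: "nat => nat => 'r" where
 "rv i 0 = E i"
| "rv i (Suc d) = br (rv i d) (E (i + Suc d))"

declare rv.simps(2) [simp del]

lemma far': "i + 2 \<le> j ==> E j * E i = E i * E j"
 by (rule far[symmetric])

lemma rv_near: "j + 2 \<le> i ==> E j * rv i d = rv i d * E j"
 by (induction d) (auto simp: rv.simps intro!: br_comm far)

text \<open>The brackets reassociate because the two outer letters are at distance at least 2 and
  therefore commute.\<close>

lemma rv_shift: "rv i (Suc d) = br (E i) (rv (Suc i) d)"
proof (induction d)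
 case 0
 then show ?case by (simp add: rv.simps)
next
 case (Suc d)
 have "rv i (Suc (Suc d)) = br (br (E i) (rv (Suc i) d)) (E (i + Suc (Suc d)))"
  by (simp add: rv.simps(2)[of i "Suc d"] Suc)
 also have "\<dots> = br (E i) (br (rv (Suc i) d) (E (i + Suc (Suc d))))"
  by (intro br_assoc far) simp
 finally show ?case by (simp add: rv.simps(2)[of "Suc i" d])
qed

lemma serre_top: "serre_rel (E (Suc (i + d))) (rv i d)"
proof (induction d arbitrary: i)
 case (Suc d)
 show ?case
  unfolding rv_shift using Suc[of "Suc i"] by (auto intro!: serre_rel_br_left far')
qed (simp add: serre')

lemma serre_bottom: "serre_rel (E i) (rv (Suc i) d)"
 by (induction d) (auto simp: rv.simps serre intro!: serre_rel_br_right far)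

lemma E_first_rv: "E i * rv i (Suc d) = sq 1 (rv i (Suc d) * E i)"
 unfolding rv_shift by (rule serre_rel_first serre_bottom)+

lemma E_last_rv: "E (i + Suc d) * rv i (Suc d) = sq (-1) (rv i (Suc d) * E (i + Suc d))"
 unfolding rv.simps using serre_rel_last serre_top by simp

lemma E_second_rv: "E (Suc i) * rv i (Suc (Suc d)) = rv i (Suc (Suc d)) * E (Suc i)"
 unfolding rv_shift
 by (rule serre_rel_middle serre' serre_bottom rv_near)+ simp

text \<open>Peeling letters off on the left reduces this to the case where \<open>E j\<close> is the
  second letter, which rests on \<open>serre_rel_middle\<close>.\<close>

lemma E_mid_rv: "i < j ==> j < i + d ==> E j * rv i d = rv i d * E j"
proof (induction "j - i" arbitrary: i d)
 case 0
 then show ?case by simp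
next
 case (Suc n)
 then obtain d' where d: "d = Suc (Suc d')"
  by (metis Suc_lessD add_0_right add_Suc_right less_antisym not_less_eq not0_implies_Suc)
 show ?case
 proof (cases "j = Suc i")
  case True
  then show ?thesis using E_second_rv d by simp
 next
  case False
  have "E j * rv (Suc i) (Suc d') = rv (Suc i) (Suc d') * E j"
   using Suc False d by auto
  then show ?thesis unfolding d rv_shift[of i]
   using Suc False by (intro br_comm far') auto
 qed
qed

text \<open>From here on \<open>rv i (t - i)\<close> is the root vector of row \<open>i\<close> in the \<open>t\<close>-th column.\<close>

lemma rv_column:
 assumes "i < j" "j \<le> t"
 shows "rv j (t - j) * rv i (t - i) = sq (-1) (rv i (t - i) * rv j (t - j))"
 using assms
proof (induction "t - j" arbitrary: j)
 case 0
 obtain d where "t = i + Suc d" using 0 by (metis add_Suc_right less_imp_Suc_add less_le_trans)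
 then show ?case using 0 E_last_rv[of i d] by simp
next
 case (Suc n)
 then have tj: "t - j = Suc (t - Suc j)" by simp
 show ?case unfolding tj rv_shift
  using Suc E_mid_rv[of i j "t - i"] by (intro br_qcomm) auto
qed

text \<open>The two halves are proved together while i descends from t: by
  \<open>serre_rel_polarize\<close>, the Serre relation in row \<open>Suc i\<close> yields both its
  polarization between rows \<open>Suc i\<close> and i and the Serre relation in row i.\<close>

lemma serre_column_aux:
 assumes "i \<le> t"
 shows "E (Suc t) * rv i (t - i) * rv i (t - i) + rv i (t - i) * rv i (t - i) * E (Suc t)
   = sq 1 (rv i (t - i) * E (Suc t) * rv i (t - i)) + sq (-1) (rv i (t - i) * E (Suc t) * rv i (t - i))
  \<and> (i < t --> E (Suc t) * rv (Suc i) (t - Suc i) * rv i (t - i) + rv (Suc i) (t - Suc i) * rv i (t - i) * E (Suc t)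
   = rv i (t - i) * E (Suc t) * rv (Suc i) (t - Suc i) + sq (-1) (rv (Suc i) (t - Suc i) * E (Suc t) * rv i (t - i)))"
 using assms
proof (induction "t - i" arbitrary: i)
 case 0
 then show ?case using serre[of t] by (simp add: serre_rel_def add.commute)
next
 case (Suc n)
 have ti: "t - i = Suc (t - Suc i)" using Suc by simp
 have "rv (Suc i) (t - Suc i) * rv i (t - i) = sq (-1) (rv i (t - i) * rv (Suc i) (t - Suc i))"
  using rv_column[of i "Suc i" t] Suc by simp
 moreover have "E i * rv i (t - i) = sq 1 (rv i (t - i) * E i)"
  unfolding ti by (rule E_first_rv)
 moreover have "rv i (t - i) = br (E i) (rv (Suc i) (t - Suc i))"
  unfolding ti by (rule rv_shift)
 moreover have "E i * E (Suc t) = E (Suc t) * E i" using Suc by (intro far) auto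
 moreover have "E (Suc t) * rv (Suc i) (t - Suc i) * rv (Suc i) (t - Suc i) + rv (Suc i) (t - Suc i) * rv (Suc i) (t - Suc i) * E (Suc t)
   = sq 1 (rv (Suc i) (t - Suc i) * E (Suc t) * rv (Suc i) (t - Suc i)) + sq (-1) (rv (Suc i) (t - Suc i) * E (Suc t) * rv (Suc i) (t - Suc i))"
  using Suc by auto
 ultimately show ?case using serre_rel_polarize by blast
qed

lemma serre_column: "i \<le> t ==> serre_rel (rv i (t - i)) (E (Suc t))"
 using serre_column_aux[of i t] by (simp add: serre_rel_def add.commute)

lemma serre_polarized:
 assumes "i < j" "j \<le> t"
 shows "E (Suc t) * rv j (t - j) * rv i (t - i) + rv j (t - j) * rv i (t - i) * E (Suc t)
   = rv i (t - i) * E (Suc t) * rv j (t - j) + sq (-1) (rv j (t - j) * E (Suc t) * rv i (t - i))"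
 using assms
proof (induction "j - i" arbitrary: i)
 case 0
 then show ?case by simp
next
 case (Suc n)
 show ?case
 proof (cases "j = Suc i")
  case True
  then show ?thesis using serre_column_aux[of i t] Suc by simp
 next
  case False
  have ti: "t - i = Suc (t - Suc i)" using Suc by simp
  show ?thesis unfolding ti rv_shift
   using Suc False by (intro serre_rel_polarize_step far rv_near) auto
 qed
qed

text \<open>A relation coupling two rows and two columns, obtained by combining the polarized
  relation with its multiple by \<open>q^2\<close>. It makes the off-diagonal terms cancel in pairs
  in \<open>D_Om\<close> and \<open>Z_Om\<close>.\<close>

lemma rv_cross:
 assumes "i < j" "j \<le> t"
 shows "sq 2 (rv i (Suc t - i) * rv j (t - j)) + sq 1 (rv j (Suc t - j) * rv i (t - i))
  = rv j (t - j) * rv i (Suc t - i) + sq 1 (rv i (t - i) * rv j (Suc t - j))"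
proof -
 have ti: "Suc t - i = Suc (t - i)" "Suc t - j = Suc (t - j)" using assms by auto
 have eq: "i + Suc (t - i) = Suc t" "j + Suc (t - j) = Suc t" using assms by auto
 define a b e where "a = rv i (t - i)" and "b = rv j (t - j)" and "e = E (Suc t)"
 have ab: "a * b = sq 1 (b * a)"
  using rv_column[OF assms] by (simp add: a_def b_def sq_simps)
 have P: "e * b * a + b * a * e = a * e * b + sq (-1) (b * e * a)"
  unfolding a_def b_def e_def by (rule serre_polarized[OF assms])
 have "sq n (e * b * a + b * a * e) = sq n (a * e * b + sq (-1) (b * e * a))" for n
  using P by simp
 from this[of 2] P have "sq 2 (br a e * b) + sq 1 (br b e * a) = b * br a e + sq 1 (a * br b e)"
  unfolding br_def by (simp add: algebra_simps sq_simps ab qcomm_left[OF ab])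
 then show ?thesis
  unfolding ti rv.simps eq by (simp add: a_def b_def e_def)
qed

lemma rv_step: "i \<le> t ==> rv i (Suc t - i) = br (rv i (t - i)) (E (Suc t))"
 by (simp add: Suc_diff_le rv.simps)

lemma rv_row: "i \<le> t ==> rv i (t - i) * rv i (Suc t - i) = sq 1 (rv i (Suc t - i) * rv i (t - i))"
 unfolding rv_step by (intro serre_rel_first serre_column)

end

section \<open>The quasi-R-matrix as a product over columns\<close>

text \<open>For \<open>i \<le> t\<close>, the value of the Cartan form on the simple root a and the
  sum of the simple roots i, ..., t; thus \<open>wt_pair i j j\<close> is an entry of the Cartan
  matrix.\<close>

definition wt_pair :: "nat => nat => nat => int" where
 "wt_pair a i t = 2 * of_bool (i \<le> a \<and> a \<le> t) - of_bool (i < a \<and> a \<le> Suc t)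
   - of_bool (i \<le> Suc a \<and> a < t)"

lemma wt_pair_Suc: "i \<le> t ==> wt_pair a i (Suc t) = wt_pair a i t + wt_pair a (Suc t) (Suc t)"
 by (auto simp: wt_pair_def)

lemma sum_skew_zero:
 fixes M :: "nat => nat => 'a::ab_group_add"
 assumes "\<And>i. i < n ==> M i i = 0" "\<And>i j. i < j ==> j < n ==> M i j + M j i = 0"
 shows "(\<Sum>i<n. \<Sum>j<n. M i j) = 0"
 using assms
proof (induction n)
 case (Suc n)
 have "(\<Sum>i<Suc n. \<Sum>j<Suc n. M i j)
   = (\<Sum>i<n. \<Sum>j<n. M i j) + (\<Sum>i<n. M i n + M n i) + M n n"
  by (simp add: sum.distrib algebra_simps)
 then show ?case using Suc by simp
qed simp

context qalg
begin

lemma cs_left: "x * (cs a * y) = cs a * (x * y)"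
 unfolding mult.assoc[symmetric] cs_comm ..

text \<open>Commutators of E with F are handled with the denominator \<open>q - q^-1\<close>
  cleared; this lemma removes the factor again.\<close>

lemma sq_c_cancel:
 assumes "sq 1 x - sq (-1) x = sq 1 y - sq (-1) y"
 shows "x = y"
proof -
 have "cs (qq - inverse qq) * (x - y) = (sq 1 x - sq (-1) x) - (sq 1 y - sq (-1) y)"
  by (simp add: sq_def cs_diff left_diff_distrib right_diff_distrib)
 then have "cs (qq - inverse qq) * (x - y) = 0" using assms by simp
 moreover have "qq - inverse qq = inverse qq * (qq * qq - 1)"
  by (simp add: right_diff_distrib flip: mult.assoc)
 then have "qq - inverse qq \<noteq> 0"
  by (simp only:) (intro no_zero_divisors nonzero_imp_inverse_nonzero qq_nonzero qq_transcendental)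
 ultimately have "x - y = 0" by (rule cs_cancel[rotated])
 then show ?thesis by simp
qed

lemma br_weight:
 assumes "k * x = sq m (x * k)" "k * y = sq n (y * k)"
 shows "k * br x y = sq (m + n) (br x y * k)"
 unfolding br_def
 by (simp add: algebra_simps sq_simps assms qcomm_left[OF assms(1)] qcomm_left[OF assms(2)])

definition cf :: "nat => 'r => 'r" where
 "cf n x = cs ((- qq) ^ n) * x"

lemma cf_simps:
 "cf n (x + y) = cf n x + cf n y" "cf n (x - y) = cf n x - cf n y" "cf n (- x) = - cf n x"
 "cf n 0 = 0" "cf 0 x = x" "cf n x * y = cf n (x * y)" "x * cf n y = cf n (x * y)"
 by (simp_all add: cf_def distrib_left right_diff_distrib mult.assoc cs_left)

lemma cf_cf: "cf m (cf n x) = cf (m + n) x"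
 by (simp add: cf_def power_add cs_mult mult.assoc)

lemma sq_cf: "sq k (cf n x) = cf n (sq k x)"
 unfolding cf_def sq_def by (rule cs_left)

lemma cf_Suc: "cf (Suc n) x = - cf n (sq 1 x)"
proof -
 have "(- qq) ^ Suc n = - ((- qq) ^ n * qq)" by simp
 then show ?thesis unfolding cf_def sq_def by (simp only: cs_uminus cs_mult) (simp add: mult.assoc)
qed

end

text \<open>Two commuting copies of the quantum group; \<open>\<tau>\<close> is a central element which makes the positive
 part of the first and the negative part of the second copy topologically nilpotent. The roles of
 the copies may be exchanged: \<open>(E1, F1, K1, J1)\<close> with \<open>(F2, E2, J2, K2)\<close>.\<close>

locale q_pair = qalg cs for cs :: "qfield => 'r::ring_1" +
 fixes E1 F1 K1 J1 E2 F2 K2 J2 :: "nat => 'r" and \<tau> :: 'r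
 assumes tau: "\<tau> * x = x * \<tau>"
  and serre_E1: "q_serre cs E1" and serre_F2: "q_serre cs F2"
  and commute: "x \<in> range E1 \<union> range F1 \<union> range K1 \<union> range J1 ==>
   y \<in> range E2 \<union> range F2 \<union> range K2 \<union> range J2 ==> y * x = x * y"
  and JE1: "J1 i * E1 j = sq (- wt_pair i j j) (E1 j * J1 i)"
  and KE1: "K1 i * E1 j = sq (wt_pair i j j) (E1 j * K1 i)"
  and JF2: "J2 i * F2 j = sq (wt_pair i j j) (F2 j * J2 i)"
  and KF2: "K2 i * F2 j = sq (- wt_pair i j j) (F2 j * K2 i)"
  and EF1: "i \<noteq> j ==> F1 i * E1 j = E1 j * F1 i"
  and EF2: "i \<noteq> j ==> E2 i * F2 j = F2 j * E2 i"
  and EF1_diag: "sq 1 (E1 i * F1 i - F1 i * E1 i) - sq (-1) (E1 i * F1 i - F1 i * E1 i) = \<tau> * (K1 i - J1 i)"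
  and EF2_diag: "sq 1 (E2 i * F2 i - F2 i * E2 i) - sq (-1) (E2 i * F2 i - F2 i * E2 i) = \<tau> * (K2 i - J2 i)"
begin

sublocale A: q_serre cs E1 by (rule serre_E1)
sublocale B: q_serre cs F2 by (rule serre_F2)

abbreviation "X i t \<equiv> A.rv i (t - i)"
abbreviation "Y i t \<equiv> B.rv i (t - i)"

lemma commute_simps:
 "E2 i * E1 j = E1 j * E2 i" "E2 i * F1 j = F1 j * E2 i" "E2 i * K1 j = K1 j * E2 i" "E2 i * J1 j = J1 j * E2 i"
 "F2 i * E1 j = E1 j * F2 i" "F2 i * F1 j = F1 j * F2 i" "F2 i * K1 j = K1 j * F2 i" "F2 i * J1 j = J1 j * F2 i"
 "K2 i * E1 j = E1 j * K2 i" "K2 i * F1 j = F1 j * K2 i" "K2 i * K1 j = K1 j * K2 i" "K2 i * J1 j = J1 j * K2 i"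
 "J2 i * E1 j = E1 j * J2 i" "J2 i * F1 j = F1 j * J2 i" "J2 i * K1 j = K1 j * J2 i" "J2 i * J1 j = J1 j * J2 i"
 by (rule commute; blast)+

lemma A_commute: "(\<And>j. b * E1 j = E1 j * b) ==> b * A.rv i d = A.rv i d * b"
 by (induction d) (auto simp: A.rv.simps intro!: br_comm)

lemma B_commute: "(\<And>j. b * F2 j = F2 j * b) ==> b * B.rv i d = B.rv i d * b"
 by (induction d) (auto simp: B.rv.simps intro!: br_comm)

lemma B_A: "B.rv i d * A.rv j e = A.rv j e * B.rv i d"
 by (intro A_commute B_commute[symmetric] commute_simps(5)[symmetric] commute_simps(5))

lemma JA: "J1 a * A.rv i d = sq (- wt_pair a i (i + d)) (A.rv i d * J1 a)"
 and KA: "K1 a * A.rv i d = sq (wt_pair a i (i + d)) (A.rv i d * K1 a)"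
 and JB: "J2 a * B.rv i d = sq (wt_pair a i (i + d)) (B.rv i d * J2 a)"
 and KB: "K2 a * B.rv i d = sq (- wt_pair a i (i + d)) (B.rv i d * K2 a)"
proof (induction d)
 case (Suc d)
 have w: "wt_pair a i (i + Suc d) = wt_pair a i (i + d) + wt_pair a (i + Suc d) (i + Suc d)"
  using wt_pair_Suc[of i "i + d" a] by simp
 { case 1 show ?case unfolding A.rv.simps w minus_add_distrib by (intro br_weight Suc JE1) }
 { case 2 show ?case unfolding A.rv.simps w by (intro br_weight Suc KE1) }
 { case 3 show ?case unfolding B.rv.simps w by (intro br_weight Suc JF2) }
 { case 4 show ?case unfolding B.rv.simps w minus_add_distrib by (intro br_weight Suc KF2) }
qed (simp_all add: JE1 KE1 JF2 KF2)

definition tu :: "'r => 'r" where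
 "tu x = \<tau> * x"

lemma tu_simps:
 "tu (x + y) = tu x + tu y" "tu (x - y) = tu x - tu y" "tu (- x) = - tu x" "tu 0 = 0"
 "tu x * y = tu (x * y)" "x * tu y = tu (x * y)"
 by (simp_all add: tu_def distrib_left right_diff_distrib mult.assoc comm_left[OF tau])

lemma sq_tu: "sq n (tu x) = tu (sq n x)" and cf_tu: "cf m (tu x) = tu (cf m x)"
 unfolding tu_def sq_def cf_def by (rule cs_left[symmetric])+

text \<open>The commutator of e with the bracket is a bracket of u with
  \<open>w = e f - f e\<close>, and w is known only after multiplication by \<open>q - q^-1\<close>.
  Since k and j q-commute with u in opposite ways, the contribution of k cancels and that of j
  survives; in \<open>E2_br_left\<close> it is the other way round.\<close>

lemma E2_br_right:
 assumes eu: "e * u = u * e" and ef: "sq 1 (e * f - f * e) - sq (-1) (e * f - f * e) = tu (k - j)"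
  and ku: "k * u = sq 1 (u * k)" and ju: "j * u = sq (-1) (u * j)"
 shows "e * br u f = br u f * e - sq (-1) (tu (u * j))"
proof -
 define w where "w = e * f - f * e"
 have w: "sq 1 w - sq (-1) w = tu (k - j)" using ef by (simp add: w_def)
 have "e * br u f - br u f * e = u * w - sq (-1) (w * u)"
  unfolding w_def br_def by (simp add: algebra_simps sq_simps eu comm_left[OF eu])
 moreover have "u * w - sq (-1) (w * u) = - sq (-1) (tu (u * j))"
 proof (rule sq_c_cancel)
  have "sq 1 (u * w - sq (-1) (w * u)) - sq (-1) (u * w - sq (-1) (w * u))
    = u * (sq 1 w - sq (-1) w) - sq (-1) ((sq 1 w - sq (-1) w) * u)"
   by (simp add: algebra_simps sq_simps)
  then show "sq 1 (u * w - sq (-1) (w * u)) - sq (-1) (u * w - sq (-1) (w * u))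
    = sq 1 (- sq (-1) (tu (u * j))) - sq (-1) (- sq (-1) (tu (u * j)))"
   unfolding w by (simp add: algebra_simps sq_simps sq_tu tu_simps ku ju)
 qed
 ultimately show ?thesis by (simp add: algebra_simps)
qed

lemma E2_br_left:
 assumes eu: "e * u = u * e" and ef: "sq 1 (e * f - f * e) - sq (-1) (e * f - f * e) = tu (k - j)"
  and ku: "k * u = sq 1 (u * k)" and ju: "j * u = sq (-1) (u * j)"
 shows "e * br f u = br f u * e + tu (u * k)"
proof -
 define w where "w = e * f - f * e"
 have w: "sq 1 w - sq (-1) w = tu (k - j)" using ef by (simp add: w_def)
 have "e * br f u - br f u * e = w * u - sq (-1) (u * w)"
  unfolding w_def br_def by (simp add: algebra_simps sq_simps eu comm_left[OF eu])
 moreover have "w * u - sq (-1) (u * w) = tu (u * k)"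
 proof (rule sq_c_cancel)
  have "sq 1 (w * u - sq (-1) (u * w)) - sq (-1) (w * u - sq (-1) (u * w))
    = (sq 1 w - sq (-1) w) * u - sq (-1) (u * (sq 1 w - sq (-1) w))"
   by (simp add: algebra_simps sq_simps)
  then show "sq 1 (w * u - sq (-1) (u * w)) - sq (-1) (w * u - sq (-1) (u * w))
    = sq 1 (tu (u * k)) - sq (-1) (tu (u * k))"
   unfolding w by (simp add: algebra_simps sq_simps sq_tu tu_simps ku ju)
 qed
 ultimately show ?thesis by (simp add: algebra_simps)
qed

lemma E2_B_far: "a < i \<or> i + d < a ==> E2 a * B.rv i d = B.rv i d * E2 a"
 by (induction d) (auto simp: B.rv.simps intro!: br_comm EF2)

lemma EF2_tu: "sq 1 (E2 i * F2 i - F2 i * E2 i) - sq (-1) (E2 i * F2 i - F2 i * E2 i) = tu (K2 i - J2 i)"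
 using EF2_diag by (simp add: tu_def)

lemma E2_Y_last:
 assumes "i \<le> s"
 shows "E2 (Suc s) * Y i (Suc s) = Y i (Suc s) * E2 (Suc s) - sq (-1) (tu (Y i s * J2 (Suc s)))"
 unfolding B.rv_step[OF assms]
 using KB[of "Suc s" i "s - i"] JB[of "Suc s" i "s - i"] assms
 by (intro E2_br_right[OF _ EF2_tu] E2_B_far) (auto simp: wt_pair_def)

lemma E2_Y_first:
 assumes "a < t"
 shows "E2 a * Y a t = Y a t * E2 a + tu (Y (Suc a) t * K2 a)"
proof -
 have t: "t - a = Suc (t - Suc a)" using assms by simp
 show ?thesis unfolding t B.rv_shift
  using KB[of a "Suc a" "t - Suc a"] JB[of a "Suc a" "t - Suc a"] assms
  by (intro E2_br_left[OF _ EF2_tu] E2_B_far) (auto simp: wt_pair_def)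
qed

lemma E2_Y_other:
 assumes "i \<noteq> a" "i \<le> t" "a < t"
 shows "E2 a * Y i t = Y i t * E2 a"
proof (cases "a < i")
 case True
 then show ?thesis by (simp add: E2_B_far)
next
 case False
 then have "i < a" using assms by simp
 then show ?thesis using assms
 proof (induction "a - i" arbitrary: i)
  case (Suc n)
  have ti: "t - i = Suc (t - Suc i)" using Suc by simp
  have ef: "E2 a * F2 i = F2 i * E2 a" using Suc by (intro EF2) auto
  show ?case
  proof (cases "a = Suc i")
   case True
   define e f u v k where "e = E2 a" and "f = F2 i" and "u = Y (Suc i) t"
    and "v = Y (Suc a) t" and "k = K2 a"
   \<comment> \<open>The extra term \<open>v k\<close> is killed by the bracket with f: f commutes
     with v, and moving it past k costs a factor q, which compensates the \<open>q^-1\<close> of the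
     bracket.\<close>
   have eu: "e * u = u * e + tu (v * k)"
    unfolding e_def u_def v_def k_def using E2_Y_first Suc True by simp
   have eu': "e * (u * z) = u * (e * z) + tu (v * (k * z))" for z
    unfolding mult.assoc[symmetric] eu distrib_right tu_simps ..
   have ef': "e * f = f * e" unfolding e_def f_def by (rule ef)
   have kf: "k * f = sq 1 (f * k)"
    unfolding k_def f_def using KF2[of a i] True by (simp add: wt_pair_def)
   have fv: "f * v = v * f" unfolding f_def v_def using True by (intro B.rv_near) simp
   have "e * br f u = br f u * e"
    unfolding br_def
    by (simp add: algebra_simps sq_simps sq_tu tu_simps ef' comm_left[OF ef'] eu eu' kf
      fv comm_left[OF fv])
   then show ?thesis unfolding ti B.rv_shift e_def f_def u_def .
  next
   case False
   then show ?thesis unfolding ti B.rv_shift using Suc ef by (intro br_comm) auto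
  qed
 qed simp
qed

text \<open>The sum over all positive roots ending in column t. By \<open>rv_column\<close> its
  summands q-commute, so one q-exponential of the sum stands for a product over the roots of the
  column. The factor \<open>- q\<close> from row to row is what makes neighbouring rows cancel in
  \<open>W_Om\<close>.\<close>

definition Om :: "nat => 'r" where
 "Om t = (\<Sum>i\<le>t. cf (t - i) (X i t * Y i t))"

text \<open>The bar conjugate of the coproduct of E, with \<tau> marking the term whose first tensor
  factor is E.\<close>

definition W :: "nat => 'r" where
 "W a = E2 a + tu (E1 a * K2 a)"

text \<open>Row i commutes with \<open>W a\<close> unless i is a or \<open>Suc a\<close>, and the
  two exceptional rows contribute opposite terms.\<close>

lemma W_Om:
 assumes at: "a < t"
 shows "W a * Om t = Om t * W a"
proof -
 define C where "C i = W a * cf (t - i) (X i t * Y i t) - cf (t - i) (X i t * Y i t) * W a" for i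
 have XE2: "E2 a * X i t = X i t * E2 a" for i by (intro A_commute commute_simps)
 have XK2: "K2 a * X i t = X i t * K2 a" for i by (intro A_commute commute_simps)
 have YE1: "Y i t * E1 a = E1 a * Y i t" for i by (intro B_commute[symmetric] commute_simps(5)[symmetric])
 have other: "C i = 0" if "i \<le> t" "i \<noteq> a" "i \<noteq> Suc a" for i
 proof -
  have EY: "E2 a * Y i t = Y i t * E2 a" using E2_Y_other that at by simp
  have EX: "E1 a * X i t = X i t * E1 a"
   using A.E_mid_rv[of i a "t - i"] A.rv_near[of a i] that at by (cases "i < a") auto
  have KY: "K2 a * Y i t = Y i t * K2 a"
   using KB[of a i "t - i"] that at by (auto simp: wt_pair_def sq_0)
  show ?thesis unfolding C_def W_def
   by (simp add: algebra_simps cf_simps sq_cf sq_tu cf_tu tu_simps XE2 comm_left[OF XE2] XK2 comm_left[OF XK2]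
     YE1 comm_left[OF YE1] EX comm_left[OF EX] EY comm_left[OF EY] KY comm_left[OF KY])
 qed
 have t: "t - a = Suc (t - Suc a)" using at by simp
 have first: "C a = cf (t - a) (tu (X a t * Y (Suc a) t * K2 a))"
 proof -
  have EX: "E1 a * X a t = sq 1 (X a t * E1 a)" unfolding t by (rule A.E_first_rv)
  have KY: "K2 a * Y a t = sq (-1) (Y a t * K2 a)"
   using KB[of a a "t - a"] at by (auto simp: wt_pair_def)
  show ?thesis unfolding C_def W_def
   by (simp add: algebra_simps cf_simps sq_cf sq_tu cf_tu tu_simps sq_simps XE2 comm_left[OF XE2] XK2 comm_left[OF XK2]
     YE1 comm_left[OF YE1] EX qcomm_left[OF EX] E2_Y_first[OF at] KY qcomm_left[OF KY])
 qed
 have second: "C (Suc a) = cf (t - Suc a) (tu (sq 1 (X a t * Y (Suc a) t * K2 a)))"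
 proof -
  have EY: "E2 a * Y (Suc a) t = Y (Suc a) t * E2 a" using E2_Y_other at by simp
  have KY: "K2 a * Y (Suc a) t = sq 1 (Y (Suc a) t * K2 a)"
   using KB[of a "Suc a" "t - Suc a"] at by (auto simp: wt_pair_def)
  have XX: "X a t = E1 a * X (Suc a) t - sq (-1) (X (Suc a) t * E1 a)"
   unfolding t A.rv_shift br_def ..
  show ?thesis unfolding C_def W_def XX
   by (simp add: algebra_simps cf_simps sq_cf sq_tu cf_tu tu_simps sq_simps XE2 comm_left[OF XE2] XK2 comm_left[OF XK2]
     YE1 comm_left[OF YE1] EY comm_left[OF EY] KY qcomm_left[OF KY])
 qed
 have "W a * Om t - Om t * W a = (\<Sum>i\<le>t. C i)"
  unfolding Om_def C_def by (simp add: sum_distrib_left sum_distrib_right sum_subtractf)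
 also have "\<dots> = (\<Sum>i\<in>{a, Suc a}. C i)"
  using at other by (intro sum.mono_neutral_right) auto
 also have "\<dots> = C a + C (Suc a)" by simp
 also have "\<dots> = 0"
  unfolding first second t cf_Suc cf_tu sq_tu tu_simps by (rule left_minus)
 finally show ?thesis by simp
qed

section \<open>The last column: relations between its column sum and the coproduct of E\<close>

definition e :: "nat => 'r" where
 "e t = E1 t * J2 t"

definition P :: "nat => 'r" where
 "P t = E1 t * K2 t"

text \<open>The commutator of \<open>e (Suc s)\<close> with \<open>Om s\<close>; see
  \<open>e_Om\<close>.\<close>

definition D :: "nat => 'r" where
 "D s = - (\<Sum>i\<le>s. cf (s - i) (X i (Suc s) * Y i s * J2 (Suc s)))"

text \<open>What becomes of \<open>e t\<close> on being moved past the product of the earlier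
  columns (\<open>e_Th\<close>). Only column t - 1 interferes, and it adds the correction
  \<open>(q - q^-1) D\<close>.\<close>

fun Z :: "nat => 'r" where
 "Z 0 = e 0"
| "Z (Suc s) = e (Suc s) + (sq 1 (D s) - sq (-1) (D s))"

lemma Y_X: "Y i t * X j u = X j u * Y i t"
 by (rule B_A)

lemma J2_X: "J2 a * X i t = X i t * J2 a" and K2_X: "K2 a * X i t = X i t * K2 a"
 and E2_X: "E2 a * X i t = X i t * E2 a" and F2_X: "F2 a * X i t = X i t * F2 a"
 by (intro A_commute commute_simps)+

lemma Y_E1: "Y i t * E1 a = E1 a * Y i t"
 by (intro B_commute[symmetric] commute_simps(5)[symmetric])

lemmas mixed = J2_X comm_left[OF J2_X] K2_X comm_left[OF K2_X] E2_X comm_left[OF E2_X]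
 F2_X comm_left[OF F2_X] Y_E1 comm_left[OF Y_E1] Y_X comm_left[OF Y_X]
 commute_simps comm_left[OF commute_simps(1)] comm_left[OF commute_simps(5)]
 comm_left[OF commute_simps(9)] comm_left[OF commute_simps(13)]

lemma J2_Y_prev: "i \<le> s ==> J2 (Suc s) * Y i s = sq (-1) (Y i s * J2 (Suc s))"
 using JB[of "Suc s" i "s - i"] by (simp add: wt_pair_def)

lemma e_Om: "e (Suc s) * Om s = Om s * e (Suc s) + D s"
proof -
 have "e (Suc s) * cf (s - i) (X i s * Y i s) = cf (s - i) (X i s * Y i s) * e (Suc s)
   - cf (s - i) (X i (Suc s) * Y i s * J2 (Suc s))" if "i \<le> s" for i
  unfolding e_def A.rv_step[OF that] br_def
  by (simp add: algebra_simps cf_simps sq_simps sq_cf mixed J2_Y_prev[OF that])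
 then have "e (Suc s) * Om s = (\<Sum>i\<le>s. cf (s - i) (X i s * Y i s) * e (Suc s)
   - cf (s - i) (X i (Suc s) * Y i s * J2 (Suc s)))"
  unfolding Om_def sum_distrib_left by (intro sum.cong) auto
 then show ?thesis
  by (simp add: Om_def D_def sum_distrib_right sum_subtractf)
qed

text \<open>The difference of the two sides is a double sum over rows. Its diagonal terms vanish by
  \<open>rv_row\<close>; the terms at (i, j) and (j, i) cancel by \<open>rv_cross\<close> for X and
  \<open>rv_column\<close> for Y.\<close>

lemma D_Om: "D s * Om s = sq (-2) (Om s * D s)"
proof -
 define a where "a i = X i s" for i
 define a' where "a' i = X i (Suc s)" for i
 define b where "b i = Y i s" for i
 define J where "J = J2 (Suc s)"
 define M where "M i j = cf (s - i + (s - j)) (a' i * b i * J * (a j * b j) - sq (-2) (a j * b j * (a' i * b i * J)))" for i j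
 have Jb: "J * b i = sq (-1) (b i * J)" if "i \<le> s" for i
  unfolding J_def b_def using J2_Y_prev that .
 have ba: "b i * a j = a j * b i" and ba': "b i * a' j = a' j * b i"
  and Ja: "J * a i = a i * J" and Ja': "J * a' i = a' i * J" for i j
  unfolding a_def a'_def b_def J_def by (rule Y_X J2_X)+
 note mx = ba ba' Ja Ja' comm_left[OF ba] comm_left[OF ba'] comm_left[OF Ja] comm_left[OF Ja']
 have "(\<Sum>i<Suc s. \<Sum>j<Suc s. M i j) = 0"
 proof (rule sum_skew_zero)
  fix i assume "i < Suc s"
  then have i: "i \<le> s" by simp
  have aa': "a i * a' i = sq 1 (a' i * a i)"
   unfolding a_def a'_def using i by (rule A.rv_row)
  show "M i i = 0"
   unfolding M_def by (simp add: algebra_simps cf_simps sq_simps sq_cf mx Jb[OF i]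
     qcomm_left[OF Jb[OF i]] qcomm_left[OF aa'])
 next
  fix i j assume ij: "i < j" "j < Suc s"
  then have il: "i \<le> s" and jl: "j \<le> s" by auto
  have bb: "b j * b i = sq (-1) (b i * b j)"
   unfolding b_def using ij by (intro B.rv_column) auto
  have cross: "sq 2 (a' i * a j) + sq 1 (a' j * a i) = a j * a' i + sq 1 (a i * a' j)"
   unfolding a_def a'_def using ij by (intro A.rv_cross) auto
  have add: "s - j + (s - i) = s - i + (s - j)" by simp
  have "M i j + M j i = cf (s - i + (s - j))
   (sq (-3) (sq 2 (a' i * a j) + sq 1 (a' j * a i) - (a j * a' i + sq 1 (a i * a' j))) * (b i * b j * J))"
   unfolding M_def add
   by (simp add: algebra_simps cf_simps sq_simps sq_cf mx Jb[OF il] Jb[OF jl]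
     qcomm_left[OF Jb[OF il]] qcomm_left[OF Jb[OF jl]] bb qcomm_left[OF bb])
  then show "M i j + M j i = 0" unfolding cross by (simp add: sq_zero cf_simps)
 qed
 moreover have "sq (-2) (Om s * D s) - D s * Om s = (\<Sum>i<Suc s. \<Sum>j<Suc s. M i j)"
 proof -
  have "D s = - (\<Sum>i<Suc s. cf (s - i) (a' i * b i * J))"
   unfolding D_def a'_def b_def J_def lessThan_Suc_atMost ..
  moreover have "Om s = (\<Sum>i<Suc s. cf (s - i) (a i * b i))"
   unfolding Om_def a_def b_def lessThan_Suc_atMost ..
  \<comment> \<open>In \<open>M i j\<close> the first index belongs to \<open>D s\<close>, in the
    product \<open>Om s * D s\<close> it belongs to \<open>Om s\<close>; hence the exchange of
    summations.\<close>
  moreover have "(\<Sum>i<Suc s. \<Sum>j<Suc s. cf (s - i) (a i * b i) * cf (s - j) (a' j * b j * J))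
    = (\<Sum>i<Suc s. \<Sum>j<Suc s. cf (s - j) (a j * b j) * cf (s - i) (a' i * b i * J))"
   by (rule sum.swap)
  ultimately show ?thesis
   unfolding M_def
   by (simp only: sum_product minus_mult_left[symmetric] minus_mult_right[symmetric] sq_uminus sq_sum)
     (simp add: cf_simps cf_cf sq_cf algebra_simps sum_subtractf)
 qed
 ultimately show ?thesis by simp
qed

lemma Om_Suc: "Om (Suc s) = E1 (Suc s) * F2 (Suc s) - (\<Sum>i\<le>s. cf (s - i) (sq 1 (X i (Suc s) * Y i (Suc s))))"
proof -
 have "cf (Suc s - i) (X i (Suc s) * Y i (Suc s)) = - cf (s - i) (sq 1 (X i (Suc s) * Y i (Suc s)))"
  if "i \<le> s" for i
  using that by (simp add: Suc_diff_le cf_Suc)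
 then show ?thesis
  unfolding Om_def by (simp add: sum_negf cf_simps)
qed

lemma P_Om: "P t * Om t = sq (-2) (Om t * P t)"
proof -
 have "P t * cf (t - i) (X i t * Y i t) = sq (-2) (cf (t - i) (X i t * Y i t) * P t)" if "i \<le> t" for i
 proof (cases "i = t")
  case True
  have "K2 t * F2 t = sq (-2) (F2 t * K2 t)" using KF2[of t t] by (simp add: wt_pair_def)
  then show ?thesis using True unfolding P_def
   by (simp add: algebra_simps cf_simps sq_simps sq_cf mixed)
 next
  case False
  then have "i < t" using that by simp
  then obtain d where t: "t = i + Suc d" by (auto dest: less_imp_Suc_add)
  have EX: "E1 t * X i t = sq (-1) (X i t * E1 t)" unfolding t using A.E_last_rv[of i d] by simp
  have "K2 t * Y i t = sq (-1) (Y i t * K2 t)"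
   using KB[of t i "t - i"] t by (simp add: wt_pair_def)
  then show ?thesis unfolding P_def
   by (simp add: algebra_simps cf_simps sq_simps sq_cf mixed EX qcomm_left[OF EX])
 qed
 then show ?thesis
  unfolding Om_def sum_distrib_left sum_distrib_right sq_sum by (intro sum.cong) auto
qed

text \<open>Row t contributes \<open>\<tau> (P - e)\<close>. Each row i < t contributes one term
  through \<open>E2_Y_last\<close>, and these terms add up to the correction contained in
  \<open>Z t\<close>.\<close>

lemma E2_Om: "sq 1 (E2 t * Om t - Om t * E2 t) - sq (-1) (E2 t * Om t - Om t * E2 t) = tu (P t - Z t)"
proof -
 define w where "w x = E2 t * x - x * E2 t" for x
 define cw where "cw x = sq 1 (w x) - sq (-1) (w x)" for x
 have cw_diff: "cw (x - y) = cw x - cw y" and cw_sum: "cw (sum f A) = (\<Sum>i\<in>A. cw (f i))" for x y f and A :: "nat set"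
  unfolding cw_def w_def
  by (simp_all add: algebra_simps sq_simps sq_sum sum_distrib_left sum_distrib_right sum_subtractf sum.distrib)
 have diag: "cw (E1 t * F2 t) = tu (P t - e t)"
 proof -
  have "w (E1 t * F2 t) = E1 t * (E2 t * F2 t - F2 t * E2 t)"
   unfolding w_def by (simp add: algebra_simps mixed)
  then have "cw (E1 t * F2 t) = E1 t * tu (K2 t - J2 t)"
   unfolding cw_def EF2_tu[symmetric] by (simp only: sq_mult_right right_diff_distrib)
  then show ?thesis unfolding P_def e_def by (simp add: algebra_simps tu_simps)
 qed
 show ?thesis
 proof (cases t)
  case 0
  then have "Om t = E1 t * F2 t" by (simp add: Om_def cf_simps)
  then show ?thesis using diag 0 by (simp add: cw_def w_def)
 next
  case (Suc s)
  have "cw (cf (s - i) (sq 1 (X i t * Y i t)))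
    = tu (sq (-1) (cf (s - i) (X i t * Y i s * J2 t)) - sq 1 (cf (s - i) (X i t * Y i s * J2 t)))"
   if "i \<le> s" for i
   unfolding cw_def w_def Suc
   by (simp add: algebra_simps cf_simps sq_simps sq_cf sq_tu cf_tu tu_simps mixed E2_Y_last[OF that])
  then have "cw (\<Sum>i\<le>s. cf (s - i) (sq 1 (X i t * Y i t)))
    = (\<Sum>i\<le>s. tu (sq (-1) (cf (s - i) (X i t * Y i s * J2 t)) - sq 1 (cf (s - i) (X i t * Y i s * J2 t))))"
   unfolding cw_sum by (intro sum.cong) auto
  also have "\<dots> = tu (sq 1 (D s) - sq (-1) (D s))"
   unfolding D_def Suc
   by (simp add: sq_simps sq_sum sum_subtractf tu_def sum_distrib_left right_diff_distrib)
  finally have "cw (Om t) = tu (P t - Z t)"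
   unfolding Suc Om_Suc cw_diff using diag unfolding Suc by (simp add: tu_simps algebra_simps)
  then show ?thesis by (simp add: cw_def w_def)
 qed
qed

text \<open>Row t is split off from both factors: \<open>Om = E F - q S\<close> and
  \<open>Z = E J + (q^-1 - q) N\<close>. Both \<open>E J\<close> against S and N against
  \<open>E F\<close> reduce to multiples of one sum G, while N against S is again a pairwise
  cancellation; the coefficients of G then add up to zero.\<close>

lemma Z_Om: "Z t * Om t = sq 2 (Om t * Z t)"
proof (cases t)
 case 0
 have "J2 0 * F2 0 = sq 2 (F2 0 * J2 0)" using JF2[of 0 0] by (simp add: wt_pair_def)
 then show ?thesis unfolding 0
  by (simp add: Om_def e_def cf_simps algebra_simps sq_simps mixed)
next
 case (Suc s)
 define a where "a i = X i t" for i
 define b where "b i = Y i t" for i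
 define b' where "b' i = Y i s" for i
 define J where "J = J2 t"
 define E where "E = E1 t"
 define F where "F = F2 t"
 define N where "N = (\<Sum>i\<le>s. cf (s - i) (a i * b' i * J))"
 define S where "S = (\<Sum>i\<le>s. cf (s - i) (a i * b i))"
 have Om: "Om t = E * F - sq 1 S"
  unfolding Suc Om_Suc S_def E_def F_def a_def b_def sq_sum sq_cf ..
 have Z: "Z t = E * J + (sq (-1) N - sq 1 N)"
  unfolding Suc N_def E_def a_def b'_def J_def by (simp add: e_def D_def sq_simps)
 have JF: "J * F = sq 2 (F * J)" unfolding J_def F_def using JF2[of t t] by (simp add: wt_pair_def)
 have FE: "F * E = E * F" and JE: "J * E = E * J" unfolding F_def E_def J_def by (rule commute_simps)+
 have Ja: "J * a i = a i * J" and Fa: "F * a i = a i * F" and bE: "b i * E = E * b i"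
  and b'E: "b' i * E = E * b' i" and ba: "b i * a j = a j * b i" and b'a: "b' i * a j = a j * b' i" for i j
  unfolding a_def b_def b'_def J_def E_def F_def by (rule J2_X F2_X Y_E1 Y_X)+
 note mx = JF qcomm_left[OF JF] FE JE comm_left[OF FE] comm_left[OF JE] Ja comm_left[OF Ja] Fa comm_left[OF Fa]
  bE comm_left[OF bE] b'E comm_left[OF b'E] ba comm_left[OF ba] b'a comm_left[OF b'a]
 have Ea: "E * a i = sq (-1) (a i * E)" if "i \<le> s" for i
  using A.E_last_rv[of i "s - i"] that unfolding E_def a_def Suc by (simp add: Suc_diff_le)
 have Jb: "J * b i = sq 1 (b i * J)" if "i \<le> s" for i
  using JB[of t i "t - i"] that unfolding J_def b_def Suc by (simp add: wt_pair_def)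
 have Jb': "J * b' i = sq (-1) (b' i * J)" if "i \<le> s" for i
  unfolding J_def b'_def Suc using J2_Y_prev that .
 have bF: "b i = b' i * F - sq (-1) (F * b' i)" if "i \<le> s" for i
  unfolding b_def b'_def F_def Suc B.rv_step[OF that] br_def ..
 define G where "G = (\<Sum>i\<le>s. cf (s - i) (a i * E * b i * J))"
 have 1: "E * J * S = S * (E * J)"
 proof -
  have "E * J * cf (s - i) (a i * b i) = cf (s - i) (a i * b i) * (E * J)" if "i \<le> s" for i
   by (simp add: algebra_simps cf_simps sq_simps sq_cf mx Ea[OF that] qcomm_left[OF Ea[OF that]]
     Jb[OF that] qcomm_left[OF Jb[OF that]])
  then show ?thesis
   unfolding S_def sum_distrib_left sum_distrib_right by (intro sum.cong) auto
 qed
 have 2: "S * (E * J) = G"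
  unfolding S_def G_def sum_distrib_right by (simp add: algebra_simps cf_simps mx)
 have 3: "N * (E * F) - sq 2 (E * F * N) = sq 2 G"
 proof -
  have "cf (s - i) (a i * b' i * J) * (E * F) - sq 2 (E * F * cf (s - i) (a i * b' i * J))
   = sq 2 (cf (s - i) (a i * E * b i * J))" if "i \<le> s" for i
   unfolding bF[OF that]
   by (simp add: algebra_simps cf_simps sq_simps sq_cf mx Ea[OF that] qcomm_left[OF Ea[OF that]])
  then show ?thesis
   unfolding N_def G_def sum_distrib_left sum_distrib_right sum_subtractf[symmetric] sq_sum
   by (intro sum.cong) auto
 qed
 have 4: "N * S = sq 2 (S * N)"
 proof -
  define M where "M i j = cf (s - i + (s - j)) (a i * b' i * J * (a j * b j) - sq 2 (a j * b j * (a i * b' i * J)))" for i j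
  have "(\<Sum>i<Suc s. \<Sum>j<Suc s. M i j) = 0"
  proof (rule sum_skew_zero)
   fix i assume "i < Suc s"
   then have i: "i \<le> s" by simp
   have bb': "b' i * b i = sq 1 (b i * b' i)"
    unfolding b_def b'_def Suc using i by (rule B.rv_row)
   show "M i i = 0"
    unfolding M_def by (simp add: algebra_simps cf_simps sq_simps sq_cf mx Jb[OF i]
      qcomm_left[OF Jb[OF i]] qcomm_left[OF bb'])
  next
   fix i j assume ij: "i < j" "j < Suc s"
   then have il: "i \<le> s" and jl: "j \<le> s" by auto
   have aa: "a j * a i = sq (-1) (a i * a j)"
    unfolding a_def using ij Suc by (intro A.rv_column) auto
   have cross: "sq 2 (b i * b' j) + sq 1 (b j * b' i) = b' j * b i + sq 1 (b' i * b j)"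
    unfolding b_def b'_def Suc using ij by (intro B.rv_cross) auto
   have add: "s - j + (s - i) = s - i + (s - j)" by simp
   have "M i j + M j i = cf (s - i + (s - j)) (a i * a j *
    (b' j * b i + sq 1 (b' i * b j) - (sq 2 (b i * b' j) + sq 1 (b j * b' i))) * J)"
    unfolding M_def add
    by (simp add: algebra_simps cf_simps sq_simps sq_cf mx Jb[OF il] Jb[OF jl]
      qcomm_left[OF Jb[OF il]] qcomm_left[OF Jb[OF jl]] aa qcomm_left[OF aa])
   then show "M i j + M j i = 0" unfolding cross by (simp add: cf_simps)
  qed
  moreover have "N * S - sq 2 (S * N) = (\<Sum>i<Suc s. \<Sum>j<Suc s. M i j)"
  proof -
   have "N = (\<Sum>i<Suc s. cf (s - i) (a i * b' i * J))" "S = (\<Sum>i<Suc s. cf (s - i) (a i * b i))"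
    unfolding N_def S_def lessThan_Suc_atMost by simp_all
   moreover have "(\<Sum>i<Suc s. \<Sum>j<Suc s. cf (s - i) (a i * b i) * cf (s - j) (a j * b' j * J))
     = (\<Sum>i<Suc s. \<Sum>j<Suc s. cf (s - j) (a j * b j) * cf (s - i) (a i * b' i * J))"
    by (rule sum.swap)
   ultimately show ?thesis
    unfolding M_def
    by (simp only: sum_product sq_sum)
      (simp add: cf_simps cf_cf sq_cf algebra_simps sum_subtractf)
  qed
  ultimately show ?thesis by simp
 qed
 have 5: "E * J * (E * F) = sq 2 (E * F * (E * J))"
  by (simp add: algebra_simps sq_simps mx)
 have "Z t * Om t - sq 2 (Om t * Z t)
  = (E * J * (E * F) - sq 2 (E * F * (E * J))) + sq 3 (S * (E * J)) - sq 1 (E * J * S)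
   + sq (-1) (N * (E * F) - sq 2 (E * F * N)) - sq 1 (N * (E * F) - sq 2 (E * F * N))
   - (N * S - sq 2 (S * N)) + sq 2 (N * S - sq 2 (S * N))"
  unfolding Om Z by (simp add: ring_distribs right_diff_distrib left_diff_distrib sq_simps)
 also have "\<dots> = 0"
  unfolding 1 2 3 4 5 by (simp add: sq_simps)
 finally show ?thesis by simp
qed

end

section \<open>q-integers and commutators with powers\<close>

fun hq :: "nat => qfield" where
 "hq 0 = 0"
| "hq (Suc n) = 1 + qq powi (-2) * hq n"

declare hq.simps(2) [simp del]

lemma hq_Suc': "hq (Suc n) = hq n + qq powi (- 2 * int n)"
proof (induction n)
 case (Suc n)
 have "hq (Suc (Suc n)) = 1 + qq powi (-2) * (hq n + qq powi (- 2 * int n))"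
  using Suc hq.simps(2)[of "Suc n"] by simp
 also have "\<dots> = hq (Suc n) + qq powi (-2) * qq powi (- 2 * int n)"
  by (simp add: distrib_left hq.simps)
 also have "qq powi (-2) * qq powi (- 2 * int n) = qq powi (- 2 * int (Suc n))"
  by (simp add: power_int_add[symmetric])
 finally show ?case .
qed (simp add: hq.simps)

lemma qq_power: "qq ^ n = Fract (monom 1 n) 1"
 by (induction n) (simp_all add: qq_def One_fract_def monom_Suc monom_eq_1)

text \<open>After multiplication by \<open>q^(2n)\<close> this q-integer becomes a polynomial with
  constant term 1.\<close>

lemma hq_nonzero: "hq (Suc n) \<noteq> 0"
proof -
 have "\<exists>p. hq (Suc n) * qq ^ (2 * n) = Fract p 1 \<and> poly p 0 = 1"
 proof (induction n)
  case 0
  then show ?case by (auto simp: One_fract_def hq.simps intro!: exI[of _ 1])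
 next
  case (Suc n)
  then obtain p where p: "hq (Suc n) * qq ^ (2 * n) = Fract p 1" "poly p 0 = 1" by auto
  have "hq (Suc (Suc n)) * qq ^ (2 * Suc n)
    = qq ^ (2 * Suc n) + hq (Suc n) * qq ^ (2 * n) * (qq powi (-2) * qq ^ 2)"
   unfolding hq.simps(2)[of "Suc n"] by (simp add: distrib_right power2_eq_square)
  also have "qq powi (-2) * qq ^ 2 = 1"
   by (simp add: power_int_minus)
  also have "qq ^ (2 * Suc n) + hq (Suc n) * qq ^ (2 * n) * 1 = Fract (monom 1 (2 * Suc n) + p) 1"
   unfolding p unfolding qq_power by simp
  finally show ?case using p(2) by (intro exI[of _ "monom 1 (2 * Suc n) + p"]) (simp add: poly_monom)
 qed
 then obtain p where p: "hq (Suc n) * qq ^ (2 * n) = Fract p 1" "p \<noteq> 0" by force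
 then have "Fract p 1 \<noteq> 0" by (simp add: Zero_fract_def eq_fract)
 with p show ?thesis by auto
qed

lemma qq_diff_inverse_nonzero: "qq - inverse qq \<noteq> 0"
proof -
 have "qq - inverse qq = inverse qq * (qq * qq - 1)"
  by (simp add: right_diff_distrib flip: mult.assoc)
 then show ?thesis
  by (simp only:) (intro no_zero_divisors nonzero_imp_inverse_nonzero qq_nonzero qq_transcendental)
qed

text \<open>The coefficients of the \<open>q\<close>-exponential of \<open>(q - q\<^sup>-\<^sup>1) x\<close>.\<close>

fun gq :: "nat => qfield" where
 "gq 0 = 1"
| "gq (Suc n) = gq n * (qq - inverse qq) / hq (Suc n)"

lemma gq_hq: "gq (Suc n) * hq (Suc n) = gq n * (qq - inverse qq)"
 using hq_nonzero[of n] by (simp add: gq.simps)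

declare gq.simps(2) [simp del]

context qalg
begin

definition sc :: "qfield => 'r => 'r" where
 "sc a x = cs a * x"

lemma sc_simps:
 "sc a (x + y) = sc a x + sc a y" "sc a (x - y) = sc a x - sc a y" "sc a 0 = 0"
 "sc 1 x = x" "sc 0 x = 0" "sc a x * y = sc a (x * y)" "x * sc a y = sc a (x * y)"
 by (simp_all add: sc_def distrib_left right_diff_distrib mult.assoc cs_left)

lemma sc_sc: "sc a (sc b x) = sc (a * b) x"
 by (simp add: sc_def cs_mult mult.assoc)

lemma sc_add: "sc (a + b) x = sc a x + sc b x"
 by (simp add: sc_def cs_add distrib_right)

lemma sq_sc: "sq n x = sc (qq powi n) x"
 by (simp add: sc_def sq_def)

lemma c_sq: "sq 1 x - sq (-1) x = sc (qq - inverse qq) x"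
 by (simp add: sq_def sc_def cs_diff left_diff_distrib)

lemma power_shift_qcomm:
 assumes "p * v = sq n (v * p)"
 shows "p * v ^ k = sq (n * int k) (v ^ k * p)"
proof (induction k)
 case (Suc k)
 have "p * v ^ Suc k = (p * v ^ k) * v" by (simp add: power_commutes mult.assoc)
 also have "\<dots> = sq (n * int k) (v ^ k * (p * v))" unfolding Suc by (simp add: sq_simps mult.assoc)
 also have "\<dots> = sq (n * int (Suc k)) (v ^ Suc k * p)"
  unfolding assms by (simp add: sq_simps algebra_simps power_commutes flip: mult.assoc)
 finally show ?case .
qed (simp add: sq_0)

text \<open>Each of the powers of v that d has to pass costs \<open>q^-2\<close>, and the geometric
  sum of these factors is \<open>hq\<close>.\<close>

lemma commutator_power:
 assumes "e * v = v * e + d" "d * v = sq (-2) (v * d)"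
 shows "e * v ^ Suc n = v ^ Suc n * e + sc (hq (Suc n)) (v ^ n * d)"
proof (induction n)
 case 0
 then show ?case using assms by (simp add: hq.simps sc_simps)
next
 case (Suc n)
 have "e * v ^ Suc (Suc n) = (e * v ^ Suc n) * v" by (simp only: power_Suc2 mult.assoc)
 also have "\<dots> = v ^ Suc n * (e * v) + sc (hq (Suc n)) (v ^ n * (d * v))"
  unfolding Suc by (simp only: distrib_right mult.assoc sc_simps)
 also have "\<dots> = v ^ Suc (Suc n) * e + (v ^ Suc n * d + sc (hq (Suc n)) (sq (-2) (v ^ Suc n * d)))"
  unfolding assms by (simp only: distrib_left sq_mult_right power_Suc2 mult.assoc add.assoc)
 also have "v ^ Suc n * d + sc (hq (Suc n)) (sq (-2) (v ^ Suc n * d)) = sc (hq (Suc (Suc n))) (v ^ Suc n * d)"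
  unfolding hq.simps(2)[of "Suc n"] by (simp only: sq_sc sc_sc sc_add sc_simps mult.commute)
 finally show ?case .
qed

text \<open>Collecting p on the right and z on the left of the powers makes both carry the same
  q-integer. Accordingly the induction step uses both recursions of \<open>hq\<close>: the one
  splitting off the first summand for p, and the one splitting off the last summand for z.\<close>

lemma commutator_power2:
 assumes c: "e * v - v * e = sc k (p - z)"
  and p: "p * v = sq (-2) (v * p)" and z: "z * v = sq 2 (v * z)"
 shows "e * v ^ Suc n - v ^ Suc n * e = sc (k * hq (Suc n)) (v ^ n * p - z * v ^ n)"
proof (induction n)
 case 0
 then show ?case using c by (simp add: hq.simps)
next
 case (Suc n)
 define w where "w = v ^ Suc n"
 have "z * w = sq (2 * int (Suc n)) (w * z)"
  unfolding w_def by (rule power_shift_qcomm[OF z])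
 then have wz: "w * z = sq (- 2 * int (Suc n)) (z * w)"
  by (simp add: sq_simps)
 have "e * v ^ Suc (Suc n) - v ^ Suc (Suc n) * e = (e * w - w * e) * v + w * (e * v - v * e)"
  unfolding w_def power_Suc2[of v "Suc n"] left_diff_distrib right_diff_distrib mult.assoc by simp
 also have "(e * w - w * e) * v = sc (k * hq (Suc n)) (v ^ n * (p * v) - z * w)"
  using Suc unfolding w_def by (simp only: sc_simps left_diff_distrib mult.assoc power_Suc2)
 also have "v ^ n * (p * v) = sq (-2) (w * p)"
  unfolding p w_def by (simp only: sq_mult_right power_Suc2 mult.assoc)
 also have "w * (e * v - v * e) = sc k (w * p - sq (- 2 * int (Suc n)) (z * w))"
  unfolding c wz[symmetric] by (simp only: sc_simps right_diff_distrib)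
 finally have "e * v ^ Suc (Suc n) - v ^ Suc (Suc n) * e
   = (sc k (w * p) + sc (k * hq (Suc n)) (sq (-2) (w * p)))
   - (sc (k * hq (Suc n)) (z * w) + sc k (sq (- 2 * int (Suc n)) (z * w)))"
  by (simp add: sc_simps)
 also have "sc k (w * p) + sc (k * hq (Suc n)) (sq (-2) (w * p)) = sc (k * hq (Suc (Suc n))) (w * p)"
  unfolding hq.simps(2)[of "Suc n"]
  by (simp only: sq_sc sc_sc sc_add[symmetric]) (simp add: algebra_simps)
 also have "sc (k * hq (Suc n)) (z * w) + sc k (sq (- 2 * int (Suc n)) (z * w)) = sc (k * hq (Suc (Suc n))) (z * w)"
  unfolding hq_Suc'[of "Suc n"] by (simp only: sq_sc sc_sc sc_add[symmetric]) (simp add: algebra_simps)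
 finally show ?case by (simp only: sc_simps w_def)
qed

end

section \<open>q-exponentials of power series without constant term\<close>

locale qalg_fps = qalg cs for cs :: "qfield => 'a::ring_1 fps"
begin

definition qexp_part :: "nat => 'a fps => 'a fps" where
 "qexp_part N v = (\<Sum>m\<le>N. sc (gq m) (v ^ m))"

text \<open>Coefficient n is read off from the n-th partial sum: if v has no constant term, later
  powers do not reach degree n (\<open>qexp_nth\<close>).\<close>

definition qexp :: "'a fps => 'a fps" where
 "qexp v = Abs_fps (\<lambda>n. qexp_part n v $ n)"

lemma power_nth_below: "v $ 0 = 0 ==> n < m ==> (v ^ m) $ n = (0 :: 'a)"
proof (cases "v = 0")
 case False
 assume "v $ 0 = 0" "n < m"
 from this False have "subdegree v \<noteq> 0" using nth_subdegree_nonzero[of v] by metis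
 then have "m * 1 \<le> m * subdegree v" by (intro mult_le_mono) auto
 with \<open>n < m\<close> show ?thesis by (intro fps_pow_nth_below_subdegree) linarith
qed (simp add: zero_power)

lemma mult_nth_cong:
 "(\<And>i. i \<le> n ==> x $ i = x' $ i) ==> (\<And>i. i \<le> n ==> y $ i = y' $ i) ==> (x * y) $ n = (x' * y') $ n"
 for x y :: "'a fps"
 unfolding fps_mult_nth by (intro sum.cong) auto

lemma qexp_nth:
 assumes v: "v $ 0 = 0" and "n \<le> N"
 shows "qexp v $ n = qexp_part N v $ n"
proof -
 have "sc a (v ^ m) $ n = 0" if "n < m" for m a
 proof -
  have "(cs a * v ^ m) $ n = (cs a * 0) $ n"
   using that v by (intro mult_nth_cong) (auto simp: power_nth_below)
  then show ?thesis by (simp add: sc_def)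
 qed
 then have "qexp_part N v $ n = (\<Sum>m\<le>n. sc (gq m) (v ^ m) $ n)"
  unfolding qexp_part_def fps_sum_nth using assms by (intro sum.mono_neutral_right) auto
 then show ?thesis
  by (simp add: qexp_def qexp_part_def fps_sum_nth)
qed

text \<open>A commutator lowers the exponent of a power by one, so the available identities relate
  partial sums of lengths N + 1 and N. For a fixed coefficient the length is immaterial once it is
  at least the degree.\<close>

lemma qexp_eqI:
 assumes v: "v $ 0 = 0" and
  eq: "\<And>N. x * qexp_part (Suc N) v * y = x' * qexp_part (Suc N) v * y' + z * qexp_part N v * z'
   + w * qexp_part N v * w'"
 shows "x * qexp v * y = x' * qexp v * y' + z * qexp v * z' + w * qexp v * w'"
proof (rule fps_ext)
 fix n
 have *: "(a * qexp v * b) $ n = (a * qexp_part N v * b) $ n" if "n \<le> N" for a b N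
  using that by (intro mult_nth_cong refl qexp_nth[OF v]) auto
 show "(x * qexp v * y) $ n = (x' * qexp v * y' + z * qexp v * z' + w * qexp v * w') $ n"
  using arg_cong[OF eq[of n], of "\<lambda>u. u $ n"]
  by (simp add: *[of "Suc n" x y] *[of "Suc n" x' y'] *[of n z z'] *[of n w w'])
qed

lemma qexp_part_Suc: "qexp_part (Suc N) v = 1 + (\<Sum>m\<le>N. sc (gq (Suc m)) (v ^ Suc m))"
 unfolding qexp_part_def by (subst sum.atMost_Suc_shift) (simp add: sc_simps)

lemma qexp_part_comm: "x * v = v * x ==> x * qexp_part N v = qexp_part N v * x"
 unfolding qexp_part_def sum_distrib_left sum_distrib_right
 by (simp add: sc_simps power_commuting_commutes)

lemma qexp_comm: "v $ 0 = 0 ==> x * v = v * x ==> x * qexp v = qexp v * x"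
 using qexp_eqI[of v x 1 1 x 0 0 0 0] qexp_part_comm[of x v] by simp

lemma qexp_commutator:
 assumes v: "v $ 0 = 0" and "e * v = v * e + d" "d * v = sq (-2) (v * d)"
 shows "e * qexp v = qexp v * e + qexp v * sc (qq - inverse qq) d"
proof -
 have "e * qexp_part (Suc N) v = qexp_part (Suc N) v * e + qexp_part N v * sc (qq - inverse qq) d" for N
 proof -
  have "e * qexp_part (Suc N) v
    = e + (\<Sum>m\<le>N. sc (gq (Suc m)) (v ^ Suc m * e + sc (hq (Suc m)) (v ^ m * d)))"
   unfolding qexp_part_Suc distrib_left sum_distrib_left
   by (simp only: sc_simps commutator_power[OF assms(2,3)] mult_1_right)
  also have "\<dots> = qexp_part (Suc N) v * e + (\<Sum>m\<le>N. sc (gq (Suc m) * hq (Suc m)) (v ^ m * d))"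
   unfolding qexp_part_Suc distrib_right sum_distrib_right
   by (simp only: sc_simps sc_sc sum.distrib mult_1_left add.assoc)
  also have "(\<Sum>m\<le>N. sc (gq (Suc m) * hq (Suc m)) (v ^ m * d)) = qexp_part N v * sc (qq - inverse qq) d"
   unfolding qexp_part_def sum_distrib_right gq_hq
   by (simp only: sc_simps sc_sc mult.commute)
  finally show ?thesis .
 qed
 then show ?thesis using qexp_eqI[OF v, of e 1 1 e 1 "sc (qq - inverse qq) d" 0 0] by simp
qed

text \<open>With z on the left and p on the right, the result says that the q-exponential
  intertwines e + z with e + p.\<close>

lemma qexp_commutator2:
 assumes v: "v $ 0 = 0" and c: "sc (qq - inverse qq) (e * v - v * e) = p - z"
  and p: "p * v = sq (-2) (v * p)" and z: "z * v = sq 2 (v * z)"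
 shows "e * qexp v + z * qexp v = qexp v * e + qexp v * p"
proof -
 have "sc (inverse (qq - inverse qq)) (sc (qq - inverse qq) (e * v - v * e)) = sc (inverse (qq - inverse qq)) (p - z)"
  unfolding c ..
 then have c': "e * v - v * e = sc (inverse (qq - inverse qq)) (p - z)"
  unfolding sc_sc using qq_diff_inverse_nonzero by (simp add: sc_simps)
 have step: "sc (gq (Suc m)) (e * v ^ Suc m) - sc (gq (Suc m)) (v ^ Suc m * e)
   = sc (gq m) (v ^ m * p) - sc (gq m) (z * v ^ m)" for m
 proof -
  have "sc (gq (Suc m)) (e * v ^ Suc m) - sc (gq (Suc m)) (v ^ Suc m * e)
   = sc (gq (Suc m) * (inverse (qq - inverse qq) * hq (Suc m))) (v ^ m * p - z * v ^ m)"
   unfolding sc_simps(2)[symmetric] commutator_power2[OF c' p z] sc_sc ..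
  also have "gq (Suc m) * (inverse (qq - inverse qq) * hq (Suc m)) = gq m"
   using gq_hq[of m] qq_diff_inverse_nonzero by (simp add: field_simps)
  finally show ?thesis by (simp add: sc_simps)
 qed
 have "e * qexp_part (Suc N) v = qexp_part (Suc N) v * e + qexp_part N v * p + (- z) * qexp_part N v" for N
 proof -
  have "e * qexp_part (Suc N) v - qexp_part (Suc N) v * e
   = (\<Sum>m\<le>N. sc (gq (Suc m)) (e * v ^ Suc m) - sc (gq (Suc m)) (v ^ Suc m * e))"
   unfolding qexp_part_Suc distrib_right distrib_left sum_distrib_right sum_distrib_left
   by (simp only: sc_simps sum_subtractf mult_1_left mult_1_right add_diff_cancel_left)
  also have "\<dots> = qexp_part N v * p - z * qexp_part N v"
   unfolding step qexp_part_def sum_distrib_right sum_distrib_left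
   by (simp only: sc_simps sum_subtractf)
  finally show ?thesis by (simp add: algebra_simps)
 qed
 then have "e * qexp v = qexp v * e + qexp v * p + (- z) * qexp v"
  using qexp_eqI[OF v, of e 1 1 e 1 p "- z" 1] by simp
 then show ?thesis by simp
qed

end

locale q_pair_fps = q_pair cs E1 F1 K1 J1 E2 F2 K2 J2 \<tau> + qalg_fps cs
 for cs :: "qfield => 'a::ring_1 fps" and E1 F1 K1 J1 E2 F2 K2 J2 \<tau> +
 assumes E1_nth_0: "E1 i $ 0 = 0" and F2_nth_0: "F2 i $ 0 = 0"
begin

fun Th :: "nat => 'a fps" where
 "Th 0 = 1"
| "Th (Suc t) = Th t * qexp (Om t)"

lemma A_rv_nth_0: "A.rv i d $ 0 = 0"
proof (induction d)
 case (Suc d)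
 then show ?case by (simp add: A.rv.simps br_def sq_def mult.assoc)
qed (simp add: E1_nth_0)

lemma Om_nth_0: "Om t $ 0 = 0"
 by (simp add: Om_def cf_def fps_sum_nth A_rv_nth_0)

lemma comm_Om:
 assumes "\<And>a. a \<le> t ==> x * E1 a = E1 a * x" "\<And>a. a \<le> t ==> x * F2 a = F2 a * x"
 shows "x * Om t = Om t * x"
proof -
 have "x * A.rv i d = A.rv i d * x" if "i + d \<le> t" for i d
  using that by (induction d) (auto simp: A.rv.simps intro!: br_comm assms)
 then have X: "x * X i t = X i t * x" if "i \<le> t" for i using that by simp
 have "x * B.rv i d = B.rv i d * x" if "i + d \<le> t" for i d
  using that by (induction d) (auto simp: B.rv.simps intro!: br_comm assms)
 then have Y: "x * Y i t = Y i t * x" if "i \<le> t" for i using that by simp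
 show ?thesis
  unfolding Om_def sum_distrib_left sum_distrib_right
  by (intro sum.cong refl) (simp add: cf_simps X Y comm_left[OF X] mult.assoc)
qed

lemma comm_Th:
 assumes "\<And>a. a < t ==> x * E1 a = E1 a * x" "\<And>a. a < t ==> x * F2 a = F2 a * x"
 shows "x * Th t = Th t * x"
 using assms
proof (induction t)
 case (Suc t)
 have q: "x * qexp (Om t) = qexp (Om t) * x"
  using Suc by (intro qexp_comm comm_Om Om_nth_0) auto
 have xT: "x * Th t = Th t * x" using Suc by simp
 show ?case by (simp add: mult.assoc comm_left[OF xT] q)
qed simp

text \<open>All columns before \<open>Om s\<close> commute with \<open>e (Suc s)\<close>, so only
  the conjugation by \<open>qexp (Om s)\<close> changes it.\<close>

lemma e_Th: "e t * Th t = Th t * Z t"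
proof (cases t)
 case (Suc s)
 have T: "e (Suc s) * Th s = Th s * e (Suc s)"
 proof (rule comm_Th)
  fix a assume a: "a < s"
  have EE: "E1 (Suc s) * E1 a = E1 a * E1 (Suc s)" using a by (intro A.far') simp
  show "e (Suc s) * E1 a = E1 a * e (Suc s)"
   unfolding e_def by (simp add: mult.assoc mixed comm_left[OF EE])
  have "J2 (Suc s) * F2 a = F2 a * J2 (Suc s)" using JF2[of "Suc s" a] a by (simp add: wt_pair_def sq_0)
  then show "e (Suc s) * F2 a = F2 a * e (Suc s)"
   unfolding e_def by (simp add: mult.assoc mixed)
 qed
 have "e (Suc s) * qexp (Om s) = qexp (Om s) * Z (Suc s)"
  using qexp_commutator[OF Om_nth_0 e_Om D_Om] by (simp add: c_sq distrib_left)
 then show ?thesis unfolding Suc by (simp add: mult.assoc comm_left[OF T] del: Z.simps)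
qed simp

text \<open>A column beyond a commutes with \<open>W a\<close>. In column a itself,
  \<open>tu (e t)\<close> turns into \<open>tu (Z t)\<close> on passing \<open>Th t\<close>, and
  \<open>qexp_commutator2\<close> replaces Z by P.\<close>

lemma intertwine_E: "a < t ==> (E2 a + tu (E1 a * J2 a)) * Th t = Th t * (E2 a + tu (E1 a * K2 a))"
proof (induction t)
 case (Suc t)
 show ?case
 proof (cases "a < t")
  case True
  have "W a * qexp (Om t) = qexp (Om t) * W a"
   using W_Om[OF True] by (intro qexp_comm Om_nth_0)
  then show ?thesis using Suc True unfolding W_def[symmetric] by (simp flip: mult.assoc) (simp add: mult.assoc)
 next
  case False
  then have a: "a = t" using Suc by simp
  have E: "E2 t * Th t = Th t * E2 t"
   using EF2 by (intro comm_Th) (auto simp: commute_simps)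
  have "sc (qq - inverse qq) (E2 t * Om t - Om t * E2 t) = tu (P t) - tu (Z t)"
   unfolding c_sq[symmetric] E2_Om tu_simps ..
  moreover have "tu (P t) * Om t = sq (-2) (Om t * tu (P t))" "tu (Z t) * Om t = sq 2 (Om t * tu (Z t))"
   by (simp_all add: tu_simps sq_tu P_Om Z_Om)
  ultimately have "E2 t * qexp (Om t) + tu (Z t) * qexp (Om t) = qexp (Om t) * E2 t + qexp (Om t) * tu (P t)"
   by (rule qexp_commutator2[OF Om_nth_0])
  then have "Th t * (E2 t * qexp (Om t) + tu (Z t) * qexp (Om t)) = Th t * (qexp (Om t) * E2 t + qexp (Om t) * tu (P t))"
   by simp
  moreover have "tu (e t) * Th t = Th t * tu (Z t)" by (simp add: tu_simps e_Th)
  ultimately have "(E2 t + tu (e t)) * Th t * qexp (Om t) = Th t * qexp (Om t) * (E2 t + tu (P t))"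
   by (simp add: distrib_left distrib_right mult.assoc[symmetric] E)
  then show ?thesis unfolding a by (simp add: e_def P_def mult.assoc)
 qed
qed simp

end

context q_pair
begin

lemma swapped: "q_pair cs F2 E2 J2 K2 F1 E1 J1 K1 \<tau>"
proof (intro q_pair.intro q_pair_axioms.intro qalg_axioms)
 show "\<tau> * x = x * \<tau>" for x by (rule tau)
 show "q_serre cs F2" "q_serre cs E1" by (rule serre_F2 serre_E1)+
 show "y * x = x * y" if "x \<in> range F2 \<union> range E2 \<union> range J2 \<union> range K2"
  "y \<in> range F1 \<union> range E1 \<union> range J1 \<union> range K1" for x y
  using that by (intro commute[symmetric]) auto
 show "sq 1 (F2 i * E2 i - E2 i * F2 i) - sq (-1) (F2 i * E2 i - E2 i * F2 i) = \<tau> * (J2 i - K2 i)" for i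
  using arg_cong[OF EF2_diag[of i], of uminus] by (simp add: sq_simps algebra_simps)
 show "sq 1 (F1 i * E1 i - E1 i * F1 i) - sq (-1) (F1 i * E1 i - E1 i * F1 i) = \<tau> * (J1 i - K1 i)" for i
  using arg_cong[OF EF1_diag[of i], of uminus] by (simp add: sq_simps algebra_simps)
qed (simp_all add: JE1 KE1 JF2 KF2 EF1 EF2)

end

context q_pair_fps
begin

text \<open>After the exchange of the two copies the column sums are unchanged, because X and Y
  commute; so the product is the same and the statement for E applies.\<close>

lemma intertwine_F:
 assumes "a < t"
 shows "(F1 a + tu (K1 a * F2 a)) * Th t = Th t * (F1 a + tu (J1 a * F2 a))"
proof -
 interpret S: q_pair cs F2 E2 J2 K2 F1 E1 J1 K1 \<tau> by (rule swapped)
 interpret S: q_pair_fps cs F2 E2 J2 K2 F1 E1 J1 K1 \<tau>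
  by unfold_locales (rule F2_nth_0 E1_nth_0)+
 have "S.Om t = Om t" for t
  unfolding S.Om_def Om_def by (intro sum.cong refl) (simp add: Y_X)
 then have "S.Th t = Th t" for t
  by (induction t) auto
 with S.intertwine_E[OF assms] show ?thesis
  by (simp add: commute_simps)
qed

end

section \<open>Linear extension\<close>

abbreviation "single \<equiv> Poly_Mapping.single"
abbreviation "lookup \<equiv> Poly_Mapping.lookup"
abbreviation "keys \<equiv> Poly_Mapping.keys"

lemma pm_expand: "x = (\<Sum>k\<in>keys x. single k (lookup x k))"
 by (rule poly_mapping_eqI)
   (simp add: lookup_sum lookup_single when_def sum.delta' in_keys_iff)

lemma pm_induct [case_names zero single add]:
 fixes x :: "'k \<Rightarrow>\<^sub>0 'b::comm_monoid_add"
 assumes "P 0" "\<And>k c. P (single k c)" "\<And>x y. P x ==> P y ==> P (x + y)"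
 shows "P x"
proof -
 have "P (\<Sum>k\<in>A. single k (lookup x k))" if "finite A" for A
  using that by (induction A) (auto intro: assms)
 from this[of "keys x"] show ?thesis using pm_expand[of x] by simp
qed

lemma lookup_cst_mult [simp]: "lookup (cst c * x) k = c * lookup x k"
 unfolding cst_def mult_map_scale_conv_mult[symmetric] by (simp add: Poly_Mapping.map.rep_eq when_def)

lemma cst_simps: "cst (a + b) = cst a + cst b" "cst (a - b) = cst a - cst b" "cst (a * b) = cst a * cst b"
 "cst 1 = 1" "cst 0 = 0"
 by (simp_all add: cst_def single_add single_diff mult_single)

lemma cst_central: "x * cst c = cst c * (x :: 'k::monoid_add \<Rightarrow>\<^sub>0 qfield)"
proof (induction x rule: pm_induct)
 case (add x y)
 then show ?case by (simp only: distrib_left distrib_right)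
qed (simp_all add: cst_def mult_single mult.commute)

lemma cst_left: "y * (cst c * z) = cst c * (y * z)"
 by (metis cst_central mult.assoc)

lemma cst_single: "cst c * single k a = single k (c * a)"
 by (simp add: cst_def mult_single)

lemma cst_cst: "cst a * (cst b * x) = cst (a * b) * x"
 by (simp add: cst_simps mult.assoc)

text \<open>One construction for linear and anti-linear extension: \<sigma> will be the identity or
  the automorphism inverting q.\<close>

definition sl_ext :: "(qfield => qfield) => ('k => ('l::monoid_add \<Rightarrow>\<^sub>0 qfield)) => ('k \<Rightarrow>\<^sub>0 qfield) => ('l \<Rightarrow>\<^sub>0 qfield)" where
 "sl_ext \<sigma> F x = (\<Sum>k\<in>keys x. cst (\<sigma> (lookup x k)) * F k)"

lemma lin_ext_sl: "lin_ext = sl_ext (\<lambda>c. c)"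
 by (simp add: lin_ext_def sl_ext_def fun_eq_iff)

lemma antilin_ext_sl: "antilin_ext = sl_ext qbar"
 by (simp add: antilin_ext_def sl_ext_def fun_eq_iff)

locale semilin =
 fixes \<sigma> :: "qfield => qfield"
 assumes sigma_add: "\<sigma> (a + b) = \<sigma> a + \<sigma> b"
  and sigma_mult: "\<sigma> (a * b) = \<sigma> a * \<sigma> b"
  and sigma_1: "\<sigma> 1 = 1"
begin

lemma sigma_0: "\<sigma> 0 = 0"
 using sigma_add[of 0 0] by simp

lemma sl_ext_superset:
 assumes "finite A" "keys x \<subseteq> A"
 shows "sl_ext \<sigma> F x = (\<Sum>k\<in>A. cst (\<sigma> (lookup x k)) * F k)"
 unfolding sl_ext_def using assms
 by (intro sum.mono_neutral_left) (auto simp: in_keys_iff cst_simps sigma_0)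

lemma sl_ext_0 [simp]: "sl_ext \<sigma> F 0 = 0"
 by (simp add: sl_ext_def)

lemma sl_ext_add: "sl_ext \<sigma> F (x + y) = sl_ext \<sigma> F x + sl_ext \<sigma> F y"
proof -
 let ?A = "keys x \<union> keys y"
 have "keys (x + y) \<subseteq> ?A" by (rule Poly_Mapping.keys_add)
 then show ?thesis
  by (simp add: sl_ext_superset[of ?A] lookup_add sigma_add cst_simps distrib_right sum.distrib)
qed

lemma sl_ext_single [simp]: "sl_ext \<sigma> F (single k c) = cst (\<sigma> c) * F k"
 by (simp add: sl_ext_superset[of "{k}"] sigma_0 cst_simps)

lemma sl_ext_cst: "sl_ext \<sigma> F (cst c * x) = cst (\<sigma> c) * sl_ext \<sigma> F x"
proof (induction x rule: pm_induct)
 case (add x y)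
 then show ?case by (simp add: distrib_left sl_ext_add)
qed (simp_all add: cst_single sigma_mult cst_simps mult.assoc)

lemma sl_ext_uminus: "sl_ext \<sigma> F (- x) = - sl_ext \<sigma> F x"
 using sl_ext_add[of F x "- x"] by (simp add: eq_neg_iff_add_eq_0 add.commute)

lemma sl_ext_diff: "sl_ext \<sigma> F (x - y) = sl_ext \<sigma> F x - sl_ext \<sigma> F y"
 using sl_ext_add[of F x "- y"] by (simp add: sl_ext_uminus)

lemma sl_ext_sum: "sl_ext \<sigma> F (sum f A) = (\<Sum>i\<in>A. sl_ext \<sigma> F (f i))"
 by (induction A rule: infinite_finite_induct) (auto simp: sl_ext_add)

lemma lookup_sl_ext: "lookup (sl_ext \<sigma> F x) g = (\<Sum>k\<in>keys x. \<sigma> (lookup x k) * lookup (F k) g)"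
 by (simp add: sl_ext_def lookup_sum)

end

lemma keys_sl_ext: "keys (sl_ext \<sigma> F x) \<subseteq> (\<Union>k\<in>keys x. keys (F k))"
proof
 fix g assume "g \<in> keys (sl_ext \<sigma> F x)"
 then have "(\<Sum>k\<in>keys x. \<sigma> (lookup x k) * lookup (F k) g) \<noteq> 0"
  by (simp add: in_keys_iff sl_ext_def lookup_sum)
 then obtain k where "k \<in> keys x" "\<sigma> (lookup x k) * lookup (F k) g \<noteq> 0"
  by (rule sum.not_neutral_contains_not_neutral)
 then show "g \<in> (\<Union>k\<in>keys x. keys (F k))" by (auto simp: in_keys_iff)
qed

lemma sl_ext_cong: "(\<And>k. k \<in> keys x ==> F k = G k) ==> sl_ext \<sigma> F x = sl_ext \<sigma> G x"
 by (simp add: sl_ext_def)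

interpretation id_semilin: semilin "\<lambda>c. c"
 by unfold_locales auto

lemmas lin_ext_simps = id_semilin.sl_ext_0[folded lin_ext_sl] id_semilin.sl_ext_add[folded lin_ext_sl]
 id_semilin.sl_ext_single[folded lin_ext_sl] id_semilin.sl_ext_cst[folded lin_ext_sl]
 id_semilin.sl_ext_uminus[folded lin_ext_sl] id_semilin.sl_ext_diff[folded lin_ext_sl]
 id_semilin.sl_ext_sum[folded lin_ext_sl]

lemmas lookup_lin_ext = id_semilin.lookup_sl_ext[folded lin_ext_sl]
lemmas keys_lin_ext = keys_sl_ext[of "\<lambda>c. c", folded lin_ext_sl]
lemmas lin_ext_cong = sl_ext_cong[of _ _ _ "\<lambda>c. c", folded lin_ext_sl]

lemma lin_ext_lin_ext: "lin_ext F (lin_ext G x) = lin_ext (\<lambda>k. lin_ext F (G k)) x"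
 by (induction x rule: pm_induct) (simp_all add: lin_ext_simps)

lemma lin_ext_id [simp]: "lin_ext (\<lambda>k. single k 1) x = x"
proof (induction x rule: pm_induct)
 case zero
 show ?case by (rule lin_ext_simps)
next
 case (single k c)
 show ?case by (simp only: lin_ext_simps cst_single mult_1_right)
next
 case (add x y)
 then show ?case by (simp only: lin_ext_simps)
qed

lemma lin_ext_zero_fun [simp]: "lin_ext (\<lambda>k. 0) x = 0"
 by (simp add: lin_ext_def)

lemma lin_ext_add_fun: "lin_ext (\<lambda>k. F k + G k) x = lin_ext F x + lin_ext G x"
 by (simp add: lin_ext_def distrib_left sum.distrib)

lemma lin_ext_cst_fun: "lin_ext (\<lambda>k. cst c * F k) x = cst c * lin_ext F x"
 unfolding lin_ext_def sum_distrib_left cst_cst by (simp add: mult.commute)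

text \<open>Evaluation of a monoid algebra along a multiplicative map; the monoids will be words and
  pairs of words.\<close>

locale ev_hom = qalg cs for cs :: "qfield => 'r::ring_1" +
 fixes \<chi> :: "'k::monoid_add => 'r"
 assumes chi_0 [simp]: "\<chi> 0 = 1" and chi_add: "\<chi> (a + b) = \<chi> a * \<chi> b"
begin

definition ev :: "('k \<Rightarrow>\<^sub>0 qfield) => 'r" where
 "ev x = (\<Sum>k\<in>keys x. sc (lookup x k) (\<chi> k))"

lemma ev_superset: "finite A ==> keys x \<subseteq> A ==> ev x = (\<Sum>k\<in>A. sc (lookup x k) (\<chi> k))"
 unfolding ev_def by (intro sum.mono_neutral_left) (auto simp: in_keys_iff sc_simps)

lemma ev_0 [simp]: "ev 0 = 0"
 by (simp add: ev_def)

lemma ev_add: "ev (x + y) = ev x + ev y"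
proof -
 let ?A = "keys x \<union> keys y"
 have "keys (x + y) \<subseteq> ?A" by (rule Poly_Mapping.keys_add)
 then show ?thesis by (simp add: ev_superset[of ?A] lookup_add sc_add sum.distrib)
qed

lemma ev_uminus: "ev (- x) = - ev x"
 using ev_add[of x "- x"] by (simp add: eq_neg_iff_add_eq_0 add.commute)

lemma ev_diff: "ev (x - y) = ev x - ev y"
 using ev_add[of x "- y"] by (simp add: ev_uminus)

lemma ev_sum: "ev (sum f A) = (\<Sum>i\<in>A. ev (f i))"
 by (induction A rule: infinite_finite_induct) (auto simp: ev_add)

lemma ev_single: "ev (single k c) = sc c (\<chi> k)"
 by (simp add: ev_superset[of "{k}"])

lemma ev_cst: "ev (cst c) = cs c"
 by (simp add: cst_def ev_single sc_def)

lemma ev_1 [simp]: "ev 1 = 1"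
 using ev_cst[of 1] by (simp add: cst_simps)

lemma ev_mult: "ev (x * y) = ev x * ev y"
proof (induction x rule: pm_induct)
 case (single k c)
 show ?case
 proof (induction y rule: pm_induct)
  case (single l d)
  show ?case by (simp add: mult_single ev_single chi_add sc_simps sc_sc mult.commute[of c d])
 next
  case (add x y)
  then show ?case by (simp add: distrib_left ev_add)
 qed simp
next
 case (add x y)
 then show ?case by (simp add: distrib_right ev_add)
qed simp

lemma ev_zero_ideal:
 assumes "x \<in> two_sided_ideal R" "\<And>r. r \<in> R ==> ev r = 0"
 shows "ev x = 0"
 using assms(1) by induction (auto simp: assms(2) ev_add ev_mult)

end

section \<open>Representations of the quantum group\<close>

context qalg
begin

text \<open>The prescribed q-commutations make all mixed terms cancel, which leaves the sum of the
  two given Serre relations.\<close>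

lemma serre_rel_coproduct:
 assumes "serre_rel a b" "serre_rel a' b'"
  and aa: "a' * a = sq (-2) (a * a')" and ab: "a' * b = sq 1 (b * a')" and ba: "b' * a = sq 1 (a * b')"
 shows "serre_rel (a + a') (b + b')"
proof -
 have "(a + a') * (a + a') * (b + b') + (b + b') * (a + a') * (a + a')
   - (sq 1 ((a + a') * (b + b') * (a + a')) + sq (-1) ((a + a') * (b + b') * (a + a')))
  = (a * a * b + b * a * a - (sq 1 (a * b * a) + sq (-1) (a * b * a)))
  + (a' * a' * b' + b' * a' * a' - (sq 1 (a' * b' * a') + sq (-1) (a' * b' * a')))"
  by (simp add: algebra_simps sq_simps aa qcomm_left[OF aa] ab qcomm_left[OF ab] ba qcomm_left[OF ba])
 then show ?thesis
  using assms(1,2) unfolding serre_rel_def by simp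
qed

end

text \<open>Homomorphic images of the quantum group, described by elements of an arbitrary ring, so
  that operators on Fock space and classes in a quotient ring are both instances.\<close>

locale uq_alg = qalg cs for cs :: "qfield => 'r::ring_1" +
 fixes E F K L :: "int => 'r"
 assumes KL: "K a * L a = 1" and LK: "L a * K a = 1" and KK: "K a * K b = K b * K a"
  and KEL: "K a * E b * L a = sq (of_bool (a = b) - of_bool (a = b + 1)) (E b)"
  and KFL: "K a * F b * L a = sq (of_bool (a = b + 1) - of_bool (a = b)) (F b)"
  and EF: "E a * F b - F b * E a = sc (of_bool (a = b) / (qq - inverse qq)) (K a * L (a + 1) - K (a + 1) * L a)"
  and serre_E: "\<bar>a - b\<bar> = 1 ==> serre_rel (E a) (E b)"
  and far_E: "\<bar>a - b\<bar> > 1 ==> E a * E b = E b * E a"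
  and serre_F: "\<bar>a - b\<bar> = 1 ==> serre_rel (F a) (F b)"
  and far_F: "\<bar>a - b\<bar> > 1 ==> F a * F b = F b * F a"
begin

lemma LK_comm: "L a * K b = K b * L a"
proof -
 have "L a * K b = L a * (K b * K a) * L a" by (simp add: mult.assoc KL)
 also have "\<dots> = (L a * K a) * K b * L a" by (simp only: KK[of b a] mult.assoc)
 finally show ?thesis by (simp add: LK)
qed

lemma LL: "L a * L b = L b * L a"
proof -
 have "L a * L b = L b * (K b * L a) * L b" by (simp add: mult.assoc[symmetric] LK)
 also have "\<dots> = L b * L a * (K b * L b)" by (simp only: LK_comm[of a b, symmetric] mult.assoc)
 finally show ?thesis by (simp add: KL)
qed

lemma KE: "K a * E b = sq (of_bool (a = b) - of_bool (a = b + 1)) (E b * K a)"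
proof -
 have "K a * E b = K a * E b * L a * K a" by (simp add: mult.assoc LK)
 then show ?thesis unfolding KEL sq_mult_left .
qed

lemma KF: "K a * F b = sq (of_bool (a = b + 1) - of_bool (a = b)) (F b * K a)"
proof -
 have "K a * F b = K a * F b * L a * K a" by (simp add: mult.assoc LK)
 then show ?thesis unfolding KFL sq_mult_left .
qed

lemma L_qcomm:
 assumes "K a * x = sq n (x * K a)"
 shows "L a * x = sq (- n) (x * L a)"
proof -
 have "L a * x = sq (- n) (L a * sq n (x * K a) * L a)" by (simp add: sq_simps mult.assoc KL)
 also have "\<dots> = sq (- n) ((L a * K a) * x * L a)" by (simp only: assms[symmetric] mult.assoc)
 finally show ?thesis by (simp add: LK)
qed

lemmas LE = L_qcomm[OF KE] and LF = L_qcomm[OF KF]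

definition "KJ a = K a * L (a + 1)"
definition "JK a = K (a + 1) * L a"

definition cart :: "int => int => int" where
 "cart a b = 2 * of_bool (a = b) - of_bool (a = b + 1) - of_bool (b = a + 1)"

lemma qcomm_mult:
 assumes "k * x = sq m (x * k)" "l * x = sq n (x * l)"
 shows "k * l * x = sq (m + n) (x * (k * l))"
 by (simp add: mult.assoc assms sq_simps qcomm_left[OF assms(1)] add.commute)

lemma KJ_E: "KJ a * E b = sq (cart a b) (E b * KJ a)"
 and JK_E: "JK a * E b = sq (- cart a b) (E b * JK a)"
 and KJ_F: "KJ a * F b = sq (- cart a b) (F b * KJ a)"
 and JK_F: "JK a * F b = sq (cart a b) (F b * JK a)"
 unfolding KJ_def JK_def
 by (subst qcomm_mult[OF KE LE] qcomm_mult[OF KF LF];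
   auto simp: cart_def intro!: arg_cong2[where f = sq])+

lemma JK_JK: "JK a * JK b = JK b * JK a"
 unfolding JK_def
 by (metis KK LK_comm LL mult.assoc)

lemma EF_diag: "sq 1 (E a * F a - F a * E a) - sq (-1) (E a * F a - F a * E a) = KJ a - JK a"
 unfolding c_sq EF sc_sc using qq_diff_inverse_nonzero by (simp add: sc_simps KJ_def JK_def)

lemma EF_comm: "a \<noteq> b ==> E a * F b = F b * E a"
 using EF[of a b] by (simp add: sc_simps)

lemma swapped: "uq_alg cs F E L K"
proof (intro uq_alg.intro uq_alg_axioms.intro qalg_axioms KL LK LL serre_E serre_F far_E far_F)
 show "L a * F b * K a = sq (of_bool (a = b) - of_bool (a = b + 1)) (F b)" for a b
  unfolding LF by (simp add: sq_simps mult.assoc LK)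
 show "L a * E b * K a = sq (of_bool (a = b + 1) - of_bool (a = b)) (E b)" for a b
  unfolding LE by (simp add: sq_simps mult.assoc LK)
 show "F a * E b - E b * F a = sc (of_bool (a = b) / (qq - inverse qq)) (L a * K (a + 1) - L (a + 1) * K a)" for a b
  using arg_cong[OF EF[of b a], of uminus]
  by (cases "a = b") (simp_all add: LK_comm sc_simps)
qed

lemma serre_E_nat: "q_serre cs (\<lambda>i. E (s + int i))"
 by (intro q_serre.intro q_serre_axioms.intro qalg_axioms far_E serre_E) auto

end

text \<open>The tensor product of two representations: commuting images with the comultiplication.\<close>

locale uq_pair = qalg cs + A: uq_alg cs E1 F1 K1 L1 + B: uq_alg cs E2 F2 K2 L2
 for cs :: "qfield => 'r::ring_1" and E1 F1 K1 L1 E2 F2 K2 L2 +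
 assumes commute: "x \<in> range E1 \<union> range F1 \<union> range K1 \<union> range L1 ==>
   y \<in> range E2 \<union> range F2 \<union> range K2 \<union> range L2 ==> y * x = x * y"
begin

lemma commute_simps:
 "E2 i * E1 j = E1 j * E2 i" "E2 i * F1 j = F1 j * E2 i" "E2 i * K1 j = K1 j * E2 i" "E2 i * L1 j = L1 j * E2 i"
 "F2 i * E1 j = E1 j * F2 i" "F2 i * F1 j = F1 j * F2 i" "F2 i * K1 j = K1 j * F2 i" "F2 i * L1 j = L1 j * F2 i"
 "K2 i * E1 j = E1 j * K2 i" "K2 i * F1 j = F1 j * K2 i" "K2 i * K1 j = K1 j * K2 i" "K2 i * L1 j = L1 j * K2 i"
 "L2 i * E1 j = E1 j * L2 i" "L2 i * F1 j = F1 j * L2 i" "L2 i * K1 j = K1 j * L2 i" "L2 i * L1 j = L1 j * L2 i"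
 by (rule commute; blast)+

lemmas mixed = commute_simps commute_simps[THEN comm_left]

definition "dE a = E2 a + E1 a * (K2 (a + 1) * L2 a)"
definition "dF a = F1 a + K1 a * L1 (a + 1) * F2 a"
definition "dK a = K1 a * K2 a"
definition "dL a = L1 a * L2 a"

text \<open>Exchanging the tensor factors, E with F, and K with its inverse turns the coproduct of E
  into that of F; the relations among the F's thus follow from those among the E's.\<close>

lemma flipped: "uq_pair cs F2 E2 L2 K2 F1 E1 L1 K1"
 by (intro uq_pair.intro uq_pair_axioms.intro qalg_axioms A.swapped B.swapped commute[symmetric]) auto

lemma dK_dL: "dK a * dL a = 1" "dL a * dK a = 1" "dK a * dK b = dK b * dK a"
proof -
 have "dK a * dL a = K1 a * L1 a * (K2 a * L2 a)" "dL a * dK a = L1 a * K1 a * (L2 a * K2 a)"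
  unfolding dK_def dL_def by (simp_all add: mult.assoc mixed)
 then show "dK a * dL a = 1" "dL a * dK a = 1"
  by (simp_all add: A.KL B.KL A.LK B.LK)
 have "dK a * dK b = K1 a * K1 b * (K2 a * K2 b)" "dK b * dK a = K1 b * K1 a * (K2 b * K2 a)"
  unfolding dK_def by (simp_all add: mult.assoc mixed)
 then show "dK a * dK b = dK b * dK a" using A.KK[of a b] B.KK[of a b] by simp
qed

lemma dE_JK: "dE a = E2 a + E1 a * B.JK a"
 by (simp add: dE_def B.JK_def)

lemma JK2_mixed: "B.JK a * E1 b = E1 b * B.JK a" "B.JK a * K1 b = K1 b * B.JK a"
 unfolding B.JK_def by (simp_all add: mult.assoc mixed)

lemma dKE: "dK a * dE b * dL a = sq (of_bool (a = b) - of_bool (a = b + 1)) (dE b)"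
proof -
 have KJ: "K2 a * B.JK b = B.JK b * K2 a"
  unfolding B.JK_def by (simp add: mult.assoc B.LK_comm[of b a] comm_left[OF B.KK[of a "b + 1"]])
 have "dK a * dE b = sq (of_bool (a = b) - of_bool (a = b + 1)) (dE b * dK a)"
  unfolding dE_JK dK_def
  by (simp add: algebra_simps sq_simps mixed JK2_mixed A.KE qcomm_left[OF A.KE] B.KE qcomm_left[OF B.KE]
    comm_left[OF JK2_mixed(1)] comm_left[OF JK2_mixed(2)] KJ)
 then show ?thesis by (simp add: sq_simps mult.assoc dK_dL)
qed

lemma serre_dE:
 assumes "\<bar>a - b\<bar> = 1"
 shows "serre_rel (dE a) (dE b)"
 unfolding dE_JK
proof (rule serre_rel_coproduct)
 have c: "A.cart a b = -1" if "\<bar>a - b\<bar> = 1" for a b using that by (auto simp: A.cart_def)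
 have ba: "\<bar>b - a\<bar> = 1" using assms by simp
 show "serre_rel (E2 a) (E2 b)" using assms by (rule B.serre_E)
 have "E1 a * B.JK a * (E1 a * B.JK a) * (E1 b * B.JK b) + E1 b * B.JK b * (E1 a * B.JK a) * (E1 a * B.JK a)
   = (E1 a * E1 a * E1 b + E1 b * E1 a * E1 a) * (B.JK a * B.JK a * B.JK b)"
  and "E1 a * B.JK a * (E1 b * B.JK b) * (E1 a * B.JK a) = (E1 a * E1 b * E1 a) * (B.JK a * B.JK a * B.JK b)"
  by (simp_all add: algebra_simps JK2_mixed comm_left[OF JK2_mixed(1)] B.JK_JK[of b a] comm_left[OF B.JK_JK[of b a]])
 then show "serre_rel (E1 a * B.JK a) (E1 b * B.JK b)"
  using A.serre_E[OF assms] unfolding serre_rel_def by (simp add: distrib_right sq_simps)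
 show "E1 a * B.JK a * E2 a = sq (-2) (E2 a * (E1 a * B.JK a))"
  by (simp add: mult.assoc mixed B.JK_E sq_simps A.cart_def)
 show "E1 a * B.JK a * E2 b = sq 1 (E2 b * (E1 a * B.JK a))"
  using c[OF assms] by (simp add: mult.assoc mixed B.JK_E sq_simps)
 show "E1 b * B.JK b * E2 a = sq 1 (E2 a * (E1 b * B.JK b))"
  using c[OF ba] by (simp add: mult.assoc mixed B.JK_E sq_simps)
qed

lemma far_dE:
 assumes "\<bar>a - b\<bar> > 1"
 shows "dE a * dE b = dE b * dE a"
proof -
 have "A.cart a b = 0" "A.cart b a = 0" using assms by (auto simp: A.cart_def)
 then have "B.JK a * E2 b = E2 b * B.JK a" "B.JK b * E2 a = E2 a * B.JK b"
  using B.JK_E[of a b] B.JK_E[of b a] by (simp_all add: sq_simps)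
 note J = this this[THEN comm_left]
 note far = A.far_E[OF assms] B.far_E[OF assms] B.JK_JK[of a b]
 show ?thesis
  unfolding dE_JK
  by (simp add: algebra_simps mixed JK2_mixed comm_left[OF JK2_mixed(1)] J far far[THEN comm_left])
qed

lemma dE_dF: "dE a * dF b - dF b * dE a
  = sc (of_bool (a = b) / (qq - inverse qq)) (dK a * dL (a + 1) - dK (a + 1) * dL a)"
proof -
 have 1: "E2 a * (K1 b * L1 (b + 1) * F2 b) - K1 b * L1 (b + 1) * F2 b * E2 a
   = K1 b * L1 (b + 1) * (E2 a * F2 b - F2 b * E2 a)"
  by (simp add: algebra_simps mixed)
 have 2: "E1 a * B.JK a * F1 b - F1 b * (E1 a * B.JK a) = (E1 a * F1 b - F1 b * E1 a) * B.JK a"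
  unfolding B.JK_def by (simp add: algebra_simps mixed)
 have "E1 a * B.JK a * (A.KJ b * F2 b) = A.KJ b * F2 b * (E1 a * B.JK a)"
 proof -
  have JF: "B.JK a * F2 b = sq (A.cart a b) (F2 b * B.JK a)" by (rule B.JK_F)
  have KE: "A.KJ b * E1 a = sq (A.cart b a) (E1 a * A.KJ b)" by (rule A.KJ_E)
  have KJ: "B.JK a * A.KJ b = A.KJ b * B.JK a" and KF: "F2 b * E1 a = E1 a * F2 b"
   unfolding B.JK_def A.KJ_def by (simp_all add: mult.assoc mixed)
  have "A.cart a b = A.cart b a" by (auto simp: A.cart_def)
  then show ?thesis
   by (simp add: mult.assoc sq_simps JF KF comm_left[OF KF] KE qcomm_left[OF KE] KJ comm_left[OF KJ])
 qed
 then have 3: "E1 a * B.JK a * (K1 b * L1 (b + 1) * F2 b) = K1 b * L1 (b + 1) * F2 b * (E1 a * B.JK a)"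
  by (simp add: A.KJ_def)
 have "dE a * dF b - dF b * dE a
  = (E2 a * (K1 b * L1 (b + 1) * F2 b) - K1 b * L1 (b + 1) * F2 b * E2 a)
   + (E1 a * B.JK a * F1 b - F1 b * (E1 a * B.JK a))"
  unfolding dE_JK dF_def distrib_left distrib_right 3 commute_simps(2) by simp
 also have "\<dots> = sc (of_bool (a = b) / (qq - inverse qq))
   (K1 b * L1 (b + 1) * (K2 a * L2 (a + 1) - K2 (a + 1) * L2 a)
   + (K1 a * L1 (a + 1) - K1 (a + 1) * L1 a) * (K2 (a + 1) * L2 a))"
  unfolding 1 2 A.EF B.EF by (simp only: B.JK_def sc_simps(1,6,7))
 \<comment> \<open>The two mixed products of a K-ratio with an inverse K-ratio cancel.\<close>
 also have "\<dots> = sc (of_bool (a = b) / (qq - inverse qq)) (dK a * dL (a + 1) - dK (a + 1) * dL a)"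
 proof (cases "a = b")
  case True
  then show ?thesis unfolding dK_def dL_def by (simp add: algebra_simps mixed)
 qed (simp add: sc_simps)
 finally show ?thesis .
qed

end

context uq_pair
begin

interpretation S: uq_pair cs F2 E2 L2 K2 F1 E1 L1 K1 by (rule flipped)

lemma uq_alg_coproduct: "uq_alg cs dE dF dK dL"
proof -
 have dF: "S.dE a = dF a" and dL: "S.dK a = dL a" and dK: "S.dL a = dK a" for a
  unfolding S.dE_def dF_def S.dK_def dL_def S.dL_def dK_def
  by (simp_all add: mult.assoc mixed A.LK_comm)
 have KFL: "dK a * dF b * dL a = sq (of_bool (a = b + 1) - of_bool (a = b)) (dF b)" for a b
 proof -
  define n :: int where "n = of_bool (a = b) - of_bool (a = b + 1)"
  have LFK: "dL a * dF b * dK a = sq n (dF b)" using S.dKE[of a b] unfolding dF dL dK n_def .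
  have "dF b = dK a * (dL a * dF b * dK a) * dL a"
   by (simp add: mult.assoc dK_dL) (simp add: dK_dL flip: mult.assoc)
  then have "dF b = sq n (dK a * dF b * dL a)"
   unfolding LFK by (simp only: sq_mult_left sq_mult_right)
  then have "sq (- n) (dF b) = sq (- n) (sq n (dK a * dF b * dL a))" by simp
  then have "dK a * dF b * dL a = sq (- n) (dF b)" by (simp only: sq_sq left_minus sq_0)
  then show ?thesis unfolding n_def minus_diff_eq .
 qed
 show ?thesis
  using S.serre_dE S.far_dE unfolding dF
  by (intro uq_alg.intro uq_alg_axioms.intro qalg_axioms dK_dL dKE KFL dE_dF serre_dE far_dE)
qed

end

section \<open>The automorphism inverting \<open>q\<close>\<close>

definition kap :: "rat => qfield" where
 "kap c = Fract [:c:] 1"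

lemma kap_simps [simp]: "kap 0 = 0" "kap 1 = 1"
 by (simp_all add: kap_def Zero_fract_def One_fract_def one_pCons)

lemma kap_add: "kap (a + b) = kap a + kap b" and kap_mult: "kap (a * b) = kap a * kap b"
 by (simp_all add: kap_def mult.commute)

lemma eval_inv_0 [simp]: "eval_inv 0 = 0"
 by (simp add: eval_inv_def)

lemma eval_inv_pCons: "eval_inv (pCons a p) = kap a + inverse qq * eval_inv p"
 by (simp add: eval_inv_def map_poly_pCons kap_def[symmetric])

lemma eval_inv_add: "eval_inv (p + r) = eval_inv p + eval_inv r"
 by (induction p r rule: poly_induct2) (simp_all add: eval_inv_pCons kap_add algebra_simps)

lemma eval_inv_smult: "eval_inv (smult a p) = kap a * eval_inv p"
 by (induction p) (simp_all add: eval_inv_pCons kap_mult algebra_simps)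

lemma eval_inv_mult: "eval_inv (p * r) = eval_inv p * eval_inv r"
 by (induction p) (simp_all add: eval_inv_pCons eval_inv_add eval_inv_smult algebra_simps)

lemma eval_inv_1 [simp]: "eval_inv 1 = 1"
 by (simp add: one_pCons eval_inv_pCons)

lemma Fract_pCons: "Fract (pCons a p) 1 = kap a + qq * Fract p 1"
 by (simp add: kap_def qq_def)

text \<open>Multiplying by a power of \<open>q\<close> turns \<open>eval_inv p\<close> into the reflected polynomial.\<close>

lemma eval_inv_nonzero:
 assumes "p \<noteq> 0"
 shows "eval_inv p \<noteq> 0"
proof -
 have "\<exists>r. qq ^ degree p * eval_inv p = Fract r 1 \<and> coeff r 0 = lead_coeff p"
  using assms
 proof (induction p)
  case (pCons a p)
  show ?case
  proof (cases "p = 0")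
   case True
   then show ?thesis by (auto simp: eval_inv_pCons kap_def intro!: exI[of _ "[:a:]"])
  next
   case False
   with pCons obtain r where r: "qq ^ degree p * eval_inv p = Fract r 1" "coeff r 0 = lead_coeff p"
    by auto
   have "qq ^ degree (pCons a p) * eval_inv (pCons a p)
     = qq ^ Suc (degree p) * kap a + (qq * inverse qq) * (qq ^ degree p * eval_inv p)"
    using False by (simp add: eval_inv_pCons algebra_simps)
   also have "\<dots> = Fract (monom a (Suc (degree p)) + r) 1"
    unfolding r unfolding kap_def qq_power by (simp add: mult_monom smult_monom mult.commute)
   finally show ?thesis using r False by (intro exI[of _ "monom a (Suc (degree p)) + r"]) simp
  qed
 qed simp
 then obtain r where r: "qq ^ degree p * eval_inv p = Fract r 1" "coeff r 0 = lead_coeff p" by blast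
 then have "r \<noteq> 0" using assms by auto
 then have "Fract r 1 \<noteq> 0" by (simp add: Zero_fract_def eq_fract)
 then show ?thesis using r by auto
qed

lemma qbar_Fract: "r \<noteq> 0 ==> qbar (Fract p r) = eval_inv p / eval_inv r"
proof -
 assume r: "r \<noteq> 0"
 obtain p' r' where q: "quot_of_fract (Fract p r) = (p', r')" by fastforce
 have r': "r' \<noteq> 0" using snd_quot_of_fract_nonzero[of "Fract p r"] q by simp
 have "Fract p' r' = Fract p r"
  using quot_to_fract_quot_of_fract[of "Fract p r"] q r' by (simp add: quot_to_fract_def)
 then have "eval_inv (p' * r) = eval_inv (p * r')" using r r' by (simp add: eq_fract)
 then have "eval_inv p' * eval_inv r = eval_inv p * eval_inv r'" by (simp add: eval_inv_mult)
 then show ?thesis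
  using eval_inv_nonzero[OF r] eval_inv_nonzero[OF r'] q
  by (simp add: qbar_def field_simps)
qed

lemma qbar_add: "qbar (x + y) = qbar x + qbar y"
proof -
 obtain a b c d where xy: "x = Fract a b" "b \<noteq> 0" "y = Fract c d" "d \<noteq> 0"
  by (cases x; cases y) blast
 then have "qbar (x + y) = (eval_inv a * eval_inv d + eval_inv c * eval_inv b) / (eval_inv b * eval_inv d)"
  by (simp only: add_fract qbar_Fract mult_eq_0_iff eval_inv_add eval_inv_mult simp_thms)
 also have "\<dots> = eval_inv a / eval_inv b + eval_inv c / eval_inv d"
  using xy by (intro add_frac_eq[symmetric] eval_inv_nonzero)
 finally show ?thesis unfolding xy(1,3) qbar_Fract[OF xy(2)] qbar_Fract[OF xy(4)] .
qed

lemma qbar_mult: "qbar (x * y) = qbar x * qbar y"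
proof -
 obtain a b c d where xy: "x = Fract a b" "b \<noteq> 0" "y = Fract c d" "d \<noteq> 0"
  by (cases x; cases y) blast
 then have "qbar (x * y) = (eval_inv a * eval_inv c) / (eval_inv b * eval_inv d)"
  by (simp only: mult_fract qbar_Fract mult_eq_0_iff eval_inv_mult simp_thms)
 then show ?thesis unfolding xy(1,3) qbar_Fract[OF xy(2)] qbar_Fract[OF xy(4)] times_divide_times_eq .
qed

lemma qbar_1 [simp]: "qbar 1 = 1"
 using qbar_Fract[of 1 1] by (simp flip: One_fract_def)

lemma qbar_qq [simp]: "qbar qq = inverse qq"
 using qbar_Fract[of 1 "[:0, 1:]"] by (simp add: eval_inv_pCons flip: qq_def)

interpretation qbar: semilin qbar
 by unfold_locales (auto simp: qbar_add qbar_mult)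

lemma qbar_0 [simp]: "qbar 0 = 0"
 by (rule qbar.sigma_0)

lemma qbar_uminus: "qbar (- x) = - qbar x"
 using qbar_add[of x "- x"] by (simp add: eq_neg_iff_add_eq_0 add.commute)

lemma qbar_diff: "qbar (x - y) = qbar x - qbar y"
 using qbar_add[of x "- y"] by (simp add: qbar_uminus)

lemma qbar_inverse: "qbar (inverse x) = inverse (qbar x)"
proof (cases "x = 0")
 case False
 then have "qbar x * qbar (inverse x) = 1" by (simp flip: qbar_mult)
 then show ?thesis by (metis inverse_unique)
qed simp

lemma qbar_divide: "qbar (x / y) = qbar x / qbar y"
 by (simp add: divide_inverse qbar_mult qbar_inverse)

lemma qbar_power: "qbar (x ^ n) = qbar x ^ n"
 by (induction n) (simp_all add: qbar_mult)

lemma qbar_power_int: "qbar (x powi n) = qbar x powi n"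
 by (simp add: power_int_def qbar_power qbar_inverse)

lemma qbar_powi [simp]: "qbar (qq powi n) = qq powi (- n)"
 by (simp add: qbar_power_int power_int_minus power_int_inverse)

lemma qbar_kap [simp]: "qbar (kap c) = kap c"
 using qbar_Fract[of 1 "[:c:]"] by (simp add: eval_inv_pCons flip: kap_def)

lemma qbar_eval_inv: "qbar (eval_inv p) = Fract p 1"
proof (induction p)
 case (pCons a p)
 then show ?case by (simp add: eval_inv_pCons Fract_pCons qbar_add qbar_mult qbar_inverse)
qed (simp flip: Zero_fract_def)

lemma qbar_qbar [simp]: "qbar (qbar x) = x"
proof (cases x)
 case (Fract p r)
 then have "qbar (qbar x) = Fract p 1 / Fract r 1"
  by (simp add: qbar_Fract qbar_divide qbar_eval_inv)
 with Fract show ?thesis by simp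
qed

section \<open>The tensor square of the quantum group\<close>

lemma tens_single: "tens (single k a) (single l b) = single (k, l) (a * b)"
 by (simp add: tens_def lin_ext_simps cst_single)

lemma tens_add: "tens (x + x') y = tens x y + tens x' y" "tens x (y + y') = tens x y + tens x y'"
 by (simp_all add: tens_def lin_ext_simps lin_ext_add_fun)

lemma tens_0 [simp]: "tens 0 y = 0" "tens x 0 = 0"
 by (simp_all add: tens_def lin_ext_simps)

lemma tens_cst: "tens (cst c * x) y = cst c * tens x y" "tens x (cst c * y) = cst c * tens x y"
 by (simp_all add: tens_def lin_ext_simps lin_ext_cst_fun)

lemma tens_uminus: "tens (- x) y = - tens x y" "tens x (- y) = - tens x y"
 using tens_add(1)[of x "- x" y] tens_add(2)[of x y "- y"]
 by (simp_all add: eq_neg_iff_add_eq_0 add.commute)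

lemma tens_1_1: "tens 1 1 = 1"
 using tens_single[of 0 1 0 1] by (simp add: zero_prod_def[symmetric])

locale gen_hom = qalg cs for cs :: "qfield => 'r::ring_1" +
 fixes g :: "gen => 'r"
begin

definition chi :: "gen list => 'r" where
 "chi w = prod_list (map g w)"

sublocale ev_hom cs chi
 by unfold_locales (simp_all add: chi_def zero_list_def plus_list_def)

lemma ev_gens: "ev (xE a) = g (gE a)" "ev (xF a) = g (gF a)" "ev (xK a) = g (gK a)" "ev (xKinv a) = g (gKinv a)"
 by (simp_all add: xE_def xF_def xK_def xKinv_def ev_single chi_def sc_simps)

lemma cs_sq: "cs (qq powi n) * x = sq n x"
 by (simp add: sq_def)

lemma cs_two: "cs (qq + inverse qq) * x = sq 1 x + sq (-1) x"
 by (simp add: sq_def cs_add distrib_right)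

lemmas ev_simps = ev_diff ev_add ev_mult ev_gens ev_cst cs_sq cs_two

lemma ev_rels:
 assumes "uq_alg cs (\<lambda>a. g (gE a)) (\<lambda>a. g (gF a)) (\<lambda>a. g (gK a)) (\<lambda>a. g (gKinv a))"
  and "r \<in> uq_rels"
 shows "ev r = 0"
proof -
 interpret R: uq_alg cs "\<lambda>a. g (gE a)" "\<lambda>a. g (gF a)" "\<lambda>a. g (gK a)" "\<lambda>a. g (gKinv a)" by fact
 have S: "x = y ==> x - y = 0" for x y :: 'r by simp
 show ?thesis
  using assms(2) unfolding uq_rels_def Un_iff mem_Collect_eq xKK_def
  apply (elim disjE exE conjE; simp only: ev_simps ev_1; intro S)
  subgoal by (rule R.KL)
  subgoal by (rule R.LK)
  subgoal by (rule R.KK)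
  subgoal by (rule R.KEL)
  subgoal by (rule R.KFL)
  subgoal using R.EF by (simp add: sc_def)
  subgoal using R.serre_E by (simp add: serre_rel_def mult.assoc)
  subgoal by (rule R.far_E)
  subgoal using R.serre_F by (simp add: serre_rel_def mult.assoc)
  subgoal by (rule R.far_F)
  done
qed

lemma rels_uq_alg:
 assumes "\<And>r. r \<in> uq_rels ==> ev r = 0"
 shows "uq_alg cs (\<lambda>a. g (gE a)) (\<lambda>a. g (gF a)) (\<lambda>a. g (gK a)) (\<lambda>a. g (gKinv a))"
proof (intro uq_alg.intro uq_alg_axioms.intro qalg_axioms)
 fix a b :: int
 have *: "ev x = ev y" if "x - y \<in> uq_rels" for x y using assms[OF that] by (simp add: ev_diff)
 note R = uq_rels_def Un_iff mem_Collect_eq xKK_def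
 have "ev (xK a * xKinv a) = ev 1" by (rule *) (unfold R, blast)
 then show "g (gK a) * g (gKinv a) = 1" by (simp add: ev_simps)
 have "ev (xKinv a * xK a) = ev 1" by (rule *) (unfold R, blast)
 then show "g (gKinv a) * g (gK a) = 1" by (simp add: ev_simps)
 have "ev (xK a * xK b) = ev (xK b * xK a)" by (rule *) (unfold R, blast)
 then show "g (gK a) * g (gK b) = g (gK b) * g (gK a)" by (simp add: ev_simps)
 have "ev (xK a * xE b * xKinv a) = ev (cst (qq powi (of_bool (a = b) - of_bool (a = b + 1))) * xE b)"
  by (rule *) (unfold R, blast)
 then show "g (gK a) * g (gE b) * g (gKinv a) = sq (of_bool (a = b) - of_bool (a = b + 1)) (g (gE b))"
  by (simp only: ev_simps)
 have "ev (xK a * xF b * xKinv a) = ev (cst (qq powi (of_bool (a = b + 1) - of_bool (a = b))) * xF b)"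
  by (rule *) (unfold R, blast)
 then show "g (gK a) * g (gF b) * g (gKinv a) = sq (of_bool (a = b + 1) - of_bool (a = b)) (g (gF b))"
  by (simp only: ev_simps)
 have "ev (xE a * xF b - xF b * xE a) = ev (cst (of_bool (a = b) / (qq - inverse qq)) * (xKK a (a + 1) - xKK (a + 1) a))"
  by (rule *) (unfold R, blast)
 then show "g (gE a) * g (gF b) - g (gF b) * g (gE a) = sc (of_bool (a = b) / (qq - inverse qq))
   (g (gK a) * g (gKinv (a + 1)) - g (gK (a + 1)) * g (gKinv a))"
  by (simp only: ev_simps sc_def xKK_def)
 {
  assume ab: "\<bar>a - b\<bar> = 1"
  have "ev (xE a * xE a * xE b + xE b * xE a * xE a) = ev (cst (qq + inverse qq) * (xE a * xE b * xE a))"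
   by (rule *) (use ab in \<open>unfold R, blast\<close>)
  then show "serre_rel (g (gE a)) (g (gE b))" by (simp only: ev_simps serre_rel_def)
  have "ev (xF a * xF a * xF b + xF b * xF a * xF a) = ev (cst (qq + inverse qq) * (xF a * xF b * xF a))"
   by (rule *) (use ab in \<open>unfold R, blast\<close>)
  then show "serre_rel (g (gF a)) (g (gF b))" by (simp only: ev_simps serre_rel_def)
 }
 {
  assume ab: "\<bar>a - b\<bar> > 1"
  have "ev (xE a * xE b) = ev (xE b * xE a)" by (rule *) (use ab in \<open>unfold R, blast\<close>)
  then show "g (gE a) * g (gE b) = g (gE b) * g (gE a)" by (simp only: ev_simps)
  have "ev (xF a * xF b) = ev (xF b * xF a)" by (rule *) (use ab in \<open>unfold R, blast\<close>)
  then show "g (gF a) * g (gF b) = g (gF b) * g (gF a)" by (simp only: ev_simps)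
 }
qed

end

locale gen_hom2 = qalg cs + A: gen_hom cs g1 + B: gen_hom cs g2
 for cs :: "qfield => 'r::ring_1" and g1 g2 +
 assumes g_comm: "g2 y * g1 x = g1 x * g2 y"
begin

definition chi2 :: "gen list \<times> gen list => 'r" where
 "chi2 k = A.chi (fst k) * B.chi (snd k)"

lemma chi_comm: "B.chi v * A.chi w = A.chi w * B.chi v"
proof -
 have 1: "g2 y * A.chi w = A.chi w * g2 y" for y
  unfolding A.chi_def by (induction w) (simp_all add: g_comm comm_left[OF g_comm] mult.assoc)
 show ?thesis
  unfolding B.chi_def by (induction v) (simp_all add: 1 mult.assoc comm_left[OF 1])
qed

sublocale T: ev_hom cs chi2
proof unfold_locales
 show "chi2 0 = 1" by (simp add: chi2_def zero_prod_def)
 show "chi2 (a + b) = chi2 a * chi2 b" for a b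
  by (simp add: chi2_def A.chi_add B.chi_add mult.assoc comm_left[OF chi_comm])
qed

lemma ev_tens: "T.ev (tens x y) = A.ev x * B.ev y"
proof (induction x rule: pm_induct)
 case (single k a)
 show ?case
 proof (induction y rule: pm_induct)
  case (single l b)
  show ?case
   unfolding tens_single T.ev_single A.ev_single B.ev_single
   by (simp add: chi2_def sc_simps sc_sc mult.commute[of a b])
 qed (simp_all add: tens_add T.ev_add B.ev_add distrib_left)
qed (simp_all add: tens_add T.ev_add A.ev_add distrib_right)

lemma ev_uq2_ideal:
 assumes "uq_alg cs (\<lambda>a. g1 (gE a)) (\<lambda>a. g1 (gF a)) (\<lambda>a. g1 (gK a)) (\<lambda>a. g1 (gKinv a))"
  and "uq_alg cs (\<lambda>a. g2 (gE a)) (\<lambda>a. g2 (gF a)) (\<lambda>a. g2 (gK a)) (\<lambda>a. g2 (gKinv a))"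
  and "x \<in> uq2_ideal"
 shows "T.ev x = 0"
 using assms(3) unfolding uq2_ideal_def
 by (rule T.ev_zero_ideal) (auto simp: ev_tens A.ev_rels[OF assms(1)] B.ev_rels[OF assms(2)])

lemma uq_pairI:
 assumes "uq_alg cs (\<lambda>a. g1 (gE a)) (\<lambda>a. g1 (gF a)) (\<lambda>a. g1 (gK a)) (\<lambda>a. g1 (gKinv a))"
  and "uq_alg cs (\<lambda>a. g2 (gE a)) (\<lambda>a. g2 (gF a)) (\<lambda>a. g2 (gK a)) (\<lambda>a. g2 (gKinv a))"
 shows "uq_pair cs (\<lambda>a. g1 (gE a)) (\<lambda>a. g1 (gF a)) (\<lambda>a. g1 (gK a)) (\<lambda>a. g1 (gKinv a))
  (\<lambda>a. g2 (gE a)) (\<lambda>a. g2 (gF a)) (\<lambda>a. g2 (gK a)) (\<lambda>a. g2 (gKinv a))"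
 using g_comm by (intro uq_pair.intro uq_pair_axioms.intro qalg_axioms assms) auto

lemma ev_comult:
 assumes "uq_alg cs (\<lambda>a. g1 (gE a)) (\<lambda>a. g1 (gF a)) (\<lambda>a. g1 (gK a)) (\<lambda>a. g1 (gKinv a))"
  and "uq_alg cs (\<lambda>a. g2 (gE a)) (\<lambda>a. g2 (gF a)) (\<lambda>a. g2 (gK a)) (\<lambda>a. g2 (gKinv a))"
 defines "d \<equiv> \<lambda>x. T.ev (comult_gen x)"
 shows "uq_alg cs (\<lambda>a. d (gE a)) (\<lambda>a. d (gF a)) (\<lambda>a. d (gK a)) (\<lambda>a. d (gKinv a))"
proof -
 interpret U: uq_pair cs "\<lambda>a. g1 (gE a)" "\<lambda>a. g1 (gF a)" "\<lambda>a. g1 (gK a)" "\<lambda>a. g1 (gKinv a)"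
  "\<lambda>a. g2 (gE a)" "\<lambda>a. g2 (gF a)" "\<lambda>a. g2 (gK a)" "\<lambda>a. g2 (gKinv a)"
  by (rule uq_pairI[OF assms(1,2)])
 have "(\<lambda>a. d (gE a)) = U.dE" "(\<lambda>a. d (gF a)) = U.dF" "(\<lambda>a. d (gK a)) = U.dK" "(\<lambda>a. d (gKinv a)) = U.dL"
  by (simp_all add: fun_eq_iff d_def U.dE_def U.dF_def U.dK_def U.dL_def T.ev_add ev_tens
    A.ev_gens B.ev_gens A.ev_mult B.ev_mult xKK_def)
 then show ?thesis using U.uq_alg_coproduct by simp
qed

end

lemma uq2_ideal_uminus: "x \<in> uq2_ideal ==> - x \<in> uq2_ideal"
 unfolding uq2_ideal_def using two_sided_ideal.mult_left[of x _ "- 1"] by simp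

lemma uq2_ideal_rules:
 "0 \<in> uq2_ideal" "x \<in> uq2_ideal ==> y \<in> uq2_ideal ==> x + y \<in> uq2_ideal"
 "x \<in> uq2_ideal ==> r * x \<in> uq2_ideal" "x \<in> uq2_ideal ==> x * r \<in> uq2_ideal"
 unfolding uq2_ideal_def by (auto intro: two_sided_ideal.intros)

lemma uq2_ideal_diff: "x \<in> uq2_ideal ==> y \<in> uq2_ideal ==> x - y \<in> uq2_ideal"
 using uq2_ideal_rules(2)[of x "- y"] uq2_ideal_uminus by simp

fun counit_gen :: "gen => qfield" where
 "counit_gen (gE a) = 0"
| "counit_gen (gF a) = 0"
| "counit_gen (gK a) = 1"
| "counit_gen (gKinv a) = 1"

text \<open>The counit kills the ideal and sends 1 to 1. This gives \<open>0 \<noteq> 1\<close> in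
  the quotient, which the class \<open>ring_1\<close> demands.\<close>

lemma one_notin_uq2_ideal: "1 \<notin> uq2_ideal"
proof -
 interpret gen_hom2 id counit_gen counit_gen
  by unfold_locales auto
 have "uq_alg id (\<lambda>a. counit_gen (gE a)) (\<lambda>a. counit_gen (gF a)) (\<lambda>a. counit_gen (gK a)) (\<lambda>a. counit_gen (gKinv a))"
  by unfold_locales (simp_all add: serre_rel_def sq_def sc_def)
 from ev_uq2_ideal[OF this this, of 1] show ?thesis by auto
qed

\<comment> \<open>The ring of the tensor square and the two copies of the quantum group in
  it\<close>
quotient_type uq2 = free2 / "\<lambda>x y. x - y \<in> uq2_ideal"
proof (rule equivpI)
 show "reflp (\<lambda>x y. x - y \<in> uq2_ideal)" by (auto intro!: reflpI uq2_ideal_rules)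
 show "symp (\<lambda>x y. x - y \<in> uq2_ideal)"
  by (rule sympI) (metis minus_diff_eq uq2_ideal_uminus)
 show "transp (\<lambda>x y. x - y \<in> uq2_ideal)"
 proof (rule transpI)
  fix x y z :: free2 assume "x - y \<in> uq2_ideal" "y - z \<in> uq2_ideal"
  then have "(x - y) + (y - z) \<in> uq2_ideal" by (rule uq2_ideal_rules)
  then show "x - z \<in> uq2_ideal" by simp
 qed
qed

lemma abs_uq2_surj: "\<exists>x. a = abs_uq2 x"
 by (induction a rule: uq2.abs_induct) auto

instantiation uq2 :: ring_1
begin

lift_definition zero_uq2 :: uq2 is 0 .
lift_definition one_uq2 :: uq2 is 1 .
lift_definition plus_uq2 :: "uq2 => uq2 => uq2" is "(+)"
proof -
 fix a a' b b' :: free2 assume "a - a' \<in> uq2_ideal" "b - b' \<in> uq2_ideal"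
 then have "(a - a') + (b - b') \<in> uq2_ideal" by (rule uq2_ideal_rules)
 then show "a + b - (a' + b') \<in> uq2_ideal" by (simp add: algebra_simps)
qed
lift_definition uminus_uq2 :: "uq2 => uq2" is uminus
proof -
 fix a a' :: free2 assume "a - a' \<in> uq2_ideal"
 then have "- (a - a') \<in> uq2_ideal" by (rule uq2_ideal_uminus)
 then show "- a - - a' \<in> uq2_ideal" by (simp add: algebra_simps)
qed
lift_definition minus_uq2 :: "uq2 => uq2 => uq2" is "(-)"
proof -
 fix a a' b b' :: free2 assume "a - a' \<in> uq2_ideal" "b - b' \<in> uq2_ideal"
 then have "(a - a') - (b - b') \<in> uq2_ideal" by (rule uq2_ideal_diff)
 then show "a - b - (a' - b') \<in> uq2_ideal" by (simp add: algebra_simps)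
qed
lift_definition times_uq2 :: "uq2 => uq2 => uq2" is "(*)"
proof -
 fix a a' b b' :: free2 assume "a - a' \<in> uq2_ideal" "b - b' \<in> uq2_ideal"
 then have "(a - a') * b + a' * (b - b') \<in> uq2_ideal" by (intro uq2_ideal_rules)
 then show "a * b - a' * b' \<in> uq2_ideal" by (simp add: algebra_simps)
qed

instance
proof
 fix a b c :: uq2
 obtain x y z where abc: "a = abs_uq2 x" "b = abs_uq2 y" "c = abs_uq2 z"
  using abs_uq2_surj by metis
 note simps = zero_uq2.abs_eq one_uq2.abs_eq plus_uq2.abs_eq minus_uq2.abs_eq uminus_uq2.abs_eq times_uq2.abs_eq
 show "a + b + c = a + (b + c)" "a + b = b + a" "0 + a = a" "- a + a = 0" "a - b = a + - b"
  "a * b * c = a * (b * c)" "(a + b) * c = a * c + b * c" "a * (b + c) = a * b + a * c"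
  "1 * a = a" "a * 1 = a"
  by (simp_all add: abc simps algebra_simps)
 show "(0 :: uq2) \<noteq> 1"
  using one_notin_uq2_ideal uq2_ideal_uminus[of "-1"] unfolding simps uq2.abs_eq_iff by auto
qed

end

definition cl :: "free2 => uq2" where
 "cl = abs_uq2"

lemma cl_eq_iff: "cl x = cl y \<longleftrightarrow> x - y \<in> uq2_ideal"
 unfolding cl_def by (rule uq2.abs_eq_iff)

lemma cl_simps: "cl 0 = 0" "cl 1 = 1" "cl (x + y) = cl x + cl y" "cl (x - y) = cl x - cl y"
 "cl (- x) = - cl x" "cl (x * y) = cl x * cl y"
 unfolding cl_def
 by (simp_all add: zero_uq2.abs_eq one_uq2.abs_eq plus_uq2.abs_eq minus_uq2.abs_eq uminus_uq2.abs_eq times_uq2.abs_eq)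

lemma cl_zero_iff: "cl x = 0 \<longleftrightarrow> x \<in> uq2_ideal"
 using cl_eq_iff[of x 0] by (simp add: cl_simps)

lemma cl_surj: "\<exists>x. y = cl x"
 unfolding cl_def by (rule abs_uq2_surj)

definition csq :: "qfield => uq2" where
 "csq c = cl (cst c)"

definition g1 :: "gen => uq2" where
 "g1 x = cl (single ([x], []) 1)"

definition g2 :: "gen => uq2" where
 "g2 x = cl (single ([], [x]) 1)"

interpretation Q: gen_hom2 csq g1 g2
proof unfold_locales
 show "csq (a + b) = csq a + csq b" "csq (a * b) = csq a * csq b" "csq 1 = 1" for a b
  by (simp_all add: csq_def cst_simps cl_simps)
 show "x * csq a = csq a * x" for x a
  using cl_surj[of x] by (auto simp: csq_def cst_central simp flip: cl_simps)
 show "g2 y * g1 x = g1 x * g2 y" for x y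
  by (simp add: g1_def g2_def mult_single plus_list_def flip: cl_simps)
qed

lemma single_Nil: "single ([], []) 1 = (1 :: free2)"
 by (simp flip: single_one add: zero_prod_def zero_list_def)

text \<open>Evaluation at the classes of the letters is the quotient map itself, so the general
  facts on evaluations apply to \<open>cl\<close>.\<close>

lemma Q_ev: "Q.T.ev x = cl x"
proof (induction x rule: pm_induct)
 case (single k c)
 have 1: "Q.A.chi w = cl (single (w, []) 1)" for w
  unfolding Q.A.chi_def
  by (induction w) (simp_all add: g1_def mult_single plus_list_def single_Nil cl_simps(2) flip: cl_simps(6))
 have 2: "Q.B.chi v = cl (single ([], v) 1)" for v
  unfolding Q.B.chi_def
  by (induction v) (simp_all add: g2_def mult_single plus_list_def single_Nil cl_simps(2) flip: cl_simps(6))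
 show ?case
  unfolding Q.T.ev_single unfolding Q.chi2_def 1 2 Q.sc_def csq_def
  by (simp add: mult_single plus_list_def cst_single flip: cl_simps(6))
qed (simp_all add: cl_simps Q.T.ev_add)

lemma Q1: "uq_alg csq (\<lambda>a. g1 (gE a)) (\<lambda>a. g1 (gF a)) (\<lambda>a. g1 (gK a)) (\<lambda>a. g1 (gKinv a))"
proof (rule Q.A.rels_uq_alg)
 fix r assume "r \<in> uq_rels"
 then have "tens r 1 \<in> uq2_ideal" unfolding uq2_ideal_def by (auto intro: two_sided_ideal.gen)
 then show "Q.A.ev r = 0" using Q.ev_tens[of r 1] cl_zero_iff[of "tens r 1"] by (simp add: Q_ev)
qed

lemma Q2: "uq_alg csq (\<lambda>a. g2 (gE a)) (\<lambda>a. g2 (gF a)) (\<lambda>a. g2 (gK a)) (\<lambda>a. g2 (gKinv a))"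
proof (rule Q.B.rels_uq_alg)
 fix r assume "r \<in> uq_rels"
 then have "tens 1 r \<in> uq2_ideal" unfolding uq2_ideal_def by (auto intro: two_sided_ideal.gen)
 then show "Q.B.ev r = 0" using Q.ev_tens[of 1 r] cl_zero_iff[of "tens 1 r"] by (simp add: Q_ev)
qed

section \<open>Grading a commuting pair by powers of a variable\<close>

locale uq_pair_fps = uq_pair cs E1 F1 K1 L1 E2 F2 K2 L2
 for cs :: "qfield => 'a::ring_1" and E1 F1 K1 L1 E2 F2 K2 L2 +
 fixes s :: int
begin

definition csf :: "qfield => 'a fps" where
 "csf c = fps_const (cs c)"

sublocale P: qalg csf
proof
 show "x * csf a = csf a * x" for x a
  unfolding csf_def by (rule fps_ext) (simp add: cs_comm)
qed (simp_all add: csf_def cs_add cs_mult)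

definition shX :: "'a fps => 'a fps" where
 "shX y = fps_X * y"

lemma shX_simps: "shX y * z = shX (y * z)" "z * shX y = shX (z * y)"
 "shX (y + z) = shX y + shX z" "shX (y - z) = shX y - shX z"
proof -
 show "z * shX y = shX (z * y)" unfolding shX_def by (metis fps_mult_fps_X_commute mult.assoc)
qed (simp_all add: shX_def distrib_left right_diff_distrib mult.assoc)

lemma shX_nth: "shX y $ n = (if n = 0 then 0 else y $ (n - 1))"
 by (simp add: shX_def)

text \<open>The variable is attached to E in the first and to F in the second copy. Each commutator
  of an E with an F of the same copy then carries it once, so that \<tau> is the variable itself,
  and coefficient n of the product collects the terms with n letters in all.\<close>

definition "eE1 i = shX (fps_const (E1 (s + int i)))"
definition "eF1 i = fps_const (F1 (s + int i))"
definition "eK1 i = fps_const (A.KJ (s + int i))"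
definition "eJ1 i = fps_const (A.JK (s + int i))"
definition "eE2 i = fps_const (E2 (s + int i))"
definition "eF2 i = shX (fps_const (F2 (s + int i)))"
definition "eK2 i = fps_const (B.KJ (s + int i))"
definition "eJ2 i = fps_const (B.JK (s + int i))"

lemmas e_defs = eE1_def eF1_def eK1_def eJ1_def eE2_def eF2_def eK2_def eJ2_def

lemma sq_fps: "P.sq n (fps_const x) = fps_const (sq n x)" "P.sq n (shX y) = shX (P.sq n y)"
 by (simp_all add: P.sq_def sq_def csf_def shX_simps)

lemma serre_fps:
 assumes "serre_rel b x"
 shows "P.serre_rel (shX (fps_const b)) (shX (fps_const x))"
proof -
 have "shX (shX (shX (fps_const (b * b * x + x * b * b))))
  = shX (shX (shX (fps_const (sq 1 (b * x * b) + sq (-1) (b * x * b)))))"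
  using assms unfolding serre_rel_def by simp
 then show ?thesis
  unfolding P.serre_rel_def
  by (simp add: sq_fps shX_simps mult.assoc flip: fps_const_add)
qed

lemma cart_wt_pair: "A.cart (s + int i) (s + int j) = wt_pair i j j"
 by (auto simp: A.cart_def wt_pair_def)

lemma q_pair_fps: "q_pair_fps csf eE1 eF1 eK1 eJ1 eE2 eF2 eK2 eJ2 fps_X"
proof (intro q_pair_fps.intro q_pair.intro q_pair_axioms.intro q_pair_fps_axioms.intro qalg_fps.intro P.qalg_axioms)
 show "fps_X * x = x * fps_X" for x :: "'a fps" by (rule fps_mult_fps_X_commute)
 show "q_serre csf eE1" "q_serre csf eF2"
  by (auto intro!: q_serre.intro q_serre_axioms.intro P.qalg_axioms serre_fps A.serre_E B.serre_F
    simp: e_defs shX_simps A.far_E B.far_F)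
 show "y * x = x * y" if "x \<in> range eE1 \<union> range eF1 \<union> range eK1 \<union> range eJ1"
  "y \<in> range eE2 \<union> range eF2 \<union> range eK2 \<union> range eJ2" for x y
 proof -
  have "\<exists>a. (x = fps_const a \<or> x = shX (fps_const a)) \<and> a \<in> range E1 \<union> range F1 \<union> range A.KJ \<union> range A.JK"
   using that(1) unfolding image_def e_defs by blast
  then obtain a where x: "x = fps_const a \<or> x = shX (fps_const a)"
   and a: "a \<in> range E1 \<union> range F1 \<union> range A.KJ \<union> range A.JK" by blast
  have "\<exists>b. (y = fps_const b \<or> y = shX (fps_const b)) \<and> b \<in> range E2 \<union> range F2 \<union> range B.KJ \<union> range B.JK"
   using that(2) unfolding image_def e_defs by blast
  then obtain b where y: "y = fps_const b \<or> y = shX (fps_const b)"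
   and b: "b \<in> range E2 \<union> range F2 \<union> range B.KJ \<union> range B.JK" by blast
  have "b * a = a * b"
   using a b by (auto simp: A.KJ_def A.JK_def B.KJ_def B.JK_def mult.assoc mixed)
  then have "fps_const b * fps_const a = fps_const a * fps_const b" by simp
  with x y show ?thesis
   by (auto simp: shX_simps mult.assoc simp del: fps_const_mult)
 qed
 show "eJ1 i * eE1 j = P.sq (- wt_pair i j j) (eE1 j * eJ1 i)" for i j
  by (simp add: e_defs shX_simps sq_fps A.JK_E cart_wt_pair mult.assoc)
 show "eK1 i * eE1 j = P.sq (wt_pair i j j) (eE1 j * eK1 i)" for i j
  by (simp add: e_defs shX_simps sq_fps A.KJ_E cart_wt_pair mult.assoc)
 show "eJ2 i * eF2 j = P.sq (wt_pair i j j) (eF2 j * eJ2 i)" for i j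
  by (simp add: e_defs shX_simps sq_fps B.JK_F cart_wt_pair mult.assoc)
 show "eK2 i * eF2 j = P.sq (- wt_pair i j j) (eF2 j * eK2 i)" for i j
  by (simp add: e_defs shX_simps sq_fps B.KJ_F cart_wt_pair mult.assoc)
 show "eF1 i * eE1 j = eE1 j * eF1 i" if "i \<noteq> j" for i j
  using that by (simp add: e_defs shX_simps A.EF_comm mult.assoc)
 show "eE2 i * eF2 j = eF2 j * eE2 i" if "i \<noteq> j" for i j
  using that by (simp add: e_defs shX_simps B.EF_comm mult.assoc)
 show "P.sq 1 (eE1 i * eF1 i - eF1 i * eE1 i) - P.sq (-1) (eE1 i * eF1 i - eF1 i * eE1 i)
   = fps_X * (eK1 i - eJ1 i)" for i
  unfolding shX_def[symmetric]
  by (simp add: e_defs shX_simps sq_fps mult.assoc A.EF_diag flip: shX_simps(4))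
 show "P.sq 1 (eE2 i * eF2 i - eF2 i * eE2 i) - P.sq (-1) (eE2 i * eF2 i - eF2 i * eE2 i)
   = fps_X * (eK2 i - eJ2 i)" for i
  unfolding shX_def[symmetric]
  by (simp add: e_defs shX_simps sq_fps mult.assoc B.EF_diag flip: shX_simps(4))
 show "eE1 i $ 0 = 0" "eF2 i $ 0 = 0" for i
  by (simp_all add: e_defs shX_nth)
qed

sublocale H: q_pair_fps csf eE1 eF1 eK1 eJ1 eE2 eF2 eK2 eJ2 fps_X
 by (rule q_pair_fps)

text \<open>Both \<tau> and \<open>eE1\<close> carry one power of the variable; hence the shift by
  2.\<close>

lemma Th_nth_E:
 assumes "i < t"
 shows "E2 (s + int i) * (H.Th t $ n) + (if n < 2 then 0 else E1 (s + int i) * B.JK (s + int i) * (H.Th t $ (n - 2)))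
  = (H.Th t $ n) * E2 (s + int i) + (if n < 2 then 0 else (H.Th t $ (n - 2)) * (E1 (s + int i) * B.KJ (s + int i)))"
 using arg_cong[OF H.intertwine_E[OF assms], of "\<lambda>x. x $ n"]
 by (cases "n < 2") (auto simp: e_defs H.tu_def shX_def[symmetric] shX_nth shX_simps mult.assoc distrib_left distrib_right not_less Suc_le_eq
   numeral_2_eq_2 split: if_splits)

lemma Th_nth_F:
 assumes "i < t"
 shows "F1 (s + int i) * (H.Th t $ n) + (if n < 2 then 0 else A.KJ (s + int i) * F2 (s + int i) * (H.Th t $ (n - 2)))
  = (H.Th t $ n) * F1 (s + int i) + (if n < 2 then 0 else (H.Th t $ (n - 2)) * (A.JK (s + int i) * F2 (s + int i)))"
 using arg_cong[OF H.intertwine_F[OF assms], of "\<lambda>x. x $ n"]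
 by (cases "n < 2") (auto simp: e_defs H.tu_def shX_def[symmetric] shX_nth shX_simps mult.assoc distrib_left distrib_right not_less Suc_le_eq
   numeral_2_eq_2 split: if_splits)

end

section \<open>Existence of the quasi-R-matrix\<close>

lemma wt_simps: "wt [] = 0" "wt (x # w) = wt_gen x + wt w" "wt (w @ v) = wt w + wt v"
 by (auto simp: wt_def fun_eq_iff)

lemma lookup_bidegree_part:
 "lookup (bidegree_part l n p) k = (if wt (fst k) = l \<and> wt (snd k) = n then lookup p k else 0)"
proof (induction p rule: pm_induct)
 case (single k' c)
 then show ?case
  by (cases k'; cases k) (auto simp: bidegree_part_def lin_ext_simps lookup_single when_def)
qed (simp_all add: bidegree_part_def lin_ext_simps lookup_add)

lemma bd_simps: "bidegree_part l n 0 = 0" "bidegree_part l n (x + y) = bidegree_part l n x + bidegree_part l n y"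
 "bidegree_part l n (x - y) = bidegree_part l n x - bidegree_part l n y"
 by (simp_all add: bidegree_part_def lin_ext_simps)

lemma bd_sum: "bidegree_part l n (sum f A) = (\<Sum>i\<in>A. bidegree_part l n (f i))"
 by (simp add: bidegree_part_def lin_ext_simps)

lemma bd_single: "bidegree_part l n (single k c) = (if wt (fst k) = l \<and> wt (snd k) = n then single k c else 0)"
 by (cases k) (auto simp: bidegree_part_def lin_ext_simps cst_single)

lemma bd_mult_left: "bidegree_part l n (single k c * p) = single k c * bidegree_part (l - wt (fst k)) (n - wt (snd k)) p"
proof (induction p rule: pm_induct)
 case (single k' d)
 then show ?case
  by (cases k; cases k') (auto simp: mult_single bd_single plus_list_def wt_simps algebra_simps)
qed (simp_all add: bd_simps distrib_left)

lemma bd_mult_right: "bidegree_part l n (p * single k c) = bidegree_part (l - wt (fst k)) (n - wt (snd k)) p * single k c"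
proof (induction p rule: pm_induct)
 case (single k' d)
 then show ?case
  by (cases k; cases k') (auto simp: mult_single bd_single plus_list_def wt_simps algebra_simps)
qed (simp_all add: bd_simps distrib_right)

definition homog :: "(int => int) => free => bool" where
 "homog l x \<longleftrightarrow> (\<forall>w\<in>keys x. wt w = l)"

lemma homog_add: "homog l x ==> homog l y ==> homog l (x + y)"
 unfolding homog_def using Poly_Mapping.keys_add[of x y] by blast

lemma homog_cst: "homog l x ==> homog l (cst c * x)"
 by (auto simp: homog_def in_keys_iff)

lemma homog_diff: "homog l x ==> homog l y ==> homog l (x - y)"
 by (auto simp: homog_def in_keys_iff lookup_minus)

lemma homog_mult: "homog l x ==> homog m y ==> homog (l + m) (x * y)"
 unfolding homog_def using keys_mult[of x y] by (fastforce simp: plus_list_def wt_simps)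

lemma homog_mult': "homog l x ==> homog m y ==> l + m = k ==> homog k (x * y)"
 using homog_mult by blast

lemma homog_gens: "homog (wt_gen (gE a)) (xE a)" "homog (wt_gen (gF a)) (xF a)" "homog 0 (xK a)" "homog 0 (xKinv a)"
 "homog 0 1"
 by (auto simp: homog_def xE_def xF_def xK_def xKinv_def wt_def zero_list_def fun_eq_iff)

text \<open>In the relation between E and F of the same index, homogeneity in weight 0 comes from
  their opposite weights.\<close>

lemma homog_rels:
 assumes "r \<in> uq_rels"
 shows "\<exists>l. homog l r"
proof -
 have E3: "homog (wt_gen (gE a) + wt_gen (gE b) + wt_gen (gE c)) (xE a * xE b * xE c)"
  and F3: "homog (wt_gen (gF a) + wt_gen (gF b) + wt_gen (gF c)) (xF a * xF b * xF c)" for a b c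
  by (intro homog_mult homog_gens)+
 have *: "homog k x ==> k = l ==> homog l x" for k x l by simp
 have KK: "homog 0 (xK a * xKinv b)" "homog 0 (xKinv a * xK b)" "homog 0 (xK a * xK b)" for a b
  using homog_mult[OF homog_gens(3,4)] homog_mult[OF homog_gens(4,3)] homog_mult[OF homog_gens(3,3)]
  by auto
 have 0: "\<exists>l. homog l (xK a * xKinv a - 1)" for a
  by (rule exI, rule homog_diff[OF KK(1) homog_gens(5)])
 have 1: "\<exists>l. homog l (xKinv a * xK a - 1)" for a
  by (rule exI, rule homog_diff[OF KK(2) homog_gens(5)])
 have 2: "\<exists>l. homog l (xK a * xK b - xK b * xK a)" for a b
  by (rule exI, rule homog_diff[OF KK(3,3)])
 have 3: "\<exists>l. homog l (xK a * xE b * xKinv a - cst c * xE b)" for a b c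
  by (rule exI[of _ "wt_gen (gE b)"], intro homog_diff homog_cst homog_gens)
    (rule homog_mult'[OF homog_mult'[OF homog_gens(3) homog_gens(1) refl] homog_gens(4)], simp)
 have 4: "\<exists>l. homog l (xK a * xF b * xKinv a - cst c * xF b)" for a b c
  by (rule exI[of _ "wt_gen (gF b)"], intro homog_diff homog_cst homog_gens)
    (rule homog_mult'[OF homog_mult'[OF homog_gens(3) homog_gens(2) refl] homog_gens(4)], simp)
 have EF: "homog (wt_gen (gE a) + wt_gen (gF b)) (xE a * xF b - xF b * xE a)" for a b
  by (intro homog_diff homog_mult homog_gens homog_mult'[OF homog_gens(2,1)]) (rule add.commute)
 have 5: "\<exists>l. homog l (xE a * xF b - xF b * xE a
   - cst (of_bool (a = b) / (qq - inverse qq)) * (xKK a (a + 1) - xKK (a + 1) a))" for a b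
 proof (cases "a = b")
  case True
  have "wt_gen (gE b) + wt_gen (gF b) = 0" by (auto simp: fun_eq_iff)
  then have "homog 0 (xE a * xF b - xF b * xE a)" using EF[of b b] True by simp
  from homog_diff[OF this homog_cst[OF homog_diff[OF KK(1) KK(1)]]] show ?thesis
   unfolding xKK_def by blast
 next
  case False
  then show ?thesis using EF[of a b] by (auto simp: cst_simps)
 qed
 have 6: "\<exists>l. homog l (xE a * xE a * xE b + xE b * xE a * xE a - cst c * (xE a * xE b * xE a))" for a b c
  by (rule exI[of _ "wt_gen (gE a) + wt_gen (gE a) + wt_gen (gE b)"])
    (intro homog_diff homog_add homog_cst; rule *[OF E3]; simp add: fun_eq_iff)
 have 7: "\<exists>l. homog l (xF a * xF a * xF b + xF b * xF a * xF a - cst c * (xF a * xF b * xF a))" for a b c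
  by (rule exI[of _ "wt_gen (gF a) + wt_gen (gF a) + wt_gen (gF b)"])
    (intro homog_diff homog_add homog_cst; rule *[OF F3]; simp add: fun_eq_iff)
 have 8: "\<exists>l. homog l (xE a * xE b - xE b * xE a)" for a b
  by (rule exI, rule homog_diff[OF homog_mult[OF homog_gens(1,1)] homog_mult'[OF homog_gens(1,1)]])
    (rule add.commute)
 have 9: "\<exists>l. homog l (xF a * xF b - xF b * xF a)" for a b
  by (rule exI, rule homog_diff[OF homog_mult[OF homog_gens(2,2)] homog_mult'[OF homog_gens(2,2)]])
    (rule add.commute)
 show ?thesis
  using assms unfolding uq_rels_def Un_iff mem_Collect_eq
  by (elim disjE exE conjE; simp only: 0 1 2 3 4 5 6 7 8 9)
qed

lemma single_Nil1: "(1 :: free) = single [] 1"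
 by (metis single_one zero_list_def)

lemma keys_tens_1:
 fixes r :: free
 shows "keys (tens r (1 :: free)) \<subseteq> (\<lambda>w. (w, [])) ` keys r"
  and "keys (tens (1 :: free) r) \<subseteq> (\<lambda>w. ([], w)) ` keys r"
proof -
 have 1: "tens r (1 :: free) = lin_ext (\<lambda>w. single (w, []) 1) r"
  unfolding tens_def single_Nil1 lin_ext_simps(3) cst_simps(4) by simp
 show "keys (tens r (1 :: free)) \<subseteq> (\<lambda>w. (w, [])) ` keys r"
  unfolding 1 using keys_lin_ext[of "\<lambda>w. single (w, [] :: gen list) 1" r] by auto
 have 2: "tens (1 :: free) r = lin_ext (\<lambda>w. single ([], w) 1) r"
  unfolding tens_def single_Nil1 lin_ext_simps(3) cst_simps(4) by simp
 show "keys (tens (1 :: free) r) \<subseteq> (\<lambda>w. ([], w)) ` keys r"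
  unfolding 2 using keys_lin_ext[of "\<lambda>w. single ([] :: gen list, w) 1" r] by auto
qed

lemma bd_homog:
 assumes "\<And>k. k \<in> keys p ==> wt (fst k) = l' \<and> wt (snd k) = n'"
 shows "bidegree_part l n p = p \<or> bidegree_part l n p = 0"
proof (cases "l' = l \<and> n' = n")
 case True
 have "bidegree_part l n p = p"
  using assms True by (intro poly_mapping_eqI) (auto simp: lookup_bidegree_part in_keys_iff)
 then show ?thesis ..
next
 case False
 have "bidegree_part l n p = 0"
  using assms False by (intro poly_mapping_eqI) (auto simp: lookup_bidegree_part in_keys_iff)
 then show ?thesis ..
qed

text \<open>Homogeneous generators make the ideal graded, so an identity in the quotient may be read
  in one bidegree at a time.\<close>

lemma bd_uq2_ideal:
 assumes "x \<in> uq2_ideal"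
 shows "bidegree_part l n x \<in> uq2_ideal"
 using assms unfolding uq2_ideal_def
proof (induction arbitrary: l n)
 case (gen r)
 then obtain r' where r': "r' \<in> uq_rels" "r = tens r' 1 \<or> r = tens 1 r'" by blast
 from homog_rels[OF r'(1)] obtain m where m: "homog m r'" by blast
 have "bidegree_part l n r = r \<or> bidegree_part l n r = 0"
  using r'(2)
 proof
  assume "r = tens r' 1"
  then show ?thesis using m keys_tens_1(1)[of r'] unfolding homog_def
   by (intro bd_homog[of r m 0]) (auto simp: wt_simps)
 next
  assume "r = tens 1 r'"
  then show ?thesis using m keys_tens_1(2)[of r'] unfolding homog_def
   by (intro bd_homog[of r 0 m]) (auto simp: wt_simps)
 qed
 then show ?case using gen by (auto intro: two_sided_ideal.intros)
next
 case (mult_left x r)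
 show ?case
 proof (induction r rule: pm_induct)
  case (single k c)
  then show ?case unfolding bd_mult_left by (intro two_sided_ideal.mult_left mult_left.IH)
 qed (simp_all add: bd_simps distrib_right two_sided_ideal.intros)
next
 case (mult_right x r)
 show ?case
 proof (induction r rule: pm_induct)
  case (single k c)
  then show ?case unfolding bd_mult_right by (intro two_sided_ideal.mult_right mult_right.IH)
 qed (simp_all add: bd_simps distrib_left two_sided_ideal.intros)
qed (simp_all add: bd_simps two_sided_ideal.intros)

interpretation R: uq_pair_fps csq "\<lambda>a. g1 (gE a)" "\<lambda>a. g1 (gF a)" "\<lambda>a. g1 (gK a)" "\<lambda>a. g1 (gKinv a)"
 "\<lambda>a. g2 (gE a)" "\<lambda>a. g2 (gF a)" "\<lambda>a. g2 (gK a)" "\<lambda>a. g2 (gKinv a)" "- int k" for k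
 by (intro uq_pair_fps.intro Q.uq_pairI Q1 Q2)

text \<open>For l = 0 this is the shape demanded of the terms of \<Theta>: opposite weights, with
  letters E on the left and F on the right.\<close>

definition Lset :: "nat => (int => int) => nat => (gen list \<times> gen list) set" where
 "Lset k l n = {(w, v). set w \<subseteq> pos_letters k \<and> set v \<subseteq> neg_letters k \<and> wt w + wt v = l \<and> length w + length v = n}"

definition HD :: "nat => (int => int) => nat => uq2 => bool" where
 "HD k l n x \<longleftrightarrow> (\<exists>p. keys p \<subseteq> Lset k l n \<and> cl p = x)"

lemma HD_0: "HD k l n 0"
 unfolding HD_def by (intro exI[of _ 0]) (simp add: cl_simps)

lemma HD_1: "HD k 0 0 1"
 unfolding HD_def by (intro exI[of _ 1]) (simp add: cl_simps Lset_def zero_prod_def zero_list_def wt_simps)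

lemma HD_add: "HD k l n x ==> HD k l n y ==> HD k l n (x + y)"
proof -
 assume "HD k l n x" "HD k l n y"
 then obtain p r where "keys p \<subseteq> Lset k l n" "cl p = x" "keys r \<subseteq> Lset k l n" "cl r = y"
  by (auto simp: HD_def)
 then show ?thesis
  unfolding HD_def using Poly_Mapping.keys_add[of p r] by (intro exI[of _ "p + r"]) (auto simp: cl_simps)
qed

lemma HD_csq: "HD k l n x ==> HD k l n (csq c * x)"
proof -
 assume "HD k l n x"
 then obtain p where "keys p \<subseteq> Lset k l n" "cl p = x" by (auto simp: HD_def)
 then show ?thesis
  unfolding HD_def csq_def by (intro exI[of _ "cst c * p"]) (auto simp: cl_simps in_keys_iff subset_iff)
qed

lemma HD_diff: "HD k l n x ==> HD k l n y ==> HD k l n (x - y)"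
 using HD_add[of k l n x "csq (-1) * y"] HD_csq[of k l n y "-1"] Q.cs_uminus[of 1]
 by simp

lemma HD_sum: "(\<And>i. i \<in> A ==> HD k l n (f i)) ==> HD k l n (sum f A)"
 by (induction A rule: infinite_finite_induct) (auto intro: HD_0 HD_add)

lemma HD_mult:
 assumes "HD k l n x" "HD k m i y"
 shows "HD k (l + m) (n + i) (x * y)"
proof -
 obtain p r where pr: "keys p \<subseteq> Lset k l n" "cl p = x" "keys r \<subseteq> Lset k m i" "cl r = y"
  using assms by (auto simp: HD_def)
 have "keys (p * r) \<subseteq> Lset k (l + m) (n + i)"
 proof
  fix z assume "z \<in> keys (p * r)"
  then obtain a b where ab: "a \<in> Lset k l n" "b \<in> Lset k m i" "z = a + b"
   using keys_mult[of p r] pr by blast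
  then show "z \<in> Lset k (l + m) (n + i)"
   by (cases a; cases b) (auto simp: Lset_def plus_list_def wt_simps)
 qed
 then show ?thesis unfolding HD_def using pr by (auto simp: cl_simps)
qed

definition HF :: "nat => (int => int) => uq2 fps => bool" where
 "HF k l x \<longleftrightarrow> (\<forall>n. HD k l n (x $ n))"

lemma HF_simps: "HF k l x ==> HF k l y ==> HF k l (x + y)" "HF k l x ==> HF k l y ==> HF k l (x - y)"
 "HF k l 0"
 by (auto simp: HF_def HD_add HD_diff HD_0)

lemma HF_1: "HF k 0 1"
 by (auto simp: HF_def HD_0 HD_1)

lemma HF_csf: "HF k l x ==> HF k l (R.csf c * x)"
 by (auto simp: HF_def R.csf_def HD_csq)

lemma HF_mult: "HF k l x ==> HF k m y ==> HF k (l + m) (x * y)"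
 unfolding HF_def fps_mult_nth
proof (intro allI HD_sum)
 fix n i :: nat assume "\<forall>n. HD k l n (x $ n)" "\<forall>n. HD k m n (y $ n)" "i \<in> {0..n}"
 then show "HD k (l + m) n (x $ i * y $ (n - i))"
  using HD_mult[of k l i "x $ i" m "n - i" "y $ (n - i)"] by auto
qed

lemma HF_sum: "(\<And>i. i \<in> A ==> HF k l (f i)) ==> HF k l (sum f A)"
 by (induction A rule: infinite_finite_induct) (auto intro: HF_simps)

lemma HF_power: "HF k 0 x ==> HF k 0 (x ^ n)"
 by (induction n) (use HF_mult[of k 0 x 0] in \<open>auto simp: HF_1\<close>)

lemma HF_br:
 assumes "HF k l x" "HF k m y"
 shows "HF k (l + m) (R.P.br x y)"
proof -
 have "HF k (l + m) (y * x)" using HF_mult[OF assms(2,1)] by (simp add: add.commute)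
 then show ?thesis
  unfolding R.P.br_def R.P.sq_def by (rule HF_simps(2)[OF HF_mult[OF assms] HF_csf])
qed

lemma HF_E1: "i < 2 * k ==> HF k (wt_gen (gE (- int k + int i))) (R.eE1 k i)"
 unfolding HF_def
proof
 fix n assume "i < 2 * k"
 then have "HD k (wt_gen (gE (- int k + int i))) 1 (g1 (gE (- int k + int i)))"
  unfolding HD_def g1_def
  by (intro exI[of _ "single ([gE (- int k + int i)], []) 1"])
    (auto simp: Lset_def wt_simps pos_letters_def)
 then show "HD k (wt_gen (gE (- int k + int i))) n (R.eE1 k i $ n)"
  by (cases "n = 1") (auto simp: R.eE1_def R.shX_nth HD_0)
qed

lemma HF_F2: "i < 2 * k ==> HF k (- wt_gen (gE (- int k + int i))) (R.eF2 k i)"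
 unfolding HF_def
proof
 fix n assume "i < 2 * k"
 moreover have "wt_gen (gF a) = - wt_gen (gE a)" for a by (simp add: fun_eq_iff)
 ultimately have "HD k (- wt_gen (gE (- int k + int i))) 1 (g2 (gF (- int k + int i)))"
  unfolding HD_def g2_def
  by (intro exI[of _ "single ([], [gF (- int k + int i)]) 1"])
    (auto simp: Lset_def wt_simps neg_letters_def simp del: wt_gen.simps)
 then show "HD k (- wt_gen (gE (- int k + int i))) n (R.eF2 k i $ n)"
  by (cases "n = 1") (auto simp: R.eF2_def R.shX_nth HD_0)
qed

text \<open>The weight of the root vector \<open>rv i d\<close> when the simple roots are counted
  from \<open>- k\<close>.\<close>

fun ow :: "nat => nat => nat => int => int" where
 "ow k i 0 = wt_gen (gE (- int k + int i))"
| "ow k i (Suc d) = ow k i d + wt_gen (gE (- int k + int (i + Suc d)))"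

lemma HF_rv: "i + d < 2 * k ==> HF k (ow k i d) (R.H.A.rv k i d)"
 "i + d < 2 * k ==> HF k (- ow k i d) (R.H.B.rv k i d)"
proof (induction d)
 case (Suc d)
 { case 1 then show ?case unfolding R.H.A.rv.simps ow.simps by (intro HF_br HF_E1 Suc) auto }
 { case 2 then show ?case unfolding R.H.B.rv.simps ow.simps minus_add_distrib by (intro HF_br HF_F2 Suc) auto }
qed (simp_all only: R.H.A.rv.simps R.H.B.rv.simps ow.simps HF_E1 HF_F2)

lemma HF_Om: "t < 2 * k ==> HF k 0 (R.H.Om k t)"
 unfolding R.H.Om_def R.P.cf_def
proof (intro HF_sum HF_csf)
 fix i assume "t < 2 * k" "i \<in> {..t}"
 then have "HF k (ow k i (t - i) + - ow k i (t - i)) (R.H.A.rv k i (t - i) * R.H.B.rv k i (t - i))"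
  by (intro HF_mult HF_rv) auto
 then show "HF k 0 (R.H.A.rv k i (t - i) * R.H.B.rv k i (t - i))" by simp
qed

lemma HF_qexp: "HF k 0 x ==> HF k 0 (R.H.qexp x)"
proof -
 assume "HF k 0 x"
 then have "HF k 0 (R.H.qexp_part N x)" for N
  unfolding R.H.qexp_part_def R.P.sc_def by (intro HF_sum HF_csf HF_power)
 then show ?thesis unfolding R.H.qexp_def by (simp add: HF_def)
qed

lemma HF_Th: "t \<le> 2 * k ==> HF k 0 (R.H.Th k t)"
proof (induction t)
 case (Suc t)
 then have "HF k 0 (R.H.Th k t)" by (intro Suc.IH) linarith
 moreover have "HF k 0 (R.H.qexp (R.H.Om k t))" using Suc by (intro HF_qexp HF_Om) linarith
 ultimately have "HF k (0 + 0) (R.H.Th k t * R.H.qexp (R.H.Om k t))" by (rule HF_mult)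
 then show ?case by (simp only: add_0_left R.H.Th.simps)
qed (simp only: HF_1 R.H.Th.simps)

text \<open>Degree 0 is treated separately because \<open>is_quasi_R\<close> demands
  \<open>\<Theta> 0 = 1\<close> in the free algebra, not only modulo the ideal.\<close>

definition th_rep :: "nat => nat => free2" where
 "th_rep k n = (if n = 0 then 1 else SOME p. keys p \<subseteq> Lset k 0 n \<and> cl p = R.H.Th k (2 * k) $ n)"

lemma th_rep_0 [simp]: "th_rep k 0 = 1"
 by (simp add: th_rep_def)

lemma Th_nth_0: "R.H.Th k t $ 0 = 1"
 by (induction t) (simp_all add: R.H.qexp_def R.H.qexp_part_def R.P.sc_simps)

lemma th_rep: "keys (th_rep k n) \<subseteq> Lset k 0 n" "cl (th_rep k n) = R.H.Th k (2 * k) $ n"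
proof -
 have "keys (th_rep k n) \<subseteq> Lset k 0 n \<and> cl (th_rep k n) = R.H.Th k (2 * k) $ n"
 proof (cases "n = 0")
  case True
  then show ?thesis by (simp add: Th_nth_0 cl_simps Lset_def zero_prod_def zero_list_def wt_simps)
 next
  case False
  have "\<exists>p. keys p \<subseteq> Lset k 0 n \<and> cl p = R.H.Th k (2 * k) $ n"
   using HF_Th[of "2 * k" k] by (auto simp: HF_def HD_def)
  then have "keys (SOME p. keys p \<subseteq> Lset k 0 n \<and> cl p = R.H.Th k (2 * k) $ n) \<subseteq> Lset k 0 n
   \<and> cl (SOME p. keys p \<subseteq> Lset k 0 n \<and> cl p = R.H.Th k (2 * k) $ n) = R.H.Th k (2 * k) $ n"
   by (rule someI_ex)
  then show ?thesis using False by (simp add: th_rep_def)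
 qed
 then show "keys (th_rep k n) \<subseteq> Lset k 0 n" "cl (th_rep k n) = R.H.Th k (2 * k) $ n" by auto
qed

text \<open>The linear form with value 1 on every simple root in range; it recovers the number of
  letters of a word from its weight.\<close>

definition height :: "nat => (int => int) => int" where
 "height k l = (\<Sum>c\<in>{- int k..int k}. - c * l c)"

lemma height_simps: "height k (l + m) = height k l + height k m" "height k 0 = 0" "height k (- l) = - height k l"
 "height k (l - m) = height k l - height k m"
 by (simp_all add: height_def algebra_simps sum.distrib sum_subtractf sum_negf)

lemma height_wt_gen: "- int k \<le> a ==> a \<le> int k - 1 ==> height k (wt_gen (gE a)) = 1"
 "- int k \<le> a ==> a \<le> int k - 1 ==> height k (wt_gen (gF a)) = - 1"
proof -
 assume a: "- int k \<le> a" "a \<le> int k - 1"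
 have "height k (wt_gen (gE a)) = (\<Sum>c\<in>{- int k..int k}. (if c = a then - a else 0) + (if c = a + 1 then a + 1 else 0))"
  unfolding height_def by (intro sum.cong) auto
 also have "\<dots> = 1" using a by (simp add: sum.distrib)
 finally show E: "height k (wt_gen (gE a)) = 1" .
 have "wt_gen (gF a) = - wt_gen (gE a)" by (simp add: fun_eq_iff)
 then show "height k (wt_gen (gF a)) = - 1" using E by (simp only: height_simps)
qed

lemma height_wt: "set w \<subseteq> pos_letters k ==> height k (wt w) = int (length w)"
 "set w \<subseteq> neg_letters k ==> height k (wt w) = - int (length w)"
 by (induction w) (auto simp: wt_simps height_simps pos_letters_def neg_letters_def height_wt_gen simp del: wt_gen.simps)

lemma Lset_height:
 assumes "(w, v) \<in> Lset k 0 n"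
 shows "wt v = - wt w" "int n = 2 * height k (wt w)"
proof -
 show v: "wt v = - wt w" using assms by (auto simp: Lset_def eq_neg_iff_add_eq_0 add.commute)
 have "height k (wt w) = int (length w)" "height k (wt v) = - int (length v)"
  using assms by (auto simp: Lset_def height_wt)
 then show "int n = 2 * height k (wt w)" using assms v by (auto simp: Lset_def height_simps)
qed

text \<open>In bidegree \<open>(l, - l)\<close> there are \<open>height k l\<close> letters E and as
  many letters F, so this component sits in coefficient \<open>2 * height k l\<close> of the power
  series.\<close>

definition th :: "nat => (int => int) => free2" where
 "th k l = (if height k l < 0 then 0 else bidegree_part l (- l) (th_rep k (nat (2 * height k l))))"

lemma th_keys:
 assumes "(w, v) \<in> keys (th k l)"
 shows "set w \<subseteq> pos_letters k" "wt w = l" "set v \<subseteq> neg_letters k" "wt v = - l"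
proof -
 have "(w, v) \<in> keys (th_rep k (nat (2 * height k l)))" "wt w = l" "wt v = - l"
  using assms by (auto simp: th_def in_keys_iff lookup_bidegree_part split: if_splits)
 then show "set w \<subseteq> pos_letters k" "wt w = l" "set v \<subseteq> neg_letters k" "wt v = - l"
  using th_rep(1)[of k "nat (2 * height k l)"] by (auto simp: Lset_def)
qed

lemma th_0: "th k 0 = 1"
proof -
 have "bidegree_part 0 0 (single ([], []) 1) = single ([], []) 1"
  by (simp add: bd_single wt_simps)
 then show ?thesis by (simp add: th_def height_simps single_Nil)
qed

text \<open>The component of bidegree \<open>(l, n)\<close> of the formal sum.\<close>

definition thc :: "((int => int) => free2) => (int => int) => (int => int) => free2" where
 "thc \<Theta> l n = (if n = - l then \<Theta> l else 0)"

definition graded :: "((int => int) => free2) => bool" where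
 "graded \<Theta> \<longleftrightarrow> (\<forall>\<mu>. \<forall>j\<in>keys (\<Theta> \<mu>). wt (fst j) = \<mu> \<and> wt (snd j) = - \<mu>)"

lemma bd_th_rep: "int m = 2 * height k l ==> bidegree_part l n (th_rep k m) = thc (th k) l n"
proof -
 assume m: "int m = 2 * height k l"
 show ?thesis
 proof (cases "n = - l")
  case True
  have "nat (2 * height k l) = m" using m by simp
  then show ?thesis using True m by (simp add: thc_def th_def)
 next
  case False
  have "bidegree_part l n (th_rep k m) = 0"
  proof (rule poly_mapping_eqI)
   fix z show "lookup (bidegree_part l n (th_rep k m)) z = lookup 0 z"
    using th_rep(1)[of k m] Lset_height(1)[of "fst z" "snd z" k m] False
    by (cases z) (auto simp: lookup_bidegree_part in_keys_iff)
  qed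
  then show ?thesis using False by (simp add: thc_def)
 qed
qed

lemma graded_th: "graded (th k)"
 unfolding graded_def using th_keys(2,4) by (metis prod.collapse)

lemma bd_graded:
 assumes "graded \<Theta>"
 shows "bidegree_part l n (\<Theta> m) = (if m = l then thc \<Theta> l n else 0)"
proof (rule poly_mapping_eqI)
 fix z
 have "lookup (\<Theta> m) z = 0 \<or> (wt (fst z) = m \<and> wt (snd z) = - m)"
  using assms by (auto simp: graded_def in_keys_iff)
 then show "lookup (bidegree_part l n (\<Theta> m)) z = lookup (if m = l then thc \<Theta> l n else 0) z"
  by (auto simp: lookup_bidegree_part thc_def)
qed

lemma pm_expand_mult: "x * p = (\<Sum>j\<in>keys x. single j (lookup x j) * p)"
 by (subst (1) pm_expand[of x]) (simp add: sum_distrib_right)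

lemma pm_expand_mult': "p * x = (\<Sum>j\<in>keys x. p * single j (lookup x j))"
 by (subst (1) pm_expand[of x]) (simp add: sum_distrib_left)

text \<open>Bidegree (l, n) of the left side of the intertwining identity in
  \<open>is_quasi_R\<close>; \<open>rth\<close> is the right side.\<close>

definition lth :: "((int => int) => free2) => free2 => (int => int) => (int => int) => free2" where
 "lth \<Theta> x l n = Sum_any (\<lambda>\<mu>. bidegree_part l n (x * \<Theta> \<mu>))"

definition rth :: "((int => int) => free2) => free2 => (int => int) => (int => int) => free2" where
 "rth \<Theta> x l n = Sum_any (\<lambda>\<mu>. bidegree_part l n (\<Theta> \<mu> * x))"

definition intertw :: "((int => int) => free2) => free2 => free2 => bool" where
 "intertw \<Theta> x y \<longleftrightarrow> (\<forall>l n. cl (lth \<Theta> x l n) = cl (rth \<Theta> y l n))"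

context
 fixes \<Theta> :: "(int => int) => free2"
 assumes graded: "graded \<Theta>"
begin

text \<open>In a fixed bidegree each term of x can meet just one \<mu>, which turns the formal sum
  into a finite one.\<close>

lemma lth_eq: "lth \<Theta> x l n = (\<Sum>j\<in>keys x. single j (lookup x j) * thc \<Theta> (l - wt (fst j)) (n - wt (snd j)))"
proof -
 let ?M = "(\<lambda>j. l - wt (fst j)) ` keys x"
 have eq: "bidegree_part l n (x * \<Theta> \<mu>)
   = (\<Sum>j\<in>keys x. if \<mu> = l - wt (fst j) then single j (lookup x j) * thc \<Theta> (l - wt (fst j)) (n - wt (snd j)) else 0)" for \<mu>
  unfolding pm_expand_mult[of x] bd_sum bd_mult_left bd_graded[OF graded] by (intro sum.cong) auto
 have "lth \<Theta> x l n = (\<Sum>\<mu>\<in>?M. bidegree_part l n (x * \<Theta> \<mu>))"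
  unfolding lth_def
 proof (rule Sum_any.expand_superset)
  show "{\<mu>. bidegree_part l n (x * \<Theta> \<mu>) \<noteq> 0} \<subseteq> ?M"
  proof
   fix \<mu> assume "\<mu> \<in> {\<mu>. bidegree_part l n (x * \<Theta> \<mu>) \<noteq> 0}"
   then show "\<mu> \<in> ?M"
    unfolding eq mem_Collect_eq
    by (rule sum.not_neutral_contains_not_neutral) (auto split: if_splits)
  qed
 qed simp
 also have "\<dots> = (\<Sum>j\<in>keys x. \<Sum>\<mu>\<in>?M. if \<mu> = l - wt (fst j) then single j (lookup x j) * thc \<Theta> (l - wt (fst j)) (n - wt (snd j)) else 0)"
  unfolding eq by (rule sum.swap)
 also have "\<dots> = (\<Sum>j\<in>keys x. single j (lookup x j) * thc \<Theta> (l - wt (fst j)) (n - wt (snd j)))"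
  by (intro sum.cong refl) (subst sum.delta, auto)
 finally show ?thesis .
qed

lemma rth_eq: "rth \<Theta> x l n = (\<Sum>j\<in>keys x. thc \<Theta> (l - wt (fst j)) (n - wt (snd j)) * single j (lookup x j))"
proof -
 let ?M = "(\<lambda>j. l - wt (fst j)) ` keys x"
 have eq: "bidegree_part l n (\<Theta> \<mu> * x)
   = (\<Sum>j\<in>keys x. if \<mu> = l - wt (fst j) then thc \<Theta> (l - wt (fst j)) (n - wt (snd j)) * single j (lookup x j) else 0)" for \<mu>
  unfolding pm_expand_mult'[of _ x] bd_sum bd_mult_right bd_graded[OF graded] by (intro sum.cong) auto
 have "rth \<Theta> x l n = (\<Sum>\<mu>\<in>?M. bidegree_part l n (\<Theta> \<mu> * x))"
  unfolding rth_def
 proof (rule Sum_any.expand_superset)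
  show "{\<mu>. bidegree_part l n (\<Theta> \<mu> * x) \<noteq> 0} \<subseteq> ?M"
  proof
   fix \<mu> assume "\<mu> \<in> {\<mu>. bidegree_part l n (\<Theta> \<mu> * x) \<noteq> 0}"
   then show "\<mu> \<in> ?M"
    unfolding eq mem_Collect_eq
    by (rule sum.not_neutral_contains_not_neutral) (auto split: if_splits)
  qed
 qed simp
 also have "\<dots> = (\<Sum>j\<in>keys x. \<Sum>\<mu>\<in>?M. if \<mu> = l - wt (fst j) then thc \<Theta> (l - wt (fst j)) (n - wt (snd j)) * single j (lookup x j) else 0)"
  unfolding eq by (rule sum.swap)
 also have "\<dots> = (\<Sum>j\<in>keys x. thc \<Theta> (l - wt (fst j)) (n - wt (snd j)) * single j (lookup x j))"
  by (intro sum.cong refl) (subst sum.delta, auto)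
 finally show ?thesis .
qed

lemma lth_superset: "finite A ==> keys x \<subseteq> A ==>
  lth \<Theta> x l n = (\<Sum>j\<in>A. single j (lookup x j) * thc \<Theta> (l - wt (fst j)) (n - wt (snd j)))"
 unfolding lth_eq by (intro sum.mono_neutral_left) (auto simp: in_keys_iff)

lemma rth_superset: "finite A ==> keys x \<subseteq> A ==>
  rth \<Theta> x l n = (\<Sum>j\<in>A. thc \<Theta> (l - wt (fst j)) (n - wt (snd j)) * single j (lookup x j))"
 unfolding rth_eq by (intro sum.mono_neutral_left) (auto simp: in_keys_iff)

lemma lth_add: "lth \<Theta> (x + y) l n = lth \<Theta> x l n + lth \<Theta> y l n"
 and rth_add: "rth \<Theta> (x + y) l n = rth \<Theta> x l n + rth \<Theta> y l n"
proof -
 let ?A = "keys x \<union> keys y"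
 have "keys (x + y) \<subseteq> ?A" by (rule Poly_Mapping.keys_add)
 then show "lth \<Theta> (x + y) l n = lth \<Theta> x l n + lth \<Theta> y l n" "rth \<Theta> (x + y) l n = rth \<Theta> x l n + rth \<Theta> y l n"
  by (simp_all add: lth_superset[of ?A] rth_superset[of ?A] lookup_add single_add distrib_left distrib_right sum.distrib)
qed

lemma lth_0 [simp]: "lth \<Theta> 0 l n = 0" and rth_0 [simp]: "rth \<Theta> 0 l n = 0"
 by (simp_all add: lth_eq rth_eq)

lemma lth_sum: "lth \<Theta> (sum f A) l n = (\<Sum>i\<in>A. lth \<Theta> (f i) l n)"
 and rth_sum: "rth \<Theta> (sum f A) l n = (\<Sum>i\<in>A. rth \<Theta> (f i) l n)"
 by (induction A rule: infinite_finite_induct) (simp_all add: lth_add rth_add)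

lemma lth_single: "lth \<Theta> (single j c) l n = single j c * thc \<Theta> (l - wt (fst j)) (n - wt (snd j))"
 and rth_single: "rth \<Theta> (single j c) l n = thc \<Theta> (l - wt (fst j)) (n - wt (snd j)) * single j c"
 by (simp_all add: lth_superset[of "{j}"] rth_superset[of "{j}"])

lemma lth_mult_single: "lth \<Theta> (single j c * x) l n = single j c * lth \<Theta> x (l - wt (fst j)) (n - wt (snd j))"
proof (induction x rule: pm_induct)
 case (single i d)
 show ?case
  unfolding mult_single lth_single mult.assoc[symmetric]
  by (cases i; cases j) (simp add: mult_single wt_simps plus_list_def algebra_simps)
qed (simp_all add: lth_add distrib_left)

lemma rth_mult_single: "rth \<Theta> (x * single j c) l n = rth \<Theta> x (l - wt (fst j)) (n - wt (snd j)) * single j c"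
proof (induction x rule: pm_induct)
 case (single i d)
 show ?case
  unfolding mult_single rth_single mult.assoc
  by (cases i; cases j) (simp add: mult_single wt_simps plus_list_def algebra_simps)
qed (simp_all add: rth_add distrib_right)

lemma intertw_add: "intertw \<Theta> x y ==> intertw \<Theta> x' y' ==> intertw \<Theta> (x + x') (y + y')"
 by (simp add: intertw_def lth_add rth_add cl_simps)

lemma intertw_0: "intertw \<Theta> 0 0"
 by (simp add: intertw_def)

text \<open>This is \<open>x x' \<Theta> = x \<Theta> y' = \<Theta> y y'\<close>, carried out on
  components as a rearrangement of finite double sums. It reduces the identity to
  generators.\<close>

lemma intertw_mult:
 assumes "intertw \<Theta> x y" "intertw \<Theta> x' y'"
 shows "intertw \<Theta> (x * x') (y * y')"
 unfolding intertw_def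
proof (intro allI)
 fix l n
 have "cl (lth \<Theta> (x * x') l n) = cl (\<Sum>j\<in>keys x. single j (lookup x j) * lth \<Theta> x' (l - wt (fst j)) (n - wt (snd j)))"
  unfolding pm_expand_mult[of x x'] lth_mult_single[symmetric] lth_sum ..
 also have "\<dots> = (\<Sum>j\<in>keys x. cl (single j (lookup x j) * rth \<Theta> y' (l - wt (fst j)) (n - wt (snd j))))"
  using assms(2) unfolding Q_ev[symmetric] Q.T.ev_sum Q.T.ev_mult by (simp add: intertw_def Q_ev)
 also have "\<dots> = cl (\<Sum>j\<in>keys x. \<Sum>i\<in>keys y'. single j (lookup x j) *
   (thc \<Theta> (l - wt (fst j) - wt (fst i)) (n - wt (snd j) - wt (snd i)) * single i (lookup y' i)))"
  unfolding rth_eq sum_distrib_left Q_ev[symmetric] Q.T.ev_sum ..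
 also have "(\<Sum>j\<in>keys x. \<Sum>i\<in>keys y'. single j (lookup x j) *
   (thc \<Theta> (l - wt (fst j) - wt (fst i)) (n - wt (snd j) - wt (snd i)) * single i (lookup y' i)))
  = (\<Sum>i\<in>keys y'. \<Sum>j\<in>keys x. (single j (lookup x j) *
   thc \<Theta> (l - wt (fst i) - wt (fst j)) (n - wt (snd i) - wt (snd j))) * single i (lookup y' i))"
  by (subst sum.swap) (simp add: mult.assoc diff_diff_eq add.commute)
 also have "cl \<dots> = (\<Sum>i\<in>keys y'. cl (lth \<Theta> x (l - wt (fst i)) (n - wt (snd i)) * single i (lookup y' i)))"
  unfolding lth_eq[of x] sum_distrib_right Q_ev[symmetric] Q.T.ev_sum ..
 also have "\<dots> = (\<Sum>i\<in>keys y'. cl (rth \<Theta> y (l - wt (fst i)) (n - wt (snd i)) * single i (lookup y' i)))"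
  using assms(1) by (simp add: intertw_def cl_simps)
 also have "\<dots> = cl (rth \<Theta> (y * y') l n)"
  unfolding pm_expand_mult'[of y y'] rth_mult_single[symmetric] Q_ev[symmetric] rth_sum Q.T.ev_sum ..
 finally show "cl (lth \<Theta> (x * x') l n) = cl (rth \<Theta> (y * y') l n)" .
qed

lemma intertw_cst: "intertw \<Theta> (cst c) (cst c)"
 unfolding intertw_def cst_def lth_single rth_single
 by (simp flip: cst_def add: cst_central)

end

lemma cl_gens:
 "cl (single ([x], []) 1) = g1 x" "cl (single ([], [x]) 1) = g2 x"
 "cl (single (x # w, []) 1) = g1 x * cl (single (w, []) 1)"
 "cl (single ([], x # w) 1) = g2 x * cl (single ([], w) 1)"
 "cl (single (w, v) 1) = cl (single (w, []) 1) * cl (single ([], v) 1)"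
 by (simp_all add: g1_def g2_def mult_single plus_list_def flip: cl_simps(6))

text \<open>The two words of each term have opposite weights, so the powers of q produced in the two
  factors cancel.\<close>

lemma K_th: "g1 (gK a) * g2 (gK a) * cl (th k l) = cl (th k l) * (g1 (gK a) * g2 (gK a))"
proof -
 have 1: "g1 (gK a) * cl (single (w, []) 1) = Q.sq (wt w a) (cl (single (w, []) 1) * g1 (gK a))"
  if "set w \<subseteq> pos_letters k" for w
  using that
 proof (induction w)
  case (Cons x w)
  then obtain b where x: "x = gE b" by (auto simp: pos_letters_def)
  have "g1 (gK a) * g1 x = Q.sq (wt_gen x a) (g1 x * g1 (gK a))"
   unfolding x using R.A.KE[of a b] by simp
  then show ?case unfolding cl_gens(3) using Cons
   by (simp add: Q.qcomm_left wt_simps Q.sq_simps mult.assoc add.commute)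
 qed (simp add: single_Nil cl_simps wt_simps Q.sq_simps)
 have 2: "g2 (gK a) * cl (single ([], v) 1) = Q.sq (wt v a) (cl (single ([], v) 1) * g2 (gK a))"
  if "set v \<subseteq> neg_letters k" for v
  using that
 proof (induction v)
  case (Cons x v)
  then obtain b where x: "x = gF b" by (auto simp: neg_letters_def)
  have "g2 (gK a) * g2 x = Q.sq (wt_gen x a) (g2 x * g2 (gK a))"
   unfolding x using R.B.KF[of a b] by simp
  then show ?case unfolding cl_gens(4) using Cons
   by (simp add: Q.qcomm_left wt_simps Q.sq_simps mult.assoc add.commute)
 qed (simp add: single_Nil cl_simps wt_simps Q.sq_simps)
 have 3: "g1 (gK a) * g2 (gK a) * cl (single (w, v) 1) = cl (single (w, v) 1) * (g1 (gK a) * g2 (gK a))"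
  if "(w, v) \<in> keys (th k l)" for w v
 proof -
  define x y where "x = cl (single (w, []) 1)" and "y = cl (single ([], v) 1)"
  note t = th_keys[OF that]
  have c: "g2 (gK a) * x = x * g2 (gK a)" "y * g1 (gK a) = g1 (gK a) * y"
   unfolding x_def y_def using Q.chi_comm[of "[gK a]" w] Q.chi_comm[of v "[gK a]"] Q_ev[of "single (w, []) 1"] Q_ev[of "single ([], v) 1"]
   by (simp_all add: Q.T.ev_single Q.chi2_def Q.sc_simps Q.A.chi_def Q.B.chi_def)
  have "g1 (gK a) * x = Q.sq (l a) (x * g1 (gK a))" "g2 (gK a) * y = Q.sq (- l a) (y * g2 (gK a))"
   unfolding x_def y_def using 1[OF t(1)] 2[OF t(3)] t(2,4) by auto
  then show ?thesis
   unfolding cl_gens(5)[of w v] x_def[symmetric] y_def[symmetric]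
   by (simp add: mult.assoc Q.comm_left[OF c(1)] c(2) Q.comm_left[OF c(2)] Q.qcomm_left Q.sq_simps)
 qed
 show ?thesis
  unfolding Q_ev[symmetric] Q.T.ev_def sum_distrib_left sum_distrib_right
 proof (intro sum.cong refl)
  fix j assume "j \<in> keys (th k l)"
  then have "g1 (gK a) * g2 (gK a) * cl (single j 1) = cl (single j 1) * (g1 (gK a) * g2 (gK a))"
   using 3 by (cases j) auto
  moreover have "cl (single j 1) = Q.chi2 j"
   unfolding Q_ev[symmetric] Q.T.ev_single by (simp add: Q.sc_simps)
  ultimately show "g1 (gK a) * g2 (gK a) * Q.sc (lookup (th k l) j) (Q.chi2 j)
    = Q.sc (lookup (th k l) j) (Q.chi2 j) * (g1 (gK a) * g2 (gK a))"
   by (simp add: Q.sc_simps)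
 qed
qed

lemma L_th: "g1 (gKinv a) * g2 (gKinv a) * cl (th k l) = cl (th k l) * (g1 (gKinv a) * g2 (gKinv a))"
proof -
 define x y z where "x = g1 (gKinv a) * g2 (gKinv a)" and "y = g1 (gK a) * g2 (gK a)" and "z = cl (th k l)"
 have "x * y = (g1 (gKinv a) * g1 (gK a)) * (g2 (gKinv a) * g2 (gK a))"
  and "y * x = (g1 (gK a) * g1 (gKinv a)) * (g2 (gK a) * g2 (gKinv a))"
  unfolding x_def y_def by (simp_all add: mult.assoc Q.comm_left[OF Q.g_comm])
 then have xy: "x * y = 1" "y * x = 1" using R.A.LK R.B.LK R.A.KL R.B.KL by simp_all
 have "x * z = x * (z * y) * x" by (simp add: mult.assoc xy)
 also have "\<dots> = (x * y) * z * x" using K_th[of a k l] by (simp only: y_def z_def mult.assoc)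
 finally have "x * z = z * x" using xy by simp
 then show ?thesis by (simp only: x_def z_def)
qed

lemma bar_free2_simps:
 "bar_free2 0 = 0" "bar_free2 (x + y) = bar_free2 x + bar_free2 y"
 "bar_free2 (cst c * x) = cst (qbar c) * bar_free2 x"
 "bar_free2 (single (w, v) c) = single (map bar_gen w, map bar_gen v) (qbar c)"
 by (simp_all add: bar_free2_def antilin_ext_sl qbar.sl_ext_add qbar.sl_ext_cst cst_single)

lemma bar_free2_mult: "bar_free2 (x * y) = bar_free2 x * bar_free2 y"
proof (induction x rule: pm_induct)
 case (single k c)
 show ?case
 proof (induction y rule: pm_induct)
  case (single l d)
  then show ?case
   by (cases k; cases l) (simp add: mult_single plus_list_def bar_free2_simps qbar_mult)
 qed (simp_all add: bar_free2_simps distrib_left)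
qed (simp_all add: bar_free2_simps distrib_right)

lemma bar_free2_1: "bar_free2 1 = 1"
 using bar_free2_simps(4)[of "[]" "[]" 1] by (simp add: single_Nil)

definition dbar :: "gen => free2" where
 "dbar x = bar_free2 (comult_gen (bar_gen x))"

lemma xKK_single: "xKK a b = single [gK a, gKinv b] 1"
 by (simp add: xKK_def xK_def xKinv_def mult_single plus_list_def)

lemma comult_gen_single:
 "comult_gen (gE a) = single ([], [gE a]) 1 + single ([gE a], [gK (a + 1), gKinv a]) 1"
 "comult_gen (gF a) = single ([gF a], []) 1 + single ([gK a, gKinv (a + 1)], [gF a]) 1"
 "comult_gen (gK a) = single ([gK a], [gK a]) 1"
 "comult_gen (gKinv a) = single ([gKinv a], [gKinv a]) 1"
 by (simp_all add: xE_def xF_def xK_def xKinv_def xKK_single single_Nil1 tens_single)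

lemma dbar_single:
 "dbar (gE a) = single ([], [gE a]) 1 + single ([gE a], [gKinv (a + 1), gK a]) 1"
 "dbar (gF a) = single ([gF a], []) 1 + single ([gKinv a, gK (a + 1)], [gF a]) 1"
 "dbar (gK a) = single ([gK a], [gK a]) 1"
 "dbar (gKinv a) = single ([gKinv a], [gKinv a]) 1"
 by (simp_all add: dbar_def comult_gen_single bar_free2_simps del: comult_gen.simps)

lemma cl_bd_eq:
 assumes "cl x = cl y"
 shows "cl (bidegree_part l n x) = cl (bidegree_part l n y)"
 using assms bd_uq2_ideal[of "x - y" l n] by (simp add: cl_eq_iff bd_simps)

lemma thc_neg: "height k l < 0 ==> thc (th k) l n = 0"
 by (simp add: thc_def th_def)

lemma wt_single: "wt [x] = wt_gen x" "wt [gK a, gKinv b] = 0" "wt [gKinv a, gK b] = 0"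
 by (auto simp: wt_def fun_eq_iff)

text \<open>Common form of the cases E and F: the coproduct is p + r and its bar conjugate is p +
  r'. Here \<alpha> is the negative of a simple root. The bidegree of r differs from that of p so
  that r meets the component of \<Theta> of height one less, that is, the coefficient two degrees
  lower.\<close>

lemma intertw_two_terms:
 assumes p: "p = single j 1" "wt (fst j) = \<beta>" "wt (snd j) = \<gamma>"
  and r: "r = single i 1" "r' = single i' 1" "wt (fst i) = \<beta> - \<alpha>" "wt (snd i) = \<gamma> + \<alpha>"
   "wt (fst i') = \<beta> - \<alpha>" "wt (snd i') = \<gamma> + \<alpha>"
  and h: "height k \<alpha> = -1"
  and eq: "\<And>n. cl p * (R.H.Th k (2 * k) $ n) + (if n < 2 then 0 else cl r * (R.H.Th k (2 * k) $ (n - 2)))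
   = (R.H.Th k (2 * k) $ n) * cl p + (if n < 2 then 0 else (R.H.Th k (2 * k) $ (n - 2)) * cl r')"
 shows "intertw (th k) (p + r) (p + r')"
 unfolding intertw_def
proof (intro allI)
 fix l' n'
 define l n where "l = l' - \<beta>" and "n = n' - \<gamma>"
 have ln: "l' - \<beta> = l" "n' - \<gamma> = n" "l' - (\<beta> - \<alpha>) = l + \<alpha>" "n' - (\<gamma> + \<alpha>) = n - \<alpha>"
  by (simp_all add: l_def n_def algebra_simps)
 have lhs: "lth (th k) (p + r) l' n' = p * thc (th k) l n + r * thc (th k) (l + \<alpha>) (n - \<alpha>)"
  and rhs: "rth (th k) (p + r') l' n' = thc (th k) l n * p + thc (th k) (l + \<alpha>) (n - \<alpha>) * r'"
  unfolding lth_add[OF graded_th] rth_add[OF graded_th] p(1) r(1,2) lth_single[OF graded_th] rth_single[OF graded_th] p(2,3) r(3-6) ln by (rule refl)+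
 show "cl (lth (th k) (p + r) l' n') = cl (rth (th k) (p + r') l' n')"
 proof (cases "height k l < 0")
  case True
  then have "thc (th k) l m = 0" "thc (th k) (l + \<alpha>) m = 0" for m using h by (simp_all add: thc_neg height_simps)
  then show ?thesis unfolding lhs rhs by simp
 next
  case False
  define m where "m = nat (2 * height k l)"
  have m: "int m = 2 * height k l" using False by (simp add: m_def)
  \<comment> \<open>For m < 2 the height of \<open>l + \<alpha>\<close> is negative and the
    component vanishes.\<close>
  define s where "s = (if m < 2 then 0 else th_rep k (m - 2))"
  have 1: "thc (th k) l n = bidegree_part l n (th_rep k m)" by (rule bd_th_rep[OF m, symmetric])
  have 2: "thc (th k) (l + \<alpha>) (n - \<alpha>) = bidegree_part (l + \<alpha>) (n - \<alpha>) s"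
  proof (cases "m < 2")
   case True
   then have "height k l = 0" using m by linarith
   then show ?thesis using True h by (simp add: thc_neg height_simps s_def bd_simps)
  next
   case False
   then have "int (m - 2) = 2 * height k (l + \<alpha>)" using m h by (simp add: height_simps of_nat_diff)
   from bd_th_rep[OF this] False show ?thesis by (simp add: s_def)
  qed
  have "cl (p * th_rep k m + r * s) = cl (th_rep k m * p + s * r')"
   using eq[of m] by (cases "m < 2") (simp_all add: cl_simps th_rep(2) s_def)
  from cl_bd_eq[OF this, of l' n']
  have "cl (p * bidegree_part l n (th_rep k m) + r * bidegree_part (l + \<alpha>) (n - \<alpha>) s)
   = cl (bidegree_part l n (th_rep k m) * p + bidegree_part (l + \<alpha>) (n - \<alpha>) s * r')"
   unfolding bd_simps p(1) r(1,2) bd_mult_left bd_mult_right p(2,3) r(3-6) ln .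
  then show ?thesis unfolding lhs rhs 1 2 .
 qed
qed

lemma cl_two: "cl (single ([x], [y, z]) 1) = g1 x * (g2 y * g2 z)"
 "cl (single ([y, z], [x]) 1) = g1 y * g1 z * g2 x"
 "cl (single ([x], [y]) 1) = g1 x * g2 y"
 unfolding cl_gens(5)[of "[x]" "[y, z]"] cl_gens(5)[of "[y, z]" "[x]"] cl_gens(5)[of "[x]" "[y]"]
 unfolding cl_gens(3)[of y "[z]"] cl_gens(4)[of y "[z]"] cl_gens(1,2) by (rule refl)+

lemma intertw_gen:
 assumes "x \<in> letters k"
 shows "intertw (th k) (comult_gen x) (dbar x)"
proof -
 consider a where "x = gE a" "- int k \<le> a" "a \<le> int k - 1" | a where "x = gF a" "- int k \<le> a" "a \<le> int k - 1"
  | a where "x = gK a" | a where "x = gKinv a"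
  using assms by (auto simp: letters_def pos_letters_def neg_letters_def)
 then show ?thesis
 proof cases
  case (1 a)
  define i where "i = nat (a + int k)"
  have i: "- int k + int i = a" "i < 2 * k" using 1 by (auto simp: i_def)
  show ?thesis unfolding 1(1) comult_gen_single dbar_single
  proof (rule intertw_two_terms[OF refl _ _ refl refl, where \<alpha> = "- wt_gen (gE a)"
     and \<beta> = 0 and \<gamma> = "wt_gen (gE a)"])
   show "height k (- wt_gen (gE a)) = - 1"
    using height_wt_gen(1)[OF 1(2,3)] by (simp only: height_simps)
   show "cl (single ([], [gE a]) 1) * (R.H.Th k (2 * k) $ n) +
     (if n < 2 then 0 else cl (single ([gE a], [gK (a + 1), gKinv a]) 1) * (R.H.Th k (2 * k) $ (n - 2))) =
     (R.H.Th k (2 * k) $ n) * cl (single ([], [gE a]) 1) +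
     (if n < 2 then 0 else (R.H.Th k (2 * k) $ (n - 2)) * cl (single ([gE a], [gKinv (a + 1), gK a]) 1))" for n
    using R.Th_nth_E[OF i(2), where k = k and n = n] R.B.LK_comm[of "a + 1" a]
    unfolding i cl_two cl_gens(2) by (cases "n < 2") (simp_all add: R.B.KJ_def R.B.JK_def mult.assoc)
  qed (simp_all only: fst_conv snd_conv wt_single wt_simps(1) diff_minus_eq_add add_0_left right_minus)
 next
  case (2 a)
  define i where "i = nat (a + int k)"
  have i: "- int k + int i = a" "i < 2 * k" using 2 by (auto simp: i_def)
  show ?thesis unfolding 2(1) comult_gen_single dbar_single
  proof (rule intertw_two_terms[OF refl _ _ refl refl, where \<alpha> = "wt_gen (gF a)"
     and \<beta> = "wt_gen (gF a)" and \<gamma> = 0])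
   show "height k (wt_gen (gF a)) = - 1"
    using height_wt_gen(2)[OF 2(2,3)] .
   show "cl (single ([gF a], []) 1) * (R.H.Th k (2 * k) $ n) +
     (if n < 2 then 0 else cl (single ([gK a, gKinv (a + 1)], [gF a]) 1) * (R.H.Th k (2 * k) $ (n - 2))) =
     (R.H.Th k (2 * k) $ n) * cl (single ([gF a], []) 1) +
     (if n < 2 then 0 else (R.H.Th k (2 * k) $ (n - 2)) * cl (single ([gKinv a, gK (a + 1)], [gF a]) 1))" for n
    using R.Th_nth_F[OF i(2), where k = k and n = n] R.A.LK_comm[of a "a + 1"]
    unfolding i cl_two cl_gens(1) by (cases "n < 2") (simp_all add: R.A.KJ_def R.A.JK_def mult.assoc)
  qed (simp_all only: fst_conv snd_conv wt_single wt_simps(1) diff_self add_0_left)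
 next
  case (3 a)
  show ?thesis unfolding 3 comult_gen_single dbar_single intertw_def lth_single[OF graded_th] rth_single[OF graded_th]
   using K_th by (simp add: wt_single cl_simps cl_two thc_def)
 next
  case (4 a)
  show ?thesis unfolding 4 comult_gen_single dbar_single intertw_def lth_single[OF graded_th] rth_single[OF graded_th]
   using L_th by (simp add: wt_single cl_simps cl_two thc_def)
 qed
qed

lemma comult_simps: "comult (x + y) = comult x + comult y" "comult 0 = 0"
 "comult (single w c) = cst c * prod_list (map comult_gen w)"
 by (simp_all add: comult_def lin_ext_simps)

lemma bar_free_simps: "bar_free (x + y) = bar_free x + bar_free y" "bar_free 0 = 0"
 "bar_free (single w c) = single (map bar_gen w) (qbar c)"
 by (simp_all add: bar_free_def antilin_ext_sl qbar.sl_ext_add cst_single)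

lemma bar_free2_comult_bar: "bar_free2 (comult (bar_free (single w c))) = cst c * prod_list (map dbar w)"
proof -
 have "bar_free2 (prod_list (map comult_gen (map bar_gen w))) = prod_list (map dbar w)"
  by (induction w) (simp_all add: bar_free2_1 bar_free2_mult dbar_def)
 then show ?thesis by (simp add: bar_free_simps comult_simps bar_free2_simps)
qed

lemma intertw_word: "set w \<subseteq> letters k ==> intertw (th k) (prod_list (map comult_gen w)) (prod_list (map dbar w))"
proof (induction w)
 case Nil
 show ?case using intertw_cst[OF graded_th, of k 1] by (simp add: cst_simps)
next
 case (Cons x w)
 then show ?case by (auto intro!: intertw_mult[OF graded_th] intertw_gen)
qed

theorem is_quasi_R_th: "is_quasi_R k (th k)"
proof -
 have "intertw (th k) (comult u) (bar_free2 (comult (bar_free u)))"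
  if "\<forall>w\<in>keys u. set w \<subseteq> letters k" for u
 proof -
  have "intertw (th k) (comult (\<Sum>w\<in>A. single w (lookup u w))) (bar_free2 (comult (bar_free (\<Sum>w\<in>A. single w (lookup u w)))))"
   if "finite A" "A \<subseteq> keys u" for A
   using that
  proof (induction A)
   case (insert w A)
   have "intertw (th k) (comult (single w (lookup u w))) (bar_free2 (comult (bar_free (single w (lookup u w)))))"
    unfolding bar_free2_comult_bar comult_simps(3)
    using insert \<open>\<forall>w\<in>keys u. set w \<subseteq> letters k\<close> by (intro intertw_mult[OF graded_th] intertw_cst[OF graded_th] intertw_word) auto
   then show ?case using insert by (auto simp: comult_simps bar_free_simps bar_free2_simps intro!: intertw_add[OF graded_th])
  qed (simp add: comult_simps bar_free_simps bar_free2_simps intertw_0[OF graded_th])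
  from this[of "keys u"] show ?thesis using pm_expand[of u] by simp
 qed
 then have "lth (th k) (comult u) l n - rth (th k) (bar_free2 (comult (bar_free u))) l n \<in> uq2_ideal"
  if "\<forall>w\<in>keys u. set w \<subseteq> letters k" for u l n
  using that by (simp add: intertw_def cl_eq_iff)
 then have eq: "\<forall>u. (\<forall>w\<in>keys u. set w \<subseteq> letters k) -->
   (\<forall>l n. lth (th k) (comult u) l n - rth (th k) (bar_free2 (comult (bar_free u))) l n \<in> uq2_ideal)"
  by blast
 have "\<forall>\<mu>. \<forall>(w, v)\<in>keys (th k \<mu>).
   set w \<subseteq> pos_letters k \<and> wt w = \<mu> \<and> set v \<subseteq> neg_letters k \<and> wt v = - \<mu>"
  by (intro allI ballI prod.case_eq_if[THEN iffD2]) (metis prod.collapse th_keys)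
 with eq th_0[of k] show ?thesis
  unfolding is_quasi_R_def lth_def rth_def by (intro conjI)
qed

lemma is_quasi_R_quasi_R: "is_quasi_R k (quasi_R k)"
 unfolding quasi_R_def by (rule someI[of "is_quasi_R k" "th k", OF is_quasi_R_th])

lemma quasi_R_keys: "(w, v) \<in> keys (quasi_R k \<mu>) ==>
  set w \<subseteq> pos_letters k \<and> wt w = \<mu> \<and> set v \<subseteq> neg_letters k \<and> wt v = - \<mu>"
 using is_quasi_R_quasi_R[of k] unfolding is_quasi_R_def by blast

lemma quasi_R_0: "quasi_R k 0 = 1"
 using is_quasi_R_quasi_R[of k] unfolding is_quasi_R_def by blast

lemma graded_quasi_R: "graded (quasi_R k)"
 unfolding graded_def using quasi_R_keys by (metis prod.collapse)

lemma intertw_quasi_R: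
 assumes "x \<in> letters k"
 shows "intertw (quasi_R k) (comult_gen x) (dbar x)"
proof -
 have "\<forall>w\<in>keys (single [x] (1::qfield)). set w \<subseteq> letters k" using assms by simp
 then have "\<forall>l n. lth (quasi_R k) (comult (single [x] 1)) l n
   - rth (quasi_R k) (bar_free2 (comult (bar_free (single [x] 1)))) l n \<in> uq2_ideal"
  using is_quasi_R_quasi_R[of k] unfolding is_quasi_R_def lth_def rth_def by blast
 then show ?thesis
  unfolding bar_free2_comult_bar comult_simps(3) by (simp add: intertw_def cl_eq_iff cst_simps)
qed

section \<open>Length-preserving operators on Fock spaces\<close>

text \<open>Linear operators, given by their values on the basis. As lengths are preserved, tensor
  products with a fixed cutting position can be multiplied factor by factor
  (\<open>tnp_mult\<close>); a type of its own provides the \<open>ring_1\<close> in which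
  \<open>uq_alg\<close> can be interpreted.\<close>

typedef lend = "{F :: int list => vec. \<forall>f. \<forall>g\<in>keys (F f). length g = length f}"
 by (rule exI[of _ "\<lambda>f. 0"]) simp

setup_lifting type_definition_lend

lemma lend_length: "g \<in> keys (Rep_lend T f) ==> length g = length f"
 using Rep_lend[of T] by blast

lemma lend_eqI: "(\<And>f. Rep_lend S f = Rep_lend T f) ==> S = T"
 by (metis Rep_lend_inject ext)

instantiation lend :: ring_1
begin

lift_definition zero_lend :: lend is "\<lambda>f. 0" by simp
lift_definition one_lend :: lend is "\<lambda>f. single f 1" by simp
lift_definition plus_lend :: "lend => lend => lend" is "\<lambda>S T f. S f + T f"
proof -
 fix S T :: "int list => vec" and f g
 assume "\<And>f g. g \<in> keys (S f) ==> length g = length f" "\<And>f g. g \<in> keys (T f) ==> length g = length f"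
  "g \<in> keys (S f + T f)"
 then show "length g = length f" using Poly_Mapping.keys_add[of "S f" "T f"] by blast
qed
lift_definition uminus_lend :: "lend => lend" is "\<lambda>S f. - S f"
 by (simp add: in_keys_iff)
lift_definition minus_lend :: "lend => lend => lend" is "\<lambda>S T f. S f - T f"
proof -
 fix S T :: "int list => vec" and f g
 assume *: "\<And>f g. g \<in> keys (S f) ==> length g = length f" "\<And>f g. g \<in> keys (T f) ==> length g = length f"
  "g \<in> keys (S f - T f)"
 then have "g \<in> keys (S f) \<or> g \<in> keys (T f)" by (auto simp: in_keys_iff lookup_minus)
 with * show "length g = length f" by blast
qed
lift_definition times_lend :: "lend => lend => lend" is "\<lambda>S T f. lin_ext S (T f)"
proof -
 fix S T :: "int list => vec" and f g
 assume *: "\<And>f g. g \<in> keys (S f) ==> length g = length f" "\<And>f g. g \<in> keys (T f) ==> length g = length f"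
  "g \<in> keys (lin_ext S (T f))"
 then obtain h where "h \<in> keys (T f)" "g \<in> keys (S h)" using keys_lin_ext[of S "T f"] by blast
 with * show "length g = length f" by metis
qed

instance
proof
 fix S T U :: lend
 show "S * T * U = S * (T * U)" by transfer (simp add: lin_ext_lin_ext)
 show "1 * S = S" by transfer simp
 show "S * 1 = S" by transfer (simp add: lin_ext_simps cst_simps)
 show "(S + T) * U = S * U + T * U" by transfer (simp add: lin_ext_add_fun)
 show "S * (T + U) = S * T + S * U" by transfer (simp add: lin_ext_simps)
 show "S + T + U = S + (T + U)" "S + T = T + S" "0 + S = S" "- S + S = 0" "S - T = S + - T"
  by (transfer; simp add: algebra_simps fun_eq_iff)+
 show "(0 :: lend) \<noteq> 1"
 proof
  assume "(0 :: lend) = 1"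
  then have "Rep_lend 0 [] = Rep_lend 1 []" by simp
  then have "single [] (1 :: qfield) = (0 :: vec)"
   by (simp add: zero_lend.rep_eq one_lend.rep_eq)
  then have "keys (single [] (1 :: qfield)) = keys (0 :: vec)" by (rule arg_cong)
  then show False by simp
 qed
qed

end

lemmas lend_rep = zero_lend.rep_eq one_lend.rep_eq plus_lend.rep_eq uminus_lend.rep_eq minus_lend.rep_eq times_lend.rep_eq

definition ap :: "lend => vec => vec" where
 "ap T x = lin_ext (Rep_lend T) x"

lemma ap_simps: "ap T 0 = 0" "ap T (x + y) = ap T x + ap T y" "ap T (single f c) = cst c * Rep_lend T f"
 "ap T (cst c * x) = cst c * ap T x" "ap T (- x) = - ap T x" "ap T (x - y) = ap T x - ap T y"
 "ap T (sum h A) = (\<Sum>i\<in>A. ap T (h i))"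
 by (simp_all add: ap_def lin_ext_simps)

lemma ap_ring: "ap 1 x = x" "ap (S * T) x = ap S (ap T x)" "ap (S + T) x = ap S x + ap T x"
 "ap (S - T) x = ap S x - ap T x" "ap 0 x = 0" "ap (- S) x = - ap S x"
proof -
 show "ap 1 x = x" "ap (S * T) x = ap S (ap T x)" "ap 0 x = 0"
  by (simp_all add: ap_def lend_rep lin_ext_lin_ext)
 show add: "ap (S + T) x = ap S x + ap T x" for S T by (simp add: ap_def lend_rep lin_ext_add_fun)
 show m: "ap (- S) x = - ap S x" for S
  using add[of S "- S"] \<open>ap 0 x = 0\<close> by (simp add: eq_neg_iff_add_eq_0 add.commute)
 show "ap (S - T) x = ap S x - ap T x" using add[of S "- T"] m by simp
qed

lemma ap_sum_left: "ap (sum h A) x = (\<Sum>i\<in>A. ap (h i) x)"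
 by (induction A rule: infinite_finite_induct) (simp_all add: ap_ring)

lemma ap_single_1: "ap T (single f 1) = Rep_lend T f"
 by (simp add: ap_simps cst_simps)

lemma lend_eqI': "(\<And>f. ap S (single f 1) = ap T (single f 1)) ==> S = T"
 by (intro lend_eqI) (simp add: ap_single_1)

lemma lend_ext: "(\<And>x. ap S x = ap T x) ==> S = T"
 by (rule lend_eqI')

definition csl :: "qfield => lend" where
 "csl c = Abs_lend (\<lambda>f. single f c)"

lemma Rep_csl: "Rep_lend (csl c) f = single f c"
 unfolding csl_def by (subst Abs_lend_inverse) auto

lemma ap_csl: "ap (csl c) x = cst c * x"
 by (induction x rule: pm_induct) (simp_all add: ap_simps Rep_csl cst_single distrib_left mult.commute)

interpretation L: qalg csl
proof
 show "csl (a + b) = csl a + csl b" "csl (a * b) = csl a * csl b" for a b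
  by (rule lend_ext; simp add: ap_csl ap_ring cst_simps distrib_right mult.assoc)+
 show "csl 1 = 1" by (rule lend_ext) (simp add: ap_csl ap_ring cst_simps)
 show "T * csl a = csl a * T" for T a by (rule lend_ext) (simp add: ap_csl ap_ring ap_simps(4))
qed

interpretation G: gen_hom csl A for A :: "gen => lend"
 by unfold_locales

lemma ap_sc: "ap (L.sc c T) x = cst c * ap T x" and ap_sq: "ap (L.sq n T) x = cst (qq powi n) * ap T x"
 by (simp_all add: L.sc_def L.sq_def ap_ring ap_csl)

section \<open>Tensor products of operators and of representations\<close>

definition tnsl :: "nat => lend => lend => int list => vec" where
 "tnsl n S T f = Rep_lend S (take n f) * Rep_lend T (drop n f)"

definition tnp :: "nat => lend => lend => lend" where
 "tnp n S T = Abs_lend (tnsl n S T)"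

lemma Rep_tnp: "Rep_lend (tnp n S T) = tnsl n S T"
 unfolding tnp_def
proof (intro Abs_lend_inverse CollectI allI ballI)
 fix f g assume "g \<in> keys (tnsl n S T f)"
 then have "g \<in> {g1 + g2 | g1 g2. g1 \<in> keys (Rep_lend S (take n f)) \<and> g2 \<in> keys (Rep_lend T (drop n f))}"
  unfolding tnsl_def by (rule subsetD[OF keys_mult])
 then obtain g1 g2 where "g = g1 @ g2" "g1 \<in> keys (Rep_lend S (take n f))" "g2 \<in> keys (Rep_lend T (drop n f))"
  unfolding plus_list_def by blast
 then show "length g = length f" using lend_length[of g1 S] lend_length[of g2 T] by auto
qed

lemma ap_tnp_single: "ap (tnp n S T) (single f 1) = ap S (single (take n f) 1) * ap T (single (drop n f) 1)"
 by (simp add: ap_single_1 Rep_tnp tnsl_def)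

lemma cst_mult_cst: "(cst a * x) * (cst b * y) = cst (a * b) * (x * y)"
 unfolding mult.assoc cst_left[of x] cst_cst ..

text \<open>Either the first factor has length \<open>n\<close>, or it is shorter and the second one is empty.\<close>

lemma ap_tnp_gen:
 assumes "\<And>f g. f \<in> keys x ==> g \<in> keys y ==> take n (f @ g) = f \<and> drop n (f @ g) = g"
 shows "ap (tnp n S T) (x * y) = ap S x * ap T y"
proof -
 have x: "x = (\<Sum>f\<in>keys x. cst (lookup x f) * single f 1)" for x :: vec
  by (subst pm_expand[of x]) (simp add: cst_single)
 have "x * y = (\<Sum>f\<in>keys x. \<Sum>g\<in>keys y. cst (lookup x f * lookup y g) * single (f @ g) 1)"
  by (subst (1) x[of x], subst (1) x[of y])
    (simp only: sum_product cst_mult_cst mult_single plus_list_def mult_1_left)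
 then have "ap (tnp n S T) (x * y) = (\<Sum>f\<in>keys x. \<Sum>g\<in>keys y. cst (lookup x f * lookup y g) *
   ap (tnp n S T) (single (f @ g) 1))"
  by (simp only: ap_simps(4,7))
 also have "\<dots> = (\<Sum>f\<in>keys x. \<Sum>g\<in>keys y. cst (lookup x f * lookup y g) *
   (ap S (single f 1) * ap T (single g 1)))"
  using assms by (intro sum.cong refl) (simp add: ap_tnp_single)
 also have "\<dots> = ap S x * ap T y"
  by (subst (3) x[of x], subst (3) x[of y]) (simp only: ap_simps(4,7) sum_product cst_mult_cst)
 finally show ?thesis .
qed

lemma ap_tnp: "(\<And>f. f \<in> keys x ==> length f = n) ==> ap (tnp n S T) (x * y) = ap S x * ap T y"
 by (rule ap_tnp_gen) auto

lemma tnp_mult: "tnp n S T * tnp n S' T' = tnp n (S * S') (T * T')"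
proof (rule lend_eqI')
 fix f
 show "ap (tnp n S T * tnp n S' T') (single f 1) = ap (tnp n (S * S') (T * T')) (single f 1)"
  unfolding ap_ring ap_tnp_single
 proof (rule ap_tnp_gen)
  fix g h assume "g \<in> keys (ap S' (single (take n f) 1))" "h \<in> keys (ap T' (single (drop n f) 1))"
  then have "length g = length (take n f)" "length h = length (drop n f)"
   by (auto simp: ap_single_1 lend_length)
  then show "take n (g @ h) = g \<and> drop n (g @ h) = h" by (cases "n \<le> length f") auto
 qed
qed

lemma single_append: "single (f @ g) (1 :: qfield) = single f 1 * single g 1"
 by (simp add: mult_single plus_list_def)

lemma single_Nil_list: "single [] (1 :: qfield) = 1"
 by (metis single_one zero_list_def)

lemma tnp_1: "tnp n 1 1 = 1"
 by (rule lend_eqI') (simp add: ap_tnp_single ap_ring single_append[symmetric])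

lemma tnp_add: "tnp n (S + S') T = tnp n S T + tnp n S' T" "tnp n S (T + T') = tnp n S T + tnp n S T'"
 by (rule lend_eqI'; simp add: ap_tnp_single ap_ring algebra_simps)+

lemma tnp_csl: "tnp n (csl c * S) T = csl c * tnp n S T" "tnp n S (csl c * T) = csl c * tnp n S T"
 by (rule lend_eqI'; simp add: ap_tnp_single ap_ring ap_csl mult.assoc cst_left)+

abbreviation "lt n S \<equiv> tnp n S 1"
abbreviation "rt n T \<equiv> tnp n 1 T"

interpretation TT: gen_hom2 csl "\<lambda>x. lt n (A x)" "\<lambda>x. rt n (B x)" for n A B
 by unfold_locales (simp add: tnp_mult)

lemma TT_chi: "G.chi (\<lambda>x. lt n (A x)) w = lt n (G.chi A w)" "G.chi (\<lambda>x. rt n (B x)) w = rt n (G.chi B w)"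
 by (induction w) (simp_all add: G.chi_def  tnp_mult tnp_1)

lemma TT_chi2: "TT.chi2 n A B (w, v) = tnp n (G.chi A w) (G.chi B v)"
 by (simp add: TT.chi2_def TT_chi tnp_mult)

definition tns :: "nat => (gen => lend) => (gen => lend) => gen => lend" where
 "tns n A B x = TT.T.ev n A B (comult_gen x)"

abbreviation rep_uq :: "(gen => lend) => bool" where
 "rep_uq A \<equiv> uq_alg csl (\<lambda>a. A (gE a)) (\<lambda>a. A (gF a)) (\<lambda>a. A (gK a)) (\<lambda>a. A (gKinv a))"

lemma G_ev_lt: "G.ev (\<lambda>x. lt n (A x)) x = lt n (G.ev A x)" "G.ev (\<lambda>x. rt n (A x)) x = rt n (G.ev A x)"
proof -
 have "lt n (sum h I) = (\<Sum>i\<in>I. lt n (h i))" "rt n (sum h I) = (\<Sum>i\<in>I. rt n (h i))" for h and I :: "gen list set"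
 proof (induction I rule: infinite_finite_induct)
  case (insert x F)
  { case 1 then show ?case using insert by (simp add: tnp_add) }
  { case 2 then show ?case using insert by (simp add: tnp_add) }
 qed (use tnp_add(1)[of n 0 0] tnp_add(2)[of n _ 0 0] in auto)
 then show "G.ev (\<lambda>x. lt n (A x)) x = lt n (G.ev A x)" "G.ev (\<lambda>x. rt n (A x)) x = rt n (G.ev A x)"
  unfolding G.ev_def TT_chi by (simp_all add: L.sc_def tnp_csl)
qed

lemma tnp_0: "tnp n 0 T = 0" "tnp n S 0 = 0"
 using tnp_add(1)[of n 0 0 T] tnp_add(2)[of n S 0 0] by auto

lemma rep_lt: "rep_uq A ==> rep_uq (\<lambda>x. lt n (A x))" and rep_rt: "rep_uq A ==> rep_uq (\<lambda>x. rt n (A x))"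
 by (rule G.rels_uq_alg, simp add: G_ev_lt G.ev_rels tnp_0) (rule G.rels_uq_alg, simp add: G_ev_lt G.ev_rels tnp_0)

lemma rep_tns: "rep_uq A ==> rep_uq B ==> rep_uq (tns n A B)"
 using TT.ev_comult[of n A B, OF rep_lt rep_rt] by (simp add: tns_def)

lemma TT_ideal: "rep_uq A ==> rep_uq B ==> x \<in> uq2_ideal ==> TT.T.ev n A B x = 0"
 by (rule TT.ev_uq2_ideal[OF rep_lt rep_rt])

lemma tns_simps:
 "tns n A B (gE a) = rt n (B (gE a)) + tnp n (A (gE a)) (B (gK (a + 1)) * B (gKinv a))"
 "tns n A B (gF a) = lt n (A (gF a)) + tnp n (A (gK a) * A (gKinv (a + 1))) (B (gF a))"
 "tns n A B (gK a) = tnp n (A (gK a)) (B (gK a))"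
 "tns n A B (gKinv a) = tnp n (A (gKinv a)) (B (gKinv a))"
 unfolding tns_def comult_gen_single TT.T.ev_add TT.T.ev_single TT_chi2
 by (simp_all add: L.sc_simps G.chi_def)

lemma tnp_tnp: "tnp (n + m) (tnp n S T) U = tnp n S (tnp m T U)"
proof (rule lend_eqI')
 fix f :: "int list"
 have "take n (take (n + m) f) = take n f" "drop n (take (n + m) f) = take m (drop n f)"
  "drop (n + m) f = drop m (drop n f)"
  by (simp_all add: min_def drop_take add.commute)
 then show "ap (tnp (n + m) (tnp n S T) U) (single f 1) = ap (tnp n S (tnp m T U)) (single f 1)"
  by (simp only: ap_tnp_single mult.assoc)
qed

text \<open>Coassociativity, checked on the generators.\<close>

lemma tns_assoc: "tns (n + m) (tns n A B) C = tns n A (tns m B C)"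
proof
 fix x
 show "tns (n + m) (tns n A B) C x = tns n A (tns m B C) x"
 proof (cases x)
  case (gE a)
  have "rt (n + m) T = tnp n 1 (rt m T)" for T using tnp_tnp[of n m 1 1 T] by (simp add: tnp_1)
  then show ?thesis unfolding gE tns_simps by (simp add: tnp_add tnp_tnp tnp_mult add.assoc)
 next
  case (gF a)
  show ?thesis unfolding gF tns_simps by (simp add: tnp_add tnp_tnp tnp_mult add.assoc tnp_1)
 qed (simp_all add: tns_simps tnp_tnp)
qed

section \<open>The representations on single factors and on Fock spaces\<close>

definition bs :: "nat => gen => int list => vec" where
 "bs s x f = (if length f = 1 then act_factor s x f
   else case x of gE a => 0 | gF a => 0 | gK a => single f 1 | gKinv a => single f 1)"

text \<open>On lists of the wrong length this is the trivial representation.\<close>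

definition base :: "nat => gen => lend" where
 "base s x = Abs_lend (bs s x)"

lemma Rep_base: "Rep_lend (base s x) = bs s x"
 unfolding base_def
proof (intro Abs_lend_inverse CollectI allI ballI)
 fix f g assume "g \<in> keys (bs s x f)"
 then show "length g = length f"
  by (cases x) (auto simp: bs_def act_factor_def split: if_splits)
qed

lemma ap_base: "ap (base s x) (single f c) = cst c * bs s x f"
 by (simp add: ap_simps Rep_base)

lemma bs_V: "bs 0 (gE a) [c] = (if c = a + 1 then single [a] 1 else 0)"
 "bs 0 (gF a) [c] = (if c = a then single [a + 1] 1 else 0)"
 "bs 0 (gK a) [c] = single [c] (qq powi of_bool (a = c))"
 "bs 0 (gKinv a) [c] = single [c] (qq powi (- of_bool (a = c)))"
 by (simp_all add: bs_def act_factor_def)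

lemma bs_W: "s \<noteq> 0 ==> bs s (gE a) [c] = (if c = a then single [a + 1] 1 else 0)"
 "s \<noteq> 0 ==> bs s (gF a) [c] = (if c = a + 1 then single [a] 1 else 0)"
 "s \<noteq> 0 ==> bs s (gK a) [c] = single [c] (qq powi (- of_bool (a = c)))"
 "s \<noteq> 0 ==> bs s (gKinv a) [c] = single [c] (qq powi of_bool (a = c))"
 by (simp_all add: bs_def act_factor_def)

lemma bs_other: "length f \<noteq> 1 ==> bs s (gE a) f = 0" "length f \<noteq> 1 ==> bs s (gF a) f = 0"
 "length f \<noteq> 1 ==> bs s (gK a) f = single f 1" "length f \<noteq> 1 ==> bs s (gKinv a) f = single f 1"
 by (auto simp: bs_def)

lemma lend_eqI_base:
 assumes "\<And>c. ap S (single [c] 1) = ap T (single [c] 1)"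
  "\<And>f. length f \<noteq> 1 ==> ap S (single f 1) = ap T (single f 1)"
 shows "S = T"
proof (rule lend_eqI')
 fix f show "ap S (single f 1) = ap T (single f 1)"
  using assms by (cases "length f = 1") (auto simp: length_Suc_conv)
qed

lemma ap_V: "ap (base 0 (gE a)) (single [c] v) = (if c = a + 1 then single [a] v else 0)"
 "ap (base 0 (gF a)) (single [c] v) = (if c = a then single [a + 1] v else 0)"
 "ap (base 0 (gK a)) (single [c] v) = single [c] (v * qq powi of_bool (a = c))"
 "ap (base 0 (gKinv a)) (single [c] v) = single [c] (v * qq powi (- of_bool (a = c)))"
 by (simp_all add: ap_base bs_V cst_single)

lemma ap_W:
 assumes "s \<noteq> 0"
 shows "ap (base s (gE a)) (single [c] v) = (if c = a then single [a + 1] v else 0)"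
 "ap (base s (gF a)) (single [c] v) = (if c = a + 1 then single [a] v else 0)"
 "ap (base s (gK a)) (single [c] v) = single [c] (v * qq powi (- of_bool (a = c)))"
 "ap (base s (gKinv a)) (single [c] v) = single [c] (v * qq powi of_bool (a = c))"
 using assms by (simp_all add: ap_base bs_W cst_single)

lemma ap_other:
 assumes "length f \<noteq> 1"
 shows "ap (base s (gE a)) (single f v) = 0" "ap (base s (gF a)) (single f v) = 0"
 "ap (base s (gK a)) (single f v) = single f v" "ap (base s (gKinv a)) (single f v) = single f v"
 using assms by (simp_all add: ap_base bs_other cst_single)

lemma pm_single_diff: "single f a - single f b = single f (a - b)"
 by (simp add: single_diff)

lemma c_divide: "qq \<noteq> inverse qq" "(inverse qq - qq) / (qq - inverse qq) = - 1"
proof -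
 show "qq \<noteq> inverse qq" using qq_diff_inverse_nonzero by auto
 have "(inverse qq - qq) / (qq - inverse qq) = - ((qq - inverse qq) / (qq - inverse qq))"
  by (metis minus_diff_eq minus_divide_left)
 then show "(inverse qq - qq) / (qq - inverse qq) = - 1"
  using qq_diff_inverse_nonzero by simp
qed

lemma rep_base: "rep_uq (base s)"
proof (intro uq_alg.intro uq_alg_axioms.intro L.qalg_axioms)
 note ap = ap_ring ap_sc ap_sq cst_single cst_simps(4,5) mult_zero_left mult_zero_right mult_1_left ap_simps(1)
  ap_V ap_W ap_other
 fix a b
 show "base s (gK a) * base s (gKinv a) = 1" "base s (gKinv a) * base s (gK a) = 1"
  by (rule lend_eqI_base; cases "s = 0"; simp add: ap)+
 show "base s (gK a) * base s (gK b) = base s (gK b) * base s (gK a)"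
  by (rule lend_eqI_base; cases "s = 0"; simp add: ap)
 show "base s (gK a) * base s (gE b) * base s (gKinv a) = L.sq (of_bool (a = b) - of_bool (a = b + 1)) (base s (gE b))"
  "base s (gK a) * base s (gF b) * base s (gKinv a) = L.sq (of_bool (a = b + 1) - of_bool (a = b)) (base s (gF b))"
  by (rule lend_eqI_base; cases "s = 0"; simp add: ap)+
 {
  assume far: "1 < \<bar>a - b\<bar>"
  show "base s (gE a) * base s (gE b) = base s (gE b) * base s (gE a)"
   by (rule lend_eqI_base; cases "s = 0"; use far in \<open>auto simp: ap\<close>)
  show "base s (gF a) * base s (gF b) = base s (gF b) * base s (gF a)"
   by (rule lend_eqI_base; cases "s = 0"; use far in \<open>auto simp: ap\<close>)
 }
 {
  assume near: "\<bar>a - b\<bar> = 1"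
  show "L.serre_rel (base s (gE a)) (base s (gE b))"
   unfolding L.serre_rel_def by (rule lend_eqI_base; cases "s = 0"; use near in \<open>auto simp: ap\<close>)
  show "L.serre_rel (base s (gF a)) (base s (gF b))"
   unfolding L.serre_rel_def by (rule lend_eqI_base; cases "s = 0"; use near in \<open>auto simp: ap\<close>)
 }
 show "base s (gE a) * base s (gF b) - base s (gF b) * base s (gE a) = L.sc (of_bool (a = b) / (qq - inverse qq))
   (base s (gK a) * base s (gKinv (a + 1)) - base s (gK (a + 1)) * base s (gKinv a))"
  by (rule lend_eqI_base; cases "s = 0"; auto simp: ap pm_single_diff c_divide single_uminus)
qed

text \<open>The recursion runs over the reversed sequence because the coproduct splits off the last
  factor.\<close>

fun rhor :: "nat list => gen => lend" where
 "rhor [] = base 0"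
| "rhor [s] = base s"
| "rhor (s # t # r) = tns (length (t # r)) (rhor (t # r)) (base s)"

definition rho :: "nat list => gen => lend" where
 "rho b = rhor (rev b)"

lemma rho_single: "rho [s] = base s"
 by (simp add: rho_def)

lemma rho_snoc: "b \<noteq> [] ==> rho (b @ [s]) = tns (length b) (rho b) (base s)"
 by (cases "rev b") (auto simp: rho_def)

lemma rep_rho: "rep_uq (rho b)"
proof (induction b rule: rev_induct)
 case Nil
 show ?case by (simp add: rho_def rep_base)
next
 case (snoc s b)
 then show ?case using rep_tns[OF snoc rep_base, of "length b" s]
  by (cases "b = []") (simp_all add: rho_snoc rho_single rep_base)
qed

lemma rho_append: "b1 \<noteq> [] ==> b2 \<noteq> [] ==> rho (b1 @ b2) = tns (length b1) (rho b1) (rho b2)"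
proof (induction b2 rule: rev_induct)
 case (snoc s b)
 show ?case
 proof (cases "b = []")
  case True
  then show ?thesis using snoc by (simp add: rho_snoc rho_single)
 next
  case False
  then have "rho (b1 @ b @ [s]) = tns (length b1 + length b) (tns (length b1) (rho b1) (rho b)) (base s)"
   using snoc rho_snoc[of "b1 @ b" s] by simp
  then show ?thesis using False by (simp add: tns_assoc rho_snoc)
 qed
qed simp

section \<open>The recursively defined action and bar map in terms of operators\<close>

definition len :: "nat => vec => bool" where
 "len n x \<longleftrightarrow> (\<forall>f\<in>keys x. length f = n)"

lemma len_simps: "len n 0" "len n x ==> len n y ==> len n (x + y)" "len n x ==> len n (cst c * x)"
 "length f = n ==> len n (single f c)" "len n x ==> len n (ap T x)"
 "len n x ==> len m y ==> len (n + m) (x * y)"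
proof -
 show "len n 0" by (simp add: len_def)
 show "len n (x + y)" if "len n x" "len n y" using that Poly_Mapping.keys_add[of x y] by (auto simp: len_def)
 show "len n (cst c * x)" if "len n x" using that by (auto simp: len_def in_keys_iff)
 show "len n (single f c)" if "length f = n" using that by (auto simp: len_def)
 show "len n (ap T x)" if "len n x"
  unfolding len_def ap_def
 proof
  fix g assume "g \<in> keys (lin_ext (Rep_lend T) x)"
  then obtain f where "f \<in> keys x" "g \<in> keys (Rep_lend T f)" using keys_lin_ext[of "Rep_lend T" x] by blast
  then show "length g = n" using that lend_length[of g T f] by (auto simp: len_def)
 qed
 show "len (n + m) (x * y)" if "len n x" "len m y"
  unfolding len_def
 proof
  fix g assume "g \<in> keys (x * y)"
  then have "g \<in> {a + b |a b. a \<in> keys x \<and> b \<in> keys y}" by (rule subsetD[OF keys_mult])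
  then show "length g = n + m" using that by (auto simp: len_def plus_list_def)
 qed
qed

lemma len_sum: "(\<And>i. i \<in> A ==> len n (h i)) ==> len n (sum h A)"
 by (induction A rule: infinite_finite_induct) (auto intro: len_simps)

text \<open>\<open>act_gen\<close> is meaningful on lists of the length of its sequence only, so
  agreement with an operator is asked for there.\<close>

definition agree :: "nat => (gen => int list => vec) => (gen => lend) => bool" where
 "agree n A A' \<longleftrightarrow> (\<forall>x f. length f = n --> A x f = Rep_lend (A' x) f)"

lemma act_word_eq:
 assumes "agree n A A'" "len n x"
 shows "act_word A w x = ap (G.chi A' w) x"
proof (induction w)
 case Nil
 show ?case by (simp add: act_word_def G.chi_def ap_ring)
next
 case (Cons g w)
 have "len n (ap (G.chi A' w) x)" using assms(2) by (rule len_simps)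
 then have "lin_ext (A g) (ap (G.chi A' w) x) = ap (A' g) (ap (G.chi A' w) x)"
  unfolding ap_def[of "A' g"] using assms(1) by (intro lin_ext_cong) (auto simp: agree_def len_def)
 then show ?case using Cons by (simp add: act_word_def G.chi_def ap_ring)
qed

lemma act_tens_eq:
 assumes "agree n A A'" "agree m B B'" "len n x" "len m y"
 shows "act_tens A B t x y = ap (TT.T.ev n A' B' t) (x * y)"
proof -
 have "ap (TT.chi2 n A' B' (w, v)) (x * y) = act_word A w x * act_word B v y" for w v
  unfolding TT_chi2 act_word_eq[OF assms(1,3)] act_word_eq[OF assms(2,4)]
  using assms(3) by (intro ap_tnp) (auto simp: len_def)
 then show ?thesis
  unfolding act_tens_def TT.T.ev_def ap_sum_left ap_sc lin_ext_def
  by (intro sum.cong refl) (auto split: prod.splits)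
qed

lemma agree_factor: "agree (Suc 0) (act_factor s) (base s)"
 by (simp add: agree_def Rep_base bs_def)

lemma agree_gen: "b \<noteq> [] ==> agree (length b) (act_gen b) (rho b)"
proof (induction b rule: rev_induct)
 case (snoc s b)
 show ?case
 proof (cases "b = []")
  case True
  then show ?thesis using agree_factor[of s]
   by (simp add: rho_single agree_def act_gen.simps[of "[s]"])
 next
  case False
  show ?thesis
   unfolding agree_def
  proof (intro allI impI)
   fix x and f :: "int list" assume f: "length f = length (b @ [s])"
   then have "f \<noteq> []" by auto
   with f have f': "f = butlast f @ [last f]" "length (butlast f) = length b" by simp_all
   have "act_gen (b @ [s]) x f = act_tens (act_gen b) (act_factor s) (comult_gen x)
     (single (butlast f) 1) (single [last f] 1)"
    using False by (simp add: act_gen.simps[of "b @ [s]"])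
   also have "\<dots> = ap (tns (length b) (rho b) (base s) x) (single (butlast f) 1 * single [last f] 1)"
    unfolding tns_def using f'
    by (intro act_tens_eq[OF snoc.IH[OF False] agree_factor] len_simps) auto
   also have "\<dots> = Rep_lend (rho (b @ [s]) x) f"
    using f' False by (simp add: rho_snoc ap_single_1 flip: single_append)
   finally show "act_gen (b @ [s]) x f = Rep_lend (rho (b @ [s]) x) f" .
  qed
 qed
qed simp

definition Thop :: "nat => nat => (gen => lend) => (gen => lend) => vec => vec" where
 "Thop k n A B z = Sum_any (\<lambda>\<mu>. ap (TT.T.ev n A B (quasi_R k \<mu>)) z)"

lemma len_Thop: "len m z ==> len m (Thop k n A B z)"
 unfolding Thop_def Sum_any.expand_set by (intro len_sum len_simps)

text \<open>The two statements are proved together: \<open>act_tens_eq\<close> needs the length of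
  the shorter value, and the length of the longer one is read off from the operator formula.\<close>

lemma len_psi: "length f = length b ==> len (length b) (psi k b f)"
 and psi_snoc: "b \<noteq> [] ==> length f = Suc (length b) ==>
  psi k (b @ [s]) f = Thop k (length b) (rho b) (base s) (psi k b (butlast f) * single [last f] 1)"
proof (induction b arbitrary: f s rule: rev_induct)
 case Nil
 { case 1 then show ?case by (simp add: psi.simps len_simps) }
 { case 2 then show ?case by simp }
next
 case (snoc t b)
 { case 1
  show ?case
  proof (cases "b = []")
   case True
   then show ?thesis using 1 by (simp add: psi.simps len_simps)
  next
   case False
   have "len (length b + 1) (psi k b (butlast f) * single [last f] 1)"
    using 1 by (intro len_simps snoc.IH) auto
   then show ?thesis using snoc.IH(2)[of f t] False 1 by (simp add: len_Thop)
  qed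
 note len = this }
 { case 2
  have "len (length (b @ [t])) (psi k (b @ [t]) (butlast f))"
  proof (cases "b = []")
   case True
   then show ?thesis using 2 by (simp add: psi.simps len_simps)
  next
   case False
   have "len (length b + 1) (psi k b (butlast (butlast f)) * single [last (butlast f)] 1)"
    using 2 by (intro len_simps snoc.IH) auto
   then show ?thesis using snoc.IH(2)[of "butlast f" t] False 2 by (simp add: len_Thop)
  qed
  then have "act_tens (act_gen (b @ [t])) (act_factor s) (quasi_R k \<mu>) (psi k (b @ [t]) (butlast f)) (single [last f] 1)
   = ap (TT.T.ev (length (b @ [t])) (rho (b @ [t])) (base s) (quasi_R k \<mu>)) (psi k (b @ [t]) (butlast f) * single [last f] 1)" for \<mu>
   by (intro act_tens_eq[OF agree_gen agree_factor] len_simps) auto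
  then have "psi k ((b @ [t]) @ [s]) f = Sum_any (\<lambda>\<mu>. ap (TT.T.ev (length (b @ [t])) (rho (b @ [t])) (base s)
    (quasi_R k \<mu>)) (psi k (b @ [t]) (butlast f) * single [last f] 1))"
   by (subst psi.simps) (simp add: butlast_append)
  then show ?case by (simp only: Thop_def)
 }
qed

section \<open>Raising and lowering in the Bruhat order\<close>

lemma sharp_append:
 assumes "length f1 = length b1" "length f2 = length b2"
 shows "sharp (b1 @ b2) (f1 @ f2) r j = sharp b1 f1 r j + sharp b2 f2 r (j - length b1)"
proof -
 let ?n = "length b1"
 have "{i. j \<le> i \<and> i < length (b1 @ b2) \<and> (f1 @ f2) ! i \<le> r}
   = {i. j \<le> i \<and> i < ?n \<and> f1 ! i \<le> r} \<union> (\<lambda>i. i + ?n) ` {i. j - ?n \<le> i \<and> i < length b2 \<and> f2 ! i \<le> r}"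
  (is "?A = ?B \<union> ?h ` ?C")
 proof (intro set_eqI iffI)
  fix i assume i: "i \<in> ?A"
  show "i \<in> ?B \<union> ?h ` ?C"
  proof (cases "i < ?n")
   case True then show ?thesis using i assms by (auto simp: nth_append)
  next
   case False
   then have "i - ?n \<in> ?C" "i = ?h (i - ?n)" using i assms by (auto simp: nth_append)
   then show ?thesis by blast
  qed
 qed (use assms in \<open>auto simp: nth_append\<close>)
 moreover have "finite ?B" "finite ?C" by simp_all
 moreover have "?B \<inter> ?h ` ?C = {}" by auto
 ultimately have "sharp (b1 @ b2) (f1 @ f2) r j = (\<Sum>i\<in>?B. (-1) ^ ((b1 @ b2) ! i)) + (\<Sum>i\<in>?h ` ?C. (-1) ^ ((b1 @ b2) ! i))"
  unfolding sharp_def by (simp add: sum.union_disjoint)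
 also have "(\<Sum>i\<in>?B. (-1) ^ ((b1 @ b2) ! i)) = sharp b1 f1 r j"
  unfolding sharp_def by (intro sum.cong) (auto simp: nth_append)
 also have "(\<Sum>i\<in>?h ` ?C. (-1) ^ ((b1 @ b2) ! i)) = sharp b2 f2 r (j - ?n)"
  unfolding sharp_def by (subst sum.reindex) (auto simp: inj_on_def nth_append intro!: sum.cong)
 finally show ?thesis .
qed

lemma sharp_single: "sharp [s] [c] r j = (if j = 0 \<and> c \<le> r then (-1) ^ s else 0)"
proof -
 have "{i. j \<le> i \<and> i < length [s] \<and> [c] ! i \<le> r} = (if j = 0 \<and> c \<le> r then {0} else {})" by auto
 then show ?thesis by (simp add: sharp_def)
qed

lemma sharp_bound: "\<bar>sharp b f r j\<bar> \<le> int (length b)"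
proof -
 have "\<bar>sharp b f r j\<bar> \<le> (\<Sum>i | j \<le> i \<and> i < length b \<and> f ! i \<le> r. 1)"
  unfolding sharp_def by (rule order_trans[OF sum_abs]) (simp add: power_abs)
 moreover have "card {i. j \<le> i \<and> i < length b \<and> f ! i \<le> r} \<le> card {..<length b}" by (intro card_mono) auto
 ultimately show ?thesis by simp
qed

text \<open>Records what is left of passing from f to g by moves with \<open>c r\<close> letters
  \<open>E_r\<close>: on a factor of either type, such a move adds 1 to \<open>sharp\<close> at
  level r for all j up to the position moved, and in particular for j = 0.\<close>

definition shift :: "nat list => (int => int) => int list => int list => bool" where
 "shift b c f g \<longleftrightarrow> length f = length b \<and> length g = length b \<and>
  (\<forall>r j. sharp b f r j \<le> sharp b g r j \<and> sharp b g r j \<le> sharp b f r j + c r) \<and>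
  (\<forall>r. sharp b g r 0 = sharp b f r 0 + c r)"

lemma shift_refl: "length f = length b ==> shift b 0 f f"
 by (simp add: shift_def)

lemma shift_trans: "shift b c f g ==> shift b d g h ==> shift b (c + d) f h"
 unfolding shift_def by (simp add: algebra_simps) (smt (verit))

lemma shift_append: "shift b1 c f1 h1 ==> shift b2 d f2 h2 ==> shift (b1 @ b2) (c + d) (f1 @ f2) (h1 @ h2)"
 unfolding shift_def by (simp add: sharp_append) (smt (verit))

text \<open>For j in the right part only the loss there is visible. For j in the left part the right
  part has lost exactly \<open>c r\<close>, and the left part has gained at most that much.\<close>

lemma shift_bruhat: "shift b1 c f1 h1 ==> shift b2 c h2 f2 ==> bruhat_le (b1 @ b2) (h1 @ h2) (f1 @ f2)"
proof -
 assume s: "shift b1 c f1 h1" "shift b2 c h2 f2"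
 have "sharp (b1 @ b2) (h1 @ h2) r j \<le> sharp (b1 @ b2) (f1 @ f2) r j" for r j
 proof (cases "j < length b1")
  case True
  then have "sharp b1 h1 r j \<le> sharp b1 f1 r j + c r" "sharp b2 f2 r 0 = sharp b2 h2 r 0 + c r"
   using s by (auto simp: shift_def)
  then show ?thesis using s True by (simp add: sharp_append shift_def)
 next
  case False
  then have "sharp b1 g r j = 0" for g unfolding sharp_def by (intro sum.neutral) auto
  then show ?thesis using s by (auto simp: sharp_append shift_def)
 qed
 then show ?thesis using s by (auto simp: bruhat_le_def sharp_append shift_def)
qed

text \<open>The flag u is \<open>True\<close> for raising by E's and \<open>False\<close> for
  lowering by F's.\<close>

definition mv :: "nat list => bool => (int => int) => int list => int list => bool" where
 "mv b u c f g = (if u then shift b c f g else shift b c g f)"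

lemma mv_len: "mv b u c f g ==> length f = length b \<and> length g = length b"
 by (auto simp: mv_def shift_def split: if_splits)

lemma mv_simps: "length f = length b ==> mv b u 0 f f"
 "mv b u c f g ==> mv b u d g h ==> mv b u (c + d) f h"
 "mv b1 u c f1 h1 ==> mv b2 u d f2 h2 ==> mv (b1 @ b2) u (c + d) (f1 @ f2) (h1 @ h2)"
 by (auto simp: mv_def shift_refl shift_append dest: shift_trans[of b c _ _ d] shift_trans[of b d _ _ c] simp: add.commute split: if_splits)

definition rais :: "nat list => bool => (int => int) => lend => bool" where
 "rais b u c T \<longleftrightarrow> (\<forall>f g. length f = length b --> g \<in> keys (Rep_lend T f) --> mv b u c f g)"

lemma rais_1: "rais b u 0 1"
 by (auto simp: rais_def lend_rep intro: mv_simps(1))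

lemma rais_add: "rais b u c S ==> rais b u c T ==> rais b u c (S + T)"
 unfolding rais_def lend_rep
proof (intro allI impI)
 fix f g
 assume *: "\<forall>f g. length f = length b --> g \<in> keys (Rep_lend S f) --> mv b u c f g"
  "\<forall>f g. length f = length b --> g \<in> keys (Rep_lend T f) --> mv b u c f g"
  "length f = length b" "g \<in> keys (Rep_lend S f + Rep_lend T f)"
 from subsetD[OF Poly_Mapping.keys_add *(4)] show "mv b u c f g" using *(1-3) by auto
qed

lemma rais_mult: "rais b u c S ==> rais b u d T ==> rais b u (c + d) (S * T)"
proof -
 assume ST: "rais b u c S" "rais b u d T"
 have "mv b u (c + d) f g" if fg: "length f = length b" "g \<in> keys (Rep_lend (S * T) f)" for f g
 proof -
  obtain h where h: "h \<in> keys (Rep_lend T f)" "g \<in> keys (Rep_lend S h)"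
   using fg(2) subsetD[OF keys_lin_ext[of "Rep_lend S" "Rep_lend T f"], of g] by (auto simp: lend_rep)
  have 1: "mv b u d f h" using ST(2) fg(1) h(1) by (auto simp: rais_def)
  then have 2: "mv b u c h g" using ST(1) h(2) mv_len[OF 1] by (auto simp: rais_def)
  show ?thesis using mv_simps(2)[OF 1 2] by (simp add: add.commute)
 qed
 then show ?thesis by (simp add: rais_def)
qed

lemma keys_mult_append: "h \<in> keys (x * y) ==> \<exists>f g. f \<in> keys x \<and> g \<in> keys y \<and> h = f @ g" for x y :: vec
proof -
 assume "h \<in> keys (x * y)"
 then have "h \<in> {a + b |a b. a \<in> keys x \<and> b \<in> keys y}" by (rule subsetD[OF keys_mult])
 then show ?thesis by (auto simp: plus_list_def)
qed

lemma rais_tnp: "rais b1 u c S ==> rais b2 u d T ==> rais (b1 @ b2) u (c + d) (tnp (length b1) S T)"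
proof -
 assume ST: "rais b1 u c S" "rais b2 u d T"
 have "mv (b1 @ b2) u (c + d) f g" if fg: "length f = length (b1 @ b2)" "g \<in> keys (Rep_lend (tnp (length b1) S T) f)" for f g
 proof -
  obtain h1 h2 where g: "h1 \<in> keys (Rep_lend S (take (length b1) f))" "h2 \<in> keys (Rep_lend T (drop (length b1) f))" "g = h1 @ h2"
   using keys_mult_append fg(2) unfolding Rep_tnp tnsl_def by blast
  then have "mv b1 u c (take (length b1) f) h1" "mv b2 u d (drop (length b1) f) h2"
   using ST fg(1) by (auto simp: rais_def)
  from mv_simps(3)[OF this] show ?thesis by (simp add: g(3))
 qed
 then show ?thesis by (simp add: rais_def)
qed

definition delta :: "int => int => int" where
 "delta a r = of_bool (r = a)"

definition diag :: "lend => bool" where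
 "diag T \<longleftrightarrow> (\<forall>f. keys (Rep_lend T f) \<subseteq> {f})"

lemma diag_rais: "diag T ==> rais b u 0 T"
 unfolding diag_def rais_def by (auto dest!: subsetD intro: mv_simps(1))

lemma diag_mult: "diag S ==> diag T ==> diag (S * T)"
 unfolding diag_def lend_rep
proof (intro allI subsetI)
 fix f g
 assume *: "\<forall>f. keys (Rep_lend S f) \<subseteq> {f}" "\<forall>f. keys (Rep_lend T f) \<subseteq> {f}"
  "g \<in> keys (lin_ext (Rep_lend S) (Rep_lend T f))"
 from subsetD[OF keys_lin_ext *(3)] show "g \<in> {f}" using *(1,2) by auto
qed

lemma diag_tnp: "diag S ==> diag T ==> diag (tnp n S T)"
 unfolding diag_def
proof (intro allI subsetI)
 fix f g assume d: "\<forall>f. keys (Rep_lend S f) \<subseteq> {f}" "\<forall>f. keys (Rep_lend T f) \<subseteq> {f}"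
  and "g \<in> keys (Rep_lend (tnp n S T) f)"
 then obtain h1 h2 where "h1 \<in> keys (Rep_lend S (take n f))" "h2 \<in> keys (Rep_lend T (drop n f))" "g = h1 @ h2"
  using keys_mult_append unfolding Rep_tnp tnsl_def by blast
 then show "g \<in> {f}" using d by (metis append_take_drop_id singletonD subsetD singletonI)
qed

lemma diag_base: "diag (base s (gK a))" "diag (base s (gKinv a))"
 unfolding diag_def Rep_base
 by (auto simp: bs_def act_factor_def length_Suc_conv split: if_splits)

lemma diag_rho: "diag (rho b (gK a))" "diag (rho b (gKinv a))"
proof (induction b rule: rev_induct)
 case Nil
 { case 1 show ?case by (simp add: rho_def diag_base) }
 { case 2 show ?case by (simp add: rho_def diag_base) }
next
 case (snoc s b)
 { case 1 show ?case using snoc diag_base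
   by (cases "b = []") (simp_all add: rho_snoc rho_single tns_simps diag_tnp) }
 { case 2 show ?case using snoc diag_base
   by (cases "b = []") (simp_all add: rho_snoc rho_single tns_simps diag_tnp) }
qed

lemma rais_base:
 assumes "s \<in> {0, 1}"
 shows "rais [s] True (delta a) (base s (gE a))" "rais [s] False (delta a) (base s (gF a))"
 using assms unfolding rais_def Rep_base
 by (auto simp: bs_def act_factor_def mv_def shift_def sharp_single delta_def length_Suc_conv split: if_splits)

lemma rais_rho:
 assumes "b \<noteq> []" "set b \<subseteq> {0, 1}"
 shows "rais b True (delta a) (rho b (gE a))" "rais b False (delta a) (rho b (gF a))"
proof -
 have "rais b True (delta a) (rho b (gE a)) \<and> rais b False (delta a) (rho b (gF a))"
  using assms
 proof (induction b rule: rev_induct)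
  case (snoc s b)
  have s: "s \<in> {0, 1}" using snoc.prems by simp
  show ?case
  proof (cases "b = []")
   case True
   then show ?thesis using rais_base[OF s] by (simp add: rho_single)
  next
   case False
   then have IH: "rais b True (delta a) (rho b (gE a))" "rais b False (delta a) (rho b (gF a))"
    using snoc by auto
   have z: "delta a = 0 + delta a" "delta a = delta a + 0" by (simp_all add: fun_eq_iff)
   have "rais (b @ [s]) True (delta a) (rt (length b) (base s (gE a)))"
    "rais (b @ [s]) False (delta a) (tnp (length b) (rho b (gK a) * rho b (gKinv (a + 1))) (base s (gF a)))"
    using rais_tnp[OF rais_1 rais_base(1)[OF s], of b a]
     rais_tnp[OF diag_rais[OF diag_mult[OF diag_rho(1)[of b a] diag_rho(2)[of b "a + 1"]]] rais_base(2)[OF s], of b a]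
    unfolding z(1)[symmetric] by auto
   moreover have "rais (b @ [s]) True (delta a) (tnp (length b) (rho b (gE a)) (base s (gK (a + 1)) * base s (gKinv a)))"
    "rais (b @ [s]) False (delta a) (lt (length b) (rho b (gF a)))"
    using rais_tnp[OF IH(1) diag_rais[OF diag_mult[OF diag_base(1)[of s "a + 1"] diag_base(2)[of s a]]], of "[s]"]
     rais_tnp[OF IH(2) rais_1, of "[s]"]
    unfolding z(2)[symmetric] by auto
   ultimately show ?thesis unfolding rho_snoc[OF False] tns_simps by (auto intro: rais_add)
  qed
 qed simp
 then show "rais b True (delta a) (rho b (gE a))" "rais b False (delta a) (rho b (gF a))" by auto
qed

text \<open>The coefficient of the simple root r in a weight, obtained as a partial sum of its
  coordinates.\<close>

definition ps :: "nat => (int => int) => int => int" where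
 "ps k \<mu> r = (\<Sum>c\<in>{- int k..r}. if c \<le> int k then \<mu> c else 0)"

lemma ps_simps: "ps k 0 = 0" "ps k (\<mu> + \<nu>) = ps k \<mu> + ps k \<nu>" "ps k (- \<mu>) = - ps k \<mu>"
proof -
 show "ps k 0 = 0" unfolding ps_def by (intro ext) (simp, intro sum.neutral, simp)
 show "ps k (\<mu> + \<nu>) = ps k \<mu> + ps k \<nu>" "ps k (- \<mu>) = - ps k \<mu>"
  by (auto simp: ps_def fun_eq_iff sum.distrib[symmetric] sum_negf[symmetric] intro!: sum.cong)
qed

lemma ps_gen: "- int k \<le> a ==> a \<le> int k - 1 ==> ps k (wt_gen (gE a)) = delta a"
 "- int k \<le> a ==> a \<le> int k - 1 ==> ps k (- wt_gen (gF a)) = delta a"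
proof -
 assume a: "- int k \<le> a" "a \<le> int k - 1"
 have "ps k (wt_gen (gE a)) r = (\<Sum>c\<in>{- int k..r}. (if c = a then 1 else 0) + (if c = a + 1 then - 1 else 0))" for r
  unfolding ps_def using a by (intro sum.cong) auto
 also have "\<dots> r = delta a r" for r using a by (auto simp: sum.distrib delta_def)
 finally show E: "ps k (wt_gen (gE a)) = delta a" by (simp add: fun_eq_iff)
 have "- wt_gen (gF a) = wt_gen (gE a)" by (simp add: fun_eq_iff)
 then show "ps k (- wt_gen (gF a)) = delta a" using E by (simp only:)
qed

lemma chi_Cons: "G.chi A [] = 1" "G.chi A (x # w) = A x * G.chi A w"
 by (simp_all add: G.chi_def)

lemma rais_word:
 assumes "b \<noteq> []" "set b \<subseteq> {0, 1}"
 shows "set w \<subseteq> pos_letters k ==> rais b True (ps k (wt w)) (G.chi (rho b) w)"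
  "set w \<subseteq> neg_letters k ==> rais b False (ps k (- wt w)) (G.chi (rho b) w)"
proof (induction w)
 case Nil
 { case 1 show ?case unfolding chi_Cons wt_simps(1) minus_zero ps_simps(1) by (rule rais_1) }
 { case 2 show ?case unfolding chi_Cons wt_simps(1) minus_zero ps_simps(1) by (rule rais_1) }
next
 case (Cons x w)
 { case 1
  then obtain a where x: "x = gE a" "- int k \<le> a" "a \<le> int k - 1" by (auto simp: pos_letters_def)
  have IH: "rais b True (ps k (wt w)) (G.chi (rho b) w)" by (rule Cons(1)) (use 1 in simp)
  show ?case
   unfolding chi_Cons x(1) wt_simps(2) ps_simps(2) ps_gen(1)[OF x(2,3)]
   by (rule rais_mult[OF rais_rho(1)[OF assms] IH]) }
 { case 2
  then obtain a where x: "x = gF a" "- int k \<le> a" "a \<le> int k - 1" by (auto simp: neg_letters_def)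
  have e: "- (wt_gen x + wt w) = - wt_gen x + - wt w" by (simp add: fun_eq_iff)
  have IH: "rais b False (ps k (- wt w)) (G.chi (rho b) w)" by (rule Cons(2)) (use 2 in simp)
  show ?case
   unfolding chi_Cons wt_simps(2) e ps_simps(2) unfolding x(1) ps_gen(2)[OF x(2,3)]
   by (rule rais_mult[OF rais_rho(2)[OF assms] IH]) }
qed

section \<open>The action of the quasi-R-matrix\<close>

definition ok :: "nat list => bool" where
 "ok b \<longleftrightarrow> b \<noteq> [] \<and> set b \<subseteq> {0, 1}"

lemma ok_append: "ok b1 ==> ok b2 ==> ok (b1 @ b2)"
 by (auto simp: ok_def)

definition EV :: "nat list => nat list => free2 => lend" where
 "EV b1 b2 t = TT.T.ev (length b1) (rho b1) (rho b2) t"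

definition TH :: "nat => nat list => nat list => vec => vec" where
 "TH k b1 b2 z = Sum_any (\<lambda>\<mu>. ap (EV b1 b2 (quasi_R k \<mu>)) z)"

lemma Thop_TH: "Thop k (length b1) (rho b1) (rho b2) = TH k b1 b2"
 by (simp add: fun_eq_iff Thop_def TH_def EV_def)

lemma EV_simps: "EV b1 b2 (x + y) = EV b1 b2 x + EV b1 b2 y" "EV b1 b2 (x * y) = EV b1 b2 x * EV b1 b2 y"
 "EV b1 b2 (sum h A) = (\<Sum>i\<in>A. EV b1 b2 (h i))" "EV b1 b2 0 = 0" "EV b1 b2 1 = 1"
 "EV b1 b2 (cst c) = csl c"
 unfolding EV_def by (simp_all add: TT.T.ev_add TT.T.ev_mult TT.T.ev_sum TT.T.ev_cst)

lemma EV_single: "ap (EV b1 b2 (single (w, v) c)) z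
  = cst c * ap (tnp (length b1) (G.chi (rho b1) w) (G.chi (rho b2) v)) z"
 unfolding EV_def TT.T.ev_single TT_chi2 ap_sc ..

lemma EV_expand: "ap (EV b1 b2 t) z = (\<Sum>j\<in>keys t. ap (EV b1 b2 (single j (lookup t j))) z)"
 by (subst pm_expand[of t]) (simp only: EV_simps ap_sum_left)

lemma EV_cl: "cl x = cl y ==> EV b1 b2 x = EV b1 b2 y"
proof -
 assume "cl x = cl y"
 then have "EV b1 b2 (x - y) = 0"
  unfolding EV_def cl_eq_iff by (intro TT_ideal rep_rho)
 moreover have "EV b1 b2 x = EV b1 b2 ((x - y) + y)" by simp
 ultimately show ?thesis unfolding EV_simps(1) by simp
qed

lemma EV_comult: "rho (b1 @ b2) x = EV b1 b2 (comult_gen x)" if "b1 \<noteq> []" "b2 \<noteq> []"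
 using rho_append[OF that] by (simp add: tns_def EV_def)

lemma keys_sum_obtain:
 assumes "g \<in> keys (sum h A)"
 obtains i where "i \<in> A" "g \<in> keys (h i)"
proof -
 have "(\<Sum>i\<in>A. lookup (h i) g) \<noteq> 0" using assms by (simp add: in_keys_iff lookup_sum)
 then obtain i where "i \<in> A" "lookup (h i) g \<noteq> 0" by (rule sum.not_neutral_contains_not_neutral)
 then show ?thesis using that by (simp add: in_keys_iff)
qed

lemma keys_EV:
 assumes "g \<in> keys (ap (EV b1 b2 t) z)"
 obtains w v where "(w, v) \<in> keys t"
  "g \<in> keys (ap (tnp (length b1) (G.chi (rho b1) w) (G.chi (rho b2) v)) z)"
proof -
 obtain j where j: "j \<in> keys t" "g \<in> keys (ap (EV b1 b2 (single j (lookup t j))) z)"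
  using assms unfolding EV_expand[of b1 b2 t z] by (rule keys_sum_obtain)
 obtain w v where "j = (w, v)" by (cases j)
 then show ?thesis using j that[of w v] by (auto simp: EV_single in_keys_iff)
qed

lemma wt_range: "set w \<subseteq> pos_letters k ==> c < - int k \<or> int k < c ==> wt w c = 0"
 by (induction w) (auto simp: wt_simps pos_letters_def)

text \<open>The word in E's raises the left part and the word in F's lowers the right part, by the
  same multiplicities, since their weights are opposite.\<close>

lemma keys_Theta:
 assumes "ok b1" "ok b2" "length f1 = length b1" "length f2 = length b2"
  and "g \<in> keys (ap (EV b1 b2 (quasi_R k \<mu>)) (single (f1 @ f2) 1))"
 obtains h1 h2 where "g = h1 @ h2" "shift b1 (ps k \<mu>) f1 h1" "shift b2 (ps k \<mu>) h2 f2"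
  "\<And>c. c < - int k \<or> int k < c ==> \<mu> c = 0"
proof -
 obtain w v where wv: "(w, v) \<in> keys (quasi_R k \<mu>)"
  "g \<in> keys (ap (tnp (length b1) (G.chi (rho b1) w) (G.chi (rho b2) v)) (single (f1 @ f2) 1))"
  by (rule keys_EV[OF assms(5)])
 note q = quasi_R_keys[OF wv(1)]
 obtain h1 h2 where h: "g = h1 @ h2" "h1 \<in> keys (Rep_lend (G.chi (rho b1) w) f1)"
  "h2 \<in> keys (Rep_lend (G.chi (rho b2) v) f2)"
  using keys_mult_append[of g "Rep_lend (G.chi (rho b1) w) f1" "Rep_lend (G.chi (rho b2) v) f2"] wv(2) assms(3,4)
  unfolding ap_tnp_single by (auto simp: ap_single_1)
 have "rais b1 True (ps k (wt w)) (G.chi (rho b1) w)" "rais b2 False (ps k (- wt v)) (G.chi (rho b2) v)"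
  using assms(1,2) q unfolding ok_def by (blast intro: rais_word)+
 moreover have "wt w = \<mu>" "- wt v = \<mu>" using q by (auto simp: fun_eq_iff)
 ultimately have "shift b1 (ps k \<mu>) f1 h1" "shift b2 (ps k \<mu>) h2 f2"
  using h assms(3,4) by (auto simp: rais_def mv_def)
 moreover have "\<mu> c = 0" if "c < - int k \<or> int k < c" for c
  using wt_range[of w k c] q that by auto
 ultimately show ?thesis using that h by blast
qed

lemma ps_diff: "- int k \<le> c ==> c \<le> int k ==> \<mu> c = ps k \<mu> c - ps k \<mu> (c - 1)"
proof -
 assume c: "- int k \<le> c" "c \<le> int k"
 then have "{- int k..c} = insert c {- int k..c - 1}" by auto
 then show ?thesis using c by (simp add: ps_def)
qed

text \<open>A term acting nontrivially changes \<open>sharp\<close> of the right part at j = 0 by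
  \<open>ps k \<mu> r\<close>. This bounds the partial sums, hence the coordinates, of
  \<mu>.\<close>

lemma finite_Theta_single:
 assumes "ok b1" "ok b2" "length f = length (b1 @ b2)"
 shows "finite {\<mu>. ap (EV b1 b2 (quasi_R k \<mu>)) (single f 1) \<noteq> 0}"
proof (rule finite_subset)
 \<comment> \<open>Two values of \<open>sharp\<close> differ by at most twice the length, and a
   coordinate of \<mu> is the difference of two such partial sums.\<close>
 let ?N = "4 * int (length b2)"
 have "(\<forall>c. (c \<in> {- int k..int k} --> \<mu> c \<in> {- ?N..?N}) \<and> (c \<notin> {- int k..int k} --> \<mu> c = 0))"
  if nz: "ap (EV b1 b2 (quasi_R k \<mu>)) (single f 1) \<noteq> 0" for \<mu>
 proof -
  have f: "f = take (length b1) f @ drop (length b1) f" by simp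
  obtain g where "g \<in> keys (ap (EV b1 b2 (quasi_R k \<mu>)) (single f 1))"
   using nz keys_eq_empty[of "ap (EV b1 b2 (quasi_R k \<mu>)) (single f 1)"] by blast
  then have g: "g \<in> keys (ap (EV b1 b2 (quasi_R k \<mu>)) (single (take (length b1) f @ drop (length b1) f) 1))"
   by simp
  have l: "length (take (length b1) f) = length b1" "length (drop (length b1) f) = length b2"
   using assms(3) by simp_all
  obtain h1 h2 where h: "shift b2 (ps k \<mu>) h2 (drop (length b1) f)"
   "\<And>c. c < - int k \<or> int k < c ==> \<mu> c = 0"
   by (rule keys_Theta[OF assms(1,2) l g]) blast
  have "\<bar>ps k \<mu> r\<bar> \<le> 2 * int (length b2)" for r
   using h(1) sharp_bound[of b2 h2 r 0] sharp_bound[of b2 "drop (length b1) f" r 0] unfolding shift_def by (smt (verit))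
  then have "\<bar>ps k \<mu> c - ps k \<mu> (c - 1)\<bar> \<le> ?N" for c by (smt (verit))
  then have "c \<in> {- int k..int k} ==> \<mu> c \<in> {- ?N..?N}" for c
   using ps_diff[of k c \<mu>] by (smt (verit) atLeastAtMost_iff)
  then show ?thesis using h(2) by auto
 qed
 then show "{\<mu>. ap (EV b1 b2 (quasi_R k \<mu>)) (single f 1) \<noteq> 0}
  \<subseteq> {\<mu>. \<forall>c. (c \<in> {- int k..int k} --> \<mu> c \<in> {- ?N..?N}) \<and> (c \<notin> {- int k..int k} --> \<mu> c = 0)}" by blast
 show "finite {\<mu>. \<forall>c. (c \<in> {- int k..int k} --> \<mu> c \<in> {- ?N..?N}) \<and> (c \<notin> {- int k..int k} --> \<mu> c = 0)}"
  by (rule finite_set_of_finite_funs) auto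
qed

lemma vec_expand: "z = (\<Sum>f\<in>keys z. cst (lookup z f) * single f 1)" for z :: vec
 by (subst pm_expand[of z]) (simp add: cst_single)

lemma finite_Theta:
 assumes "ok b1" "ok b2" "len (length (b1 @ b2)) z"
 shows "finite {\<mu>. ap (EV b1 b2 (quasi_R k \<mu>)) z \<noteq> 0}"
proof (rule finite_subset)
 show "{\<mu>. ap (EV b1 b2 (quasi_R k \<mu>)) z \<noteq> 0}
   \<subseteq> (\<Union>f\<in>keys z. {\<mu>. ap (EV b1 b2 (quasi_R k \<mu>)) (single f 1) \<noteq> 0})"
 proof
  fix \<mu> assume "\<mu> \<in> {\<mu>. ap (EV b1 b2 (quasi_R k \<mu>)) z \<noteq> 0}"
  then have "(\<Sum>f\<in>keys z. cst (lookup z f) * ap (EV b1 b2 (quasi_R k \<mu>)) (single f 1)) \<noteq> 0"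
   by (subst (asm) vec_expand[of z]) (simp only: ap_simps(4,7) mem_Collect_eq not_False_eq_True)
  then obtain f where "f \<in> keys z" "cst (lookup z f) * ap (EV b1 b2 (quasi_R k \<mu>)) (single f 1) \<noteq> 0"
   by (rule sum.not_neutral_contains_not_neutral)
  moreover from this(2) have "ap (EV b1 b2 (quasi_R k \<mu>)) (single f 1) \<noteq> 0" by (metis mult_zero_right)
  ultimately show "\<mu> \<in> (\<Union>f\<in>keys z. {\<mu>. ap (EV b1 b2 (quasi_R k \<mu>)) (single f 1) \<noteq> 0})" by blast
 qed
 show "finite (\<Union>f\<in>keys z. {\<mu>. ap (EV b1 b2 (quasi_R k \<mu>)) (single f 1) \<noteq> 0})"
  using assms by (intro finite_UN_I finite_Theta_single) (auto simp: len_def)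
qed

lemma Sum_any_additive:
 fixes h :: "'i => 'x::comm_monoid_add" and T :: "'x => 'y::comm_monoid_add"
 assumes "\<And>x y. T (x + y) = T x + T y" "T 0 = 0" "finite {i. h i \<noteq> 0}"
 shows "T (Sum_any h) = Sum_any (\<lambda>i. T (h i))"
proof -
 have "T (sum h A) = (\<Sum>i\<in>A. T (h i))" for A
  by (induction A rule: infinite_finite_induct) (simp_all add: assms)
 moreover have "Sum_any (\<lambda>i. T (h i)) = (\<Sum>i\<in>{i. h i \<noteq> 0}. T (h i))"
  by (rule Sum_any.expand_superset[OF assms(3)]) (auto simp: assms(2))
 ultimately show ?thesis by (simp add: Sum_any.expand_set)
qed

lemma Sum_any_sum:
 assumes "finite J" "\<And>j. j \<in> J ==> finite {i. h j i \<noteq> 0}"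
 shows "(\<Sum>j\<in>J. Sum_any (h j)) = Sum_any (\<lambda>i. \<Sum>j\<in>J. h j i)"
 using assms
proof (induction J)
 case (insert j J)
 have "{i. (\<Sum>j\<in>J. h j i) \<noteq> 0} \<subseteq> (\<Union>j\<in>J. {i. h j i \<noteq> 0})"
  by (auto elim: sum.not_neutral_contains_not_neutral)
 then have "finite {i. (\<Sum>j\<in>J. h j i) \<noteq> 0}" by (rule finite_subset) (use insert in auto)
 then show ?case using insert by (simp add: Sum_any.distrib)
qed simp

lemma TH_simps:
 assumes "ok b1" "ok b2"
 shows "TH k b1 b2 0 = 0"
  "len (length (b1 @ b2)) x ==> len (length (b1 @ b2)) y ==> TH k b1 b2 (x + y) = TH k b1 b2 x + TH k b1 b2 y"
  "len (length (b1 @ b2)) x ==> TH k b1 b2 (cst c * x) = cst c * TH k b1 b2 x"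
proof -
 note fin = finite_Theta[OF assms]
 show "TH k b1 b2 0 = 0" by (simp add: TH_def ap_simps)
 show "TH k b1 b2 (x + y) = TH k b1 b2 x + TH k b1 b2 y" if "len (length (b1 @ b2)) x" "len (length (b1 @ b2)) y"
  unfolding TH_def ap_simps by (rule Sum_any.distrib[OF fin[OF that(1)] fin[OF that(2)]])
 show "TH k b1 b2 (cst c * x) = cst c * TH k b1 b2 x" if "len (length (b1 @ b2)) x"
  unfolding TH_def ap_simps by (rule Sum_any_right_distrib[OF fin[OF that], symmetric])
qed

lemma TH_sum:
 assumes "ok b1" "ok b2" "\<And>i. i \<in> A ==> len (length (b1 @ b2)) (h i)"
 shows "TH k b1 b2 (sum h A) = (\<Sum>i\<in>A. TH k b1 b2 (h i))"
 using assms(3) by (induction A rule: infinite_finite_induct) (simp_all add: TH_simps[OF assms(1,2)] len_sum)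

lemma len_TH: "len m z ==> len m (TH k b1 b2 z)"
 unfolding TH_def Sum_any.expand_set by (intro len_sum len_simps)

text \<open>Summing over all bidegrees, displaced by a given pair, brings the sum over \<mu> into
  the form of \<open>lth\<close> and \<open>rth\<close>; nothing is added, as \<open>thc\<close>
  vanishes unless the two weights are opposite.\<close>

lemma TH_pairs:
 assumes "ok b1" "ok b2" "len (length (b1 @ b2)) z"
 shows "TH k b1 b2 z = Sum_any (\<lambda>x. ap (EV b1 b2 (thc (quasi_R k) (fst x - \<alpha>) (snd x - \<beta>))) z)"
  and "finite {x. ap (EV b1 b2 (thc (quasi_R k) (fst x - \<alpha>) (snd x - \<beta>))) z \<noteq> 0}"
proof -
 let ?M = "{\<mu>. ap (EV b1 b2 (quasi_R k \<mu>)) z \<noteq> 0}"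
 let ?p = "\<lambda>\<mu>. (\<mu> + \<alpha>, \<beta> - \<mu>)"
 let ?F = "\<lambda>x. ap (EV b1 b2 (thc (quasi_R k) (fst x - \<alpha>) (snd x - \<beta>))) z"
 have fin: "finite (?p ` ?M)" by (intro finite_imageI finite_Theta assms)
 have "(l, n) \<in> ?p ` ?M" if "?F (l, n) \<noteq> 0" for l n
 proof -
  from that have "n - \<beta> = - (l - \<alpha>)" by (auto simp: thc_def EV_simps ap_ring split: if_splits)
  then have "n = \<beta> - (l - \<alpha>)" by (simp add: fun_eq_iff algebra_simps)
  then show ?thesis using that by (intro image_eqI[of _ _ "l - \<alpha>"]) (auto simp: thc_def EV_simps ap_ring split: if_splits)
 qed
 then have sub: "{x. ?F x \<noteq> 0} \<subseteq> ?p ` ?M" by auto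
 show "finite {x. ?F x \<noteq> 0}" by (rule finite_subset[OF sub fin])
 have "Sum_any ?F = sum ?F (?p ` ?M)" by (rule Sum_any.expand_superset[OF fin sub])
 also have "\<dots> = (\<Sum>\<mu>\<in>?M. ?F (?p \<mu>))"
  by (rule sum.reindex_cong[of ?p]) (auto simp: inj_on_def)
 also have "\<dots> = (\<Sum>\<mu>\<in>?M. ap (EV b1 b2 (quasi_R k \<mu>)) z)"
  by (intro sum.cong refl) (simp add: thc_def)
 also have "\<dots> = TH k b1 b2 z" by (simp add: TH_def Sum_any.expand_set)
 finally show "TH k b1 b2 z = Sum_any ?F" by simp
qed

text \<open>An identity modulo the ideal becomes one of operators because the ideal acts by zero.
  Since only finitely many bidegrees act nontrivially on z, the sums over bidegrees and over terms
  may be exchanged.\<close>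

lemma TH_intertw:
 assumes "ok b1" "ok b2" "len (length (b1 @ b2)) z" "intertw (quasi_R k) p r"
 shows "ap (EV b1 b2 p) (TH k b1 b2 z) = TH k b1 b2 (ap (EV b1 b2 r) z)"
proof -
 let ?t = "\<lambda>j x. thc (quasi_R k) (fst x - wt (fst j)) (snd x - wt (snd j))"
 let ?p = "\<lambda>j. single j (lookup p j)" and ?r = "\<lambda>j. single j (lookup r j)"
 have fin: "finite {x. ap (EV b1 b2 (?t j x)) y \<noteq> 0}" if "len (length (b1 @ b2)) y" for j y
  by (rule TH_pairs(2)[OF assms(1,2) that])
 have "ap (EV b1 b2 p) (TH k b1 b2 z) = (\<Sum>j\<in>keys p. ap (EV b1 b2 (?p j)) (TH k b1 b2 z))"
  by (rule EV_expand)
 also have "\<dots> = (\<Sum>j\<in>keys p. Sum_any (\<lambda>x. ap (EV b1 b2 (?p j * ?t j x)) z))"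
 proof (intro sum.cong refl)
  fix j
  show "ap (EV b1 b2 (?p j)) (TH k b1 b2 z) = Sum_any (\<lambda>x. ap (EV b1 b2 (?p j * ?t j x)) z)"
   using fin[OF assms(3), of j]
   unfolding TH_pairs(1)[OF assms(1-3), of k "wt (fst j)" "wt (snd j)"]
   by (subst Sum_any_additive[of "ap (EV b1 b2 (?p j))"]) (simp_all add: ap_simps ap_ring EV_simps)
 qed
 also have "\<dots> = Sum_any (\<lambda>x. \<Sum>j\<in>keys p. ap (EV b1 b2 (?p j * ?t j x)) z)"
 proof (rule Sum_any_sum)
  fix j
  have "{x. ap (EV b1 b2 (?p j * ?t j x)) z \<noteq> 0} \<subseteq> {x. ap (EV b1 b2 (?t j x)) z \<noteq> 0}"
   by (auto simp: EV_simps ap_ring ap_simps)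
  then show "finite {x. ap (EV b1 b2 (?p j * ?t j x)) z \<noteq> 0}"
   by (rule finite_subset) (rule fin[OF assms(3)])
 qed simp
 also have "\<dots> = Sum_any (\<lambda>x. ap (EV b1 b2 (lth (quasi_R k) p (fst x) (snd x))) z)"
  by (simp only: lth_eq[OF graded_quasi_R] EV_simps(3) ap_sum_left)
 also have "\<dots> = Sum_any (\<lambda>x. ap (EV b1 b2 (rth (quasi_R k) r (fst x) (snd x))) z)"
  using assms(4) by (intro Sum_any.cong arg_cong2[where f = ap] EV_cl refl) (simp add: intertw_def)
 also have "\<dots> = Sum_any (\<lambda>x. \<Sum>j\<in>keys r. ap (EV b1 b2 (?t j x * ?r j)) z)"
  by (simp only: rth_eq[OF graded_quasi_R] EV_simps(3) ap_sum_left)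
 also have "\<dots> = (\<Sum>j\<in>keys r. Sum_any (\<lambda>x. ap (EV b1 b2 (?t j x)) (ap (EV b1 b2 (?r j)) z)))"
  unfolding EV_simps(2) ap_ring(2) by (intro Sum_any_sum[symmetric] fin len_simps assms(3)) simp
 also have "\<dots> = (\<Sum>j\<in>keys r. TH k b1 b2 (ap (EV b1 b2 (?r j)) z))"
  by (intro sum.cong refl TH_pairs(1)[symmetric] assms(1,2) len_simps assms(3))
 also have "\<dots> = TH k b1 b2 (ap (EV b1 b2 r) z)"
  unfolding EV_expand[of b1 b2 r z] by (intro TH_sum[symmetric] assms(1,2) len_simps assms(3))
 finally show ?thesis .
qed

lemma TH_equiv:
 assumes "ok b1" "ok b2" "len (length (b1 @ b2)) z" "x \<in> letters k"
 shows "ap (rho (b1 @ b2) x) (TH k b1 b2 z) = TH k b1 b2 (ap (EV b1 b2 (dbar x)) z)"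
 using TH_intertw[OF assms(1-3) intertw_quasi_R[OF assms(4)]] EV_comult[of b1 b2 x] assms(1,2)
 by (simp add: ok_def)

section \<open>The bar map at finite level\<close>

lemma sl_ext_sl: "semilin \<sigma> ==> sl_ext \<sigma> F (sl_ext \<sigma>' G x) = sl_ext (\<lambda>c. \<sigma> (\<sigma>' c)) (\<lambda>f. sl_ext \<sigma> F (G f)) x"
proof -
 assume "semilin \<sigma>"
 then interpret semilin \<sigma> .
 show ?thesis by (subst sl_ext_def[of \<sigma>'], subst sl_ext_def) (simp add: sl_ext_sum sl_ext_cst)
qed

abbreviation "al \<equiv> sl_ext qbar"

lemma len_sl_ext: "len n x ==> (\<And>f. length f = n ==> len m (F f)) ==> len m (sl_ext \<sigma> F x)"
 unfolding sl_ext_def by (intro len_sum len_simps) (auto simp: len_def)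

lemma len_induct [consumes 1, case_names zero single add]:
 assumes "len n z" "P 0" "\<And>f c. length f = n ==> P (single f c)"
  "\<And>x y. len n x ==> len n y ==> P x ==> P y ==> P (x + y)"
 shows "P z"
proof -
 have "P (\<Sum>f\<in>A. single f (lookup z f))" if "finite A" "A \<subseteq> keys z" for A
  using that
 proof (induction A)
  case (insert f A)
  then show ?case using assms(1)
   by (auto simp: len_def subset_iff intro!: assms(3,4) len_sum len_simps)
 qed (simp add: assms)
 from this[of "keys z"] show ?thesis using pm_expand[of z] by simp
qed

definition ten :: "nat => (int list => vec) => (int list => vec) => int list => vec" where
 "ten n \<phi>1 \<phi>2 f = \<phi>1 (take n f) * \<phi>2 (drop n f)"

lemma al_ten: "len n x ==> al (ten n \<phi>1 \<phi>2) (x * y) = al \<phi>1 x * al \<phi>2 y"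
proof (induction x rule: len_induct)
 case f: (single f c)
 show ?case
 proof (induction y rule: pm_induct)
  case (single g d)
  then show ?case using f
   by (simp add: mult_single plus_list_def ten_def qbar_mult cst_mult_cst)
 qed (simp_all add: distrib_left qbar.sl_ext_add)
qed (simp_all add: distrib_right qbar.sl_ext_add)

definition lenp :: "nat => (int list => vec) => bool" where
 "lenp n \<phi> \<longleftrightarrow> (\<forall>f. length f = n --> len n (\<phi> f))"

definition equi :: "nat => nat list => (int list => vec) => bool" where
 "equi k b \<phi> \<longleftrightarrow> lenp (length b) \<phi> \<and> (\<forall>x\<in>letters k. \<forall>z. len (length b) z -->
   al \<phi> (ap (rho b x) z) = ap (rho b (bar_gen x)) (al \<phi> z))"

lemma lenp_ten: "lenp n \<phi>1 ==> lenp m \<phi>2 ==> lenp (n + m) (ten n \<phi>1 \<phi>2)"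
 unfolding lenp_def ten_def by (auto intro!: len_simps)

lemma equi_word:
 assumes "equi k b \<phi>" "set w \<subseteq> letters k" "len (length b) z"
 shows "al \<phi> (ap (G.chi (rho b) w) z) = ap (G.chi (rho b) (map bar_gen w)) (al \<phi> z)"
 using assms(2)
proof (induction w)
 case (Cons x w)
 have "len (length b) (ap (G.chi (rho b) w) z)" using assms(3) by (rule len_simps)
 then show ?case using Cons assms(1) by (simp add: chi_Cons ap_ring equi_def)
qed (simp add: chi_Cons ap_ring)

lemma ap_tnp_len: "len n x ==> ap (tnp n S T) (x * y) = ap S x * ap T y"
 by (rule ap_tnp) (auto simp: len_def)

lemma single_split: "single f c = single (take n f) c * single (drop n f) 1" for c :: qfield
 by (simp add: mult_single plus_list_def)

lemma equi_EV_single: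
 assumes "equi k b1 \<phi>1" "equi k b2 \<phi>2" "set w \<subseteq> letters k" "set v \<subseteq> letters k" "len (length (b1 @ b2)) z"
 shows "al (ten (length b1) \<phi>1 \<phi>2) (ap (EV b1 b2 (single (w, v) c)) z)
   = ap (EV b1 b2 (bar_free2 (single (w, v) c))) (al (ten (length b1) \<phi>1 \<phi>2) z)"
 using assms(5)
proof (induction z rule: len_induct)
 case (single f d)
 define x y where "x = single (take (length b1) f) d" and "y = single (drop (length b1) f) (1::qfield)"
 have xy: "single f d = x * y" "len (length b1) x" "len (length b2) y"
  unfolding x_def y_def single_split[of f d "length b1"] using single by (auto intro: len_simps)
 have l: "len (length b1) (al \<phi>1 x)" using assms(1) xy(2) by (auto simp: equi_def lenp_def intro: len_sl_ext)
 show ?case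
  unfolding xy(1) EV_single bar_free2_simps qbar.sl_ext_cst ap_tnp_len[OF xy(2)] al_ten[OF xy(2)]
   al_ten[OF len_simps(5)[OF xy(2)]] equi_word[OF assms(1,3) xy(2)] equi_word[OF assms(2,4) xy(3)]
   ap_tnp_len[OF l] by (rule refl)
qed (simp_all add: ap_simps qbar.sl_ext_add)

lemma equi_EV:
 assumes "equi k b1 \<phi>1" "equi k b2 \<phi>2" "\<And>w v. (w, v) \<in> keys p ==> set w \<subseteq> letters k \<and> set v \<subseteq> letters k"
  "len (length (b1 @ b2)) z"
 shows "al (ten (length b1) \<phi>1 \<phi>2) (ap (EV b1 b2 p) z) = ap (EV b1 b2 (bar_free2 p)) (al (ten (length b1) \<phi>1 \<phi>2) z)"
proof -
 have bs: "bar_free2 (sum h A) = (\<Sum>i\<in>A. bar_free2 (h i))" for h :: "_ => free2" and A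
  by (induction A rule: infinite_finite_induct) (simp_all add: bar_free2_simps)
 have "al (ten (length b1) \<phi>1 \<phi>2) (ap (EV b1 b2 p) z)
  = (\<Sum>j\<in>keys p. ap (EV b1 b2 (bar_free2 (single j (lookup p j)))) (al (ten (length b1) \<phi>1 \<phi>2) z))"
  unfolding EV_expand[of b1 b2 p] qbar.sl_ext_sum
 proof (intro sum.cong refl)
  fix j assume "j \<in> keys p"
  then show "al (ten (length b1) \<phi>1 \<phi>2) (ap (EV b1 b2 (single j (lookup p j))) z)
    = ap (EV b1 b2 (bar_free2 (single j (lookup p j)))) (al (ten (length b1) \<phi>1 \<phi>2) z)"
   using assms(3)[of "fst j" "snd j"] equi_EV_single[OF assms(1,2) _ _ assms(4), of "fst j" "snd j" "lookup p j"]
   by simp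
 qed
 also have "\<dots> = ap (EV b1 b2 (bar_free2 p)) (al (ten (length b1) \<phi>1 \<phi>2) z)"
  by (subst (3) pm_expand[of p]) (simp only: bs EV_simps(3) ap_sum_left)
 finally show ?thesis .
qed

text \<open>The candidate for the bar map of a concatenation: \<Theta> after the tensor product of
  two bar maps.\<close>

definition thten :: "nat => nat list => nat list => (int list => vec) => (int list => vec) => int list => vec" where
 "thten k b1 b2 \<phi>1 \<phi>2 f = TH k b1 b2 (ten (length b1) \<phi>1 \<phi>2 f)"

lemma al_thten:
 assumes "ok b1" "ok b2" "lenp (length b1) \<phi>1" "lenp (length b2) \<phi>2" "len (length (b1 @ b2)) z"
 shows "al (thten k b1 b2 \<phi>1 \<phi>2) z = TH k b1 b2 (al (ten (length b1) \<phi>1 \<phi>2) z)"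
 using assms(5)
proof (induction z rule: len_induct)
 case (single f c)
 then have "len (length (b1 @ b2)) (ten (length b1) \<phi>1 \<phi>2 f)"
  using lenp_ten[OF assms(3,4)] by (simp add: lenp_def)
 then show ?case by (simp add: thten_def TH_simps[OF assms(1,2)])
next
 case (add x y)
 have "len (length (b1 @ b2)) (al (ten (length b1) \<phi>1 \<phi>2) x)" if "len (length (b1 @ b2)) x" for x
  using that lenp_ten[OF assms(3,4)] by (intro len_sl_ext) (auto simp: lenp_def)
 then show ?case using add by (simp add: qbar.sl_ext_add TH_simps[OF assms(1,2)])
qed (simp add: TH_simps[OF assms(1,2)])

lemma bar_gen_letters: "x \<in> letters k ==> bar_gen x \<in> letters k" "bar_gen (bar_gen x) = x"
 by (cases x; auto simp: letters_def pos_letters_def neg_letters_def)+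

lemma letters_iff:
 "gE a \<in> letters k \<longleftrightarrow> - int k \<le> a \<and> a \<le> int k - 1" "gF a \<in> letters k \<longleftrightarrow> - int k \<le> a \<and> a \<le> int k - 1"
 "gK a \<in> letters k \<longleftrightarrow> - int k \<le> a \<and> a \<le> int k" "gKinv a \<in> letters k \<longleftrightarrow> - int k \<le> a \<and> a \<le> int k"
 by (auto simp: letters_def pos_letters_def neg_letters_def)

lemma comult_letters: "x \<in> letters k ==> (w, v) \<in> keys (comult_gen x) ==> set w \<subseteq> letters k \<and> set v \<subseteq> letters k"
proof -
 assume x: "x \<in> letters k" and wv: "(w, v) \<in> keys (comult_gen x)"
 have *: "(w, v) \<in> keys a \<or> (w, v) \<in> keys c" if "(w, v) \<in> keys (a + c)" for a c :: free2
  using subsetD[OF Poly_Mapping.keys_add that] by simp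
 show ?thesis
  using x wv
  by (cases x; simp only: comult_gen_single) (auto simp: letters_iff dest!: *)
qed

text \<open>The tensor product of the anti-linear maps turns the coproduct of x into its bar
  conjugate, and \<Theta> turns this into the coproduct of the bar conjugate of x.\<close>

lemma equi_thten:
 assumes "ok b1" "ok b2" "equi k b1 \<phi>1" "equi k b2 \<phi>2"
 shows "equi k (b1 @ b2) (thten k b1 b2 \<phi>1 \<phi>2)"
proof -
 have l: "lenp (length b1) \<phi>1" "lenp (length b2) \<phi>2" using assms by (auto simp: equi_def)
 let ?D = "ten (length b1) \<phi>1 \<phi>2"
 have lD: "len (length (b1 @ b2)) (al ?D z)" if "len (length (b1 @ b2)) z" for z
  using that lenp_ten[OF l] by (intro len_sl_ext) (auto simp: lenp_def)
 have "al (thten k b1 b2 \<phi>1 \<phi>2) (ap (rho (b1 @ b2) x) z) = ap (rho (b1 @ b2) (bar_gen x)) (al (thten k b1 b2 \<phi>1 \<phi>2) z)"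
  if x: "x \<in> letters k" and z: "len (length (b1 @ b2)) z" for x z
 proof -
  have "al (thten k b1 b2 \<phi>1 \<phi>2) (ap (rho (b1 @ b2) x) z) = TH k b1 b2 (al ?D (ap (EV b1 b2 (comult_gen x)) z))"
   using EV_comult[of b1 b2 x] assms(1,2) al_thten[OF assms(1,2) l len_simps(5)[OF z]] by (simp add: ok_def)
  also have "\<dots> = TH k b1 b2 (ap (EV b1 b2 (bar_free2 (comult_gen x))) (al ?D z))"
   by (subst equi_EV[OF assms(3,4) comult_letters[OF x] z]) simp_all
  also have "\<dots> = ap (rho (b1 @ b2) (bar_gen x)) (TH k b1 b2 (al ?D z))"
   using TH_equiv[OF assms(1,2) lD[OF z] bar_gen_letters(1)[OF x]] by (simp add: dbar_def bar_gen_letters(2))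
  also have "\<dots> = ap (rho (b1 @ b2) (bar_gen x)) (al (thten k b1 b2 \<phi>1 \<phi>2) z)"
   by (simp add: al_thten[OF assms(1,2) l z])
  finally show ?thesis .
 qed
 moreover have "lenp (length (b1 @ b2)) (thten k b1 b2 \<phi>1 \<phi>2)"
  using lenp_ten[OF l] by (auto simp: lenp_def thten_def intro: len_TH)
 ultimately show ?thesis by (simp add: equi_def)
qed

lemma psi_single: "psi k [s] f = single f 1"
 by (simp add: psi.simps)

lemma psi_thten:
 assumes "b \<noteq> []" "length f = Suc (length b)"
 shows "psi k (b @ [s]) f = thten k b [s] (psi k b) (psi k [s]) f"
proof -
 have "take (length b) f = butlast f" using assms by (simp add: butlast_conv_take)
 moreover have "drop (length b) f = [last f]" using assms by (metis append_butlast_last_id append_eq_conv_conj length_0_conv length_butlast diff_Suc_1 nat.distinct(1))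
 ultimately show ?thesis
  using assms by (simp add: psi_snoc thten_def ten_def psi_single Thop_TH[of k b "[s]", unfolded rho_single, symmetric])
qed

lemma equi_cong: "equi k b \<phi> ==> (\<And>f. length f = length b ==> \<phi>' f = \<phi> f) ==> equi k b \<phi>'"
proof -
 assume e: "equi k b \<phi>" and eq: "\<And>f. length f = length b ==> \<phi>' f = \<phi> f"
 have "al \<phi>' z = al \<phi> z" if "len (length b) z" for z
  using that eq by (intro sl_ext_cong) (auto simp: len_def)
 then show ?thesis using e eq by (auto simp: equi_def lenp_def len_simps)
qed

lemma equi_base: "equi k [s] (\<lambda>f. single f 1)"
 unfolding equi_def
proof (intro conjI ballI allI impI)
 fix x and z :: vec assume "x \<in> letters k" "len (length [s]) z"
 from this(2) show "al (\<lambda>f. single f 1) (ap (rho [s] x) z) = ap (rho [s] (bar_gen x)) (al (\<lambda>f. single f 1) z)"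
 proof (induction z rule: len_induct)
  case (single f c)
  then obtain d where "f = [d]" by (auto simp: length_Suc_conv)
  then show ?case unfolding rho_single
   by (cases x; cases "s = 0") (auto simp: ap_V ap_W cst_single qbar_mult)
 qed (simp_all add: ap_simps qbar.sl_ext_add)
qed (auto simp: lenp_def intro: len_simps)

lemma equi_psi: "ok b ==> equi k b (psi k b)"
proof (induction b rule: rev_induct)
 case (snoc s b)
 show ?case
 proof (cases "b = []")
  case True
  then show ?thesis by (auto intro: equi_cong[OF equi_base] simp: psi_single)
 next
  case False
  then have "ok b" "ok [s]" using snoc.prems by (auto simp: ok_def)
  moreover have "equi k [s] (psi k [s])" by (rule equi_cong[OF equi_base]) (rule psi_single)
  ultimately have "equi k (b @ [s]) (thten k b [s] (psi k b) (psi k [s]))"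
   using snoc.IH by (intro equi_thten)
  then show ?thesis by (rule equi_cong) (use False in \<open>simp add: psi_thten\<close>)
 qed
qed (simp add: ok_def)

lemma bruhat_refl: "length f = length b ==> bruhat_le b f f"
 by (simp add: bruhat_le_def)

lemma bruhat_trans: "bruhat_le b f g ==> bruhat_le b g h ==> bruhat_le b f h"
 unfolding bruhat_le_def by (simp, meson order_trans)

lemma sharp_Suc: "j < length b ==> sharp b f r j = (if f ! j \<le> r then (-1) ^ (b ! j) else 0) + sharp b f r (Suc j)"
proof -
 assume j: "j < length b"
 have "{i. j \<le> i \<and> i < length b \<and> f ! i \<le> r} = (if f ! j \<le> r then {j} else {}) \<union> {i. Suc j \<le> i \<and> i < length b \<and> f ! i \<le> r}"
  using j by (auto simp: Suc_le_eq order.order_iff_strict)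
 moreover have "finite {i. Suc j \<le> i \<and> i < length b \<and> f ! i \<le> r}" by simp
 ultimately show ?thesis unfolding sharp_def by simp
qed

lemma sharp_length: "length b \<le> j ==> sharp b f r j = 0"
 unfolding sharp_def by (intro sum.neutral) auto

text \<open>Consecutive differences of \<open>sharp\<close> in j tell for each level whether the
  j-th entry lies below it, so \<open>sharp\<close> determines the sequence.\<close>

lemma bruhat_antisym: "bruhat_le b f g ==> bruhat_le b g f ==> f = g"
proof -
 assume fg: "bruhat_le b f g" "bruhat_le b g f"
 have eq: "sharp b f r j = sharp b g r j" for r j
  using fg sharp_length[of b j] by (cases "j < length b") (auto simp: bruhat_le_def intro: antisym)
 have "f ! j = g ! j" if "j < length b" for j
 proof -
  have "(f ! j \<le> r) = (g ! j \<le> r)" for r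
   using sharp_Suc[OF that, of f r] sharp_Suc[OF that, of g r] eq[of r j] eq[of r "Suc j"] by (auto split: if_splits)
  then show ?thesis by (metis order.antisym order.refl)
 qed
 then show ?thesis using fg by (intro nth_equalityI) (auto simp: bruhat_le_def)
qed

lemma bruhat_append: "bruhat_le b1 g1' f1 ==> bruhat_le b2 g2' f2 ==> bruhat_le (b1 @ b2) (g1' @ g2') (f1 @ f2)"
proof -
 assume a: "bruhat_le b1 g1' f1" "bruhat_le b2 g2' f2"
 have le: "sharp b g r j \<le> sharp b f r j" if "bruhat_le b g f" for b g f r j
  using that sharp_length[of b j] by (cases "j < length b") (auto simp: bruhat_le_def)
 show ?thesis using a le[OF a(1)] le[OF a(2)] unfolding bruhat_le_def
  by (auto simp: sharp_append intro: add_mono)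
qed

definition tri :: "nat list => (int list => vec) => bool" where
 "tri b \<phi> \<longleftrightarrow> (\<forall>f. length f = length b --> lookup (\<phi> f) f = 1 \<and> (\<forall>g\<in>keys (\<phi> f). bruhat_le b g f))"

lemma keys_TH:
 assumes "g \<in> keys (TH k b1 b2 z)"
 obtains \<mu> f where "f \<in> keys z" "g \<in> keys (ap (EV b1 b2 (quasi_R k \<mu>)) (single f 1))"
proof -
 obtain \<mu> where \<mu>: "g \<in> keys (ap (EV b1 b2 (quasi_R k \<mu>)) z)"
  using assms unfolding TH_def Sum_any.expand_set by (rule keys_sum_obtain)
 have "ap (EV b1 b2 (quasi_R k \<mu>)) z = (\<Sum>f\<in>keys z. cst (lookup z f) * ap (EV b1 b2 (quasi_R k \<mu>)) (single f 1))"
  by (subst vec_expand[of z]) (simp only: ap_simps(4,7))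
 then have "g \<in> keys (\<Sum>f\<in>keys z. cst (lookup z f) * ap (EV b1 b2 (quasi_R k \<mu>)) (single f 1))"
  using \<mu> by simp
 then obtain f where "f \<in> keys z" "g \<in> keys (cst (lookup z f) * ap (EV b1 b2 (quasi_R k \<mu>)) (single f 1))"
  by (rule keys_sum_obtain)
 then show ?thesis using that by (auto simp: in_keys_iff)
qed

text \<open>Only \<mu> = 0 contributes to the diagonal coefficient: if f itself occurs in the term
  of \<mu>, nothing has been shifted, so all multiplicities in \<mu> vanish.\<close>

lemma tri_TH:
 assumes "ok b1" "ok b2"
 shows "tri (b1 @ b2) (\<lambda>f. TH k b1 b2 (single f 1))"
 unfolding tri_def
proof (intro allI impI conjI ballI)
 fix f :: "int list" assume f: "length f = length (b1 @ b2)"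
 define f1 f2 where "f1 = take (length b1) f" and "f2 = drop (length b1) f"
 have l: "length f1 = length b1" "length f2 = length b2" "f = f1 @ f2" using f by (auto simp: f1_def f2_def)
 {
  fix g assume "g \<in> keys (TH k b1 b2 (single f 1))"
  then obtain \<mu> where "g \<in> keys (ap (EV b1 b2 (quasi_R k \<mu>)) (single (f1 @ f2) 1))"
   by (rule keys_TH) (auto simp: l(3))
  then obtain h1 h2 where "g = h1 @ h2" "shift b1 (ps k \<mu>) f1 h1" "shift b2 (ps k \<mu>) h2 f2"
   by (rule keys_Theta[OF assms l(1,2)]) blast
  then show "bruhat_le (b1 @ b2) g f" using l(3) by (auto intro: shift_bruhat)
 }
 have zero: "lookup (ap (EV b1 b2 (quasi_R k \<mu>)) (single f 1)) f = 0" if "\<mu> \<noteq> 0" for \<mu>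
 proof (rule ccontr)
  assume "lookup (ap (EV b1 b2 (quasi_R k \<mu>)) (single f 1)) f \<noteq> 0"
  then have "f1 @ f2 \<in> keys (ap (EV b1 b2 (quasi_R k \<mu>)) (single (f1 @ f2) 1))"
   using l(3) by (simp add: in_keys_iff)
  then obtain h1 h2 where h: "f1 @ f2 = h1 @ h2" "shift b1 (ps k \<mu>) f1 h1"
   "\<And>c. c < - int k \<or> int k < c ==> \<mu> c = 0"
   by (rule keys_Theta[OF assms l(1,2)]) blast
  then have "h1 = f1" using l by (auto simp: shift_def)
  then have "ps k \<mu> r = 0" for r using h(2) by (simp add: shift_def)
  then have "\<mu> c = 0" for c using ps_diff[of k c \<mu>] h(3)[of c] by (cases "- int k \<le> c \<and> c \<le> int k") auto
  then show False using that by (simp add: fun_eq_iff)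
 qed
 have fin: "finite {\<mu>. ap (EV b1 b2 (quasi_R k \<mu>)) (single f 1) \<noteq> 0}"
  using f by (intro finite_Theta_single assms) simp
 have "lookup (TH k b1 b2 (single f 1)) f
   = Sum_any (\<lambda>\<mu>. lookup (ap (EV b1 b2 (quasi_R k \<mu>)) (single f 1)) f)"
  unfolding TH_def by (rule Sum_any_additive) (simp_all add: lookup_add fin)
 also have "\<dots> = (\<Sum>\<mu>\<in>{0}. lookup (ap (EV b1 b2 (quasi_R k \<mu>)) (single f 1)) f)"
  by (rule Sum_any.expand_superset) (use zero in auto)
 also have "\<dots> = 1" by (simp add: quasi_R_0 EV_simps ap_ring)
 finally show "lookup (TH k b1 b2 (single f 1)) f = 1" .
qed

lemma tri_comp:
 assumes "semilin \<sigma>" "tri b \<phi>" "tri b \<psi>"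
 shows "tri b (\<lambda>f. sl_ext \<sigma> \<phi> (\<psi> f))"
 unfolding tri_def
proof (intro allI impI conjI ballI)
 interpret semilin \<sigma> by fact
 fix f :: "int list" assume f: "length f = length b"
 have le: "bruhat_le b h f \<and> length h = length b" if "h \<in> keys (\<psi> f)" for h
  using assms(3) f that by (auto simp: tri_def bruhat_le_def)
 { fix g assume "g \<in> keys (sl_ext \<sigma> \<phi> (\<psi> f))"
  from subsetD[OF keys_sl_ext this] obtain h where h: "h \<in> keys (\<psi> f)" "g \<in> keys (\<phi> h)" by blast
  then have "bruhat_le b g h" using assms(2) le[OF h(1)] by (simp add: tri_def)
  then show "bruhat_le b g f" using le[OF h(1)] by (blast intro: bruhat_trans) }
 have "lookup (sl_ext \<sigma> \<phi> (\<psi> f)) f = (\<Sum>h\<in>keys (\<psi> f). \<sigma> (lookup (\<psi> f) h) * lookup (\<phi> h) f)"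
  by (rule lookup_sl_ext)
 also have "\<dots> = (\<Sum>h\<in>{f}. \<sigma> (lookup (\<psi> f) h) * lookup (\<phi> h) f)"
 proof (rule sum.mono_neutral_right)
  show "{f} \<subseteq> keys (\<psi> f)" using assms(3) f by (auto simp: tri_def in_keys_iff)
  show "\<forall>h\<in>keys (\<psi> f) - {f}. \<sigma> (lookup (\<psi> f) h) * lookup (\<phi> h) f = 0"
  proof
   fix h assume h: "h \<in> keys (\<psi> f) - {f}"
   have "f \<notin> keys (\<phi> h)"
   proof
    assume "f \<in> keys (\<phi> h)"
    then have "bruhat_le b f h" using assms(2) le[of h] h by (simp add: tri_def)
    then show False using bruhat_antisym[of b h f] le[of h] h by auto
   qed
   then show "\<sigma> (lookup (\<psi> f) h) * lookup (\<phi> h) f = 0" by (simp add: in_keys_iff)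
  qed
 qed simp
 also have "\<dots> = 1" using assms(2,3) f by (simp add: tri_def sigma_1)
 finally show "lookup (sl_ext \<sigma> \<phi> (\<psi> f)) f = 1" .
qed

lemma tri_ten: "tri b1 \<phi>1 ==> tri b2 \<phi>2 ==> tri (b1 @ b2) (ten (length b1) \<phi>1 \<phi>2)"
 unfolding tri_def
proof (intro allI impI conjI ballI)
 assume t: "\<forall>f. length f = length b1 --> lookup (\<phi>1 f) f = 1 \<and> (\<forall>g\<in>keys (\<phi>1 f). bruhat_le b1 g f)"
  "\<forall>f. length f = length b2 --> lookup (\<phi>2 f) f = 1 \<and> (\<forall>g\<in>keys (\<phi>2 f). bruhat_le b2 g f)"
 fix f :: "int list" assume f: "length f = length (b1 @ b2)"
 define f1 f2 where "f1 = take (length b1) f" and "f2 = drop (length b1) f"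
 have l: "length f1 = length b1" "length f2 = length b2" "f = f1 @ f2" using f by (auto simp: f1_def f2_def)
 have D: "ten (length b1) \<phi>1 \<phi>2 f = \<phi>1 f1 * \<phi>2 f2" by (simp add: ten_def f1_def f2_def)
 { fix g assume "g \<in> keys (ten (length b1) \<phi>1 \<phi>2 f)"
  then obtain g1' g2' where "g1' \<in> keys (\<phi>1 f1)" "g2' \<in> keys (\<phi>2 f2)" "g = g1' @ g2'"
   using keys_mult_append[of g "\<phi>1 f1" "\<phi>2 f2"] unfolding D by blast
  then show "bruhat_le (b1 @ b2) g f" using t l by (auto intro: bruhat_append) }
 have ex: "\<phi>1 f1 * \<phi>2 f2 = (\<Sum>i\<in>keys (\<phi>1 f1). \<Sum>j\<in>keys (\<phi>2 f2). single (i @ j) (lookup (\<phi>1 f1) i * lookup (\<phi>2 f2) j))"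
  unfolding pm_expand_mult[of "\<phi>1 f1"] pm_expand_mult'[of _ "\<phi>2 f2"]
  by (subst sum.swap) (simp add: mult_single plus_list_def)
 have "lookup (\<phi>1 f1 * \<phi>2 f2) f = (\<Sum>i\<in>keys (\<phi>1 f1). \<Sum>j\<in>keys (\<phi>2 f2).
   if j = f2 then (if i = f1 then lookup (\<phi>1 f1) i * lookup (\<phi>2 f2) j else 0) else 0)"
  unfolding ex lookup_sum
 proof (intro sum.cong refl)
  fix i j assume "i \<in> keys (\<phi>1 f1)" "j \<in> keys (\<phi>2 f2)"
  then have "bruhat_le b1 i f1" using t(1) l(1) by blast
  then have "length i = length f1" using l(1) by (simp add: bruhat_le_def)
  then show "lookup (single (i @ j) (lookup (\<phi>1 f1) i * lookup (\<phi>2 f2) j)) f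
   = (if j = f2 then (if i = f1 then lookup (\<phi>1 f1) i * lookup (\<phi>2 f2) j else 0) else 0)"
   unfolding lookup_single when_def l(3) by (cases "i = f1"; cases "j = f2") simp_all
 qed
 also have "\<dots> = 1"
 proof -
  have 1: "lookup (\<phi>1 f1) f1 = 1" "lookup (\<phi>2 f2) f2 = 1" using t l(1,2) by blast+
  then have "f1 \<in> keys (\<phi>1 f1)" "f2 \<in> keys (\<phi>2 f2)" by (simp_all add: in_keys_iff)
  then show ?thesis using 1 by (simp add: sum.delta)
 qed
 finally show "lookup (ten (length b1) \<phi>1 \<phi>2 f) f = 1" unfolding D .
qed

lemma tri_thten:
 assumes "ok b1" "ok b2" "tri b1 \<phi>1" "tri b2 \<phi>2"
 shows "tri (b1 @ b2) (thten k b1 b2 \<phi>1 \<phi>2)"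
proof -
 have "thten k b1 b2 \<phi>1 \<phi>2 f = sl_ext (\<lambda>c. c) (\<lambda>f. TH k b1 b2 (single f 1)) (ten (length b1) \<phi>1 \<phi>2 f)"
  if "length f = length (b1 @ b2)" for f
 proof -
  have l: "len (length (b1 @ b2)) (ten (length b1) \<phi>1 \<phi>2 f)"
   using tri_ten[OF assms(3,4)] that by (auto simp: tri_def len_def bruhat_le_def)
  define y where "y = ten (length b1) \<phi>1 \<phi>2 f"
  have l': "len (length (b1 @ b2)) (cst c * single i 1)" "len (length (b1 @ b2)) (single i 1)"
   if "i \<in> keys y" for i c
   using l that unfolding y_def[symmetric] by (intro len_simps; simp add: len_def)+
  have "TH k b1 b2 (\<Sum>i\<in>keys y. cst (lookup y i) * single i 1)
   = (\<Sum>i\<in>keys y. TH k b1 b2 (cst (lookup y i) * single i 1))"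
   by (rule TH_sum[OF assms(1,2) l'(1)])
  also have "\<dots> = sl_ext (\<lambda>c. c) (\<lambda>f. TH k b1 b2 (single f 1)) y"
   unfolding sl_ext_def by (intro sum.cong refl TH_simps(3) assms(1,2) l'(2))
  finally show ?thesis unfolding thten_def y_def[symmetric] vec_expand[of y, symmetric] .
 qed
 then show ?thesis
  using tri_comp[OF id_semilin.semilin_axioms tri_TH[OF assms(1,2)] tri_ten[OF assms(3,4)], of k]
  by (simp add: tri_def)
qed

lemma tri_psi: "ok b ==> tri b (psi k b)"
proof (induction b rule: rev_induct)
 case (snoc s b)
 have 1: "tri [s] (psi k [s])" by (auto simp: tri_def psi_single bruhat_refl)
 show ?case
 proof (cases "b = []")
  case False
  then have "ok b" "ok [s]" using snoc.prems by (auto simp: ok_def)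
  from tri_thten[OF this snoc.IH[OF this(1)] 1, of k] show ?thesis
   using False by (simp add: tri_def psi_thten)
 qed (simp add: 1)
qed (simp add: ok_def)

section \<open>Determination of the bar map by equivariance and triangularity\<close>

text \<open>The Laurent polynomials in q over the integers, generated term by term so as to allow
  induction.\<close>

inductive_set ZQ :: "qfield set" where
 zero: "0 \<in> ZQ"
| step: "x \<in> ZQ ==> of_int c * qq powi i + x \<in> ZQ"

lemma ZQ_powi: "qq powi i \<in> ZQ"
 using ZQ.step[OF ZQ.zero, of 1 i] by simp

lemma ZQ_add: "x \<in> ZQ ==> y \<in> ZQ ==> x + y \<in> ZQ"
 by (induction x rule: ZQ.induct) (auto simp: add.assoc intro: ZQ.step)

lemma ZQ_mult_powi: "x \<in> ZQ ==> of_int d * qq powi j * x \<in> ZQ"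
proof (induction x rule: ZQ.induct)
 case (step x c i)
 have "of_int d * qq powi j * (of_int c * qq powi i + x) = of_int (d * c) * qq powi (j + i) + of_int d * qq powi j * x"
  by (simp add: power_int_add qq_nonzero algebra_simps)
 then show ?case using ZQ.step[OF step.IH, of "d * c" "j + i"] by simp
qed (simp add: ZQ.zero)

lemma ZQ_mult: "x \<in> ZQ ==> y \<in> ZQ ==> x * y \<in> ZQ"
 by (induction x rule: ZQ.induct) (auto simp: distrib_right intro: ZQ.zero ZQ_add ZQ_mult_powi)

lemma ZQ_uminus: "x \<in> ZQ ==> - x \<in> ZQ"
 using ZQ_mult_powi[of x "-1" 0] by simp

lemma ZQ_sum: "(\<And>i. i \<in> A ==> h i \<in> ZQ) ==> sum h A \<in> ZQ"
 by (induction A rule: infinite_finite_induct) (auto intro: ZQ.zero ZQ_add)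

lemma qbar_of_int: "qbar (of_int c) = of_int c"
proof -
 have "qbar (of_nat n) = of_nat n" for n by (induction n) (simp_all add: qbar_add)
 then show ?thesis by (cases c) (simp_all add: qbar_uminus qbar_add del: of_nat_Suc)
qed

lemma ZQ_qbar: "x \<in> ZQ ==> qbar x \<in> ZQ"
 by (induction x rule: ZQ.induct)
   (simp_all add: qbar_add qbar_mult qbar_of_int ZQ.zero ZQ.step flip: power_int_minus)

text \<open>On the last tensor factor, \<open>E\<^sub>r\<close> sends the index \<open>src s r\<close> to \<open>tgt s r\<close>.\<close>

definition src :: "nat => int => int" where "src s r = (if s = 0 then r + 1 else r)"
definition tgt :: "nat => int => int" where "tgt s r = (if s = 0 then r else r + 1)"
definition kex :: "nat => int => int => int" where "kex s r c = of_bool (c = src s r) - of_bool (c = tgt s r)"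

lemma base_E: "ap (base s (gE r)) (single [d] v) = (if d = src s r then single [tgt s r] v else 0)"
 by (cases "s = 0") (simp_all add: ap_V ap_W src_def tgt_def)

lemma base_KK: "ap (base s (gK (r + 1)) * base s (gKinv r)) (single [d] v) = single [d] (qq powi kex s r d * v)"
 by (cases "s = 0") (auto simp: ap_ring ap_V ap_W kex_def src_def tgt_def mult.commute)

text \<open>The part of a vector whose last tensor factor has index c, with this factor removed; see
  \<open>lookup_sl\<close>.\<close>

definition sl :: "int => vec => vec" where
 "sl c = lin_ext (\<lambda>f. if f \<noteq> [] \<and> last f = c then single (butlast f) 1 else 0)"

lemma lookup_sl: "lookup (sl c y) g = lookup y (g @ [c])"
proof (induction y rule: pm_induct)
 case (single f v)
 have "f \<noteq> [] ==> last f = c ==> butlast f = g ==> f = g @ [c]" by auto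
 then show ?case by (cases "f = g @ [c]") (auto simp: sl_def lin_ext_simps cst_single lookup_single when_def)
qed (simp_all add: sl_def lin_ext_simps lookup_add)

lemma sl_simps: "sl c (x + y) = sl c x + sl c y" "sl c 0 = 0" "sl c (cst d * x) = cst d * sl c x"
 "sl c (sum h A) = (\<Sum>i\<in>A. sl c (h i))"
 by (simp_all add: sl_def lin_ext_simps)

lemma sl_tensor: "sl c (x * single [d] v) = (if c = d then cst v * x else 0)"
proof (induction x rule: pm_induct)
 case (single f w)
 then show ?case by (simp add: mult_single plus_list_def sl_def lin_ext_simps cst_single mult.commute)
qed (simp_all add: distrib_left distrib_right sl_simps)

lemma sl_sl_ext: "sl c (sl_ext \<sigma> F y) = sl_ext \<sigma> (\<lambda>f. sl c (F f)) y"
 by (simp add: sl_ext_def sl_simps)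

lemma rho_snoc_E:
 assumes "b \<noteq> []" "len (length b) x"
 shows "ap (rho (b @ [s]) (gE r)) (x * single [d] v)
  = (if d = src s r then x * single [tgt s r] v else 0)
   + ap (rho b (gE r)) x * single [d] (qq powi kex s r d * v)"
 unfolding rho_snoc[OF assms(1)] tns_simps ap_ring(3) ap_tnp_len[OF assms(2)] base_KK base_E
 by (simp add: ap_ring)

lemma slice_E:
 assumes "b \<noteq> []" "len (Suc (length b)) y"
 shows "sl c (ap (rho (b @ [s]) (gE r)) y)
  = (if c = tgt s r then sl (src s r) y else 0) + cst (qq powi kex s r c) * ap (rho b (gE r)) (sl c y)"
 using assms(2)
proof (induction y rule: len_induct)
 case (single f v)
 then obtain f' d where f: "f = f' @ [d]" "length f' = length b" by (metis length_Suc_conv_rev)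
 have y: "single f v = single f' 1 * single [d] v" by (simp add: f mult_single plus_list_def)
 have l: "len (length b) (single f' (1::qfield))" using f by (intro len_simps)
 show ?case
  unfolding y rho_snoc_E[OF assms(1) l] sl_simps
  by (simp add: sl_tensor sl_simps ap_simps cst_simps mult.assoc)
qed (simp_all add: ap_simps sl_simps distrib_left)

definition box :: "nat => nat => int list set" where
 "box k n = {f. length f = n \<and> set f \<subseteq> {- int k..int k}}"

lemma box_snoc: "f @ [a] \<in> box k (Suc n) \<longleftrightarrow> f \<in> box k n \<and> a \<in> {- int k..int k}"
 by (auto simp: box_def)

text \<open>The letters E are fixed by the bar involution, so the same condition makes sense for
  linear and for anti-linear maps.\<close>

definition equivE :: "nat => nat list => (qfield => qfield) => (int list => vec) => bool" where
 "equivE k b \<sigma> \<phi> \<longleftrightarrow> (\<forall>r f. - int k \<le> r --> r \<le> int k - 1 --> length f = length b -->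
   sl_ext \<sigma> \<phi> (ap (rho b (gE r)) (single f 1)) = ap (rho b (gE r)) (\<phi> f))"

definition trile :: "nat list => (int list => vec) => bool" where
 "trile b \<phi> \<longleftrightarrow> (\<forall>f. length f = length b --> (\<forall>g\<in>keys (\<phi> f). bruhat_le b g f))"

text \<open>For r in this range the source and the target index of \<open>E_r\<close> both lie
  between \<open>- k\<close> and k, so the box is neither entered nor left.\<close>

lemma E_box:
 assumes "ok b" "- int k \<le> r" "r \<le> int k - 1" "length f = length b"
 shows "lookup (Rep_lend (rho b (gE r)) f) g \<in> ZQ"
  "g \<in> keys (Rep_lend (rho b (gE r)) f) ==> g \<in> box k (length b) \<longleftrightarrow> f \<in> box k (length b)"
proof -
 have "lookup (Rep_lend (rho b (gE r)) f) g \<in> ZQ \<and>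
  (g \<in> keys (Rep_lend (rho b (gE r)) f) --> (g \<in> box k (length b) \<longleftrightarrow> f \<in> box k (length b)))"
  using assms(1,4)
 proof (induction b arbitrary: f g rule: rev_induct)
  case (snoc s b)
  obtain f' d where f: "f = f' @ [d]" "length f' = length b" using snoc.prems(2) by (metis length_Suc_conv_rev length_append_singleton)
  show ?case
  proof (cases "b = []")
   case True
   have "Rep_lend (rho (b @ [s]) (gE r)) f = (if d = src s r then single [tgt s r] 1 else 0)"
    using True f base_E[of s r d 1] by (simp add: rho_single ap_single_1)
   then show ?thesis using True f assms(2,3)
    by (auto simp: lookup_single when_def ZQ.zero ZQ_powi[of 0, simplified] box_def src_def tgt_def)
  next
   case False
   then have ok: "ok b" using snoc.prems by (auto simp: ok_def)
   have l: "len (length b) (single f' (1::qfield))" using f by (intro len_simps)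
   let ?y = "Rep_lend (rho b (gE r)) f'"
   have "Rep_lend (rho (b @ [s]) (gE r)) f = ap (rho (b @ [s]) (gE r)) (single f' 1 * single [d] 1)"
    by (simp add: f mult_single plus_list_def ap_single_1)
   also have "\<dots> = (if d = src s r then single (f' @ [tgt s r]) 1 else 0) + cst (qq powi kex s r d) * (?y * single [d] 1)"
    unfolding rho_snoc_E[OF False l] ap_single_1
    by (simp add: mult_single plus_list_def cst_single flip: cst_left)
   finally have eq: "Rep_lend (rho (b @ [s]) (gE r)) f = \<dots>" .
   have lk: "lookup (?y * single [d] 1) g = (if g \<noteq> [] \<and> last g = d then lookup ?y (butlast g) else 0)"
   proof (cases "g = []")
    case True
    have "g \<notin> keys (?y * single [d] 1)"
     using keys_mult_append[of g ?y "single [d] 1"] True by auto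
    then show ?thesis using True by (simp add: in_keys_iff)
   next
    case False
    then have "lookup (?y * single [d] 1) g = lookup (sl (last g) (?y * single [d] 1)) (butlast g)"
     by (simp add: lookup_sl)
    then show ?thesis using False by (simp add: sl_tensor cst_simps)
   qed
   have lk2: "lookup (Rep_lend (rho (b @ [s]) (gE r)) f) g
    = of_bool (d = src s r \<and> g = f' @ [tgt s r])
     + qq powi kex s r d * (if g \<noteq> [] \<and> last g = d then lookup ?y (butlast g) else 0)"
    unfolding eq lookup_add lookup_cst_mult lk by (auto simp: lookup_single when_def)
   have IH: "lookup ?y (butlast g) \<in> ZQ"
    "lookup ?y (butlast g) \<noteq> 0 ==> butlast g \<in> box k (length b) \<longleftrightarrow> f' \<in> box k (length b)"
    using snoc.IH[OF ok f(2), of "butlast g"] by (auto simp: in_keys_iff)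
   have "of_bool (d = src s r \<and> g = f' @ [tgt s r]) \<in> ZQ" by (auto simp: of_bool_def ZQ.zero ZQ_powi[of 0, simplified])
   then have 1: "lookup (Rep_lend (rho (b @ [s]) (gE r)) f) g \<in> ZQ"
    unfolding lk2 using IH(1) by (auto intro!: ZQ_add ZQ_mult ZQ_powi ZQ.zero)
   have "g \<in> box k (length (b @ [s])) \<longleftrightarrow> f \<in> box k (length (b @ [s]))"
    if "g \<in> keys (Rep_lend (rho (b @ [s]) (gE r)) f)"
   proof -
    have "(d = src s r \<and> g = f' @ [tgt s r]) \<or> (g \<noteq> [] \<and> last g = d \<and> lookup ?y (butlast g) \<noteq> 0)"
     using that unfolding in_keys_iff lk2 by (auto split: if_splits)
    then show ?thesis
    proof
     assume "d = src s r \<and> g = f' @ [tgt s r]"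
     then show ?thesis using assms(2,3) f by (auto simp: box_def src_def tgt_def split: if_splits)
    next
     assume g: "g \<noteq> [] \<and> last g = d \<and> lookup ?y (butlast g) \<noteq> 0"
     then have "g = butlast g @ [d]" by (metis append_butlast_last_id)
     then show ?thesis using IH(2) g f box_snoc[of "butlast g" d k "length b"] box_snoc[of f' d k "length b"] by auto
    qed
   qed
   with 1 show ?thesis by blast
  qed
 qed (simp add: ok_def)
 then show "lookup (Rep_lend (rho b (gE r)) f) g \<in> ZQ"
  "g \<in> keys (Rep_lend (rho b (gE r)) f) ==> g \<in> box k (length b) \<longleftrightarrow> f \<in> box k (length b)" by auto
qed

definition fur :: "nat => int => int => bool" where
 "fur s a c = (if s = 0 then a \<le> c else c \<le> a)"

lemma bruhat_snoc:
 assumes "bruhat_le (b @ [s]) (g @ [c]) (f @ [a])" "s \<in> {0, 1}" "length f = length b"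
 shows "fur s a c" "a = c ==> bruhat_le b g f"
proof -
 have l: "length g = length b" using assms by (simp add: bruhat_le_def)
 have "sharp (b @ [s]) (g @ [c]) r (length b) \<le> sharp (b @ [s]) (f @ [a]) r (length b)" for r
  using assms(1) by (simp add: bruhat_le_def)
 then have "sharp [s] [c] r 0 \<le> sharp [s] [a] r 0" for r
  using l assms(3) by (simp add: sharp_append sharp_length)
 from this[of a] this[of c] show "fur s a c" using assms(2) by (auto simp: sharp_single fur_def split: if_splits)
 show "bruhat_le b g f" if "a = c"
 proof -
  have "sharp (b @ [s]) (g @ [c]) r j \<le> sharp (b @ [s]) (f @ [a]) r j" if "j < length b" for r j
   using assms(1) that by (simp add: bruhat_le_def)
  moreover have "sharp (b @ [s]) (g @ [c]) r 0 = sharp (b @ [s]) (f @ [a]) r 0" for r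
   using assms(1) by (simp add: bruhat_le_def)
  ultimately show ?thesis using l assms(3) \<open>a = c\<close> by (simp add: bruhat_le_def sharp_append)
 qed
qed

text \<open>The slices of \<open>\<phi>\<close> along the last factor: the diagonal ones are equivariant and all equal, and
 the others are determined recursively by moving away from the diagonal with \<open>E\<^sub>r\<close>.\<close>

theorem coefficients_determined:
 assumes "semilin \<sigma>" "\<And>c. c \<in> ZQ ==> \<sigma> c \<in> ZQ" "k \<ge> 1"
  and S: "0 \<in> S" "\<And>x y. x \<in> S ==> y \<in> S ==> x + y \<in> S" "\<And>c x. c \<in> ZQ ==> x \<in> S ==> c * x \<in> S"
  and \<phi>: "ok b" "equivE k b \<sigma> \<phi>" "trile b \<phi>" "\<And>f. f \<in> box k (length b) ==> lookup (\<phi> f) f \<in> S"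
  and fg: "f \<in> box k (length b)" "g \<in> box k (length b)"
 shows "lookup (\<phi> f) g \<in> S"
 using \<phi> fg
proof (induction b arbitrary: \<phi> f g rule: rev_induct)
 case (snoc s b)
 interpret semilin \<sigma> by fact
 have Ssum: "sum h A \<in> S" if "\<And>i. i \<in> A ==> h i \<in> S" for h :: "int list => qfield" and A
  using that by (induction A rule: infinite_finite_induct) (auto intro: S)
 have s: "s \<in> {0, 1}" using snoc.prems(1) by (simp add: ok_def)
 show ?case
 proof (cases "b = []")
  case True
  have "lookup (\<phi> f) g \<noteq> 0 ==> g = f"
  proof -
   assume nz: "lookup (\<phi> f) g \<noteq> 0"
   obtain a c where fg: "f = [a]" "g = [c]"
    using snoc.prems(5,6) True by (auto simp: box_def length_Suc_conv)
   have le: "bruhat_le [s] g f"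
    using snoc.prems(3,5) nz True by (auto simp: trile_def box_def in_keys_iff)
   then have "sharp [s] [c] r 0 = sharp [s] [a] r 0" for r using fg by (simp add: bruhat_le_def)
   from this[of a] this[of c] show "g = f" using fg by (auto simp: sharp_single split: if_splits)
  qed
  then show ?thesis using snoc.prems(4)[OF snoc.prems(5)] S(1) by (cases "lookup (\<phi> f) g = 0") auto
 next
  case False
  then have ok: "ok b" using snoc.prems by (auto simp: ok_def)
  define P where "P a c f = sl c (\<phi> (f @ [a]))" for a c f
  have lookup_P: "lookup (P a c f) g = lookup (\<phi> (f @ [a])) (g @ [c])" for a c f g
   by (simp add: P_def lookup_sl)
  have P_le: "fur s a c" "a = c ==> bruhat_le b g f" if "g \<in> keys (P a c f)" "length f = length b" for a c f g
  proof -
   have "bruhat_le (b @ [s]) (g @ [c]) (f @ [a])"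
    using snoc.prems(3) that by (simp add: trile_def in_keys_iff lookup_P)
   from bruhat_snoc[OF this s that(2)] show "fur s a c" "a = c ==> bruhat_le b g f" by auto
  qed
  have P_0: "P a c f = 0" if "\<not> fur s a c" "length f = length b" for a c f
  proof (rule poly_mapping_eqI)
   fix g show "lookup (P a c f) g = lookup 0 g"
    using P_le(1)[of g a c f] that by (cases "g \<in> keys (P a c f)") (auto simp: in_keys_iff)
  qed
  have len\<phi>: "len (Suc (length b)) (\<phi> (f @ [a]))" if "length f = length b" for f a
  proof -
   have "bruhat_le (b @ [s]) g (f @ [a])" if "g \<in> keys (\<phi> (f @ [a]))" for g
    using snoc.prems(3) that \<open>length f = length b\<close> unfolding trile_def by simp
   then show ?thesis by (simp add: len_def bruhat_le_def)
  qed
  let ?E = "\<lambda>r. ap (rho b (gE r))"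
  \<comment> \<open>The part with last index c of the equivariance equation applied to
    \<open>f @ [a]\<close>.\<close>
  have slice: "(if a = src s r then P (tgt s r) c f else 0) + cst (\<sigma> (qq powi kex s r a)) * sl_ext \<sigma> (P a c) (?E r (single f 1))
    = (if c = tgt s r then P a (src s r) f else 0) + cst (qq powi kex s r c) * ?E r (P a c f)"
   if r: "- int k \<le> r" "r \<le> int k - 1" and f: "length f = length b" for r a c f
  proof -
   have l: "len (length b) (single f (1::qfield))" using f by (intro len_simps)
   have *: "sl_ext \<sigma> \<phi> (x * single [a] v) = cst (\<sigma> v) * sl_ext \<sigma> (\<lambda>f. \<phi> (f @ [a])) x" for x v a
    by (induction x rule: pm_induct)
      (simp_all add: mult_single plus_list_def sigma_mult cst_simps mult.assoc distrib_left distrib_right sl_ext_add mult.commute[of "\<sigma> _" "\<sigma> v"])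
   have "sl_ext \<sigma> \<phi> (ap (rho (b @ [s]) (gE r)) (single f 1 * single [a] 1)) = ap (rho (b @ [s]) (gE r)) (\<phi> (f @ [a]))"
    using snoc.prems(2) r f by (simp add: equivE_def mult_single plus_list_def)
   then have "sl c (sl_ext \<sigma> \<phi> (ap (rho (b @ [s]) (gE r)) (single f 1 * single [a] 1)))
     = (if c = tgt s r then P a (src s r) f else 0) + cst (qq powi kex s r c) * ?E r (P a c f)"
    using slice_E[OF False len\<phi>[OF f], of c s r a] by (simp add: P_def)
   moreover have "sl c (sl_ext \<sigma> \<phi> (ap (rho (b @ [s]) (gE r)) (single f 1 * single [a] 1)))
    = (if a = src s r then P (tgt s r) c f else 0) + cst (\<sigma> (qq powi kex s r a)) * sl_ext \<sigma> (P a c) (?E r (single f 1))"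
   proof -
    have "sl_ext \<sigma> \<phi> (ap (rho (b @ [s]) (gE r)) (single f 1 * single [a] 1))
     = (if a = src s r then \<phi> (f @ [tgt s r]) else 0)
      + cst (\<sigma> (qq powi kex s r a)) * sl_ext \<sigma> (\<lambda>f. \<phi> (f @ [a])) (?E r (single f 1))"
     unfolding rho_snoc_E[OF False l] sl_ext_add *
     by (cases "a = src s r") (simp_all add: * sigma_1 cst_simps)
    then show ?thesis by (cases "a = src s r") (simp_all add: sl_simps sl_sl_ext P_def[abs_def])
   qed
   ultimately show ?thesis by simp
  qed
  have st: "src s r \<noteq> tgt s r" "\<not> fur s (src s r) (tgt s r)" for r
   by (auto simp: src_def tgt_def fur_def)
  \<comment> \<open>For a the source and c the target of \<open>E_r\<close>, the slices between them
    vanish by triangularity, and the equation identifies two neighbouring diagonal slices.\<close>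
  have step: "P (r + 1) (r + 1) f = P r r f" if r: "- int k \<le> r" "r \<le> int k - 1" and f: "length f = length b" for r f
  proof -
   have z: "sl_ext \<sigma> (P (src s r) (tgt s r)) x = 0" if "len (length b) x" for x
    unfolding sl_ext_def using that P_0[OF st(2)] by (intro sum.neutral) (auto simp: len_def)
   have "P (tgt s r) (tgt s r) f = P (src s r) (src s r) f"
    using slice[OF r f, of "src s r" "tgt s r"] st z[OF len_simps(5)[OF len_simps(4)[OF f]]] P_0[OF st(2) f]
    by (simp add: ap_simps(1))
   then show ?thesis by (auto simp: src_def tgt_def split: if_splits)
  qed
  have diag_eq: "P a a f = P (- int k) (- int k) f" if "- int k \<le> a" "a \<le> int k" "length f = length b" for a f
   using that(1,2)
  proof (induction a rule: int_ge_induct)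
   case (step i)
   then show ?case using \<open>\<And>r f. - int k \<le> r ==> r \<le> int k - 1 ==> length f = length b ==> P (r + 1) (r + 1) f = P r r f\<close> that(3) by simp
  qed simp
  have diagS: "lookup (P a a f) g \<in> S" if a: "- int k \<le> a" "a \<le> int k" and fg: "f \<in> box k (length b)" "g \<in> box k (length b)" for a f g
  proof (rule snoc.IH[OF ok _ _ _ fg])
   show "equivE k b \<sigma> (P a a)"
    unfolding equivE_def
   proof (intro allI impI)
    fix r and f :: "int list" assume r: "- int k \<le> r" "r \<le> int k - 1" and f: "length f = length b"
    \<comment> \<open>All diagonal slices agree, so equivariance may be tested on an index that
      \<open>E_r\<close> does not touch, where neither powers of q nor extra terms occur. One end of
      the range qualifies because \<open>k \<ge> 1\<close>.\<close>
    obtain a' where a': "- int k \<le> a'" "a' \<le> int k" "a' \<noteq> r" "a' \<noteq> r + 1"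
     using assms(3) that[of "if r = - int k then int k else - int k"] r by fastforce
    have "a' \<noteq> src s r" "a' \<noteq> tgt s r" using a' by (auto simp: src_def tgt_def)
    then have "sl_ext \<sigma> (P a' a') (?E r (single f 1)) = ?E r (P a' a' f)"
     using slice[OF r f, of a' a'] by (simp add: kex_def sigma_1 cst_simps)
    moreover have "sl_ext \<sigma> (P a' a') (?E r (single f 1)) = sl_ext \<sigma> (P a a) (?E r (single f 1))"
     using diag_eq[OF a(1,2)] diag_eq[OF a'(1,2)] len_simps(5)[OF len_simps(4)[OF f, of 1], of "rho b (gE r)"]
     by (intro sl_ext_cong) (auto simp: len_def)
    ultimately show "sl_ext \<sigma> (P a a) (?E r (single f 1)) = ?E r (P a a f)"
     using diag_eq[OF a(1,2) f] diag_eq[OF a'(1,2) f] by simp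
   qed
   show "trile b (P a a)" unfolding trile_def using P_le(2) by blast
   show "lookup (P a a f) f \<in> S" if "f \<in> box k (length b)" for f
    using snoc.prems(4)[of "f @ [a]"] that a by (simp add: lookup_P box_snoc)
  qed
  define coef where "coef y \<longleftrightarrow> (\<forall>g\<in>box k (length b). lookup y g \<in> S)" for y :: vec
  have coef_simps: "coef x ==> coef y ==> coef (x + y)" "c \<in> ZQ ==> coef x ==> coef (cst c * x)" for x y c
   by (auto simp: coef_def lookup_add intro: S)
  have coef_E: "coef (?E r y)" if "- int k \<le> r" "r \<le> int k - 1" "coef y" "len (length b) y" for r y
   unfolding coef_def
  proof
   fix g assume g: "g \<in> box k (length b)"
   have "lookup (?E r y) g = (\<Sum>h\<in>keys y. lookup (Rep_lend (rho b (gE r)) h) g * lookup y h)"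
    unfolding ap_def lookup_lin_ext by (simp add: mult.commute)
   also have "\<dots> \<in> S"
   proof (rule Ssum)
    fix h assume h: "h \<in> keys y"
    then have lh: "length h = length b" using that(4) by (simp add: len_def)
    note E = E_box[OF ok that(1,2) lh, of g]
    show "lookup (Rep_lend (rho b (gE r)) h) g * lookup y h \<in> S"
    proof (cases "g \<in> keys (Rep_lend (rho b (gE r)) h)")
     case True
     then have "lookup y h \<in> S" using E(2) g that(3) by (simp add: coef_def)
     then show ?thesis using E(1) S(3) by blast
    qed (simp add: in_keys_iff S(1))
   qed
   finally show "lookup (?E r y) g \<in> S" .
  qed
  have coef_sl: "coef (sl_ext \<sigma> (P a c) (?E r (single f 1)))"
   if "- int k \<le> r" "r \<le> int k - 1" "f \<in> box k (length b)" "\<And>f. f \<in> box k (length b) ==> coef (P a c f)" for r a c f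
   unfolding coef_def
  proof
   fix g assume g: "g \<in> box k (length b)"
   have lf: "length f = length b" using that(3) by (simp add: box_def)
   note E = E_box[OF ok that(1,2) lf]
   have "lookup (sl_ext \<sigma> (P a c) (?E r (single f 1))) g
    = (\<Sum>h\<in>keys (Rep_lend (rho b (gE r)) f). \<sigma> (lookup (Rep_lend (rho b (gE r)) f) h) * lookup (P a c h) g)"
    by (simp add: lookup_sl_ext ap_single_1)
   also have "\<dots> \<in> S"
   proof (rule Ssum)
    fix h assume h: "h \<in> keys (Rep_lend (rho b (gE r)) f)"
    then have "coef (P a c h)" using E(2) that(3,4) by blast
    then show "\<sigma> (lookup (Rep_lend (rho b (gE r)) f) h) * lookup (P a c h) g \<in> S"
     using g assms(2)[OF E(1)] S(3) by (simp add: coef_def)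
   qed
   finally show "lookup (sl_ext \<sigma> (P a c) (?E r (single f 1))) g \<in> S" .
  qed
  have main: "coef (P a c f)" if "nat \<bar>c - a\<bar> = n" "fur s a c" "- int k \<le> a" "a \<le> int k" "- int k \<le> c" "c \<le> int k"
    "f \<in> box k (length b)" for n a c f
   using that
  proof (induction n arbitrary: c f)
   case 0
   then have "c = a" by simp
   then show ?case using diagS 0 by (simp add: coef_def)
  next
   case (Suc n)
   \<comment> \<open>Now \<open>E_r\<close> has source c and a target one step closer to a, so the
     slice at c is expressed through the slice at the target.\<close>
   define r where "r = (if s = 0 then c - 1 else c)"
   have r: "- int k \<le> r" "r \<le> int k - 1" "src s r = c" "fur s a (tgt s r)" "nat \<bar>tgt s r - a\<bar> = n"
    "- int k \<le> tgt s r" "tgt s r \<le> int k" "a \<noteq> src s r"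
    using Suc.prems by (auto simp: r_def src_def tgt_def fur_def split: if_splits)
   have IH: "coef (P a (tgt s r) f)" if "f \<in> box k (length b)" for f
    using Suc.IH[OF r(5,4) Suc.prems(3,4) r(6,7) that] .
   have lf: "length f = length b" using Suc.prems(7) by (simp add: box_def)
   have "P a c f = cst (\<sigma> (qq powi kex s r a)) * sl_ext \<sigma> (P a (tgt s r)) (?E r (single f 1))
     + cst (- (qq powi kex s r (tgt s r))) * ?E r (P a (tgt s r) f)"
    using slice[OF r(1,2) lf, of a "tgt s r"] r(3,8) by (simp add: algebra_simps cst_def single_uminus)
   moreover have "len (length b) (P a (tgt s r) f)"
    unfolding len_def
   proof
    fix g assume "g \<in> keys (P a (tgt s r) f)"
    then have "g @ [tgt s r] \<in> keys (\<phi> (f @ [a]))" by (simp add: in_keys_iff lookup_P)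
    then have "length (g @ [tgt s r]) = Suc (length b)" using len\<phi>[OF lf, of a] unfolding len_def by blast
    then show "length g = length b" by simp
   qed
   ultimately show ?case
    using coef_sl[OF r(1,2) Suc.prems(7) IH] coef_E[OF r(1,2) IH[OF Suc.prems(7)]]
    by (auto intro!: coef_simps assms(2) ZQ_uminus ZQ_powi)
  qed
  obtain f' a where f: "f = f' @ [a]" using snoc.prems(5) by (cases f rule: rev_cases) (auto simp: box_def)
  obtain g' c where g: "g = g' @ [c]" using snoc.prems(6) by (cases g rule: rev_cases) (auto simp: box_def)
  have b: "f' \<in> box k (length b)" "a \<in> {- int k..int k}" "g' \<in> box k (length b)" "c \<in> {- int k..int k}"
   using snoc.prems(5,6) by (simp_all add: f g box_snoc)
  have "lookup (P a c f') g' \<in> S"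
  proof (cases "fur s a c")
   case True
   then show ?thesis using main[OF refl True, of f'] b by (auto simp: coef_def)
  next
   case False
   then show ?thesis using P_0[of a c f'] b(1) S(1) by (simp add: box_def)
  qed
  then show ?thesis by (simp add: lookup_P f g)
 qed
qed (simp add: ok_def)

lemma equi_equivE: "equi k b \<phi> ==> equivE k b qbar \<phi>"
 unfolding equivE_def
proof (intro allI impI)
 fix r and f :: "int list" assume e: "equi k b \<phi>" and r: "- int k \<le> r" "r \<le> int k - 1" and f: "length f = length b"
 have "gE r \<in> letters k" using r by (simp add: letters_iff)
 then have "al \<phi> (ap (rho b (gE r)) (single f 1)) = ap (rho b (bar_gen (gE r))) (al \<phi> (single f 1))"
  using e len_simps(4)[OF f, of 1] unfolding equi_def by blast
 then show "al \<phi> (ap (rho b (gE r)) (single f 1)) = ap (rho b (gE r)) (\<phi> f)"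
  by (simp add: cst_simps)
qed

lemma equivE_mono: "equivE l b \<sigma> \<phi> ==> k \<le> l ==> equivE k b \<sigma> \<phi>"
 by (auto simp: equivE_def)

lemma tri_trile: "tri b \<phi> ==> trile b \<phi>"
 by (auto simp: tri_def trile_def)

text \<open>The case \<open>S = {0}\<close> of \<open>coefficients_determined\<close>, applied to
  the difference of the two maps.\<close>

lemma coefficients_unique:
 assumes "semilin \<sigma>" "\<And>c. c \<in> ZQ ==> \<sigma> c \<in> ZQ" "k \<ge> 1" "ok b" "equivE k b \<sigma> \<phi>" "equivE k b \<sigma> \<psi>"
  "tri b \<phi>" "tri b \<psi>" "f \<in> box k (length b)" "g \<in> box k (length b)"
 shows "lookup (\<phi> f) g = lookup (\<psi> f) g"
proof -
 let ?d = "\<lambda>f. \<phi> f - \<psi> f"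
 have d: "sl_ext \<sigma> ?d z = sl_ext \<sigma> \<phi> z - sl_ext \<sigma> \<psi> z" for z
  by (simp add: sl_ext_def algebra_simps sum_subtractf)
 have "lookup (?d f) g \<in> {0}"
 proof (rule coefficients_determined[OF assms(1-3) _ _ _ assms(4) _ _ _ assms(9,10)])
  show "equivE k b \<sigma> ?d" using assms(5,6) unfolding equivE_def d by (simp add: ap_simps)
  show "trile b ?d" unfolding trile_def
  proof (intro allI impI ballI)
   fix f g :: "int list" assume f: "length f = length b" and g: "g \<in> keys (\<phi> f - \<psi> f)"
   then have "g \<in> keys (\<phi> f) \<or> g \<in> keys (\<psi> f)" by (auto simp: in_keys_iff lookup_minus)
   then show "bruhat_le b g f" using assms(7,8) f by (auto simp: tri_def)
  qed
  show "lookup (?d f) f \<in> {0}" if "f \<in> box k (length b)" for f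
   using assms(7,8) that by (simp add: tri_def box_def lookup_minus)
 qed auto
 then show ?thesis by (simp add: lookup_minus)
qed

lemma psi_stable:
 assumes "ok b" "1 \<le> k" "k \<le> l" "f \<in> box k (length b)" "g \<in> box k (length b)"
 shows "lookup (psi l b f) g = lookup (psi k b f) g"
 using assms by (intro coefficients_unique[OF qbar.semilin_axioms ZQ_qbar])
  (auto intro: equivE_mono[OF equi_equivE[OF equi_psi]] tri_psi)

text \<open>The case \<open>S = ZQ\<close> of \<open>coefficients_determined\<close>; the diagonal
  coefficients are 1.\<close>

lemma psi_ZQ:
 assumes "ok b" "1 \<le> k" "f \<in> box k (length b)" "g \<in> box k (length b)"
 shows "lookup (psi k b f) g \<in> ZQ"
proof (rule coefficients_determined[OF qbar.semilin_axioms ZQ_qbar assms(2) ZQ.zero ZQ_add ZQ_mult assms(1) _ _ _ assms(3,4)])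
 show "lookup (psi k b f) f \<in> ZQ" if "f \<in> box k (length b)" for f
  using tri_psi[OF assms(1), of k] that ZQ_powi[of 0] by (simp add: tri_def box_def)
qed (use assms in \<open>auto intro: equi_equivE equi_psi tri_trile tri_psi\<close>)

section \<open>Pairs of vectors transported in parallel\<close>

text \<open>The linear span of a set of pairs: a linear relation between two spaces, which takes the
  place of the graph of a map.\<close>

inductive_set psp :: "(vec \<times> vec) set => (vec \<times> vec) set" for G where
 zero: "(0, 0) \<in> psp G"
| step: "(x, x') \<in> G ==> (y, y') \<in> psp G ==> (cst c * x + y, cst c * x' + y') \<in> psp G"

lemma psp_gen: "(x, x') \<in> G ==> (x, x') \<in> psp G"
 using psp.step[OF _ psp.zero, of x x' G 1] by (simp add: cst_simps)

lemma psp_add: "(x, x') \<in> psp G ==> (y, y') \<in> psp G ==> (x + y, x' + y') \<in> psp G"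
 by (induction rule: psp.induct) (auto simp: add.assoc intro: psp.step)

lemma psp_cst: "(x, x') \<in> psp G ==> (cst c * x, cst c * x') \<in> psp G"
 by (induction rule: psp.induct) (auto simp: distrib_left cst_cst intro: psp.zero psp.step)

lemma psp_sum: "(\<And>i. i \<in> A ==> (h i, h' i) \<in> psp G) ==> (sum h A, sum h' A) \<in> psp G"
 by (induction A rule: infinite_finite_induct) (auto intro: psp.zero psp_add)

lemma psp_map:
 assumes "(x, x') \<in> psp G" "\<And>x x'. (x, x') \<in> G ==> (S x, S' x') \<in> psp H"
  "\<And>c x y. S (cst c * x + y) = cst (\<sigma> c) * S x + S y" "\<And>c x y. S' (cst c * x + y) = cst (\<sigma> c) * S' x + S' y"
  "S 0 = 0" "S' 0 = 0"
 shows "(S x, S' x') \<in> psp H"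
 using assms(1) by (induction rule: psp.induct) (auto simp: assms(3-6) intro!: psp.zero psp_add psp_cst assms(2))

lemma psp_len: "(x, x') \<in> psp G ==> (\<And>y y'. (y, y') \<in> G ==> len n y \<and> len n y') ==> len n x \<and> len n x'"
 by (induction rule: psp.induct) (auto intro!: len_simps)

definition prd :: "(vec \<times> vec) set => (vec \<times> vec) set => (vec \<times> vec) set" where
 "prd P Q = {(x * y, x' * y') | x y x' y'. (x, x') \<in> P \<and> (y, y') \<in> Q}"

lemma prd_span: "(x, x') \<in> psp P ==> (y, y') \<in> psp Q ==> (x * y, x' * y') \<in> psp (prd P Q)"
proof -
 assume x: "(x, x') \<in> psp P" and y: "(y, y') \<in> psp Q"
 have "(x * y, x' * y') \<in> psp (prd P Q)" if "(x, x') \<in> P" for x x'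
  using y
 proof (induction rule: psp.induct)
  case (step u u' v v' c)
  have "(x * u, x' * u') \<in> prd P Q" using that step by (auto simp: prd_def)
  then show ?case using step by (simp add: distrib_left cst_left[of x] cst_left[of x'] psp.step)
 qed (simp add: psp.zero)
 from psp_map[OF x, of "\<lambda>x. x * y" "\<lambda>x. x * y'" "prd P Q" "\<lambda>c. c", OF this]
 show ?thesis by (simp add: distrib_right mult.assoc)
qed

definition plen :: "nat => (vec \<times> vec) set => bool" where
 "plen n P \<longleftrightarrow> (\<forall>(x, x')\<in>P. len n x \<and> len n x')"

lemma plen_psp: "plen n P ==> plen n (psp P)"
 unfolding plen_def by (auto dest!: psp_len[of _ _ P n])

lemma plen_prd: "plen n P ==> plen m Q ==> plen (n + m) (prd P Q)"
 by (auto simp: plen_def prd_def intro!: len_simps)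

definition pinv :: "nat => (vec \<times> vec) set => nat list => nat list => bool" where
 "pinv k P b b' \<longleftrightarrow> (\<forall>x\<in>letters k. \<forall>(z, z')\<in>P. (ap (rho b x) z, ap (rho b' x) z') \<in> P)"

lemma pinv_word: "pinv k P b b' ==> set w \<subseteq> letters k ==> (z, z') \<in> P ==>
  (ap (G.chi (rho b) w) z, ap (G.chi (rho b') w) z') \<in> P"
 by (induction w) (auto simp: chi_Cons ap_ring pinv_def)

lemma pair_EV:
 assumes "pinv k (psp P) b1 b1'" "pinv k (psp Q) b2 b2'" "plen (length b1) P" "length b1' = length b1"
  "\<And>w v. (w, v) \<in> keys t ==> set w \<subseteq> letters k \<and> set v \<subseteq> letters k"
  and z: "(z, z') \<in> psp (prd P Q)"
 shows "(ap (EV b1 b2 t) z, ap (EV b1' b2' t) z') \<in> psp (prd P Q)"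
 using z
proof (rule psp_map[where \<sigma> = "\<lambda>c. c"])
 fix z z' assume "(z, z') \<in> prd P Q"
 then obtain x x' y y' where z: "z = x * y" "z' = x' * y'" "(x, x') \<in> P" "(y, y') \<in> Q" by (auto simp: prd_def)
 then have l: "len (length b1) x" "len (length b1) x'" using assms(3) by (auto simp: plen_def)
 show "(ap (EV b1 b2 t) z, ap (EV b1' b2' t) z') \<in> psp (prd P Q)"
  unfolding EV_expand[of _ _ t]
 proof (rule psp_sum)
  fix j assume j: "j \<in> keys t"
  obtain w v where wv: "j = (w, v)" by (cases j)
  show "(ap (EV b1 b2 (single j (lookup t j))) z, ap (EV b1' b2' (single j (lookup t j))) z') \<in> psp (prd P Q)"
   unfolding wv EV_single z ap_tnp_len[OF l(1)] assms(4) ap_tnp_len[OF l(2)]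
   using assms(5)[of w v] j wv z
   by (intro psp_cst prd_span pinv_word[OF assms(1)] pinv_word[OF assms(2)]) (auto intro: psp_gen)
 qed
qed (simp_all add: ap_simps)

lemma quasi_R_letters: "(w, v) \<in> keys (quasi_R k \<mu>) ==> set w \<subseteq> letters k \<and> set v \<subseteq> letters k"
 using quasi_R_keys[of w v k \<mu>] by (auto simp: letters_def)

text \<open>Each term of \<Theta> is a combination of pairs of words acting on the two tensor parts,
  and each part is stable; only finitely many terms act nontrivially on either component.\<close>

lemma pair_TH:
 assumes "pinv k (psp P) b1 b1'" "pinv k (psp Q) b2 b2'" "plen (length b1) P" "plen (length b2) Q"
  "length b1' = length b1" "length b2' = length b2" "ok b1" "ok b2" "ok b1'" "ok b2'"
  and z: "(z, z') \<in> psp (prd P Q)"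
 shows "(TH k b1 b2 z, TH k b1' b2' z') \<in> psp (prd P Q)"
proof -
 have "len (length (b1 @ b2)) z \<and> len (length (b1' @ b2')) z'"
  using z plen_psp[OF plen_prd[OF assms(3,4)]] assms(5,6) by (auto simp: plen_def)
 then have fin: "finite {\<mu>. ap (EV b1 b2 (quasi_R k \<mu>)) z \<noteq> 0}" "finite {\<mu>. ap (EV b1' b2' (quasi_R k \<mu>)) z' \<noteq> 0}"
  using assms by (auto intro: finite_Theta)
 let ?M = "{\<mu>. ap (EV b1 b2 (quasi_R k \<mu>)) z \<noteq> 0} \<union> {\<mu>. ap (EV b1' b2' (quasi_R k \<mu>)) z' \<noteq> 0}"
 have "TH k b1 b2 z = (\<Sum>\<mu>\<in>?M. ap (EV b1 b2 (quasi_R k \<mu>)) z)"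
  "TH k b1' b2' z' = (\<Sum>\<mu>\<in>?M. ap (EV b1' b2' (quasi_R k \<mu>)) z')"
  unfolding TH_def using fin by (auto intro!: Sum_any.expand_superset)
 then show ?thesis
  using pair_EV[OF assms(1-3,5) quasi_R_letters z] by (auto intro!: psp_sum)
qed

lemma pinv_prd:
 assumes "pinv k (psp P) b1 b1'" "pinv k (psp Q) b2 b2'" "plen (length b1) P" "length b1' = length b1"
  "ok b1" "ok b2" "ok b1'" "ok b2'"
 shows "pinv k (psp (prd P Q)) (b1 @ b2) (b1' @ b2')"
 using assms pair_EV[OF assms(1-4) comult_letters]
 unfolding pinv_def by (auto simp: EV_comult ok_def)

text \<open>With diagonal pairs, stability of a relation specializes to stability of the span of the
  box.\<close>

definition bx :: "nat => nat => (vec \<times> vec) set" where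
 "bx k n = {(single f 1, single f 1) | f. f \<in> box k n}"

lemma psp_bx: "(z, z') \<in> psp (bx k n) \<longleftrightarrow> z' = z \<and> keys z \<subseteq> box k n"
proof
 show "z' = z \<and> keys z \<subseteq> box k n" if "(z, z') \<in> psp (bx k n)"
  using that
 proof (induction rule: psp.induct)
  case (step x x' y y' c)
  have "keys (cst c * x + y) \<subseteq> box k n"
  proof
   fix g assume "g \<in> keys (cst c * x + y)"
   then have "lookup x g \<noteq> 0 \<or> g \<in> keys y" by (auto simp: in_keys_iff lookup_add)
   then show "g \<in> box k n" using step by (auto simp: bx_def lookup_single when_def split: if_splits)
  qed
  then show ?case using step by (auto simp: bx_def)
 qed simp
 show "(z, z') \<in> psp (bx k n)" if "z' = z \<and> keys z \<subseteq> box k n"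
 proof -
  have "(\<Sum>f\<in>keys z. cst (lookup z f) * single f 1, \<Sum>f\<in>keys z. cst (lookup z f) * single f 1) \<in> psp (bx k n)"
   by (rule psp_sum) (use that in \<open>auto simp: bx_def intro!: psp_cst[OF psp_gen]\<close>)
  then show ?thesis using that vec_expand[of z] by simp
 qed
qed

lemma plen_bx: "plen n (bx k n)"
 by (auto simp: plen_def bx_def box_def intro: len_simps)

lemma bx_append: "prd (bx k n) (bx k m) = bx k (n + m)"
proof
 show "prd (bx k n) (bx k m) \<subseteq> bx k (n + m)"
 proof
  fix z assume "z \<in> prd (bx k n) (bx k m)"
  then obtain f g where f: "f \<in> box k n" "g \<in> box k m" "z = (single f 1 * single g 1, single f 1 * single g 1)"
   by (auto simp: prd_def bx_def)
  then have "z = (single (f @ g) 1, single (f @ g) 1)" "f @ g \<in> box k (n + m)"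
   by (auto simp: box_def mult_single plus_list_def)
  then show "z \<in> bx k (n + m)" by (auto simp: bx_def)
 qed
 show "bx k (n + m) \<subseteq> prd (bx k n) (bx k m)"
 proof
  fix z assume "z \<in> bx k (n + m)"
  then obtain f where f: "z = (single f 1, single f 1)" "f \<in> box k (n + m)" by (auto simp: bx_def)
  have "take n f \<in> box k n" "drop n f \<in> box k m"
   using f(2) by (auto simp: box_def dest: in_set_takeD in_set_dropD)
  moreover have "single f (1::qfield) = single (take n f) 1 * single (drop n f) 1" by (rule single_split)
  ultimately show "z \<in> prd (bx k n) (bx k m)" unfolding f(1) prd_def bx_def by blast
 qed
qed

lemma pinv_base: "pinv k (psp (bx k (Suc 0))) [s] [s]"
 unfolding pinv_def
proof (intro ballI, clarify)
 fix x z z' assume x: "x \<in> letters k" and z: "(z, z') \<in> psp (bx k (Suc 0))"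
 from z show "(ap (rho [s] x) z, ap (rho [s] x) z') \<in> psp (bx k (Suc 0))"
 proof (rule psp_map[where \<sigma> = "\<lambda>c. c"])
  fix z z' assume "(z, z') \<in> bx k (Suc 0)"
  then obtain c where c: "z = single [c] 1" "z' = single [c] 1" "- int k \<le> c" "c \<le> int k"
   by (auto simp: bx_def box_def length_Suc_conv)
  show "(ap (rho [s] x) z, ap (rho [s] x) z') \<in> psp (bx k (Suc 0))"
   unfolding psp_bx c rho_single using x c(3,4)
   by (cases x; cases "s = 0") (auto simp: ap_V ap_W letters_iff box_def split: if_splits)
 qed (simp_all add: ap_simps)
qed

lemma pinv_bx: "ok b ==> pinv k (psp (bx k (length b))) b b"
proof (induction b rule: rev_induct)
 case (snoc s b)
 show ?case
 proof (cases "b = []")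
  case False
  then have ok: "ok b" "ok [s]" using snoc.prems by (auto simp: ok_def)
  then have "pinv k (psp (prd (bx k (length b)) (bx k (Suc 0)))) (b @ [s]) (b @ [s])"
   using snoc.IH by (intro pinv_prd pinv_base plen_bx) auto
  then show ?thesis by (simp add: bx_append)
 qed (use pinv_base in simp)
qed (simp add: ok_def)

lemma thten_box:
 assumes "ok b1" "ok b2" "f \<in> box k (length (b1 @ b2))"
  "\<And>f. f \<in> box k (length b1) ==> keys (\<phi>1 f) \<subseteq> box k (length b1)"
  "\<And>f. f \<in> box k (length b2) ==> keys (\<phi>2 f) \<subseteq> box k (length b2)"
 shows "keys (thten k b1 b2 \<phi>1 \<phi>2 f) \<subseteq> box k (length (b1 @ b2))"
proof -
 have "take (length b1) f \<in> box k (length b1)" "drop (length b1) f \<in> box k (length b2)"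
  using assms(3) by (auto simp: box_def dest: in_set_takeD in_set_dropD)
 then have "(ten (length b1) \<phi>1 \<phi>2 f, ten (length b1) \<phi>1 \<phi>2 f) \<in> psp (prd (bx k (length b1)) (bx k (length b2)))"
  unfolding ten_def using assms(4,5) by (intro prd_span) (simp_all add: psp_bx)
 from pair_TH[OF pinv_bx[OF assms(1)] pinv_bx[OF assms(2)] plen_bx plen_bx refl refl assms(1,2,1,2) this]
 show ?thesis unfolding thten_def bx_append psp_bx by simp
qed

lemma psi_box: "ok b ==> f \<in> box k (length b) ==> keys (psi k b f) \<subseteq> box k (length b)"
proof (induction b arbitrary: f rule: rev_induct)
 case (snoc s b)
 show ?case
 proof (cases "b = []")
  case False
  then have ok: "ok b" "ok [s]" using snoc.prems by (auto simp: ok_def)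
  have "length f = Suc (length b)" using snoc.prems by (simp add: box_def)
  moreover have "keys (thten k b [s] (psi k b) (psi k [s]) f) \<subseteq> box k (length (b @ [s]))"
   by (rule thten_box[OF ok snoc.prems(2) snoc.IH[OF ok(1)]]) (simp_all add: psi_single)
  ultimately show ?thesis using False by (simp add: psi_thten)
 qed (use snoc.prems in \<open>simp add: psi_single\<close>)
qed (simp add: ok_def)

text \<open>Inside the box this is \<open>coefficients_unique\<close>; outside it both coefficients
  vanish, since both maps preserve the box.\<close>

theorem psi_append:
 assumes "ok b1" "ok b2" "1 \<le> k" "f \<in> box k (length (b1 @ b2))"
 shows "psi k (b1 @ b2) f = thten k b1 b2 (psi k b1) (psi k b2) f"
proof (rule poly_mapping_eqI)
 fix g
 have ok: "ok (b1 @ b2)" using assms by (intro ok_append)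
 show "lookup (psi k (b1 @ b2) f) g = lookup (thten k b1 b2 (psi k b1) (psi k b2) f) g"
 proof (cases "g \<in> box k (length (b1 @ b2))")
  case True
  then show ?thesis using assms ok
   by (intro coefficients_unique[OF qbar.semilin_axioms ZQ_qbar assms(3) ok])
     (auto intro: equi_equivE equi_psi tri_psi equi_thten tri_thten)
 next
  case False
  moreover have "keys (thten k b1 b2 (psi k b1) (psi k b2) f) \<subseteq> box k (length (b1 @ b2))"
   by (rule thten_box[OF assms(1,2,4)]) (rule psi_box[OF assms(1)] psi_box[OF assms(2)]; assumption)+
  ultimately have "g \<notin> keys (psi k (b1 @ b2) f)" "g \<notin> keys (thten k b1 b2 (psi k b1) (psi k b2) f)"
   using psi_box[OF ok assms(4)] False by blast+
  then show ?thesis by (simp add: in_keys_iff)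
 qed
qed

text \<open>The square is a linear map that commutes with the \<open>E_r\<close> and is
  unitriangular, and so is the identity.\<close>

theorem psi_involution:
 assumes "ok b" "1 \<le> k" "f \<in> box k (length b)"
 shows "al (psi k b) (psi k b f) = single f 1"
proof (rule poly_mapping_eqI)
 fix g
 let ?\<phi> = "\<lambda>f. al (psi k b) (psi k b f)"
 have sl: "sl_ext (\<lambda>c. c) ?\<phi> z = al (psi k b) (al (psi k b) z)" for z
  by (subst sl_ext_sl[OF qbar.semilin_axioms]) simp
 show "lookup (al (psi k b) (psi k b f)) g = lookup (single f 1) g"
 proof (cases "g \<in> box k (length b)")
  case True
  show ?thesis
  proof (rule coefficients_unique[OF id_semilin.semilin_axioms _ assms(2,1) _ _ _ _ assms(3) True])
   show "tri b ?\<phi>" by (intro tri_comp qbar.semilin_axioms tri_psi assms(1))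
   show "tri b (\<lambda>f. single f 1)" by (auto simp: tri_def bruhat_refl)
   show "equivE k b (\<lambda>c. c) (\<lambda>f. single f 1)"
    unfolding equivE_def sl_ext_def by (auto simp flip: vec_expand)
   show "equivE k b (\<lambda>c. c) ?\<phi>"
    unfolding equivE_def sl
   proof (intro allI impI)
    fix r and f :: "int list" assume r: "- int k \<le> r" "r \<le> int k - 1" and f: "length f = length b"
    have x: "gE r \<in> letters k" using r by (simp add: letters_iff)
    have l: "len (length b) (single f (1::qfield))" "len (length b) (psi k b f)"
     using f by (auto intro: len_simps len_psi)
    show "al (psi k b) (al (psi k b) (ap (rho b (gE r)) (single f 1))) = ap (rho b (gE r)) (?\<phi> f)"
     using equi_psi[OF assms(1), of k] x l by (simp add: equi_def cst_simps)
   qed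
  qed simp
 next
  case False
  have "keys (?\<phi> f) \<subseteq> box k (length b)"
   using keys_sl_ext[of qbar "psi k b" "psi k b f"] psi_box[OF assms(1)] assms(3) by blast
  then show ?thesis using False assms(3) by (auto simp: in_keys_iff lookup_single when_def)
 qed
qed

lemma box_mono: "k \<le> l ==> box k n \<subseteq> box l n"
proof
 assume "k \<le> l"
 then have "{- int k..int k} \<subseteq> {- int l..int l}" by auto
 then show "f \<in> box l n" if "f \<in> box k n" for f using that by (auto simp: box_def simp del: atLeastatMost_subset_iff)
qed

lemma bar_coeff_eq:
 assumes "ok b" "1 \<le> k" "f \<in> box k (length b)" "g \<in> box k (length b)"
 shows "bar_coeff b f g = lookup (psi k b f) g"
 unfolding bar_coeff_def
proof (rule the_equality)
 show ev: "\<forall>\<^sub>F l in sequentially. lookup (psi l b f) g = lookup (psi k b f) g"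
  by (rule eventually_sequentiallyI[of k]) (rule psi_stable[OF assms(1,2) _ assms(3,4)])
 fix c assume "\<forall>\<^sub>F l in sequentially. lookup (psi l b f) g = c"
 from eventually_conj[OF this ev] have "\<forall>\<^sub>F l :: nat in sequentially. c = lookup (psi k b f) g"
  by (rule eventually_mono) auto
 then show "c = lookup (psi k b f) g" by simp
qed

lemma bar_coeff_length:
 assumes "ok b" "length f = length b" "length g \<noteq> length b"
 shows "bar_coeff b f g = 0"
proof -
 have "lookup (psi l b f) g = 0" for l
  using len_psi[OF assms(2), of l] assms(3) by (auto simp: len_def in_keys_iff)
 then show ?thesis unfolding bar_coeff_def by (intro the_equality) simp_all
qed

section \<open>The spaces spanned by the \<open>U\<^sub>f\<close>\<close>

lemma single2: "single [c, d] v = single [c] 1 * single [d] (v::qfield)"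
 by (simp add: mult_single plus_list_def)

abbreviation "VW \<equiv> [0, Suc 0]"
abbreviation "WV \<equiv> [Suc 0, 0]"

lemma rho_VW: "rho VW = tns (Suc 0) (base 0) (base (Suc 0))" "rho WV = tns (Suc 0) (base (Suc 0)) (base 0)"
 using rho_snoc[of "[0]" "Suc 0"] rho_snoc[of "[Suc 0]" 0] by (simp_all add: rho_single)

lemma tnp2: "ap (tnp (Suc 0) S T) (single [c, d] v) = ap S (single [c] 1) * ap T (single [d] v)"
 unfolding single2 by (intro ap_tnp_len len_simps) simp

lemma qq_cancel: "inverse qq * (qq * v) = v" "qq * (v * inverse qq) = v"
 using qq_nonzero by simp_all

lemma act2:
 "ap (rho VW (gE r)) (single [c, d] v) = (if d = r then single [c, r + 1] v else 0)
   + (if c = r + 1 then single [r, d] (qq powi (of_bool (d = r) - of_bool (d = r + 1)) * v) else 0)"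
 "ap (rho WV (gE r)) (single [c, d] v) = (if d = r + 1 then single [c, r] v else 0)
   + (if c = r then single [r + 1, d] (qq powi (of_bool (d = r + 1) - of_bool (d = r)) * v) else 0)"
 "ap (rho VW (gF r)) (single [c, d] v) = (if c = r then single [r + 1, d] v else 0)
   + (if d = r + 1 then single [c, r] (qq powi (of_bool (c = r) - of_bool (c = r + 1)) * v) else 0)"
 "ap (rho WV (gF r)) (single [c, d] v) = (if c = r + 1 then single [r, d] v else 0)
   + (if d = r then single [c, r + 1] (qq powi (of_bool (c = r + 1) - of_bool (c = r)) * v) else 0)"
 "ap (rho VW (gK r)) (single [c, d] v) = single [c, d] (qq powi (of_bool (c = r) - of_bool (d = r)) * v)"
 "ap (rho WV (gK r)) (single [c, d] v) = single [c, d] (qq powi (of_bool (d = r) - of_bool (c = r)) * v)"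
 "ap (rho VW (gKinv r)) (single [c, d] v) = single [c, d] (qq powi (of_bool (d = r) - of_bool (c = r)) * v)"
 "ap (rho WV (gKinv r)) (single [c, d] v) = single [c, d] (qq powi (of_bool (c = r) - of_bool (d = r)) * v)"
 unfolding rho_VW tns_simps
 by (auto simp: ap_ring tnp2 ap_V ap_W mult_single plus_list_def mult.commute qq_nonzero qq_cancel)

definition uV :: "int => int => vec" where
 "uV c d = single [c, d] 1 + (if c = d then single [c - 1, d - 1] qq else 0)"

text \<open>The vector \<open>U'\<close> whose index is obtained from (c, d) by \<open>fU\<close>,
  so that it corresponds to \<open>uV c d\<close>.\<close>

definition uW :: "int => int => vec" where
 "uW c d = (if c = d then single [c - 1, c - 1] 1 + single [c, c] qq else single [d, c] 1)"

text \<open>The action of the generators written for an abstract family u. That the same formula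
  fits \<open>uV\<close> and \<open>uW\<close> (\<open>comb_V\<close>, \<open>comb_W\<close>) is the
  module isomorphism for two tensor factors.\<close>

definition comb :: "gen => int => int => (int => int => vec) => vec" where
 "comb x c d u = (case x of
   gE r => if c = d then cst (if c = r \<or> c = r + 2 then 1 else if c = r + 1 then qq + inverse qq else 0) * u r (r + 1)
    else if d = r then u c (r + 1) else if c = r + 1 then u r d else 0
  | gF r => if c = d then cst (if c = r \<or> c = r + 2 then 1 else if c = r + 1 then qq + inverse qq else 0) * u (r + 1) r
    else if d = r + 1 then (if c = r then u (r + 1) (r + 1) else u c r) else if c = r then u (r + 1) d else 0
  | gK r => cst (qq powi (of_bool (c = r) - of_bool (d = r))) * u c d
  | gKinv r => cst (qq powi (of_bool (d = r) - of_bool (c = r))) * u c d)"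

lemma comb_V: "ap (rho VW x) (uV c d) = comb x c d uV"
 and comb_W: "ap (rho WV x) (uW c d) = comb x c d uW"
 by (cases x; auto simp: comb_def uV_def uW_def ap_simps(1,2) act2 cst_single distrib_left qq_nonzero single_add add.commute)+

text \<open>The exception is c = d = - k, where a term of each of \<open>uV\<close> and
  \<open>uW\<close> would leave the box.\<close>

definition I2 :: "nat => (int \<times> int) set" where
 "I2 k = {(c, d). - int k \<le> c \<and> c \<le> int k \<and> - int k \<le> d \<and> d \<le> int k \<and> (c = d --> c \<noteq> - int k)}"

definition GU :: "nat => nat => nat => (vec \<times> vec) set" where
 "GU k n1 n2 = {(single f1 1 * uV c d * single f2 1, single f1 1 * uW c d * single f2 1) | f1 f2 c d.
   f1 \<in> box k n1 \<and> f2 \<in> box k n2 \<and> (c, d) \<in> I2 k}"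

lemma box_0: "f \<in> box k 0 \<longleftrightarrow> f = []"
 by (auto simp: box_def)

lemma GU_0: "GU k 0 0 = {(uV c d, uW c d) | c d. (c, d) \<in> I2 k}"
 by (simp add: GU_def box_0 single_Nil_list)

lemma GU_left: "prd (bx k n) (GU k 0 0) = GU k n 0"
proof
 show "prd (bx k n) (GU k 0 0) \<subseteq> GU k n 0"
  unfolding GU_0 by (auto simp: GU_def prd_def bx_def box_0 single_Nil_list)
 show "GU k n 0 \<subseteq> prd (bx k n) (GU k 0 0)"
 proof
  fix z assume "z \<in> GU k n 0"
  then obtain f c d where "z = (single f 1 * uV c d, single f 1 * uW c d)" "f \<in> box k n" "(c, d) \<in> I2 k"
   by (auto simp: GU_def box_0 single_Nil_list)
  then show "z \<in> prd (bx k n) (GU k 0 0)" unfolding GU_0 prd_def bx_def by blast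
 qed
qed

lemma GU_right: "prd (GU k n1 n2) (bx k (Suc 0)) = GU k n1 (Suc n2)"
proof
 show "prd (GU k n1 n2) (bx k (Suc 0)) \<subseteq> GU k n1 (Suc n2)"
 proof
  fix z assume "z \<in> prd (GU k n1 n2) (bx k (Suc 0))"
  then obtain f1 f2 c d f3 where f: "f1 \<in> box k n1" "f2 \<in> box k n2" "(c, d) \<in> I2 k" "f3 \<in> box k (Suc 0)"
   "z = (single f1 1 * uV c d * single f2 1 * single f3 1, single f1 1 * uW c d * single f2 1 * single f3 1)"
   by (auto simp: prd_def GU_def bx_def)
  have "z = (single f1 1 * uV c d * single (f2 @ f3) 1, single f1 1 * uW c d * single (f2 @ f3) 1)"
   unfolding f(5) single_append mult.assoc by (rule refl)
  moreover have "f2 @ f3 \<in> box k (Suc n2)" using f by (auto simp: box_def)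
  ultimately show "z \<in> GU k n1 (Suc n2)" using f(1,3) unfolding GU_def by blast
 qed
 show "GU k n1 (Suc n2) \<subseteq> prd (GU k n1 n2) (bx k (Suc 0))"
 proof
  fix z assume "z \<in> GU k n1 (Suc n2)"
  then obtain f1 f2 c d where f: "f1 \<in> box k n1" "f2 \<in> box k (Suc n2)" "(c, d) \<in> I2 k"
   "z = (single f1 1 * uV c d * single f2 1, single f1 1 * uW c d * single f2 1)"
   unfolding GU_def by blast
  obtain g a where g: "f2 = g @ [a]" using f(2) by (cases f2 rule: rev_cases) (auto simp: box_def)
  have "g \<in> box k n2" "[a] \<in> box k (Suc 0)" using f(2) by (auto simp: g box_def)
  moreover have "z = (single f1 1 * uV c d * single g 1 * single [a] 1, single f1 1 * uW c d * single g 1 * single [a] 1)"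
   unfolding f(4) g single_append mult.assoc by (rule refl)
  ultimately show "z \<in> prd (GU k n1 n2) (bx k (Suc 0))"
   using f(1,3) unfolding prd_def GU_def bx_def by blast
 qed
qed

lemma len_u: "len 2 (uV c d)" "len 2 (uW c d)"
 unfolding uV_def uW_def by (auto intro!: len_simps)

lemma plen_GU: "plen (n1 + 2 + n2) (GU k n1 n2)"
proof -
 have "len (n1 + 2 + n2) (single f1 1 * uV c d * single f2 1)" "len (n1 + 2 + n2) (single f1 1 * uW c d * single f2 1)"
  if "f1 \<in> box k n1" "f2 \<in> box k n2" for f1 f2 c d
 proof -
  have l: "len n1 (single f1 (1::qfield))" "len n2 (single f2 (1::qfield))"
   using that by (auto simp: box_def intro: len_simps)
  show "len (n1 + 2 + n2) (single f1 1 * uV c d * single f2 1)" "len (n1 + 2 + n2) (single f1 1 * uW c d * single f2 1)"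
   by (rule len_simps(6)[OF len_simps(6)[OF l(1) len_u(1)] l(2)] len_simps(6)[OF len_simps(6)[OF l(1) len_u(2)] l(2)])+
 qed
 then show ?thesis unfolding plen_def GU_def by blast
qed

lemma ok_VW: "ok VW" "ok WV"
 by (simp_all add: ok_def)

lemma pinv_VW: "pinv k (psp (GU k 0 0)) VW WV"
 unfolding pinv_def
proof (intro ballI, clarify)
 fix x z z' assume x: "x \<in> letters k" and z: "(z, z') \<in> psp (GU k 0 0)"
 from z show "(ap (rho VW x) z, ap (rho WV x) z') \<in> psp (GU k 0 0)"
 proof (rule psp_map[where \<sigma> = "\<lambda>c. c"])
  fix z z' assume "(z, z') \<in> GU k 0 0"
  then obtain c d where z: "z = uV c d" "z' = uW c d" "(c, d) \<in> I2 k" by (auto simp: GU_0)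
  have u: "(uV c d, uW c d) \<in> psp (GU k 0 0)" if "(c, d) \<in> I2 k" for c d
   using that by (intro psp_gen) (auto simp: GU_0)
  show "(ap (rho VW x) z, ap (rho WV x) z') \<in> psp (GU k 0 0)"
   unfolding z(1,2) comb_V comb_W using x z(3)
   by (cases x) (auto simp: comb_def letters_iff I2_def intro!: psp_cst u psp.zero)
 qed (simp_all add: ap_simps)
qed

lemma pinv_GU:
 assumes "b1 = [] \<or> ok b1" "b2 = [] \<or> ok b2"
 shows "pinv k (psp (GU k (length b1) (length b2))) (b1 @ VW @ b2) (b1 @ WV @ b2)"
 using assms(2)
proof (induction b2 rule: rev_induct)
 case Nil
 show ?case
 proof (cases "b1 = []")
  case False
  then have ok: "ok b1" using assms(1) by simp
  from pinv_prd[OF pinv_bx[OF ok] pinv_VW plen_bx refl ok ok_VW(1) ok ok_VW(2), of k]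
  show ?thesis by (simp add: GU_left)
 qed (simp add: pinv_VW)
next
 case (snoc s b2)
 have "ok (b1 @ VW @ b2)" "ok (b1 @ WV @ b2)" "ok [s]" "b2 = [] \<or> ok b2"
  using snoc.prems assms(1) by (auto simp: ok_def)
 moreover have "plen (length (b1 @ VW @ b2)) (GU k (length b1) (length b2))"
  using plen_GU[of "length b1" "length b2" k] by (simp add: add.assoc)
 ultimately have "pinv k (psp (prd (GU k (length b1) (length b2)) (bx k (Suc 0)))) ((b1 @ VW @ b2) @ [s]) ((b1 @ WV @ b2) @ [s])"
  using snoc.IH by (intro pinv_prd pinv_base) auto
 then show ?case by (simp add: GU_right)
qed

lemma sharp2: "sharp VW [x, y] r 0 = of_bool (x \<le> r) - of_bool (y \<le> r)"
 "sharp WV [x, y] r 0 = of_bool (y \<le> r) - of_bool (x \<le> r)"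
 using sharp_append[of "[x]" "[0]" "[y]" "[Suc 0]" r 0] sharp_append[of "[x]" "[Suc 0]" "[y]" "[0]" r 0]
 by (simp_all add: sharp_single)

lemma weight_inj:
 fixes c d x y :: int
 assumes "c \<noteq> d" "\<And>r. of_bool (x \<le> r) - of_bool (y \<le> r) = (of_bool (c \<le> r) - of_bool (d \<le> r) :: int)"
 shows "x = c \<and> y = d"
proof (cases "c < d")
 case True
 then show ?thesis using assms(2)[of c] assms(2)[of "c - 1"] assms(2)[of d] assms(2)[of "d - 1"]
  by (auto simp: of_bool_def split: if_splits)
next
 case False
 then show ?thesis using assms(1) assms(2)[of c] assms(2)[of "c - 1"] assms(2)[of d] assms(2)[of "d - 1"]
  by (auto simp: of_bool_def split: if_splits)
qed

text \<open>For c \<noteq> d the weight, that is \<open>sharp\<close> at j = 0, determines the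
  sequence (\<open>weight_inj\<close>), so no other sequence lies below it.\<close>

lemma psi_2:
 assumes "c \<noteq> d"
 shows "psi k VW [c, d] = single [c, d] 1" "psi k WV [d, c] = single [d, c] 1"
proof -
 have 1: "psi k b f = single f 1" if "tri b (psi k b)" "length f = length b" "\<And>g. bruhat_le b g f ==> g = f" for b f
 proof (rule poly_mapping_eqI)
  fix g show "lookup (psi k b f) g = lookup (single f 1) g"
  proof (cases "g = f")
   case False
   then have "g \<notin> keys (psi k b f)" using that unfolding tri_def by blast
   then show ?thesis using False by (simp add: in_keys_iff lookup_single)
  qed (use that in \<open>simp add: tri_def\<close>)
 qed
 have two: "\<exists>x y. g = [x, y]" if "length g = Suc (Suc 0)" for g :: "int list"
  using that by (auto simp: length_Suc_conv)
 show "psi k VW [c, d] = single [c, d] 1"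
 proof (rule 1[OF tri_psi[OF ok_VW(1)]])
  fix g assume le: "bruhat_le VW g [c, d]"
  have "length g = Suc (Suc 0)" using le by (simp add: bruhat_le_def)
  then obtain x y where g: "g = [x, y]" using two by blast
  have "sharp VW [x, y] r 0 = sharp VW [c, d] r 0" for r using le g by (simp add: bruhat_le_def)
  then have "x = c \<and> y = d" unfolding sharp2 by (intro weight_inj[OF assms])
  then show "g = [c, d]" by (simp add: g)
 qed simp
 show "psi k WV [d, c] = single [d, c] 1"
 proof (rule 1[OF tri_psi[OF ok_VW(2)]])
  fix g assume le: "bruhat_le WV g [d, c]"
  have "length g = Suc (Suc 0)" using le by (simp add: bruhat_le_def)
  then obtain x y where g: "g = [x, y]" using two by blast
  have "sharp WV [x, y] r 0 = sharp WV [d, c] r 0" for r using le g by (simp add: bruhat_le_def)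
  then have "y = c \<and> x = d" unfolding sharp2 by (intro weight_inj[OF assms])
  then show "g = [d, c]" by (simp add: g)
 qed simp
qed

text \<open>\<open>U\<close> and \<open>U'\<close> with equal indices are images of bar-invariant basis vectors under some \<open>E\<^sub>r\<close>.\<close>

lemma psi_u:
 assumes "(c, d) \<in> I2 k"
 shows "al (psi k VW) (uV c d) = uV c d" "al (psi k WV) (uW c d) = uW c d"
proof -
 have ne: "al (psi k VW) (uV c d) = uV c d" "al (psi k WV) (uW c d) = uW c d" if "c \<noteq> d" for c d
  using that by (simp_all add: uV_def uW_def psi_2 cst_simps)
 have eq: "al (psi k VW) (uV c c) = uV c c" "al (psi k WV) (uW c c) = uW c c" if "- int k < c" "c \<le> int k" for c
 proof -
  have x: "gE (c - 1) \<in> letters k" using that by (simp add: letters_iff)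
  have u: "uV c c = ap (rho VW (gE (c - 1))) (uV c (c - 1))" "uW c c = ap (rho WV (gE (c - 1))) (uW c (c - 1))"
   unfolding comb_V comb_W by (simp_all add: comb_def)
  have l: "len (length VW) (uV c (c - 1))" "len (length WV) (uW c (c - 1))"
   using len_u by (simp_all add: numeral_2_eq_2)
  have "al (psi k VW) (ap (rho VW (gE (c - 1))) (uV c (c - 1))) = ap (rho VW (bar_gen (gE (c - 1)))) (al (psi k VW) (uV c (c - 1)))"
   "al (psi k WV) (ap (rho WV (gE (c - 1))) (uW c (c - 1))) = ap (rho WV (bar_gen (gE (c - 1)))) (al (psi k WV) (uW c (c - 1)))"
   using equi_psi[OF ok_VW(1), of k] equi_psi[OF ok_VW(2), of k] x l unfolding equi_def by blast+
  then show "al (psi k VW) (uV c c) = uV c c" "al (psi k WV) (uW c c) = uW c c"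
   unfolding u by (simp_all add: ne)
 qed
 show "al (psi k VW) (uV c d) = uV c d" "al (psi k WV) (uW c d) = uW c d"
  using ne[of c d] eq[of c] assms by (cases "c = d"; simp add: I2_def)+
qed

lemma al_psi_snoc:
 assumes "ok b" "ok [s]" "len (length b) z"
 shows "al (psi k (b @ [s])) (z * single [a] 1) = TH k b [s] (al (psi k b) z * single [a] 1)"
proof -
 have l: "len (length (b @ [s])) (z * single [a] 1)"
  using len_simps(6)[OF assms(3) len_simps(4)[of "[a]" 1 1]] by simp
 have "al (psi k (b @ [s])) (z * single [a] 1) = al (thten k b [s] (psi k b) (psi k [s])) (z * single [a] 1)"
  using l assms(1) by (intro sl_ext_cong psi_thten) (auto simp: len_def ok_def)
 also have "\<dots> = TH k b [s] (al (psi k b) z * al (psi k [s]) (single [a] 1))"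
  using equi_psi[OF assms(1), of k] equi_psi[OF assms(2), of k] l
  by (subst al_thten[OF assms(1,2)]) (auto simp: equi_def al_ten[OF assms(3)])
 finally show ?thesis by (simp add: psi_single cst_simps)
qed

lemma al_psi_append:
 assumes "ok b1" "ok b2" "1 \<le> k" "f \<in> box k (length b1)" "keys z \<subseteq> box k (length b2)"
 shows "al (psi k (b1 @ b2)) (single f 1 * z) = TH k b1 b2 (psi k b1 f * al (psi k b2) z)"
proof -
 have lf: "len (length b1) (single f (1::qfield))" "len (length b2) z"
  using assms(4,5) by (auto simp: box_def len_def)
 then have l: "len (length (b1 @ b2)) (single f 1 * z)" using len_simps(6) by simp
 have "al (psi k (b1 @ b2)) (single f 1 * z) = al (thten k b1 b2 (psi k b1) (psi k b2)) (single f 1 * z)"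
 proof (intro sl_ext_cong psi_append assms(1-3))
  fix g assume "g \<in> keys (single f 1 * z)"
  then obtain h where "h \<in> keys z" "g = f @ h"
   using keys_mult_append[of g "single f 1" z] by auto
  then show "g \<in> box k (length (b1 @ b2))" using assms(4,5) by (auto simp: box_def)
 qed
 also have "\<dots> = TH k b1 b2 (al (psi k b1) (single f 1) * al (psi k b2) z)"
  using equi_psi[OF assms(1), of k] equi_psi[OF assms(2), of k] l
  by (subst al_thten[OF assms(1,2)]) (auto simp: equi_def al_ten[OF lf(1)])
 finally show ?thesis by (simp add: cst_simps)
qed

text \<open>The factors of \<open>b2\<close> are appended one at a time by the recursion of
  \<open>psi\<close>; the base case joins \<open>b1\<close> to the two exchanged factors by
  \<open>psi_append\<close>.\<close>

theorem psi_GU: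
 assumes "b1 = [] \<or> ok b1" "b2 = [] \<or> ok b2" "1 \<le> k" "(z, z') \<in> psp (GU k (length b1) (length b2))"
 shows "(al (psi k (b1 @ VW @ b2)) z, al (psi k (b1 @ WV @ b2)) z') \<in> psp (GU k (length b1) (length b2))"
 using assms(2,4)
proof (induction b2 arbitrary: z z' rule: rev_induct)
 case Nil
 from Nil(2) show ?case
 proof (rule psp_map[where \<sigma> = qbar])
  fix z z' assume "(z, z') \<in> GU k (length b1) (length [])"
  then obtain f c d where f: "f \<in> box k (length b1)" "(c, d) \<in> I2 k" "z = single f 1 * uV c d" "z' = single f 1 * uW c d"
   by (auto simp: GU_def box_0 single_Nil_list)
  have g: "(uV c d, uW c d) \<in> GU k 0 0" using f(2) by (auto simp: GU_0)
  show "(al (psi k (b1 @ VW @ [])) z, al (psi k (b1 @ WV @ [])) z') \<in> psp (GU k (length b1) (length []))"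
  proof (cases "b1 = []")
   case True
   then show ?thesis using f psp_gen[OF g] psi_u[OF f(2)] by (simp add: box_0 single_Nil_list)
  next
   case False
   then have ok: "ok b1" using assms(1) by simp
   have u: "keys (uV c d) \<subseteq> box k (length VW)" "keys (uW c d) \<subseteq> box k (length WV)"
   proof -
    have "x \<in> box k (length VW)" if "lookup (uV c d) x \<noteq> 0 \<or> lookup (uW c d) x \<noteq> 0" for x
     using that f(2) by (auto simp: uV_def uW_def lookup_add lookup_single when_def box_def I2_def split: if_splits)
    then show "keys (uV c d) \<subseteq> box k (length VW)" "keys (uW c d) \<subseteq> box k (length WV)"
     by (auto simp: in_keys_iff)
   qed
   have "(psi k b1 f, psi k b1 f) \<in> psp (bx k (length b1))"
    using psi_box[OF ok f(1)] by (simp add: psp_bx)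
   then have "(psi k b1 f * uV c d, psi k b1 f * uW c d) \<in> psp (prd (bx k (length b1)) (GU k 0 0))"
    by (rule prd_span) (rule psp_gen[OF g])
   moreover have "plen (length VW) (GU k 0 0)" using plen_GU[of 0 0 k] by (simp add: numeral_2_eq_2)
   ultimately have "(TH k b1 VW (psi k b1 f * uV c d), TH k b1 WV (psi k b1 f * uW c d)) \<in> psp (prd (bx k (length b1)) (GU k 0 0))"
    by (intro pair_TH pinv_bx pinv_VW plen_bx ok ok_VW) auto
   then show ?thesis
    using al_psi_append[OF ok ok_VW(1) assms(3) f(1) u(1)] al_psi_append[OF ok ok_VW(2) assms(3) f(1) u(2)] psi_u[OF f(2)] f(3,4)
    by (simp add: GU_left)
  qed
 qed (simp_all add: qbar.sl_ext_add qbar.sl_ext_cst)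
next
 case (snoc s b2)
 have ok: "ok (b1 @ VW @ b2)" "ok (b1 @ WV @ b2)" "ok [s]" and ok2: "b2 = [] \<or> ok b2"
  using snoc.prems(1) assms(1) by (auto simp: ok_def)
 let ?P = "GU k (length b1) (length b2)"
 have pl: "plen (length (b1 @ VW @ b2)) ?P" "plen (length (b1 @ WV @ b2)) ?P"
  using plen_GU[of "length b1" "length b2" k] by (simp_all add: add.assoc)
 have eq: "GU k (length b1) (length (b2 @ [s])) = prd ?P (bx k (Suc 0))" by (simp add: GU_right)
 from snoc.prems(2) show ?case
  unfolding eq
 proof (rule psp_map[where \<sigma> = qbar])
  fix z z' assume "(z, z') \<in> prd ?P (bx k (Suc 0))"
  then obtain y y' f where y: "(y, y') \<in> ?P" "f \<in> box k (Suc 0)" "z = y * single f 1" "z' = y' * single f 1"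
   by (auto simp: prd_def bx_def)
  then obtain a where a: "f = [a]" by (auto simp: box_def length_Suc_conv)
  have l: "len (length (b1 @ VW @ b2)) y" "len (length (b1 @ WV @ b2)) y'"
   using pl y(1) by (auto simp: plen_def)
  have "(al (psi k (b1 @ VW @ b2)) y * single [a] 1, al (psi k (b1 @ WV @ b2)) y' * single [a] 1) \<in> psp (prd ?P (bx k (Suc 0)))"
   using y(2) a by (intro prd_span snoc.IH[OF ok2 psp_gen[OF y(1)]]) (simp add: psp_bx)
  then have "(TH k (b1 @ VW @ b2) [s] (al (psi k (b1 @ VW @ b2)) y * single [a] 1),
    TH k (b1 @ WV @ b2) [s] (al (psi k (b1 @ WV @ b2)) y' * single [a] 1)) \<in> psp (prd ?P (bx k (Suc 0)))"
   using plen_bx[of "Suc 0" k] by (intro pair_TH pinv_GU pinv_base pl(1) assms(1) ok2 ok) auto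
  then show "(al (psi k (b1 @ VW @ b2 @ [s])) z, al (psi k (b1 @ WV @ b2 @ [s])) z') \<in> psp (prd ?P (bx k (Suc 0)))"
   using al_psi_snoc[OF ok(1,3) l(1), of k a] al_psi_snoc[OF ok(2,3) l(2), of k a] y(3,4) a by simp
 qed (simp_all add: qbar.sl_ext_add qbar.sl_ext_cst)
qed

definition Iset :: "nat => nat => nat => int list set" where
 "Iset k n pos = {f \<in> box k n. f ! pos = f ! (pos + 1) --> f ! pos \<noteq> - int k}"

definition UM :: "nat => int list => vec" where
 "UM pos f = single f 1 + (if f ! pos = f ! (pos + 1) then single (down pos f) qq else 0)"

text \<open>The vector \<open>U'\<close> with index \<open>fU pos f\<close>; see
  \<open>ub_eq\<close>.\<close>

definition UM' :: "nat => int list => vec" where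
 "UM' pos f = (if f ! pos = f ! (pos + 1) then single (down pos f) 1 + single f qq else single (swap_at pos f) 1)"

lemma GU_eq: "GU k n1 n2 = {(UM n1 f, UM' n1 f) | f. f \<in> Iset k (n1 + 2 + n2) n1}"
proof -
 have u: "single f1 1 * uV c d * single f2 1 = UM (length f1) (f1 @ [c, d] @ f2)"
  "single f1 1 * uW c d * single f2 1 = UM' (length f1) (f1 @ [c, d] @ f2)" for f1 f2 c d
  by (auto simp: uV_def uW_def UM_def UM'_def down_def swap_at_def nth_append list_update_append
    mult_single plus_list_def distrib_left distrib_right)
 have I: "f1 @ [c, d] @ f2 \<in> Iset k (n1 + 2 + n2) n1 \<longleftrightarrow> (f1 \<in> box k n1 \<and> f2 \<in> box k n2 \<and> (c, d) \<in> I2 k)"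
  if "length f1 = n1" for f1 f2 c d
  using that by (auto simp: Iset_def box_def I2_def nth_append)
 show ?thesis
 proof (intro set_eqI iffI)
  fix z assume "z \<in> GU k n1 n2"
  then obtain f1 f2 c d where f: "f1 \<in> box k n1" "f2 \<in> box k n2" "(c, d) \<in> I2 k"
   "z = (single f1 1 * uV c d * single f2 1, single f1 1 * uW c d * single f2 1)"
   unfolding GU_def by blast
  then have "length f1 = n1" by (simp add: box_def)
  then show "z \<in> {(UM n1 f, UM' n1 f) | f. f \<in> Iset k (n1 + 2 + n2) n1}"
   using I[of f1 c d f2] f u[of f1 c d f2] by blast
 next
  fix z assume "z \<in> {(UM n1 f, UM' n1 f) | f. f \<in> Iset k (n1 + 2 + n2) n1}"
  then obtain f where f: "z = (UM n1 f, UM' n1 f)" "f \<in> Iset k (n1 + 2 + n2) n1" by blast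
  then have l: "length f = n1 + 2 + n2" by (simp add: Iset_def box_def)
  then have fe: "f = take n1 f @ [f ! n1, f ! Suc n1] @ drop (n1 + 2) f"
   by (simp add: Cons_nth_drop_Suc)
  have "length (take n1 f) = n1" using l by simp
  then have "take n1 f \<in> box k n1 \<and> drop (n1 + 2) f \<in> box k n2 \<and> (f ! n1, f ! Suc n1) \<in> I2 k"
   using I[of "take n1 f" "f ! n1" "f ! Suc n1" "drop (n1 + 2) f"] f(2) fe by simp
  moreover have "z = (single (take n1 f) 1 * uV (f ! n1) (f ! Suc n1) * single (drop (n1 + 2) f) 1,
   single (take n1 f) 1 * uW (f ! n1) (f ! Suc n1) * single (drop (n1 + 2) f) 1)"
   unfolding u f(1) using \<open>length (take n1 f) = n1\<close> fe by simp
  ultimately show "z \<in> GU k n1 n2" unfolding GU_def by blast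
 qed
qed

text \<open>Membership in the span of the pairs means that both bar images have the same coordinates
  y.\<close>

theorem psi_U:
 assumes "b1 = [] \<or> ok b1" "b2 = [] \<or> ok b2" "1 \<le> k" "n = length b1 + 2 + length b2" "pos = length b1"
  "f \<in> Iset k n pos"
 obtains y where "keys y \<subseteq> Iset k n pos"
  "al (psi k (b1 @ [0, 1] @ b2)) (UM pos f) = lin_ext (UM pos) y"
  "al (psi k (b1 @ [1, 0] @ b2)) (UM' pos f) = lin_ext (UM' pos) y"
proof -
 have "\<exists>y. keys y \<subseteq> Iset k n pos \<and> x = lin_ext (UM pos) y \<and> x' = lin_ext (UM' pos) y"
  if "(x, x') \<in> psp (GU k pos (length b2))" for x x'
  using that
 proof (induction rule: psp.induct)
  case (step x x' z z' c)
  then obtain y where y: "keys y \<subseteq> Iset k n pos" "z = lin_ext (UM pos) y" "z' = lin_ext (UM' pos) y" by blast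
  obtain h where h: "h \<in> Iset k n pos" "x = UM pos h" "x' = UM' pos h"
   using step(1) unfolding GU_eq assms(4,5) by blast
  have "keys (single h c + y) \<subseteq> Iset k n pos"
  proof
   fix g assume "g \<in> keys (single h c + y)"
   then have "g = h \<or> g \<in> keys y" by (auto simp: in_keys_iff lookup_add lookup_single when_def split: if_splits)
   then show "g \<in> Iset k n pos" using h y by auto
  qed
  then show ?case using h y by (intro exI[of _ "single h c + y"]) (simp add: lin_ext_simps)
 qed (auto simp: lin_ext_simps intro!: exI[of _ 0])
 moreover have "(UM pos f, UM' pos f) \<in> GU k (length b1) (length b2)"
  unfolding GU_eq using assms(4-6) by blast
 ultimately show ?thesis
  using psi_GU[OF assms(1-3) psp_gen] that unfolding assms(5) One_nat_def by blast
qed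

section \<open>Laurent polynomials and bar invariance\<close>

lemma Fract_int_poly: "Fract (map_poly rat_of_int p) 1 = poly (map_poly of_int p) qq"
proof (induction p)
 case (pCons a p)
 have "kap (rat_of_int a) = of_int a"
 proof -
  have "kap (of_nat n) = of_nat n" for n by (induction n) (simp_all add: kap_add)
  moreover have "kap (- x) = - kap x" for x using kap_add[of x "- x"] by (simp add: eq_neg_iff_add_eq_0 add.commute)
  ultimately show ?thesis by (cases a) (simp_all del: of_nat_Suc of_int_of_nat_eq, metis of_int_of_nat_eq, metis of_int_of_nat_eq of_int_minus)
 qed
 then show ?case using pCons by (simp add: map_poly_pCons Fract_pCons)
qed (simp add: Zero_fract_def)

lemma qZq_iff: "x \<in> qZq \<longleftrightarrow> (\<exists>p. x = qq * poly (map_poly of_int p) qq)"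
 by (auto simp: qZq_def Fract_int_poly)

lemma of_int_poly_add: "poly (map_poly of_int (p + r)) x = poly (map_poly of_int p) x + poly (map_poly of_int r) (x::qfield)"
 by (induction p r rule: poly_induct2) (simp_all add: map_poly_pCons algebra_simps)

lemma qZq_add: "x \<in> qZq ==> y \<in> qZq ==> x + y \<in> qZq"
 unfolding qZq_iff by (metis of_int_poly_add distrib_left)

lemma qZq_uminus: "x \<in> qZq ==> - x \<in> qZq"
proof -
 have "poly (map_poly of_int (- p)) x = - poly (map_poly of_int p) (x::qfield)" for p x
  using of_int_poly_add[of p "- p" x] by (simp add: eq_neg_iff_add_eq_0 add.commute)
 then show "x \<in> qZq ==> - x \<in> qZq" unfolding qZq_iff by (metis mult_minus_right)
qed

lemma qZq_0: "0 \<in> qZq"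
 unfolding qZq_iff by (rule exI[of _ 0]) simp

lemma qZq_powi: "i > 0 ==> of_int c * qq powi i \<in> qZq"
proof -
 assume i: "i > 0"
 have "poly (map_poly of_int (monom c n)) qq = of_int c * qq ^ n" for n
  by (induction n) (simp_all add: monom_0 monom_Suc map_poly_pCons)
 moreover have "qq powi i = qq * qq ^ (nat (i - 1))"
 proof -
  have "nat i = Suc (nat (i - 1))" using i by simp
  then show ?thesis using i by (simp add: power_int_def)
 qed
 ultimately show ?thesis unfolding qZq_iff by (intro exI[of _ "monom c (nat (i - 1))"]) simp
qed

lemma qZq_ZQ: "x \<in> qZq ==> x \<in> ZQ"
proof -
 have 1: "poly (map_poly of_int p) qq \<in> ZQ" for p
 proof (induction p)
  case (pCons a p)
  then have "qq * poly (map_poly of_int p) qq \<in> ZQ" using ZQ_mult_powi[of _ 1 1] by simp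
  from ZQ.step[OF this, of a 0] show ?case by (simp add: map_poly_pCons)
 qed (simp add: ZQ.zero)
 show "x \<in> qZq ==> x \<in> ZQ" unfolding qZq_iff using ZQ_mult_powi[OF 1, of 1 1] by auto
qed

lemma ZQ_decomp: "x \<in> ZQ ==> \<exists>P Q c. P \<in> qZq \<and> Q \<in> qZq \<and> x = P + qbar Q + of_int c"
proof (induction x rule: ZQ.induct)
 case zero
 show ?case by (intro exI[of _ 0]) (simp add: qZq_0)
next
 case (step x d i)
 then obtain P Q c where PQ: "P \<in> qZq" "Q \<in> qZq" "x = P + qbar Q + of_int c" by blast
 consider "i > 0" | "i = 0" | "i < 0" by linarith
 then show ?case
 proof cases
  case 1
  then show ?thesis using PQ qZq_add[OF qZq_powi[OF 1, of d] PQ(1)]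
   by (intro exI[of _ "of_int d * qq powi i + P"] exI[of _ Q] exI[of _ c]) simp
 next
  case 2
  then show ?thesis using PQ by (intro exI[of _ P] exI[of _ Q] exI[of _ "d + c"]) simp
 next
  case 3
  then have "of_int d * qq powi (- i) + Q \<in> qZq" using PQ by (intro qZq_add qZq_powi) auto
  moreover have "qbar (of_int d * qq powi (- i) + Q) = of_int d * qq powi i + qbar Q"
   by (simp add: qbar_add qbar_mult qbar_of_int del: power_int_minus)
  ultimately show ?thesis using PQ by (intro exI[of _ P] exI[of _ "of_int d * qq powi (- i) + Q"] exI[of _ c]) simp
 qed
qed

lemma qbar_poly: "qbar (poly (map_poly of_int p) qq) = poly (map_poly of_int p) (inverse qq)"
 by (induction p) (simp_all add: map_poly_pCons qbar_add qbar_mult qbar_of_int)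

text \<open>With n one more than the degree of r, multiplication by \<open>q^n\<close> moves P, the
  constant and the conjugate of Q to degrees above n, equal to n and below n. A vanishing integer
  polynomial then has all three parts zero.\<close>

lemma laurent_independent:
 assumes "P \<in> qZq" "Q \<in> qZq" "P + qbar Q + of_int c = 0"
 shows "P = 0 \<and> Q = 0"
proof -
 obtain p r where p: "P = qq * poly (map_poly of_int p) qq" and r: "Q = qq * poly (map_poly of_int r) qq"
  using assms by (auto simp: qZq_iff)
 define n where "n = Suc (degree r)"
 define S where "S = monom 1 (Suc n) * p + monom c n + reflect_poly r"
 have ofmult: "poly (map_poly of_int (monom 1 m * u)) qq = qq ^ m * poly (map_poly of_int u) qq" for m u
  by (induction m) (simp_all add: monom_Suc monom_0 map_poly_pCons mult.assoc)
 have ofmon: "poly (map_poly of_int (monom c m)) qq = of_int c * qq ^ m" for m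
  by (induction m) (simp_all add: monom_0 monom_Suc map_poly_pCons)
 have inj: "degree (map_poly of_int r :: qfield poly) = degree r"
  "map_poly of_int (reflect_poly r) = reflect_poly (map_poly of_int r :: qfield poly)"
 proof -
  show "degree (map_poly of_int r :: qfield poly) = degree r" by (rule degree_map_poly) simp
  then show "map_poly of_int (reflect_poly r) = reflect_poly (map_poly of_int r :: qfield poly)"
   by (intro poly_eqI) (simp add: coeff_map_poly coeff_reflect_poly)
 qed
 have "poly (map_poly of_int (reflect_poly r)) qq = qq ^ degree r * poly (map_poly of_int r) (inverse qq)"
  unfolding inj(2) poly_reflect_poly_nz[OF qq_nonzero] inj(1) ..
 also have "\<dots> = qq ^ n * qbar Q"
  by (simp add: r n_def qbar_mult qbar_poly qq_nonzero)
 finally have "poly (map_poly of_int S) qq = qq ^ n * (P + qbar Q + of_int c)"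
  unfolding S_def of_int_poly_add ofmult ofmon by (simp add: p algebra_simps)
 then have "poly (map_poly of_int S) qq = 0" using assms(3) by simp
 then have "map_poly rat_of_int S = 0"
  unfolding Fract_int_poly[symmetric] by (simp add: Zero_fract_def eq_fract)
 then have S: "coeff S i = 0" for i
  by (metis coeff_0 coeff_map_poly of_int_0 of_int_eq_0_iff)
 have "coeff p i = 0" for i
 proof -
  have "coeff (reflect_poly r) (i + Suc n) = 0"
   by (rule coeff_eq_0) (use degree_reflect_poly_le[of r] in \<open>simp add: n_def\<close>)
  then show ?thesis using S[of "i + Suc n"] by (simp add: S_def coeff_monom_mult)
 qed
 moreover have "coeff (reflect_poly r) i = 0" for i
 proof (cases "i < n")
  case True
  then show ?thesis using S[of i] by (simp add: S_def coeff_monom_mult)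
 next
  case False
  then show ?thesis by (intro coeff_eq_0) (use degree_reflect_poly_le[of r] in \<open>simp add: n_def\<close>)
 qed
 ultimately have "p = 0" "reflect_poly r = 0" by (simp_all add: poly_eq_iff)
 then show ?thesis by (simp add: p r)
qed

lemma qZq_bar_invariant: "x \<in> qZq ==> qbar x = x ==> x = 0"
 using laurent_independent[of x "- x" 0] by (simp add: qZq_uminus qbar_uminus)

text \<open>The constant term of a equals its own negative and so vanishes; the parts in positive
  and negative powers of q are then opposite conjugates.\<close>

lemma ZQ_antisym_split:
 assumes "a \<in> ZQ" "qbar a = - a"
 shows "\<exists>p\<in>qZq. p = qbar p + a"
proof -
 obtain P Q c where PQ: "P \<in> qZq" "Q \<in> qZq" "a = P + qbar Q + of_int c" using ZQ_decomp[OF assms(1)] by blast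
 have eq: "(P + Q) + qbar (P + Q) + of_int (2 * c) = 0"
  using assms(2) by (simp add: PQ(3) qbar_add qbar_of_int algebra_simps)
 then have 0: "P + Q = 0" using laurent_independent[of "P + Q" "P + Q" "2 * c"] PQ by (simp add: qZq_add)
 then have Q: "Q = - P" by (simp add: eq_neg_iff_add_eq_0 add.commute)
 have "of_int (2 * c) = (0::qfield)" using eq unfolding 0 by simp
 then have "of_int c = (0::qfield)" by simp
 then show ?thesis using PQ Q by (intro bexI[of _ P]) (simp_all add: qbar_uminus)
qed

section \<open>Lusztig's lemma\<close>

text \<open>The order is a parameter because the lemma is used for a refinement of the Bruhat order.
  Reflexivity is stated for related elements, as lists of the wrong length are related to
  nothing.\<close>

lemma lusztig:
 fixes le :: "'i => 'i => bool" and \<rho> :: "'i => 'i => qfield"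
 assumes trans: "\<And>x y z. le x y ==> le y z ==> le x z" and antisym: "\<And>x y. le x y ==> le y x ==> x = y"
  and rfl: "\<And>x y. le x y ==> le x x \<and> le y y"
  and fin: "\<And>x y. finite {z. le x z \<and> le z y}"
  and diag: "\<And>x. le x x ==> \<rho> x x = 1" and int: "\<And>x y. le y x ==> \<rho> x y \<in> ZQ"
  and inv: "\<And>x y. le y x ==> x \<noteq> y ==> (\<Sum>z | le y z \<and> le z x. qbar (\<rho> x z) * \<rho> z y) = 0"
  and f: "le f f"
 obtains x where "x f = 1" "\<And>g. x g \<noteq> 0 ==> le g f" "\<And>g. g \<noteq> f ==> x g \<in> qZq"
  "\<And>g. le g f ==> (\<Sum>h | le g h \<and> le h f. qbar (x h) * \<rho> h g) = x g"
proof -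
 let ?I = "\<lambda>g. {h. le g h \<and> le h f \<and> h \<noteq> g}"
 \<comment> \<open>The recursion descends from f; it is well-founded because the interval between g
   and f grows as g descends.\<close>
 define R where "R = {(h, g). le g h \<and> le h f \<and> h \<noteq> g}"
 have "wf R"
 proof (rule wf_subset)
  show "wf (measure (\<lambda>g. card {h. le g h \<and> le h f}))" by simp
  show "R \<subseteq> measure (\<lambda>g. card {h. le g h \<and> le h f})"
  proof (clarsimp simp: R_def)
   fix h g assume h: "le g h" "le h f" "h \<noteq> g"
   have "{z. le h z \<and> le z f} \<subset> {z. le g z \<and> le z f}"
   proof
    show "{z. le h z \<and> le z f} \<subseteq> {z. le g z \<and> le z f}" using h trans by blast
    have "g \<in> {z. le g z \<and> le z f}" "g \<notin> {z. le h z \<and> le z f}" using h trans antisym rfl by blast+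
    then show "{z. le h z \<and> le z f} \<noteq> {z. le g z \<and> le z f}" by blast
   qed
   then show "card {z. le h z \<and> le z f} < card {z. le g z \<and> le z f}" by (rule psubset_card_mono[OF fin])
  qed
 qed
 \<comment> \<open>r is an admissible value at g, given the values x above g.\<close>
 define P where "P x g r \<longleftrightarrow> (g = f --> r = 1) \<and> (\<not> le g f --> r = 0) \<and>
  (le g f \<and> g \<noteq> f --> r \<in> qZq \<and> r = qbar r + (\<Sum>h\<in>?I g. qbar (x h) * \<rho> h g))" for x g r
 have fI: "finite (?I g)" for g by (rule finite_subset[OF _ fin[of g f]]) auto
 have split: "(\<Sum>h | le g h \<and> le h m. u h) = u g + (\<Sum>h\<in>{h. le g h \<and> le h m \<and> h \<noteq> g}. u h)"
  if "le g m" for g m and u :: "'i => qfield"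
 proof -
  have "{h. le g h \<and> le h m} = insert g {h. le g h \<and> le h m \<and> h \<noteq> g}" using that rfl by blast
  moreover have "finite {h. le g h \<and> le h m \<and> h \<noteq> g}" by (rule finite_subset[OF _ fin[of g m]]) auto
  ultimately show ?thesis by simp
 qed
 have full: "x g = (\<Sum>h | le g h \<and> le h f. qbar (x h) * \<rho> h g)" if "P x g (x g)" "le g f" for x g
 proof (cases "g = f")
  case True
  then have "{h. le g h \<and> le h f} = {f}" using f antisym by blast
  then show ?thesis using that True f by (simp add: P_def diag)
 next
  case False
  then show ?thesis using that rfl[OF that(2)] by (simp add: P_def split diag)
 qed
 have ex: "\<exists>r. P x g r" if IH: "\<And>h. (h, g) \<in> R ==> P x h (x h)" for x g
 proof (cases "le g f \<and> g \<noteq> f")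
  case True
  define a where "a = (\<Sum>h\<in>?I g. qbar (x h) * \<rho> h g)"
  have xZ: "x h \<in> ZQ" if "h \<in> ?I g" for h
   using IH[of h] that ZQ_powi[of 0] by (cases "h = f") (auto simp: R_def P_def qZq_ZQ)
  have aZ: "a \<in> ZQ" unfolding a_def using xZ by (intro ZQ_sum ZQ_mult ZQ_qbar int) auto
  have "qbar a = (\<Sum>h\<in>?I g. x h * qbar (\<rho> h g))"
  proof -
   have qs: "qbar (sum u A) = (\<Sum>i\<in>A. qbar (u i))" for u :: "'i => qfield" and A
    by (induction A rule: infinite_finite_induct) (simp_all add: qbar_add)
   show ?thesis by (simp add: a_def qs qbar_mult)
  qed
  \<comment> \<open>Each value x h above g satisfies its own equation. Substituting it and
    exchanging the sums lets the involution property turn the double sum into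
    \<open>- a\<close>.\<close>
  also have "\<dots> = (\<Sum>h\<in>?I g. \<Sum>m\<in>?I g. if le h m then qbar (x m) * (\<rho> m h * qbar (\<rho> h g)) else 0)"
  proof (intro sum.cong refl)
   fix h assume h: "h \<in> ?I g"
   then have "x h = (\<Sum>m | le h m \<and> le m f. qbar (x m) * \<rho> m h)" using full[OF IH] by (auto simp: R_def)
   also have "{m. le h m \<and> le m f} = {m \<in> ?I g. le h m}" using h trans antisym by blast
   also have "(\<Sum>m\<in>{m \<in> ?I g. le h m}. qbar (x m) * \<rho> m h) = (\<Sum>m\<in>?I g. if le h m then qbar (x m) * \<rho> m h else 0)"
    by (rule sum.inter_filter[OF fI])
   finally show "x h * qbar (\<rho> h g) = (\<Sum>m\<in>?I g. if le h m then qbar (x m) * (\<rho> m h * qbar (\<rho> h g)) else 0)"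
    by (simp add: sum_distrib_right if_distrib[of "\<lambda>y. y * _"] mult.assoc cong: if_cong)
  qed
  also have "\<dots> = (\<Sum>m\<in>?I g. \<Sum>h\<in>?I g. if le h m then qbar (x m) * (\<rho> m h * qbar (\<rho> h g)) else 0)"
   by (rule sum.swap)
  also have "\<dots> = (\<Sum>m\<in>?I g. - (qbar (x m) * \<rho> m g))"
  proof (intro sum.cong refl)
   fix m assume m: "m \<in> ?I g"
   have "qbar (\<Sum>z | le g z \<and> le z m. qbar (\<rho> m z) * \<rho> z g) = 0" using inv[of g m] m by simp
   moreover have "qbar (sum u A) = (\<Sum>i\<in>A. qbar (u i))" for u :: "'i => qfield" and A
    by (induction A rule: infinite_finite_induct) (simp_all add: qbar_add)
   ultimately have "(\<Sum>z | le g z \<and> le z m. \<rho> m z * qbar (\<rho> z g)) = 0" by (simp add: qbar_mult)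
   then have s: "\<rho> m g + (\<Sum>z | le g z \<and> le z m \<and> z \<noteq> g. \<rho> m z * qbar (\<rho> z g)) = 0"
    using split[of g m "\<lambda>z. \<rho> m z * qbar (\<rho> z g)"] m rfl[of g m] diag[of g] by simp
   then have s': "(\<Sum>z | le g z \<and> le z m \<and> z \<noteq> g. \<rho> m z * qbar (\<rho> z g)) = - \<rho> m g"
    by (simp add: eq_neg_iff_add_eq_0 add.commute)
   have "(\<Sum>h\<in>?I g. if le h m then qbar (x m) * (\<rho> m h * qbar (\<rho> h g)) else 0)
     = (\<Sum>h\<in>{h \<in> ?I g. le h m}. qbar (x m) * (\<rho> m h * qbar (\<rho> h g)))"
    by (rule sum.inter_filter[OF fI, symmetric])
   also have "{h \<in> ?I g. le h m} = {z. le g z \<and> le z m \<and> z \<noteq> g}" using m trans by blast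
   also have "(\<Sum>h\<in>{z. le g z \<and> le z m \<and> z \<noteq> g}. qbar (x m) * (\<rho> m h * qbar (\<rho> h g))) = qbar (x m) * (- \<rho> m g)"
    unfolding s'[symmetric] by (rule sum_distrib_left[symmetric])
   finally show "(\<Sum>h\<in>?I g. if le h m then qbar (x m) * (\<rho> m h * qbar (\<rho> h g)) else 0) = - (qbar (x m) * \<rho> m g)"
    by simp
  qed
  also have "\<dots> = - a" by (simp add: a_def sum_negf)
  finally obtain p where "p \<in> qZq" "p = qbar p + a" using ZQ_antisym_split[OF aZ] by blast
  then show ?thesis using True by (auto simp: P_def a_def)
 next
  case False
  then show ?thesis using f by (intro exI[of _ "of_bool (g = f)"]) (auto simp: P_def)
 qed
 have adm: "P x g r = P y g r" if "\<And>h. (h, g) \<in> R ==> x h = y h" for x y g r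
 proof -
  have "(\<Sum>h\<in>?I g. qbar (x h) * \<rho> h g) = (\<Sum>h\<in>?I g. qbar (y h) * \<rho> h g)"
   using that by (intro sum.cong) (auto simp: R_def)
  then show ?thesis by (simp add: P_def)
 qed
 obtain x where x: "\<And>g. P x g (x g)"
  using dependent_wf_choice[OF \<open>wf R\<close>, of P] adm ex by blast
 show ?thesis
 proof (rule that[of x])
  show "x f = 1" "\<And>g. x g \<noteq> 0 ==> le g f" using x by (auto simp: P_def)
  show "x g \<in> qZq" if "g \<noteq> f" for g using x[of g] that by (cases "le g f") (auto simp: P_def qZq_0)
  show "(\<Sum>h | le g h \<and> le h f. qbar (x h) * \<rho> h g) = x g" if "le g f" for g
   using full[OF x that] by simp
 qed
qed

section \<open>Intervals of the Bruhat order and uniqueness of canonical bases\<close>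

lemma finite_box: "finite (box k n)"
 unfolding box_def using finite_lists_length_eq[of "{- int k..int k}" n] by (simp add: conj_commute)

lemma box_obtain: "\<exists>k\<ge>m. \<forall>f\<in>A. f \<in> box k (length f)" if "finite A"
 using that
proof (induction A)
 case (insert f A)
 then obtain k where k: "k \<ge> m" "\<forall>f\<in>A. f \<in> box k (length f)" by blast
 define l where "l = max k (nat (Max (insert 0 (abs ` set f))))"
 have "\<bar>x\<bar> \<le> int l" if "x \<in> set f" for x
 proof -
  have "\<bar>x\<bar> \<le> Max (insert 0 (abs ` set f))" using that by (intro Max_ge) auto
  then show ?thesis by (simp add: l_def)
 qed
 then have "f \<in> box l (length f)" unfolding box_def by (auto simp: abs_le_iff) (smt (verit))+
 then show ?case using k box_mono[of k l] by (intro exI[of _ l]) (auto simp: l_def)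
qed auto

text \<open>At the levels k and - k - 1 all members of the box have equal \<open>sharp\<close>, so
  h, being squeezed between two of them, has it too; hence no entry of h is above k or below -
  k.\<close>

lemma bruhat_interval:
 assumes "f \<in> box k (length b)" "g \<in> box k (length b)" "bruhat_le b g h" "bruhat_le b h f"
 shows "h \<in> box k (length b)"
proof -
 have eq: "sharp b h r j = sharp b f r j" if "sharp b g r j = sharp b f r j" for r j
 proof (cases "j < length b")
  case True
  then have "sharp b g r j \<le> sharp b h r j" "sharp b h r j \<le> sharp b f r j"
   using assms(3,4) by (simp_all add: bruhat_le_def)
  then show ?thesis using that by simp
 qed (simp add: sharp_length)
 have cong: "sharp b f r j = sharp b g r j" if "\<And>i. i < length b ==> f ! i \<le> r \<longleftrightarrow> g ! i \<le> r" for r j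
  unfolding sharp_def using that by (intro sum.cong) auto
 have fg: "- int k \<le> f ! i \<and> f ! i \<le> int k \<and> - int k \<le> g ! i \<and> g ! i \<le> int k" if "i < length b" for i
 proof -
  have "f ! i \<in> set f" "g ! i \<in> set g" using that assms(1,2) by (auto simp: box_def)
  then have "f ! i \<in> {- int k..int k}" "g ! i \<in> {- int k..int k}" using assms(1,2) by (auto simp: box_def)
  then show ?thesis by simp
 qed
 have h: "(h ! i \<le> r) = (f ! i \<le> r)" if "i < length b" "\<And>i. i < length b ==> f ! i \<le> r \<longleftrightarrow> g ! i \<le> r" for i r
  using sharp_Suc[OF that(1), of h r] sharp_Suc[OF that(1), of f r] eq[of r i] eq[of r "Suc i"] cong[OF that(2)]
  by (auto split: if_splits)
 have "- int k \<le> h ! i \<and> h ! i \<le> int k" if "i < length b" for i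
 proof -
  have 1: "f ! j \<le> int k \<longleftrightarrow> g ! j \<le> int k" "f ! j \<le> - int k - 1 \<longleftrightarrow> g ! j \<le> - int k - 1" if "j < length b" for j
   using fg[OF that] by auto
  show ?thesis using h[OF that 1(1)] h[OF that 1(2)] fg[OF that] by auto
 qed
 then show ?thesis using assms(3) by (auto simp: box_def bruhat_le_def in_set_conv_nth)
qed

lemma finite_interval: "finite {h. bruhat_le b g h \<and> bruhat_le b h f}"
proof (cases "length f = length b \<and> length g = length b")
 case True
 obtain k where "\<forall>h\<in>{f, g}. h \<in> box k (length h)" using box_obtain[of "{f, g}" 0] by blast
 then have "{h. bruhat_le b g h \<and> bruhat_le b h f} \<subseteq> box k (length b)"
  using bruhat_interval[of f k b g] True by auto
 then show ?thesis using finite_box finite_subset by blast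
next
 case False
 then have e: "{h. bruhat_le b g h \<and> bruhat_le b h f} = {}" by (auto simp: bruhat_le_def)
 show ?thesis unfolding e by simp
qed

lemma bar_coeff_props:
 assumes "ok b" "length f = length b"
 shows "bar_coeff b f f = 1" "bar_coeff b f g \<noteq> 0 ==> bruhat_le b g f" "bar_coeff b f g \<in> ZQ"
proof -
 have k: "\<exists>k\<ge>1. f \<in> box k (length b) \<and> g \<in> box k (length b)" if "length g = length b" for g
  using box_obtain[of "{f, g}" 1] assms(2) that by auto
 show "bar_coeff b f f = 1"
  using k[OF assms(2)] bar_coeff_eq[OF assms(1)] tri_psi[OF assms(1)] assms(2) by (auto simp: tri_def)
 have "(bar_coeff b f g \<noteq> 0 --> bruhat_le b g f) \<and> bar_coeff b f g \<in> ZQ"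
 proof (cases "length g = length b")
  case True
  then obtain k where k: "1 \<le> k" "f \<in> box k (length b)" "g \<in> box k (length b)" using k by blast
  then show ?thesis
   using bar_coeff_eq[OF assms(1) k] psi_ZQ[OF assms(1) k] tri_psi[OF assms(1), of k] assms(2)
   by (auto simp: tri_def in_keys_iff)
 qed (simp add: bar_coeff_length[OF assms] ZQ.zero)
 then show "bar_coeff b f g \<noteq> 0 ==> bruhat_le b g f" "bar_coeff b f g \<in> ZQ" by auto
qed

lemma bar_T_eq:
 assumes "ok b" "\<And>h. x h \<noteq> 0 ==> bruhat_le b h f"
 shows "bar_T b x g = (\<Sum>h | bruhat_le b g h \<and> bruhat_le b h f. qbar (x h) * bar_coeff b h g)"
 unfolding bar_T_def
proof (rule Sum_any.expand_superset[OF finite_interval])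
 show "{h. qbar (x h) * bar_coeff b h g \<noteq> 0} \<subseteq> {h. bruhat_le b g h \<and> bruhat_le b h f}"
 proof clarify
  fix h assume "qbar (x h) * bar_coeff b h g \<noteq> 0"
  then have "x h \<noteq> 0" "bar_coeff b h g \<noteq> 0" by auto
  then show "bruhat_le b g h \<and> bruhat_le b h f"
   using assms(2) bar_coeff_props(2)[OF assms(1), of h g] by (auto simp: bruhat_le_def)
 qed
qed

lemma unitriangular_le: "x \<in> unitriangular (bruhat_less b) f ==> length f = length b ==> x h \<noteq> 0 ==> bruhat_le b h f"
 by (auto simp: unitriangular_def bruhat_less_def bruhat_refl)

text \<open>At a maximal index g where x and y differ, bar invariance concerns the single
  coefficient \<open>x g - y g\<close>, which lies in \<open>qZq\<close> and must therefore
  vanish.\<close>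

lemma canonical_unique:
 assumes "ok b" "length f = length b"
  and x: "x \<in> unitriangular (bruhat_less b) f" "\<And>g. g \<noteq> f ==> x g \<in> qZq" "bar_T b x = x"
  and y: "y \<in> unitriangular (bruhat_less b) f" "\<And>g. g \<noteq> f ==> y g \<in> qZq" "bar_T b y = y"
 shows "x = y"
proof (rule ccontr)
 assume "x \<noteq> y"
 then obtain g0 where g0: "x g0 \<noteq> y g0" by (auto simp: fun_eq_iff)
 have le: "bruhat_le b h f" if "x h \<noteq> y h" for h
  using that unitriangular_le[OF x(1) assms(2), of h] unitriangular_le[OF y(1) assms(2), of h] by (cases "x h = 0") auto
 let ?A = "{h. bruhat_le b g0 h \<and> bruhat_le b h f \<and> x h \<noteq> y h}"
 have "finite ?A" by (rule finite_subset[OF _ finite_interval[of b g0 f]]) auto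
 moreover have "g0 \<in> ?A" using le[OF g0] g0 by (auto simp: bruhat_le_def)
 ultimately obtain g where g: "g \<in> ?A" "\<And>h. h \<in> ?A ==> bruhat_le b g h ==> h = g"
 proof -
  assume fin: "finite ?A" and g0: "g0 \<in> ?A"
  have "\<exists>g\<in>?A. \<forall>h\<in>?A. bruhat_le b g h \<and> g \<noteq> h --> False"
  proof (rule ccontr)
   assume "\<not> ?thesis"
   then have *: "\<And>g. g \<in> ?A ==> \<exists>h\<in>?A. bruhat_le b g h \<and> g \<noteq> h" by blast
   define c where "c = (\<lambda>g. card {h\<in>?A. bruhat_le b g h})"
   obtain g where gA: "g \<in> ?A" and min: "\<And>h. h \<in> ?A ==> c g \<le> c h"
    using ex_has_least_nat[of "\<lambda>g. g \<in> ?A" g0 c] g0 by blast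
   obtain h where h: "h \<in> ?A" "bruhat_le b g h" "g \<noteq> h" using *[OF gA] by blast
   have "{z\<in>?A. bruhat_le b h z} \<subset> {z\<in>?A. bruhat_le b g z}"
   proof
    show "{z\<in>?A. bruhat_le b h z} \<subseteq> {z\<in>?A. bruhat_le b g z}" using h bruhat_trans by blast
    have "g \<in> {z\<in>?A. bruhat_le b g z}" using gA by (auto simp: bruhat_le_def)
    moreover have "g \<notin> {z\<in>?A. bruhat_le b h z}" using h bruhat_antisym by blast
    ultimately show "{z\<in>?A. bruhat_le b h z} \<noteq> {z\<in>?A. bruhat_le b g z}" by blast
   qed
   then have "c h < c g"
    unfolding c_def by (rule psubset_card_mono[rotated]) (rule finite_subset[OF _ fin], blast)
   then show False using min[OF h(1)] by simp
  qed
  then show ?thesis using that by blast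
 qed
 have gl: "bruhat_le b g f" "length g = length b" "x g \<noteq> y g" using g(1) by (auto simp: bruhat_le_def)
 have eq: "x h = y h" if "bruhat_le b g h" "bruhat_le b h f" "h \<noteq> g" for h
  using g(2)[of h] that g(1) bruhat_trans[of b g0 g h] by auto
 have "x g - y g = bar_T b x g - bar_T b y g" using x(3) y(3) by simp
 also have "\<dots> = (\<Sum>h | bruhat_le b g h \<and> bruhat_le b h f. qbar (x h - y h) * bar_coeff b h g)"
  using bar_T_eq[of b x f g, OF assms(1) unitriangular_le[OF x(1) assms(2)]]
   bar_T_eq[of b y f g, OF assms(1) unitriangular_le[OF y(1) assms(2)]]
  by (simp add: qbar_diff sum_subtractf left_diff_distrib)
 also have "\<dots> = (\<Sum>h\<in>{g}. qbar (x h - y h) * bar_coeff b h g)"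
  using gl eq bruhat_refl[OF gl(2)] by (intro sum.mono_neutral_right finite_interval) auto
 also have "\<dots> = qbar (x g - y g)" using bar_coeff_props(1)[OF assms(1) gl(2)] by simp
 finally have inv: "qbar (x g - y g) = x g - y g" by simp
 have "g \<noteq> f" using x(1) y(1) gl(3) by (auto simp: unitriangular_def)
 then have "x g - y g \<in> qZq" using qZq_add[OF x(2) qZq_uminus[OF y(2)], of g g] by simp
 then show False using qZq_bar_invariant[OF _ inv] gl(3) by simp
qed

section \<open>The bar map in the coordinates of the \<open>U\<^sub>f\<close>\<close>

text \<open>Covers both orders of the exchanged factors: \<open>dn\<close> is \<open>f \<mapsto> f\<^sup>\<down>\<close> for the first sequence and
 \<open>f \<mapsto> f\<^sup>\<up>\<close> for the second one, and \<open>ud\<close> is its inverse.\<close>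

locale side =
 fixes b :: "nat list" and pos :: nat and dn ud :: "int list => int list"
 assumes ok: "ok b"
  and len_dn: "length (dn f) = length f" "length (ud f) = length f"
  and dn_ud: "length f = length b ==> dn (ud f) = f" "length f = length b ==> ud (dn f) = f"
  and eq_ud: "length f = length b ==> ud f ! pos = ud f ! (pos + 1) \<longleftrightarrow> f ! pos = f ! (pos + 1)"
  and dn_le: "length f = length b ==> f ! pos = f ! (pos + 1) ==> bruhat_le b (dn f) f"
  and esc: "length g = length b ==> g ! pos = g ! (pos + 1) ==> length f = length b ==>
   \<exists>M. \<forall>i\<ge>M. \<not> bruhat_le b ((ud ^^ i) g) f"
begin

definition E :: "int list => bool" where
 "E f \<longleftrightarrow> f ! pos = f ! (pos + 1)"

abbreviation "N \<equiv> length b"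

lemma len_iter: "length ((ud ^^ i) f) = length f"
 by (induction i) (simp_all add: len_dn)

lemma E_ud: "length f = N ==> E (ud f) = E f" and E_dn: "length f = N ==> E (dn f) = E f"
 using eq_ud[of f] eq_ud[of "dn f"] by (simp_all add: E_def len_dn dn_ud)

lemma E_iter: "length f = N ==> E ((ud ^^ i) f) = E f"
 by (induction i) (simp_all add: E_ud len_iter)

lemma le_ud: "length g = N ==> E g ==> bruhat_le b g (ud g)"
 using dn_le[of "ud g"] E_ud[of g] by (simp add: len_dn dn_ud E_def)

lemma le_iter: "length g = N ==> E g ==> bruhat_le b g ((ud ^^ i) g)"
proof (induction i)
 case (Suc i)
 then show ?case using le_ud[of "(ud ^^ i) g"] bruhat_trans by (auto simp: len_iter E_iter)
qed (simp add: bruhat_refl)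

lemma ud_not_le: "length g = N ==> E g ==> \<not> bruhat_le b (ud g) g"
proof
 assume g: "length g = N" "E g" "bruhat_le b (ud g) g"
 then have u: "ud g = g" using le_ud bruhat_antisym by blast
 have "(ud ^^ i) g = g" for i by (induction i) (simp_all add: u)
 then show False using esc[of g g] g bruhat_refl[of g b] by (auto simp: E_def)
qed

text \<open>This is \<open>U_f\<close> for the first sequence and \<open>U'_f\<close> for the second
  one.\<close>

definition ub :: "int list => vec" where
 "ub f = single f 1 + (if E f then single (dn f) qq else 0)"

lemma lookup_ub: "length f = N ==> length g = N ==>
  lookup (ub f) g = of_bool (f = g) + (if E g then qq * of_bool (f = ud g) else 0)"
 using dn_ud[of f] dn_ud[of g] E_dn[of f] E_ud[of g]
 by (auto simp: ub_def lookup_add lookup_single when_def)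

lemma lookup_lin: "len N y ==> length g = N ==>
  lookup (lin_ext ub y) g = lookup y g + (if E g then qq * lookup y (ud g) else 0)"
proof (induction y rule: len_induct)
 case (single f c)
 then show ?case by (auto simp: lin_ext_simps lookup_ub lookup_single when_def distrib_left mult.commute)
qed (auto simp: lin_ext_simps lookup_add distrib_left)

text \<open>A finitely supported coefficient cannot propagate along \<open>g, ud g, ud (ud g), \<dots>\<close>.\<close>

lemma chain:
 assumes "len N y" "\<And>g. length g = N ==> g \<notin> D ==> lookup y g \<noteq> 0 ==> E g \<and> ud g \<notin> D \<and> lookup y (ud g) \<noteq> 0"
  "lookup y g \<noteq> 0"
 shows "g \<in> D"
proof (rule ccontr)
 assume gD: "g \<notin> D"
 have lg: "length g = N" using assms(1,3) by (simp add: len_def in_keys_iff)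
 have it: "(ud ^^ i) g \<notin> D \<and> lookup y ((ud ^^ i) g) \<noteq> 0" for i
  using gD assms(3) assms(2)[of "(ud ^^ i) g" for i] by (induction i) (auto simp: len_iter lg)
 have Eg: "E g" using assms(2)[OF lg gD assms(3)] by simp
 have "\<exists>M. \<forall>i\<ge>M. \<forall>h\<in>A. \<not> bruhat_le b ((ud ^^ i) g) h" if "finite A" "\<forall>h\<in>A. length h = N" for A
  using that
 proof (induction A)
  case (insert h A)
  then obtain M1 where "\<forall>i\<ge>M1. \<forall>h\<in>A. \<not> bruhat_le b ((ud ^^ i) g) h" by auto
  moreover obtain M2 where "\<forall>i\<ge>M2. \<not> bruhat_le b ((ud ^^ i) g) h"
   using esc[OF lg Eg[unfolded E_def], of h] insert by auto
  ultimately show ?case by (intro exI[of _ "max M1 M2"]) auto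
 qed auto
 from this[of "keys y"] obtain M where M: "\<forall>i\<ge>M. \<forall>h\<in>keys y. \<not> bruhat_le b ((ud ^^ i) g) h"
  using assms(1) by (auto simp: len_def)
 have "(ud ^^ M) g \<in> keys y" using it by (simp add: in_keys_iff)
 then have "\<not> bruhat_le b ((ud ^^ M) g) ((ud ^^ M) g)" using M by blast
 then show False by (simp add: bruhat_refl len_iter lg)
qed

lemma lin_inj:
 assumes "len N y" "len N z" "lin_ext ub y = lin_ext ub z"
 shows "y = z"
proof -
 have l: "len N (y - z)" using assms(1,2) by (auto simp: len_def in_keys_iff lookup_minus)
 have 0: "lookup (lin_ext ub (y - z)) g = 0" for g
  using assms(3) by (simp add: lin_ext_simps)
 have "lookup (y - z) g = 0" for g
 proof (rule ccontr)
  assume nz: "lookup (y - z) g \<noteq> 0"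
  have "g \<in> {}"
  proof (rule chain[OF l _ nz])
   fix g assume g: "length g = N" "lookup (y - z) g \<noteq> 0"
   have "lookup (y - z) g + (if E g then qq * lookup (y - z) (ud g) else 0) = 0"
    using lookup_lin[OF l g(1)] 0 by metis
   then show "E g \<and> ud g \<notin> {} \<and> lookup (y - z) (ud g) \<noteq> 0"
    using g(2) by (cases "E g"; cases "lookup (y - z) (ud g) = 0") simp_all
  qed
  then show False by simp
 qed
 then show ?thesis by (intro poly_mapping_eqI) (simp add: lookup_minus)
qed

text \<open>The coefficient of \<open>M_g\<close> in the bar conjugate of \<open>ub f\<close>;
  anti-linearity inverts the q in \<open>ub f\<close>.\<close>

definition beta :: "int list => int list => qfield" where
 "beta f g = bar_coeff b f g + (if E f then inverse qq * bar_coeff b (dn f) g else 0)"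

lemma beta_le: "length f = N ==> beta f g \<noteq> 0 ==> bruhat_le b g f"
proof -
 assume f: "length f = N" and "beta f g \<noteq> 0"
 then have "bar_coeff b f g \<noteq> 0 \<or> (E f \<and> bar_coeff b (dn f) g \<noteq> 0)" by (auto simp: beta_def split: if_splits)
 then show ?thesis
  using bar_coeff_props(2)[OF ok f, of g] bar_coeff_props(2)[OF ok, of "dn f" g] dn_le[OF f] bruhat_trans f
  by (auto simp: len_dn E_def)
qed

lemma beta_diag: "length f = N ==> beta f f = 1"
proof -
 assume f: "length f = N"
 have "bar_coeff b (dn f) f = 0" if "E f"
 proof (rule ccontr)
  assume "bar_coeff b (dn f) f \<noteq> 0"
  then have "bruhat_le b f (dn f)" using bar_coeff_props(2)[OF ok, of "dn f" f] f by (simp add: len_dn)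
  then show False using ud_not_le[of "dn f"] f that by (simp add: len_dn E_dn dn_ud)
 qed
 then show ?thesis using bar_coeff_props(1)[OF ok f] by (simp add: beta_def)
qed

lemma beta_ZQ: "length f = N ==> beta f g \<in> ZQ"
 using bar_coeff_props(3)[OF ok, of f g] bar_coeff_props(3)[OF ok, of "dn f" g] ZQ_powi[of "-1"]
 by (auto simp: beta_def len_dn intro!: ZQ_add ZQ_mult)

text \<open>The coefficient of \<open>ub g\<close> in the bar conjugate of \<open>ub f\<close>. The
  alternating sum solves \<open>beta f g = rh f g + q * rh f (ud g)\<close> along the chain of g,
  and it is finite by \<open>esc\<close> and \<open>beta_le\<close>.\<close>

definition rh :: "int list => int list => qfield" where
 "rh f g = (if E g then Sum_any (\<lambda>i. (- qq) ^ i * beta f ((ud ^^ i) g)) else beta f g)"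

lemma rh_bound:
 assumes "length f = N" "length g = N" "E g"
 obtains M where "\<And>i. i \<ge> M ==> beta f ((ud ^^ i) g) = 0"
proof -
 obtain M where M: "\<forall>i\<ge>M. \<not> bruhat_le b ((ud ^^ i) g) f"
  using esc[OF assms(2) assms(3)[unfolded E_def] assms(1)] by blast
 show ?thesis by (rule that[of M]) (use M beta_le[OF assms(1)] in blast)
qed

lemma rh_rec:
 assumes "length f = N" "length g = N"
 shows "beta f g = rh f g + (if E g then qq * rh f (ud g) else 0)"
proof (cases "E g")
 case True
 obtain M where M: "\<And>i. i \<ge> M ==> beta f ((ud ^^ i) g) = 0" by (rule rh_bound[OF assms True]) blast
 have 1: "rh f g = (\<Sum>i<Suc M. (- qq) ^ i * beta f ((ud ^^ i) g))"
  unfolding rh_def using True M by (auto intro!: Sum_any.expand_superset simp: not_less[symmetric] intro: ccontr)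
 have ud: "(ud ^^ i) (ud g) = (ud ^^ Suc i) g" for i by (simp add: funpow_swap1)
 have 2: "rh f (ud g) = (\<Sum>i<M. (- qq) ^ i * beta f ((ud ^^ Suc i) g))"
  unfolding rh_def ud using True M E_ud[OF assms(2)]
  by (auto intro!: Sum_any.expand_superset simp del: funpow.simps intro: ccontr)
 show ?thesis using True unfolding 1 2 sum.lessThan_Suc_shift
  by (simp add: sum_distrib_left sum_negf mult.assoc del: funpow.simps)
qed (simp add: rh_def)

lemma rh_le: "length f = N ==> length g = N ==> rh f g \<noteq> 0 ==> bruhat_le b g f"
proof (cases "E g")
 case True
 assume f: "length f = N" "length g = N" "rh f g \<noteq> 0"
 then have "\<exists>i. beta f ((ud ^^ i) g) \<noteq> 0"
  using True Sum_any.not_neutral_obtains_not_neutral[of "\<lambda>i. (- qq) ^ i * beta f ((ud ^^ i) g)"]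
  unfolding rh_def by (metis mult_zero_right)
 then show ?thesis using beta_le[OF f(1)] le_iter[OF f(2) True] bruhat_trans by blast
qed (simp add: rh_def beta_le)

lemma rh_diag: "length f = N ==> rh f f = 1"
proof -
 assume f: "length f = N"
 have "rh f (ud f) = 0" if "E f"
  using rh_le[OF f, of "ud f"] ud_not_le[OF f that] f len_dn(2)[of f] by auto
 then show ?thesis using rh_rec[OF f f] beta_diag[OF f] by (cases "E f") simp_all
qed

lemma rh_ZQ: "length f = N ==> length g = N ==> rh f g \<in> ZQ"
proof -
 assume f: "length f = N" "length g = N"
 have "(- qq) ^ i \<in> ZQ" for i
 proof (induction i)
  case (Suc i)
  have "- qq \<in> ZQ" using ZQ_uminus[OF ZQ_powi[of 1]] by simp
  then show ?case using Suc by (simp only: power_Suc ZQ_mult)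
 qed (use ZQ_powi[of 0] in simp)
 then show ?thesis using beta_ZQ[OF f(1)] unfolding rh_def Sum_any.expand_set
  by (auto intro!: ZQ_sum ZQ_mult)
qed

definition II :: "nat => int list set" where
 "II k = {f \<in> box k N. E f --> dn f \<in> box k N}"

lemma psi_ub:
 assumes "1 \<le> k" "f \<in> II k" "g \<in> box k N"
 shows "lookup (al (psi k b) (ub f)) g = beta f g"
 using assms bar_coeff_eq[OF ok assms(1) _ assms(3)]
 by (auto simp: ub_def II_def beta_def qbar.sl_ext_add cst_simps lookup_add)

text \<open>y consists of the coordinates, in the family \<open>ub\<close>, of the image of
  \<open>ub f\<close> under the bar map of level k.\<close>

definition sol :: "nat => int list => vec => bool" where
 "sol k f y \<longleftrightarrow> keys y \<subseteq> II k \<and> al (psi k b) (ub f) = lin_ext ub y"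

lemma sol_len: "sol k f y ==> len N y"
 by (auto simp: sol_def len_def II_def box_def)

lemma sol_rec:
 assumes "1 \<le> k" "f \<in> II k" "sol k f y" "g \<in> box k N"
 shows "beta f g = lookup y g + (if E g then qq * lookup y (ud g) else 0)"
 using psi_ub[OF assms(1,2,4)] lookup_lin[OF sol_len[OF assms(3)], of g] assms(3,4)
 by (simp add: sol_def box_def)

lemma sol_le:
 assumes "1 \<le> k" "f \<in> II k" "sol k f y" "lookup y g \<noteq> 0"
 shows "bruhat_le b g f"
proof -
 have lf: "length f = N" using assms(2) by (simp add: II_def box_def)
 have "g \<in> {h. bruhat_le b h f}"
 proof (rule chain[OF sol_len[OF assms(3)] _ assms(4)])
  fix g assume g: "length g = N" "g \<notin> {h. bruhat_le b h f}" "lookup y g \<noteq> 0"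
  then have "g \<in> box k N" using assms(3) by (auto simp: sol_def II_def in_keys_iff)
  moreover have "beta f g = 0" using beta_le[OF lf, of g] g(2) by auto
  ultimately have "lookup y g + (if E g then qq * lookup y (ud g) else 0) = 0"
   using sol_rec[OF assms(1-3), of g] by simp
  then have "E g" "lookup y (ud g) \<noteq> 0" using g(3) by (auto split: if_splits)
  then show "E g \<and> ud g \<notin> {h. bruhat_le b h f} \<and> lookup y (ud g) \<noteq> 0"
   using le_ud[OF g(1)] g(2) bruhat_trans by blast
 qed
 then show ?thesis by simp
qed

text \<open>For large k the box contains the chain of g up to a member that is not below f. There y
  and \<open>rh f\<close> both vanish, and their common recursion carries the equality back to
  g.\<close>

lemma eventually_rh:
 assumes "length f = N" "length g = N"
 obtains K where "K \<ge> 1" "\<And>k. k \<ge> K ==> f \<in> II k \<and> g \<in> II k"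
  "\<And>k y. k \<ge> K ==> sol k f y ==> lookup y g = rh f g"
proof -
 obtain M where M: "E g ==> \<forall>i\<ge>M. \<not> bruhat_le b ((ud ^^ i) g) f"
  using esc[OF assms(2) _ assms(1)] by (cases "E g") (auto simp: E_def)
 let ?A = "{f, dn f, g, dn g} \<union> (\<lambda>i. (ud ^^ i) g) ` {..M}"
 have "finite ?A" by simp
 from box_obtain[OF this, of 1] obtain K where K: "K \<ge> 1" "\<forall>h\<in>?A. h \<in> box K (length h)" by blast
 have box: "f \<in> box k N" "dn f \<in> box k N" "g \<in> box k N" "dn g \<in> box k N" "\<And>i. i \<le> M ==> (ud ^^ i) g \<in> box k N" if "k \<ge> K" for k
  using K(2) subsetD[OF box_mono[OF that]] by (auto simp: assms len_dn len_iter)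
 then have II: "f \<in> II k \<and> g \<in> II k" if "k \<ge> K" for k using that by (auto simp: II_def)
 have "lookup y g = rh f g" if k: "k \<ge> K" and y: "sol k f y" for k y
 proof -
  note rec = sol_rec[OF order_trans[OF K(1) k] conjunct1[OF II[OF k]] y]
  show ?thesis
  proof (cases "E g")
   case False
   then show ?thesis using rec[OF box(3)[OF k]] by (simp add: rh_def)
  next
   case True
   have "lookup y ((ud ^^ (M - j)) g) = rh f ((ud ^^ (M - j)) g)" if "j \<le> M" for j
    using that
   proof (induction j)
    case 0
    have "\<not> bruhat_le b ((ud ^^ M) g) f" using M[OF True] by simp
    moreover have "length ((ud ^^ M) g) = N" by (simp add: len_iter assms(2))
    ultimately have "lookup y ((ud ^^ M) g) = 0" "rh f ((ud ^^ M) g) = 0"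
     using sol_le[OF order_trans[OF K(1) k] conjunct1[OF II[OF k]] y] rh_le[OF assms(1)] by blast+
    then show ?case by simp
   next
    case (Suc j)
    define h where "h = (ud ^^ (M - Suc j)) g"
    have e: "M - j = Suc (M - Suc j)" using Suc.prems by simp
    have "ud h = (ud ^^ (M - j)) g" unfolding h_def e by simp
    then have "lookup y (ud h) = rh f (ud h)" using Suc by simp
    moreover have "length h = N" "E h" by (simp_all add: h_def len_iter E_iter assms(2) True)
    ultimately have "lookup y h = rh f h"
     using rec[of h] box(5)[OF k, of "M - Suc j"] rh_rec[OF assms(1), of h] by (simp add: h_def)
    then show ?case by (simp add: h_def)
   qed
   from this[of M] show ?thesis by simp
  qed
 qed
 then show ?thesis using that K(1) II by blast
qed

text \<open>The interval is finite, so one level k computes all coefficients that occur. At that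
  level the claim is the involution property of \<open>psi\<close>, read in the independent family
  \<open>ub\<close>.\<close>

lemma rh_involution:
 assumes tr: "\<And>k f. 1 \<le> k ==> f \<in> II k ==> \<exists>y. sol k f y"
  and fg: "length f = N" "length g = N"
 shows "(\<Sum>h | bruhat_le b g h \<and> bruhat_le b h f. qbar (rh f h) * rh h g) = of_bool (f = g)"
proof -
 let ?A = "{h. bruhat_le b g h \<and> bruhat_le b h f}"
 have "\<exists>K. \<forall>k\<ge>K. (1 \<le> k \<and> f \<in> II k \<and> g \<in> II k) \<and> (\<forall>h\<in>B. (\<forall>y. sol k f y --> lookup y h = rh f h) \<and> (\<forall>y. sol k h y --> lookup y g = rh h g))"
  if "finite B" "B \<subseteq> ?A" for B
  using that
 proof (induction B)
  case empty
  obtain K where "K \<ge> 1" "\<And>k. k \<ge> K ==> f \<in> II k \<and> g \<in> II k" using eventually_rh[OF fg] by metis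
  then show ?case by (intro exI[of _ K]) auto
 next
  case (insert h B)
  then have h: "length h = N" by (auto simp: bruhat_le_def)
  obtain K1 where K1: "\<And>k y. k \<ge> K1 ==> sol k f y ==> lookup y h = rh f h" using eventually_rh[OF fg(1) h] by metis
  obtain K2 where K2: "\<And>k y. k \<ge> K2 ==> sol k h y ==> lookup y g = rh h g" using eventually_rh[OF h fg(2)] by metis
  obtain K where K: "\<forall>k\<ge>K. (1 \<le> k \<and> f \<in> II k \<and> g \<in> II k) \<and> (\<forall>h\<in>B. (\<forall>y. sol k f y --> lookup y h = rh f h) \<and> (\<forall>y. sol k h y --> lookup y g = rh h g))"
   using insert by auto
  then show ?case using K1 K2 by (intro exI[of _ "max K (max K1 K2)"]) auto
 qed
 from this[OF finite_interval order.refl] obtain k where k: "1 \<le> k" "f \<in> II k" "g \<in> II k"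
  "\<And>h y. h \<in> ?A ==> sol k f y ==> lookup y h = rh f h" "\<And>h y. h \<in> ?A ==> sol k h y ==> lookup y g = rh h g"
  by blast
 obtain Y where Y: "\<And>h. h \<in> II k ==> sol k h (Y h)" using tr[OF k(1)] by metis
 have invol: "al (psi k b) (al (psi k b) (ub f)) = ub f"
 proof -
  have "al (psi k b) (al (psi k b) (ub f)) = sl_ext (\<lambda>c. c) (\<lambda>f. al (psi k b) (psi k b f)) (ub f)"
   by (subst sl_ext_sl[OF qbar.semilin_axioms]) simp
  also have "\<dots> = sl_ext (\<lambda>c. c) (\<lambda>f. single f 1) (ub f)"
  proof (intro sl_ext_cong psi_involution ok k(1))
   fix h assume "h \<in> keys (ub f)"
   then have "h = f \<or> (E f \<and> h = dn f)" by (auto simp: ub_def in_keys_iff lookup_add lookup_single when_def split: if_splits)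
   then show "h \<in> box k N" using k(2) by (auto simp: II_def)
  qed
  also have "\<dots> = ub f" by (simp add: sl_ext_def flip: vec_expand)
  finally show ?thesis .
 qed
 have "lin_ext ub (al Y (Y f)) = sl_ext qbar (\<lambda>h. lin_ext ub (Y h)) (Y f)"
  unfolding lin_ext_sl by (subst sl_ext_sl[OF id_semilin.semilin_axioms]) simp
 also have "\<dots> = sl_ext qbar (\<lambda>h. al (psi k b) (ub h)) (Y f)"
  using Y[OF k(2)] Y by (intro sl_ext_cong) (auto simp: sol_def)
 also have "\<dots> = al (psi k b) (lin_ext ub (Y f))"
  unfolding lin_ext_sl by (subst sl_ext_sl[OF qbar.semilin_axioms]) simp
 also have "\<dots> = al (psi k b) (al (psi k b) (ub f))" using Y[OF k(2)] by (simp add: sol_def)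
 also have "\<dots> = lin_ext ub (single f 1)" unfolding invol by (simp add: lin_ext_simps cst_simps)
 finally have "al Y (Y f) = single f 1"
 proof (rule lin_inj[rotated 2])
  show "len N (al Y (Y f))" unfolding sl_ext_def
   using Y[OF k(2)] sol_len[OF Y] by (intro len_sum len_simps) (auto simp: sol_def)
  show "len N (single f 1)" using fg by (intro len_simps)
 qed
 then have "of_bool (f = g) = lookup (al Y (Y f)) g" by (simp add: lookup_single when_def)
 also have "\<dots> = (\<Sum>h\<in>keys (Y f). qbar (lookup (Y f) h) * lookup (Y h) g)"
  by (rule qbar.lookup_sl_ext)
 also have "\<dots> = (\<Sum>h\<in>keys (Y f) \<inter> ?A. qbar (lookup (Y f) h) * lookup (Y h) g)"
 proof (rule sum.mono_neutral_right)
  show "\<forall>h\<in>keys (Y f) - keys (Y f) \<inter> ?A. qbar (lookup (Y f) h) * lookup (Y h) g = 0"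
  proof
   fix h assume h: "h \<in> keys (Y f) - keys (Y f) \<inter> ?A"
   then have hk: "h \<in> II k" using Y[OF k(2)] by (auto simp: sol_def)
   have "bruhat_le b h f" using h sol_le[OF k(1,2) Y[OF k(2)], of h] by (simp add: in_keys_iff)
   then have "lookup (Y h) g = 0" using h sol_le[OF k(1) hk Y[OF hk], of g] by auto
   then show "qbar (lookup (Y f) h) * lookup (Y h) g = 0" by simp
  qed
 qed auto
 also have "\<dots> = (\<Sum>h\<in>keys (Y f) \<inter> ?A. qbar (rh f h) * rh h g)"
 proof (intro sum.cong refl)
  fix h assume h: "h \<in> keys (Y f) \<inter> ?A"
  then have hk: "h \<in> II k" using Y[OF k(2)] by (auto simp: sol_def)
  show "qbar (lookup (Y f) h) * lookup (Y h) g = qbar (rh f h) * rh h g"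
   using k(4)[OF _ Y[OF k(2)], of h] k(5)[OF _ Y[OF hk]] h by simp
 qed
 also have "\<dots> = (\<Sum>h\<in>?A. qbar (rh f h) * rh h g)"
 proof (rule sum.mono_neutral_left[OF finite_interval])
  show "\<forall>h\<in>?A - keys (Y f) \<inter> ?A. qbar (rh f h) * rh h g = 0"
   using k(4)[OF _ Y[OF k(2)]] by (auto simp: in_keys_iff)
 qed auto
 finally show ?thesis ..
qed

text \<open>Passage from the coordinates in the \<open>ub f\<close> to those in the
  \<open>M_g\<close>: besides \<open>ub g\<close>, the only vector containing \<open>M_g\<close> is
  \<open>ub (ud g)\<close>, provided the two entries agree.\<close>

definition ex :: "fvec => fvec" where
 "ex x = (\<lambda>g. x g + (if E g then qq * x (ud g) else 0))"

lemma cont_ext_ub: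
 assumes "x \<in> A_completion N"
 shows "cont_ext (\<lambda>f g. unit_fvec f g + (if E f then qq * unit_fvec (dn f) g else 0)) x = ex x"
proof
 fix g
 have l: "length f = N" if "x f \<noteq> 0" for f using assms that by (auto simp: A_completion_def)
 let ?u = "\<lambda>f. x f * (unit_fvec f g + (if E f then qq * unit_fvec (dn f) g else 0))"
 have u: "?u f = (if f = g then x g else 0) + (if f = ud g then (if E g then qq * x (ud g) else 0) else 0)" for f
 proof (cases "x f = 0")
  case False
  then show ?thesis using l[OF False] dn_ud[of f] dn_ud[of g] E_dn[of f] E_ud[of g] len_dn[of g] len_dn[of f]
   by (auto simp: unit_fvec_def distrib_left)
 qed auto
 have "Sum_any ?u = (\<Sum>f\<in>{g, ud g}. ?u f)"
  by (rule Sum_any.expand_superset) (auto simp: u split: if_splits)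
 also have "\<dots> = ex x g"
  unfolding u by (cases "ud g = g") (auto simp: ex_def)
 finally show "cont_ext (\<lambda>f g. unit_fvec f g + (if E f then qq * unit_fvec (dn f) g else 0)) x g = ex x g"
  by (simp add: cont_ext_def)
qed

text \<open>In the new coordinates the bar map has the matrix \<open>rh\<close>. The second terms of
  the \<open>ub h\<close> are reindexed by \<open>dn\<close> and \<open>ud\<close>, after which
  \<open>rh_rec\<close> applies.\<close>

lemma bar_ex:
 assumes f: "length f = N" and x: "\<And>h. x h \<noteq> 0 ==> bruhat_le b h f"
 shows "bar_T b (ex x) = ex (\<lambda>g. \<Sum>h | bruhat_le b g h \<and> bruhat_le b h f. qbar (x h) * rh h g)"
proof
 fix g
 let ?I = "\<lambda>g. {h. bruhat_le b g h \<and> bruhat_le b h f}"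
 have lx: "length h = N" if "x h \<noteq> 0" for h using x[OF that] by (simp add: bruhat_le_def)
 have ex_le: "bruhat_le b h f" if "ex x h \<noteq> 0" for h
 proof -
  have "x h \<noteq> 0 \<or> (E h \<and> x (ud h) \<noteq> 0)" using that by (auto simp: ex_def split: if_splits)
  then show ?thesis using x le_ud[of h] lx[of "ud h"] bruhat_trans by (auto simp: len_dn)
 qed
 show "bar_T b (ex x) g = ex (\<lambda>g. \<Sum>h\<in>?I g. qbar (x h) * rh h g) g"
 proof (cases "length g = N")
  case False
  then have "?I g = {}" "?I (ud g) = {}" by (auto simp: bruhat_le_def len_dn)
  moreover have "bar_T b (ex x) g = (\<Sum>h\<in>?I g. qbar (ex x h) * bar_coeff b h g)"
   by (rule bar_T_eq[OF ok]) (rule ex_le)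
  ultimately show ?thesis unfolding ex_def[of "\<lambda>g. \<Sum>h\<in>?I g. qbar (x h) * rh h g"]
   by (simp del: Collect_empty_eq empty_Collect_eq)
 next
  case g: True
  have lI: "length h = N" if "h \<in> ?I g" for h using that by (auto simp: bruhat_le_def)
  let ?s = "\<lambda>h. inverse qq * qbar (x (ud h)) * bar_coeff b h g"
  let ?t = "\<lambda>m. inverse qq * qbar (x m) * bar_coeff b (dn m) g"
  let ?S = "{h \<in> ?I g. E h}"
  have "bar_T b (ex x) g = (\<Sum>h\<in>?I g. qbar (ex x h) * bar_coeff b h g)"
   by (rule bar_T_eq[of b "ex x" f g, OF ok ex_le])
  also have "\<dots> = (\<Sum>h\<in>?I g. qbar (x h) * bar_coeff b h g) + (\<Sum>h\<in>?I g. if E h then ?s h else 0)"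
   unfolding sum.distrib[symmetric] by (intro sum.cong refl) (simp add: ex_def qbar_add qbar_mult distrib_right)
  also have "(\<Sum>h\<in>?I g. if E h then ?s h else 0) = sum ?s ?S"
   by (rule sum.inter_filter[OF finite_interval, symmetric])
  also have "sum ?s ?S = sum ?t ?S"
  \<comment> \<open>\<open>ud\<close> and \<open>dn\<close> may leave the interval, but not at
    indices with a nonzero term.\<close>
  proof (rule sum.reindex_bij_witness_not_neutral[where i = dn and j = ud and S' = "{h \<in> ?S. ?s h = 0}" and T' = "{m \<in> ?S. ?t m = 0}"])
   show "finite {h \<in> ?S. ?s h = 0}" "finite {m \<in> ?S. ?t m = 0}"
    by (rule finite_subset[OF _ finite_interval[of b g f]], blast)+
   fix h assume h: "h \<in> ?S - {h \<in> ?S. ?s h = 0}"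
   then have lh: "length h = N" using lI by blast
   show "dn (ud h) = h" using dn_ud(1)[OF lh] .
   have nz: "x (ud h) \<noteq> 0" "?s h \<noteq> 0" using h by auto
   then have "ud h \<in> ?S" using h x[OF nz(1)] le_ud[OF lh] bruhat_trans E_ud[OF lh] by auto
   then show "ud h \<in> ?S - {m \<in> ?S. ?t m = 0}" using nz(2) dn_ud(1)[OF lh] by simp
  next
   fix m assume m: "m \<in> ?S - {m \<in> ?S. ?t m = 0}"
   then have lm: "length m = N" using lI by blast
   show "ud (dn m) = m" using dn_ud(2)[OF lm] .
   have nz: "bar_coeff b (dn m) g \<noteq> 0" "?t m \<noteq> 0" using m by auto
   have "bruhat_le b g (dn m)" using bar_coeff_props(2)[OF ok _ nz(1)] lm by (simp add: len_dn)
   moreover have "bruhat_le b (dn m) f" using m dn_le[OF lm] bruhat_trans by (auto simp: E_def)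
   ultimately have "dn m \<in> ?S" using m E_dn[OF lm] by auto
   then show "dn m \<in> ?S - {h \<in> ?S. ?s h = 0}" using nz(2) dn_ud(2)[OF lm] by simp
  next
   fix h assume "h \<in> ?S"
   then show "?t (ud h) = ?s h" using dn_ud(1)[OF lI] by simp
  qed auto
  also have "sum ?t ?S = (\<Sum>h\<in>?I g. if E h then ?t h else 0)"
   by (rule sum.inter_filter[OF finite_interval])
  also have "(\<Sum>h\<in>?I g. qbar (x h) * bar_coeff b h g) + \<dots> = (\<Sum>h\<in>?I g. qbar (x h) * beta h g)"
   unfolding sum.distrib[symmetric] by (intro sum.cong refl) (simp add: beta_def distrib_left)
  also have "\<dots> = (\<Sum>h\<in>?I g. qbar (x h) * rh h g + (if E g then qq * (qbar (x h) * rh h (ud g)) else 0))"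
  proof (intro sum.cong refl)
   fix h assume "h \<in> ?I g"
   then show "qbar (x h) * beta h g = qbar (x h) * rh h g + (if E g then qq * (qbar (x h) * rh h (ud g)) else 0)"
    using rh_rec[OF lI g] by (simp add: algebra_simps)
  qed
  also have "\<dots> = (\<Sum>h\<in>?I g. qbar (x h) * rh h g) + (if E g then qq * (\<Sum>h\<in>?I g. qbar (x h) * rh h (ud g)) else 0)"
   by (simp add: sum.distrib sum_distrib_left)
  also have "(if E g then qq * (\<Sum>h\<in>?I g. qbar (x h) * rh h (ud g)) else 0)
   = (if E g then qq * (\<Sum>h\<in>?I (ud g). qbar (x h) * rh h (ud g)) else 0)"
  proof -
   have "(\<Sum>h\<in>?I g. qbar (x h) * rh h (ud g)) = (\<Sum>h\<in>?I (ud g). qbar (x h) * rh h (ud g))" if "E g"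
   proof (rule sum.mono_neutral_right[OF finite_interval])
    show "?I (ud g) \<subseteq> ?I g" using le_ud[OF g that] bruhat_trans by blast
    show "\<forall>h\<in>?I g - ?I (ud g). qbar (x h) * rh h (ud g) = 0"
     using rh_le[OF lI, of _ "ud g"] g by (auto simp: len_dn)
   qed
   then show ?thesis by simp
  qed
  finally show ?thesis by (simp add: ex_def)
 qed
qed

lemma B_support:
 assumes "x \<in> B_completion b"
 obtains F where "finite F" "\<And>f. f \<in> F ==> length f = N" "\<And>h. x h \<noteq> 0 ==> \<exists>f\<in>F. bruhat_le b h f"
proof -
 let ?P = "\<lambda>x :: fvec. \<exists>F. finite F \<and> (\<forall>f\<in>F. length f = N) \<and> (\<forall>h. x h \<noteq> 0 --> (\<exists>f\<in>F. bruhat_le b h f))"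
 have "?P x"
  using assms unfolding B_completion_def completion_def
 proof (induction rule: fvec.span_induct_alt)
  case base
  show ?case by (intro exI[of _ "{}"]) simp
 next
  case (step c y z)
  then obtain F f where F: "finite F" "\<forall>f\<in>F. length f = N" "\<forall>h. z h \<noteq> 0 --> (\<exists>f\<in>F. bruhat_le b h f)"
   "length f = N" "y \<in> unitriangular (bruhat_less b) f" by blast
  have "\<exists>f\<in>insert f F. bruhat_le b h f" if "((\<lambda>f. c * y f) + z) h \<noteq> 0" for h
  proof -
   have "y h \<noteq> 0 \<or> z h \<noteq> 0" using that by auto
   then show ?thesis using F unitriangular_le[OF F(5,4), of h] by blast
  qed
  then show ?case using F by (intro exI[of _ "insert f F"]) auto
 qed
 then show ?thesis using that by blast
qed

text \<open>A nonzero difference in the kernel would be nonzero along a whole chain, whereas its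
  support lies below finitely many sequences.\<close>

lemma ex_inj:
 assumes "x \<in> B_completion b" "y \<in> B_completion b" "ex x = ex y"
 shows "x = y"
proof (rule ccontr)
 define z where "z = x - y"
 assume "x \<noteq> y"
 then obtain g where g: "z g \<noteq> 0" by (auto simp: z_def fun_eq_iff)
 have "z \<in> B_completion b"
  using assms(1,2) unfolding z_def B_completion_def completion_def by (rule fvec.span_diff)
 then obtain F where F: "finite F" "\<And>f. f \<in> F ==> length f = N" "\<And>h. z h \<noteq> 0 ==> \<exists>f\<in>F. bruhat_le b h f"
  by (rule B_support) blast
 have rec: "z h + (if E h then qq * z (ud h) else 0) = 0" for h
 proof -
  have "z h + (if E h then qq * z (ud h) else 0) = ex x h - ex y h"
   by (simp add: z_def ex_def algebra_simps)
  then show ?thesis by (simp add: assms(3))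
 qed
 have lg: "length g = N" using F(3)[OF g] by (auto simp: bruhat_le_def)
 have Eg: "E g" using rec[of g] g by (auto split: if_splits)
 have it: "z ((ud ^^ i) g) \<noteq> 0" for i
 proof (induction i)
  case (Suc i)
  then show ?case using rec[of "(ud ^^ i) g"] by (auto split: if_splits)
 qed (simp add: g)
 have "\<exists>M. \<forall>i\<ge>M. \<forall>f\<in>F. \<not> bruhat_le b ((ud ^^ i) g) f" using F(1,2)
 proof (induction F)
  case (insert h A)
  then obtain M1 where "\<forall>i\<ge>M1. \<forall>h\<in>A. \<not> bruhat_le b ((ud ^^ i) g) h" by auto
  moreover obtain M2 where "\<forall>i\<ge>M2. \<not> bruhat_le b ((ud ^^ i) g) h"
   using esc[OF lg Eg[unfolded E_def], of h] insert by auto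
  ultimately show ?case by (intro exI[of _ "max M1 M2"]) auto
 qed auto
 then show False using it F(3) by blast
qed

end

lemma qZq_mult_qq: "x \<in> qZq ==> qq * x \<in> qZq"
proof -
 assume "x \<in> qZq"
 then obtain p where "x = qq * poly (map_poly of_int p) qq" by (auto simp: qZq_iff)
 then show ?thesis unfolding qZq_iff by (intro exI[of _ "pCons 0 p"]) (simp add: map_poly_pCons)
qed

lemma unitriangular_A: "x \<in> unitriangular R f ==> length f = n ==> (\<And>g. R g f ==> length g = n) ==> x \<in> A_completion n"
 by (auto simp: unitriangular_def A_completion_def)

lemma A_subspace: "fvec.subspace (A_completion n)"
 by (rule fvec.subspaceI) (auto simp: A_completion_def, metis add.right_neutral)

lemma completion_A: "(\<And>f g. length f = n ==> R g f ==> length g = n) ==> completion n R \<subseteq> A_completion n"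
 unfolding completion_def by (rule fvec.span_minimal[OF _ A_subspace]) (auto intro: unitriangular_A)

context side
begin

lemma B_A: "B_completion b \<subseteq> A_completion N"
 unfolding B_completion_def by (rule completion_A) (simp add: bruhat_less_def bruhat_le_def)

lemma unitri_B: "x \<in> unitriangular (bruhat_less b) f ==> length f = N ==> x \<in> B_completion b"
 unfolding B_completion_def completion_def by (rule fvec.span_base) auto

text \<open>The terms added by the expansion lie lower in the order and carry a factor q, so both
  conditions on the coefficients survive.\<close>

lemma ex_unitri:
 assumes f: "length f = N" and x: "x \<in> unitriangular (bruhat_less b) f" "\<And>g. g \<noteq> f ==> x g \<in> qZq"
 shows "ex x \<in> unitriangular (bruhat_less b) f" "g \<noteq> f ==> ex x g \<in> qZq"
proof -
 note le = unitriangular_le[OF x(1) f]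
 have 1: "x f = 1" using x(1) by (simp add: unitriangular_def)
 have "x (ud f) = 0" if "E f" using le[of "ud f"] ud_not_le[OF f that] by auto
 then have "ex x f = 1" by (simp add: ex_def 1)
 moreover have "bruhat_le b h f" if "ex x h \<noteq> 0" for h
 proof -
  have "x h \<noteq> 0 \<or> (E h \<and> x (ud h) \<noteq> 0)" using that by (auto simp: ex_def split: if_splits)
  then show ?thesis
  proof
   assume h: "E h \<and> x (ud h) \<noteq> 0"
   then have "length h = N" using le[of "ud h"] by (simp add: bruhat_le_def len_dn)
   then show ?thesis using le_ud[of h] le[of "ud h"] h bruhat_trans by blast
  qed (rule le)
 qed
 ultimately show "ex x \<in> unitriangular (bruhat_less b) f"
  by (auto simp: unitriangular_def bruhat_less_def)
 show "ex x g \<in> qZq" if "g \<noteq> f"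
 proof -
  have "qq * x (ud g) \<in> qZq"
   using x(2)[of "ud g"] 1 qZq_powi[of 1 1] by (cases "ud g = f") (auto intro: qZq_mult_qq)
  then show ?thesis using x(2)[OF that] by (auto simp: ex_def intro: qZq_add)
 qed
qed

text \<open>\<open>expd\<close> stands for \<open>expand_U\<close> or \<open>expand_U'\<close>.
  Uniqueness in Fock space identifies the expansion of x with the canonical element there; with
  injectivity this gives uniqueness in the U-coordinates as well.\<close>

theorem canonical:
 assumes f: "length f = N" and x: "x \<in> unitriangular (bruhat_less b) f" "\<And>g. g \<noteq> f ==> x g \<in> qZq"
  and bar: "bar_T b (ex x) = ex x" and expd: "\<And>z. z \<in> A_completion N ==> expd z = ex z"
 shows "canon_T b f = expd x" "canon_T b f \<in> expd ` B_completion b"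
  "inv_into (B_completion b) expd (canon_T b f) = x"
  "(THE z. z \<in> unitriangular (bruhat_less b) f \<and> (\<forall>g. g \<noteq> f --> z g \<in> qZq) \<and> bar_T b (expd z) = expd z) = x"
proof -
 have ex: "expd z = ex z" if "z \<in> B_completion b" for z using that B_A expd by blast
 have xB: "x \<in> B_completion b" by (rule unitri_B[OF x(1) f])
 show T: "canon_T b f = expd x"
  unfolding canon_T_def ex[OF xB]
 proof (rule the_equality)
  show "ex x \<in> unitriangular (bruhat_less b) f \<and> (\<forall>g. g \<noteq> f --> ex x g \<in> qZq) \<and> bar_T b (ex x) = ex x"
   using ex_unitri[OF f x] bar by blast
  fix z assume z: "z \<in> unitriangular (bruhat_less b) f \<and> (\<forall>g. g \<noteq> f --> z g \<in> qZq) \<and> bar_T b z = z"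
  show "z = ex x" by (rule canonical_unique[OF ok f]) (use z ex_unitri[OF f x] bar in blast)+
 qed
 then show "canon_T b f \<in> expd ` B_completion b" using xB by blast
 have inj: "inj_on expd (B_completion b)" using ex ex_inj by (auto simp: inj_on_def)
 show "inv_into (B_completion b) expd (canon_T b f) = x" unfolding T by (rule inv_into_f_f[OF inj xB])
 show "(THE z. z \<in> unitriangular (bruhat_less b) f \<and> (\<forall>g. g \<noteq> f --> z g \<in> qZq) \<and> bar_T b (expd z) = expd z) = x"
 proof (rule the_equality)
  show "x \<in> unitriangular (bruhat_less b) f \<and> (\<forall>g. g \<noteq> f --> x g \<in> qZq) \<and> bar_T b (expd x) = expd x"
   using x bar ex[OF xB] by auto
  fix z assume z: "z \<in> unitriangular (bruhat_less b) f \<and> (\<forall>g. g \<noteq> f --> z g \<in> qZq) \<and> bar_T b (expd z) = expd z"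
  then have zB: "z \<in> B_completion b" using unitri_B f by blast
  have "ex z = ex x"
  proof (rule canonical_unique[OF ok f])
   show "ex z \<in> unitriangular (bruhat_less b) f" "\<And>g. g \<noteq> f ==> ex z g \<in> qZq"
    using ex_unitri[OF f, of z] z by blast+
   show "bar_T b (ex z) = ex z" using z ex[OF zB] by simp
  qed (use ex_unitri[OF f x] bar in blast)+
  then show "z = x" by (rule ex_inj[OF zB xB])
 qed
qed

end

section \<open>Exchanging adjacent factors\<close>

lemma split2: "length f = length b1 + 2 + length b2 ==>
  \<exists>f1 c d f2. f = f1 @ [c, d] @ f2 \<and> length f1 = length b1 \<and> length f2 = length b2"
proof -
 assume l: "length f = length b1 + 2 + length b2"
 then have "f = take (length b1) f @ [f ! length b1, f ! Suc (length b1)] @ drop (length b1 + 2) f"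
  by (simp add: Cons_nth_drop_Suc)
 then show ?thesis using l by (intro exI[of _ "take (length b1) f"] exI[of _ "f ! length b1"]
  exI[of _ "f ! Suc (length b1)"] exI[of _ "drop (length b1 + 2) f"]) simp
qed

lemma ud_append: "length f1 = pos ==> up pos (f1 @ [c, d] @ f2) = f1 @ [c + 1, d + 1] @ f2"
 "length f1 = pos ==> down pos (f1 @ [c, d] @ f2) = f1 @ [c - 1, d - 1] @ f2"
 "length f1 = pos ==> swap_at pos (f1 @ [c, d] @ f2) = f1 @ [d, c] @ f2"
 "length f1 = pos ==> (f1 @ [c, d] @ f2) ! pos = c" "length f1 = pos ==> (f1 @ [c, d] @ f2) ! (pos + 1) = d"
 by (simp_all add: up_def down_def swap_at_def list_update_append nth_append)

lemma ud_iter: "length f1 = pos ==> (up pos ^^ i) (f1 @ [c, d] @ f2) = f1 @ [c + int i, d + int i] @ f2"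
 "length f1 = pos ==> (down pos ^^ i) (f1 @ [c, d] @ f2) = f1 @ [c - int i, d - int i] @ f2"
proof -
 assume l: "length f1 = pos"
 show "(up pos ^^ i) (f1 @ [c, d] @ f2) = f1 @ [c + int i, d + int i] @ f2"
 proof (induction i)
  case (Suc i)
  have e: "c + int (Suc i) = c + int i + 1" "d + int (Suc i) = d + int i + 1" by simp_all
  show ?case unfolding funpow.simps comp_def Suc ud_append(1)[OF l] e ..
 qed simp
 show "(down pos ^^ i) (f1 @ [c, d] @ f2) = f1 @ [c - int i, d - int i] @ f2"
 proof (induction i)
  case (Suc i)
  have e: "c - int (Suc i) = c - int i - 1" "d - int (Suc i) = d - int i - 1" by simp_all
  show ?case unfolding funpow.simps comp_def Suc ud_append(2)[OF l] e ..
 qed simp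
qed

lemma sharp_mid:
 assumes "length h1 = length b1" "length h2 = length b2"
 shows "sharp (b1 @ [s, t] @ b2) (h1 @ [x, y] @ h2) r (Suc (length b1)) = (if y \<le> r then (-1) ^ t else 0) + sharp b2 h2 r 0"
proof -
 have "sharp ([s] @ [t] @ b2) ([x] @ [y] @ h2) r 1 = (if y \<le> r then (-1) ^ t else 0) + sharp b2 h2 r 0"
  using assms by (subst sharp_append, simp, simp, subst sharp_append) (simp_all add: sharp_single)
 then show ?thesis using sharp_append[OF assms(1), of "[x, y] @ h2" "[s, t] @ b2" r "Suc (length b1)"] assms
  by (simp add: sharp_length)
qed

lemma sharp_extreme:
 assumes "f \<in> box k (length b)" "g \<in> box k (length b)"
 shows "sharp b f (int k) 0 = sharp b g (int k) 0" "sharp b f (- int k - 1) 0 = 0"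
proof -
 have fg: "- int k \<le> f ! i \<and> f ! i \<le> int k" if "f \<in> box k (length b)" "i < length b" for f i
 proof -
  have "f ! i \<in> set f" using that by (auto simp: box_def)
  then have "f ! i \<in> {- int k..int k}" using that(1) unfolding box_def by blast
  then show ?thesis by simp
 qed
 show "sharp b f (int k) 0 = sharp b g (int k) 0"
  unfolding sharp_def using fg[OF assms(1)] fg[OF assms(2)] by (intro sum.cong) auto
 show "sharp b f (- int k - 1) 0 = 0"
  unfolding sharp_def using fg[OF assms(1)] by (intro sum.neutral) force
qed

lemma bruhat_2: "bruhat_le VW [c - 1, c - 1] [c, c]" "bruhat_le WV [c + 1, c + 1] [c, c]"
proof -
 have "sharp VW [x, y] r 1 = - of_bool (y \<le> r)" "sharp WV [x, y] r 1 = of_bool (y \<le> r)" for x y r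
  using sharp_append[of "[x]" "[0]" "[y]" "[Suc 0]" r 1] sharp_append[of "[x]" "[Suc 0]" "[y]" "[0]" r 1]
  by (simp_all add: sharp_single)
 then show "bruhat_le VW [c - 1, c - 1] [c, c]" "bruhat_le WV [c + 1, c + 1] [c, c]"
  by (auto simp: bruhat_le_def sharp2 less_Suc_eq of_bool_def)
qed

locale adjacent =
 fixes b1 b2 :: "nat list"
 assumes seq: "set b1 \<subseteq> {0, 1}" "set b2 \<subseteq> {0, 1}"
begin

abbreviation "b \<equiv> b1 @ [0, 1] @ b2"
abbreviation "b' \<equiv> b1 @ [1, 0] @ b2"
abbreviation "pos \<equiv> length b1"
abbreviation "sz \<equiv> pos + 2 + length b2"

lemma lb: "length b = sz" "length b' = sz"
 by simp_all

lemma ud_length: "length (up pos f) = length f" "length (down pos f) = length f" "length (swap_at pos f) = length f"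
 by (simp_all add: up_def down_def swap_at_def)

lemma ud_inv:
 assumes "length f = sz"
 shows "down pos (up pos f) = f" "up pos (down pos f) = f" "swap_at pos (swap_at pos f) = f"
  "up pos f ! pos = f ! pos + 1" "up pos f ! (pos + 1) = f ! (pos + 1) + 1"
  "down pos f ! pos = f ! pos - 1" "down pos f ! (pos + 1) = f ! (pos + 1) - 1"
  "swap_at pos f ! pos = f ! (pos + 1)" "swap_at pos f ! (pos + 1) = f ! pos"
proof -
 obtain f1 c d f2 where f: "f = f1 @ [c, d] @ f2" "length f1 = pos" using split2[OF assms] by blast
 note s = ud_append[OF f(2)]
 show "down pos (up pos f) = f" "up pos (down pos f) = f" "swap_at pos (swap_at pos f) = f"
  "up pos f ! pos = f ! pos + 1" "up pos f ! (pos + 1) = f ! (pos + 1) + 1"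
  "down pos f ! pos = f ! pos - 1" "down pos f ! (pos + 1) = f ! (pos + 1) - 1"
  "swap_at pos f ! pos = f ! (pos + 1)" "swap_at pos f ! (pos + 1) = f ! pos"
  unfolding f(1) s by simp_all
qed

text \<open>\<open>sharp\<close> is compared at the position of the second exchanged entry and at an
  extreme level. Once this entry has crossed the level, the value is larger by 1 than the Bruhat
  order permits.\<close>

lemma esc2:
 assumes "length g = sz" "length f = sz"
 shows "\<exists>M. \<forall>i\<ge>M. \<not> bruhat_le b ((up pos ^^ i) g) f \<and> \<not> bruhat_le b' ((down pos ^^ i) g) f"
proof -
 obtain g1' c d g2' where g: "g = g1' @ [c, d] @ g2'" "length g1' = pos" "length g2' = length b2"
  using split2[OF assms(1)] by blast
 obtain f1 x y f2 where f: "f = f1 @ [x, y] @ f2" "length f1 = pos" "length f2 = length b2"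
  using split2[OF assms(2)] by blast
 obtain k where k: "f \<in> box k sz" "g \<in> box k sz"
  using box_obtain[of "{f, g}" 0] assms by auto
 then have B: "f2 \<in> box k (length b2)" "g2' \<in> box k (length b2)" "- int k \<le> d" "d \<le> int k" "- int k \<le> y" "y \<le> int k"
  using f g by (auto simp: box_def)
 have j: "Suc pos < length b" "Suc pos < length b'" by simp_all
 \<comment> \<open>All entries of f and g lie between \<open>- k\<close> and k, so 2k + 1 steps push
   the entry d beyond either end.\<close>
 have "\<not> bruhat_le b ((up pos ^^ i) g) f \<and> \<not> bruhat_le b' ((down pos ^^ i) g) f" if "i \<ge> nat (2 * int k + 1)" for i
 proof
  have i: "int k < d + int i" "d - int i \<le> - int k - 1" using that B by linarith+
  show "\<not> bruhat_le b ((up pos ^^ i) g) f"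
  proof
   assume "bruhat_le b ((up pos ^^ i) g) f"
   then have "sharp b ((up pos ^^ i) g) (int k) (Suc pos) \<le> sharp b f (int k) (Suc pos)"
    using j by (simp add: bruhat_le_def)
   then show False
    unfolding g(1) ud_iter[OF g(2)] f(1) sharp_mid[OF g(2,3)] sharp_mid[OF f(2,3)]
    using sharp_extreme(1)[OF B(1,2)] i(1) B by simp
  qed
  show "\<not> bruhat_le b' ((down pos ^^ i) g) f"
  proof
   assume "bruhat_le b' ((down pos ^^ i) g) f"
   then have "sharp b' ((down pos ^^ i) g) (- int k - 1) (Suc pos) \<le> sharp b' f (- int k - 1) (Suc pos)"
    using j by (simp add: bruhat_le_def)
   then show False
    unfolding g(1) ud_iter[OF g(2)] f(1) sharp_mid[OF g(2,3)] sharp_mid[OF f(2,3)]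
    using sharp_extreme(2)[OF B(1,2)] sharp_extreme(2)[OF B(2,1)] i(2) B by simp
  qed
 qed
 then show ?thesis by blast
qed

lemma le2:
 assumes "length f = sz" "f ! pos = f ! (pos + 1)"
 shows "bruhat_le b (down pos f) f" "bruhat_le b' (up pos f) f"
proof -
 obtain f1 x y f2 where f: "f = f1 @ [x, y] @ f2" "length f1 = pos" "length f2 = length b2"
  using split2[OF assms(1)] by blast
 have xy: "y = x" using assms(2) unfolding f(1) ud_append(4,5)[OF f(2)] by simp
 show "bruhat_le b (down pos f) f" "bruhat_le b' (up pos f) f"
  unfolding f(1) ud_append[OF f(2)] xy
  using bruhat_append[OF bruhat_refl[OF f(2)] bruhat_append[OF bruhat_2(1)[of x] bruhat_refl[OF f(3)]]]
   bruhat_append[OF bruhat_refl[OF f(2)] bruhat_append[OF bruhat_2(2)[of x] bruhat_refl[OF f(3)]]]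
  by simp_all
qed

lemma ok_b: "ok b" "ok b'" "b1 = [] \<or> ok b1" "b2 = [] \<or> ok b2"
 using seq by (auto simp: ok_def)

sublocale V: side b pos "down pos" "up pos"
proof
 fix f g :: "int list"
 show "ok b" by (rule ok_b)
 show "length (down pos f) = length f" "length (up pos f) = length f" by (rule ud_length)+
 {
  assume f: "length f = length b"
  note f' = f[unfolded lb]
  show "down pos (up pos f) = f" "up pos (down pos f) = f" using ud_inv[OF f'] by blast+
  show "(up pos f ! pos = up pos f ! (pos + 1)) = (f ! pos = f ! (pos + 1))" using ud_inv(4-7)[OF f'] by simp
  show "f ! pos = f ! (pos + 1) ==> bruhat_le b (down pos f) f" by (rule le2(1)[OF f'])
  assume "length g = length b"
  from esc2[OF this[unfolded lb] f'] show "\<exists>M. \<forall>i\<ge>M. \<not> bruhat_le b ((up pos ^^ i) g) f" by blast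
 }
qed

sublocale W: side b' pos "up pos" "down pos"
proof
 fix f g :: "int list"
 show "ok b'" by (rule ok_b)
 show "length (up pos f) = length f" "length (down pos f) = length f" by (rule ud_length)+
 {
  assume f: "length f = length b'"
  note f' = f[unfolded lb]
  show "up pos (down pos f) = f" "down pos (up pos f) = f" using ud_inv[OF f'] by blast+
  show "(down pos f ! pos = down pos f ! (pos + 1)) = (f ! pos = f ! (pos + 1))" using ud_inv(4-7)[OF f'] by simp
  show "f ! pos = f ! (pos + 1) ==> bruhat_le b' (up pos f) f" by (rule le2(2)[OF f'])
  assume "length g = length b'"
  from esc2[OF this[unfolded lb] f'] show "\<exists>M. \<forall>i\<ge>M. \<not> bruhat_le b' ((down pos ^^ i) g) f" by blast
 }
qed

lemma fUL:
 assumes "length f = sz"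
 shows "fL pos (fU pos f) = f" "fU pos (fL pos f) = f"
 using ud_inv[OF assms] by (auto simp: fL_def fU_def)

lemma fUL_length: "length (fU pos f) = length f" "length (fL pos f) = length f"
 by (simp_all add: fU_def fL_def ud_length)

lemma box_ud:
 assumes "f \<in> box k n" "- int k \<le> c" "c \<le> int k" "- int k \<le> d" "d \<le> int k"
 shows "f[i := c, j := d] \<in> box k n"
proof -
 have "set (f[i := c, j := d]) \<subseteq> insert d (insert c (set f))"
  using set_update_subset_insert[of "f[i := c]" j d] set_update_subset_insert[of f i c] by blast
 then show ?thesis using assms by (auto simp: box_def)
qed

lemma box_nth: "f \<in> box k sz ==>
  - int k \<le> f ! pos \<and> f ! pos \<le> int k \<and> - int k \<le> f ! (pos + 1) \<and> f ! (pos + 1) \<le> int k"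
proof -
 assume f: "f \<in> box k sz"
 then have "f ! pos \<in> set f" "f ! (pos + 1) \<in> set f" by (auto simp: box_def)
 then have "f ! pos \<in> {- int k..int k}" "f ! (pos + 1) \<in> {- int k..int k}" using f unfolding box_def by blast+
 then show ?thesis by simp
qed

lemma II_V: "V.II k = Iset k sz pos"
proof (intro set_eqI iffI)
 fix f assume "f \<in> V.II k"
 then have f: "f \<in> box k sz" "f ! pos = f ! (pos + 1) ==> down pos f \<in> box k sz"
  unfolding V.II_def V.E_def lb by auto
 have "f ! pos \<noteq> - int k" if "f ! pos = f ! (pos + 1)"
  using box_nth[OF f(2)[OF that]] ud_inv(6) f(1) by (auto simp: box_def)
 then show "f \<in> Iset k sz pos" using f(1) by (auto simp: Iset_def)
next
 fix f assume "f \<in> Iset k sz pos"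
 then have f: "f \<in> box k sz" "f ! pos = f ! (pos + 1) ==> f ! pos \<noteq> - int k" by (auto simp: Iset_def)
 have "down pos f \<in> box k sz" if "f ! pos = f ! (pos + 1)"
  unfolding down_def using f(2)[OF that] that box_nth[OF f(1)] by (intro box_ud[OF f(1)]) auto
 then show "f \<in> V.II k" using f(1) unfolding V.II_def V.E_def lb by blast
qed

lemma II_W: "f \<in> V.II k ==> fU pos f \<in> W.II k"
proof -
 assume "f \<in> V.II k"
 then have f: "f \<in> box k sz" "f ! pos = f ! (pos + 1) ==> down pos f \<in> box k sz"
  unfolding V.II_def V.E_def lb by auto
 then have lf: "length f = sz" by (simp add: box_def)
 show "fU pos f \<in> W.II k"
  unfolding W.II_def W.E_def lb
 proof (cases "f ! pos = f ! (pos + 1)")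
  case True
  then show "fU pos f \<in> {f \<in> box k sz. f ! pos = f ! (pos + 1) --> up pos f \<in> box k sz}"
   using f ud_inv(2)[OF lf] by (simp add: fU_def)
 next
  case False
  then show "fU pos f \<in> {f \<in> box k sz. f ! pos = f ! (pos + 1) --> up pos f \<in> box k sz}"
   using ud_inv(8,9)[OF lf] box_ud[OF f(1), of "f ! (pos + 1)" "f ! pos" pos "pos + 1"] box_nth[OF f(1)]
   by (auto simp: fU_def swap_at_def)
 qed
qed

lemma ub_eq: "V.ub f = UM pos f" "length f = sz ==> W.ub (fU pos f) = UM' pos f"
proof -
 show "V.ub f = UM pos f" by (simp add: V.ub_def V.E_def UM_def)
 assume f: "length f = sz"
 show "W.ub (fU pos f) = UM' pos f"
  using ud_inv(2,6-9)[OF f] by (auto simp: W.ub_def W.E_def UM'_def fU_def)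
qed

text \<open>\<open>psi_U\<close> in the language of \<open>sol\<close>: y' is y with its indices
  moved by \<open>fU\<close>.\<close>

lemma transport:
 assumes "1 \<le> k" "f \<in> V.II k"
 obtains y y' where "V.sol k f y" "W.sol k (fU pos f) y'"
  "\<And>g. length g = sz ==> lookup y' (fU pos g) = lookup y g"
proof -
 have lf: "length f = sz" using assms(2) unfolding V.II_def box_def lb by simp
 obtain y where y: "keys y \<subseteq> Iset k sz pos"
  "al (psi k b) (UM pos f) = lin_ext (UM pos) y" "al (psi k b') (UM' pos f) = lin_ext (UM' pos) y"
  by (rule psi_U[OF ok_b(3,4) assms(1) refl refl assms(2)[unfolded II_V]])
 have ly: "length g = sz" if "g \<in> keys y" for g using y(1) that by (auto simp: Iset_def box_def)
 have V: "V.sol k f y" unfolding V.sol_def II_V ub_eq(1)[abs_def] using y(1,2) by simp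
 define y' where "y' = lin_ext (\<lambda>g. single (fU pos g) 1) y"
 have "lin_ext W.ub y' = lin_ext (\<lambda>g. W.ub (fU pos g)) y"
  unfolding y'_def lin_ext_lin_ext by (simp add: lin_ext_simps cst_simps)
 also have "\<dots> = lin_ext (UM' pos) y" by (intro lin_ext_cong ub_eq(2) ly)
 finally have 1: "al (psi k b') (W.ub (fU pos f)) = lin_ext W.ub y'" using y(3) ub_eq(2)[OF lf] by simp
 have 2: "keys y' \<subseteq> W.II k"
 proof
  fix g assume "g \<in> keys y'"
  then obtain h where "h \<in> keys y" "g = fU pos h"
   using subsetD[OF keys_lin_ext[of "\<lambda>g. single (fU pos g) 1" y]] unfolding y'_def by (auto split: if_splits)
  then show "g \<in> W.II k" using y(1) II_W unfolding II_V[symmetric] by blast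
 qed
 have 3: "lookup y' (fU pos g) = lookup y g" if g: "length g = sz" for g
 proof -
  have "lookup y' (fU pos g) = (\<Sum>h\<in>keys y. lookup y h * lookup (single (fU pos h) 1) (fU pos g))"
   unfolding y'_def by (rule lookup_lin_ext)
  also have "\<dots> = (\<Sum>h\<in>keys y. if h = g then lookup y h else 0)"
  proof (intro sum.cong refl)
   fix h assume "h \<in> keys y"
   then have "fU pos h = fU pos g \<longleftrightarrow> h = g" using fUL(1)[OF ly, of h] fUL(1)[OF g] by metis
   then show "lookup y h * lookup (single (fU pos h) 1) (fU pos g) = (if h = g then lookup y h else 0)"
    by (simp add: lookup_single when_def)
  qed
  also have "\<dots> = lookup y g" by (simp add: sum.delta in_keys_iff)
  finally show ?thesis .
 qed
 have W: "W.sol k (fU pos f) y'" unfolding W.sol_def using 1 2 by blast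
 show ?thesis by (rule that[OF V W 3])
qed

text \<open>At a sufficiently large level both entries are read off from the two corresponding
  finite solutions.\<close>

lemma rh_transport:
 assumes "length f = sz" "length g = sz"
 shows "W.rh (fU pos f) (fU pos g) = V.rh f g"
proof -
 have l: "length f = length b" "length g = length b" "length (fU pos f) = length b'" "length (fU pos g) = length b'"
  using assms by (simp_all add: fUL_length)
 obtain K1 where K1: "K1 \<ge> 1" "\<And>k. k \<ge> K1 ==> f \<in> V.II k \<and> g \<in> V.II k"
  "\<And>k y. k \<ge> K1 ==> V.sol k f y ==> lookup y g = V.rh f g"
  by (rule V.eventually_rh[OF l(1,2)]) blast
 obtain K2 where K2: "\<And>k y. k \<ge> K2 ==> W.sol k (fU pos f) y ==> lookup y (fU pos g) = W.rh (fU pos f) (fU pos g)"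
  by (rule W.eventually_rh[OF l(3,4)]) blast
 define k where "k = max K1 K2"
 have k: "k \<ge> K1" "k \<ge> K2" "k \<ge> 1" using K1(1) by (auto simp: k_def)
 obtain y y' where y: "V.sol k f y" "W.sol k (fU pos f) y'"
  "\<And>g. length g = sz ==> lookup y' (fU pos g) = lookup y g"
  by (rule transport[OF k(3) conjunct1[OF K1(2)[OF k(1)]]]) blast
 show ?thesis using K1(3)[OF k(1) y(1)] K2[OF k(2) y(2)] y(3)[OF assms(2)] by simp
qed

definition leC :: "int list => int list => bool" where
 "leC g f \<longleftrightarrow> bruhat_le b g f \<and> bruhat_le b' (fU pos g) (fU pos f)"

lemma rh_leC: "length f = sz ==> length g = sz ==> V.rh f g \<noteq> 0 ==> leC g f"
 using V.rh_le[of f g] W.rh_le[of "fU pos f" "fU pos g"] rh_transport[of f g]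
 by (simp add: leC_def fUL_length)

lemma leC_len: "leC g f ==> length f = sz \<and> length g = sz"
 by (auto simp: leC_def bruhat_le_def)

lemma finite_leC: "finite {h. leC g h \<and> leC h f}"
 by (rule finite_subset[OF _ finite_interval[of b g f]]) (auto simp: leC_def)

theorem canonical_C:
 assumes f: "length f = sz"
 obtains x where "x f = 1" "\<And>g. x g \<noteq> 0 ==> leC g f" "\<And>g. g \<noteq> f ==> x g \<in> qZq"
  "bar_T b (V.ex x) = V.ex x" "bar_T b' (W.ex (\<lambda>g. x (fL pos g))) = W.ex (\<lambda>g. x (fL pos g))"
proof -
 have tr: "\<exists>y. V.sol k f y" if "1 \<le> k" "f \<in> V.II k" for k f
  by (rule transport[OF that]) blast
 obtain x where x: "x f = 1" "\<And>g. x g \<noteq> 0 ==> leC g f" "\<And>g. g \<noteq> f ==> x g \<in> qZq"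
  "\<And>g. leC g f ==> (\<Sum>h | leC g h \<and> leC h f. qbar (x h) * V.rh h g) = x g"
 proof (rule lusztig[of leC V.rh f])
  show "leC x z" if "leC x y" "leC y z" for x y z using that bruhat_trans unfolding leC_def by blast
  show "x = y" if "leC x y" "leC y x" for x y using that bruhat_antisym unfolding leC_def by blast
  show rfl: "leC x x \<and> leC y y" if "leC x y" for x y
   using leC_len[OF that] by (auto simp: leC_def fUL_length intro!: bruhat_refl)
  show "finite {z. leC x z \<and> leC z y}" for x y by (rule finite_leC)
  show "V.rh x x = 1" if "leC x x" for x using leC_len[OF that] by (intro V.rh_diag) simp
  show "V.rh x y \<in> ZQ" if "leC y x" for x y using leC_len[OF that] by (intro V.rh_ZQ) simp_all
  show "leC f f" using f by (auto simp: leC_def fUL_length intro!: bruhat_refl)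
  show "(\<Sum>z | leC y z \<and> leC z x. qbar (V.rh x z) * V.rh z y) = 0" if "leC y x" "x \<noteq> y" for x y
  proof -
   have l: "length x = length b" "length y = length b" using leC_len[OF that(1)] by simp_all
   have "(\<Sum>z | leC y z \<and> leC z x. qbar (V.rh x z) * V.rh z y)
    = (\<Sum>z | bruhat_le b y z \<and> bruhat_le b z x. qbar (V.rh x z) * V.rh z y)"
   proof (rule sum.mono_neutral_left[OF finite_interval])
    show "\<forall>z\<in>{z. bruhat_le b y z \<and> bruhat_le b z x} - {z. leC y z \<and> leC z x}. qbar (V.rh x z) * V.rh z y = 0"
    proof
     fix z assume z: "z \<in> {z. bruhat_le b y z \<and> bruhat_le b z x} - {z. leC y z \<and> leC z x}"
     then have "length z = sz" by (auto simp: bruhat_le_def)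
     then have "V.rh x z = 0 \<or> V.rh z y = 0" using z rh_leC l unfolding lb by blast
     then show "qbar (V.rh x z) * V.rh z y = 0" by auto
    qed
   qed (auto simp: leC_def)
   then show ?thesis using V.rh_involution[OF tr l] that(2) by simp
  qed
 qed blast
 \<comment> \<open>Nonzero terms come from the interval of \<open>leC\<close> only, so any finite
   set around it will do: the Bruhat interval of b as well as the image under \<open>fL\<close> of
   the one of b'.\<close>
 have all: "(\<Sum>h\<in>A. qbar (x h) * V.rh h g) = x g"
  if A: "finite A" "{h. leC g h \<and> leC h f} \<subseteq> A" "\<And>h. h \<in> A ==> length h = sz" and g: "length g = sz" for A g
 proof -
  have "(\<Sum>h\<in>A. qbar (x h) * V.rh h g) = (\<Sum>h | leC g h \<and> leC h f. qbar (x h) * V.rh h g)"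
  proof (rule sum.mono_neutral_right[OF A(1,2)])
   show "\<forall>h\<in>A - {h. leC g h \<and> leC h f}. qbar (x h) * V.rh h g = 0"
   proof
    fix h assume h: "h \<in> A - {h. leC g h \<and> leC h f}"
    then have "x h = 0 \<or> V.rh h g = 0" using x(2)[of h] rh_leC[OF A(3)[of h] g] by blast
    then show "qbar (x h) * V.rh h g = 0" by auto
   qed
  qed
  also have "\<dots> = x g"
  proof (cases "leC g f")
   case False
   then have e: "{h. leC g h \<and> leC h f} = {}" using bruhat_trans unfolding leC_def by blast
   show ?thesis unfolding e using x(2)[of g] False by auto
  qed (rule x(4))
  finally show ?thesis .
 qed
 have "bar_T b (V.ex x) = V.ex (\<lambda>g. \<Sum>h | bruhat_le b g h \<and> bruhat_le b h f. qbar (x h) * V.rh h g)"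
  using f x(2) by (intro V.bar_ex) (auto simp: leC_def)
 also have "(\<lambda>g. \<Sum>h | bruhat_le b g h \<and> bruhat_le b h f. qbar (x h) * V.rh h g) = x"
 proof
  fix g
  show "(\<Sum>h | bruhat_le b g h \<and> bruhat_le b h f. qbar (x h) * V.rh h g) = x g"
  proof (cases "length g = sz")
   case True
   show ?thesis by (rule all[OF finite_interval _ _ True]) (auto simp: leC_def bruhat_le_def)
  next
   case False
   then have e: "{h. bruhat_le b g h \<and> bruhat_le b h f} = {}" by (auto simp: bruhat_le_def)
   show ?thesis unfolding e using x(2)[of g] leC_len[of g f] False by auto
  qed
 qed
 finally have 1: "bar_T b (V.ex x) = V.ex x" .
 let ?x = "\<lambda>g. x (fL pos g)"
 have "bar_T b' (W.ex ?x) = W.ex (\<lambda>g. \<Sum>h | bruhat_le b' g h \<and> bruhat_le b' h (fU pos f). qbar (?x h) * W.rh h g)"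
 proof (rule W.bar_ex)
  show "length (fU pos f) = length b'" using f by (simp add: fUL_length)
  fix h assume "?x h \<noteq> 0"
  then have "leC (fL pos h) f" by (rule x(2))
  then show "bruhat_le b' h (fU pos f)" using leC_len[of "fL pos h" f] fUL(2)[of h] by (auto simp: leC_def fUL_length)
 qed
 also have "(\<lambda>g. \<Sum>h | bruhat_le b' g h \<and> bruhat_le b' h (fU pos f). qbar (?x h) * W.rh h g) = ?x"
 proof
  fix g
  let ?A = "{h. bruhat_le b' g h \<and> bruhat_le b' h (fU pos f)}"
  show "(\<Sum>h\<in>?A. qbar (?x h) * W.rh h g) = ?x g"
  proof (cases "length g = sz")
   case True
   have lA: "length h = sz" if "h \<in> ?A" for h using that by (auto simp: bruhat_le_def)
   have inj: "inj_on (fL pos) ?A" using fUL(2)[OF lA] by (metis (no_types, lifting) inj_onI)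
   have "(\<Sum>h\<in>?A. qbar (?x h) * W.rh h g) = (\<Sum>h\<in>?A. qbar (?x h) * V.rh (fL pos h) (fL pos g))"
   proof (intro sum.cong refl)
    fix h assume "h \<in> ?A"
    then show "qbar (?x h) * W.rh h g = qbar (?x h) * V.rh (fL pos h) (fL pos g)"
     using rh_transport[of "fL pos h" "fL pos g"] lA[of h] True by (simp add: fUL_length fUL)
   qed
   also have "\<dots> = (\<Sum>h\<in>fL pos ` ?A. qbar (x h) * V.rh h (fL pos g))"
    by (subst sum.reindex[OF inj]) (simp only: comp_def)
   also have "\<dots> = x (fL pos g)"
   proof (rule all)
    show "finite (fL pos ` ?A)" by (intro finite_imageI finite_interval)
    show "{h. leC (fL pos g) h \<and> leC h f} \<subseteq> fL pos ` ?A"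
    proof
     fix h assume h: "h \<in> {h. leC (fL pos g) h \<and> leC h f}"
     then have "length h = sz" using leC_len by blast
     then have "h = fL pos (fU pos h)" by (simp add: fUL)
     moreover have "fU pos h \<in> ?A" using h fUL(2)[OF True] by (auto simp: leC_def)
     ultimately show "h \<in> fL pos ` ?A" by blast
    qed
    show "length h = sz" if "h \<in> fL pos ` ?A" for h using that lA by (auto simp: fUL_length)
    show "length (fL pos g) = sz" using True by (simp add: fUL_length)
   qed
   finally show ?thesis .
  next
   case False
   then have e: "?A = {}" by (auto simp: bruhat_le_def)
   show ?thesis unfolding e using x(2)[of "fL pos g"] leC_len[of "fL pos g" f] False by (auto simp: fUL_length)
  qed
 qed
 finally have 2: "bar_T b' (W.ex ?x) = W.ex ?x" .
 show ?thesis by (rule that[OF x(1-3) 1 2])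
qed

lemma expand_eq:
 "z \<in> A_completion (length b) ==> expand_U pos z = V.ex z"
 "z \<in> A_completion (length b') ==> expand_U' pos z = W.ex z"
proof -
 have "U_vec pos = (\<lambda>f g. unit_fvec f g + (if V.E f then qq * unit_fvec (down pos f) g else 0))"
  "U'_vec pos = (\<lambda>f g. unit_fvec f g + (if W.E f then qq * unit_fvec (up pos f) g else 0))"
  by (auto simp: U_vec_def U'_vec_def V.E_def W.E_def fun_eq_iff)
 then show "z \<in> A_completion (length b) ==> expand_U pos z = V.ex z"
  "z \<in> A_completion (length b') ==> expand_U' pos z = W.ex z"
  using V.cont_ext_ub[of z] W.cont_ext_ub[of z] by (simp_all add: expand_U_def expand_U'_def)
qed

text \<open>On coefficient functions the relabelling of basis vectors by \<open>fU\<close> is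
  precomposition with its inverse.\<close>

lemma R_u_eq:
 assumes "x \<in> A_completion sz"
 shows "R_u pos x = (\<lambda>g. x (fL pos g))"
proof
 fix g
 have l: "length f = sz" if "x f \<noteq> 0" for f using assms that by (auto simp: A_completion_def)
 have u: "x f * unit_fvec (fU pos f) g = (if f = fL pos g then x (fL pos g) else 0)" for f
 proof (cases "x f = 0 \<and> x (fL pos g) = 0")
  case False
  then have "length f = sz \<or> length g = sz" using l fUL_length by metis
  then have "f = fL pos g \<longleftrightarrow> g = fU pos f" using fUL fUL_length by metis
  then show ?thesis by (auto simp: unit_fvec_def)
 qed auto
 show "R_u pos x g = x (fL pos g)" unfolding R_u_def cont_ext_def u by simp
qed

abbreviation "CV \<equiv> \<lambda>g f. bruhat_less b g f \<and> bruhat_less b' (fU pos g) (fU pos f)"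
abbreviation "CW \<equiv> \<lambda>g f. bruhat_less b' g f \<and> bruhat_less b (fL pos g) (fL pos f)"

lemma C_A: "completion (length b) CV \<subseteq> A_completion sz"
 "completion (length b') CW \<subseteq> A_completion sz"
 unfolding lb by (rule completion_A; simp add: bruhat_less_def bruhat_le_def)+

lemma leC_CV: "leC g f ==> g \<noteq> f ==> CV g f" "leC g f ==> g \<noteq> f ==> CW (fU pos g) (fU pos f)"
proof -
 assume g: "leC g f" "g \<noteq> f"
 then have "fU pos g \<noteq> fU pos f" using leC_len[OF g(1)] fUL(1) by metis
 then show "CV g f" "CW (fU pos g) (fU pos f)"
  using g leC_len[OF g(1)] fUL(1)[of f] fUL(1)[of g] by (auto simp: leC_def bruhat_less_def)
qed

lemma completion_unit: "length f = n ==> x \<in> unitriangular R f ==> x \<in> completion n R"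
 unfolding completion_def by (rule fvec.span_base) auto

text \<open>A relabelling that carries one relation to the other maps unitriangular elements to
  unitriangular elements, hence the spans into each other.\<close>

lemma completion_map:
 assumes "x \<in> completion n R" "\<And>f. length f = n ==> length (h' f) = m \<and> h (h' f) = f"
  "\<And>f g. length f = n ==> h g = f \<or> R (h g) f ==> g = h' f \<or> S g (h' f)"
 shows "(\<lambda>g. x (h g)) \<in> completion m S"
 using assms(1) unfolding completion_def[of n R]
proof (induction rule: fvec.span_induct_alt)
 case base
 have "(0 :: fvec) \<in> completion m S" unfolding completion_def by (rule fvec.span_zero)
 then show ?case by (simp add: zero_fun_def)
next
 case (step c y z)
 then obtain f where f: "length f = n" "y \<in> unitriangular R f" by blast
 then have "(\<lambda>g. y (h g)) \<in> unitriangular S (h' f)"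
  using assms(2)[OF f(1)] assms(3)[OF f(1)] by (auto simp: unitriangular_def)
 then have "(\<lambda>g. y (h g)) \<in> completion m S"
  using assms(2)[OF f(1)] completion_unit by blast
 then have "(\<lambda>g. c * y (h g)) + (\<lambda>g. z (h g)) \<in> completion m S"
  using step(2) unfolding completion_def by (intro fvec.span_add fvec.span_scale)
 moreover have "(\<lambda>g. ((\<lambda>f. c * y f) + z) (h g)) = (\<lambda>g. c * y (h g)) + (\<lambda>g. z (h g))" by (simp add: fun_eq_iff)
 ultimately show ?case by simp
qed

lemma C_map:
 "x \<in> completion (length b) CV ==> (\<lambda>g. x (fL pos g)) \<in> completion (length b') CW"
 "x \<in> completion (length b') CW ==> (\<lambda>g. x (fU pos g)) \<in> completion (length b) CV"
proof -
 have len: "length g = sz"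
  if "length f = sz" "fL pos g = f \<or> CV (fL pos g) f \<or> fU pos g = f \<or> CW (fU pos g) f" for f g
  using that fUL_length[of g] by (auto simp: bruhat_less_def bruhat_le_def)
 show "x \<in> completion (length b) CV ==> (\<lambda>g. x (fL pos g)) \<in> completion (length b') CW"
  by (erule completion_map[where h' = "fU pos"]; unfold lb) (use len fUL fUL_length in metis)+
 show "x \<in> completion (length b') CW ==> (\<lambda>g. x (fU pos g)) \<in> completion (length b) CV"
  by (erule completion_map[where h' = "fL pos"]; unfold lb) (use len fUL fUL_length in metis)+
qed

lemma R_u_iso: "linear_iso_on (completion (length b) CV) (completion (length b') CW) (R_u pos)"
 unfolding linear_iso_on_def
proof (intro conjI ballI allI)
 let ?C = "completion (length b) CV" and ?D = "completion (length b') CW"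
 show sub: "fvec.subspace ?C" "fvec.subspace ?D" unfolding completion_def by (rule fvec.subspace_span)+
 have R: "R_u pos x = (\<lambda>g. x (fL pos g))" if "x \<in> ?C" for x using that C_A(1) R_u_eq by blast
 have wrong: "x f = 0" if "x \<in> ?C \<or> x \<in> ?D" "length f \<noteq> sz" for x f
  using that C_A by (auto simp: A_completion_def)
 show "bij_betw (R_u pos) ?C ?D"
 proof (rule bij_betwI[where g = "\<lambda>x g. x (fU pos g)"])
  show "R_u pos \<in> ?C \<rightarrow> ?D" using R C_map(1) by auto
  show "(\<lambda>x g. x (fU pos g)) \<in> ?D \<rightarrow> ?C" using C_map(2) by auto
  show "(\<lambda>g. R_u pos x (fU pos g)) = x" if x: "x \<in> ?C" for x
  proof
   fix g show "R_u pos x (fU pos g) = x g"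
    using fUL(1)[of g] wrong[of x g] wrong[of x "fL pos (fU pos g)"] x
    by (cases "length g = sz") (simp_all add: R fUL_length)
  qed
  show "R_u pos (\<lambda>g. y (fU pos g)) = y" if y: "y \<in> ?D" for y
  proof
   fix g show "R_u pos (\<lambda>g. y (fU pos g)) g = y g"
    unfolding R[OF C_map(2)[OF y]]
    using fUL(2)[of g] wrong[of y g] wrong[of y "fU pos (fL pos g)"] y
    by (cases "length g = sz") (simp_all add: fUL_length)
  qed
 qed
 fix x y assume "x \<in> ?C" "y \<in> ?C"
 then show "R_u pos (x + y) = R_u pos x + R_u pos y"
  using R fvec.subspace_add[OF sub(1)] by (simp add: fun_eq_iff)
next
 let ?C = "completion (length b) CV"
 fix c x assume x: "x \<in> ?C"
 have sub: "fvec.subspace ?C" unfolding completion_def by (rule fvec.subspace_span)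
 have R: "R_u pos x = (\<lambda>g. x (fL pos g))" if "x \<in> ?C" for x using that C_A(1) R_u_eq by blast
 show "R_u pos (\<lambda>f. c * x f) = (\<lambda>f. c * R_u pos x f)"
  using R[OF x] R[OF fvec.subspace_scale[OF sub x, of c]] by simp
qed

end

lemma length_01: "set b \<subseteq> {0, 1} ==> length b = count_list b 0 + count_list b (1::nat)"
 by (induction b) auto

theorem theorem5p15:
 fixes m n \<kappa> :: nat and b1 b2 b b' :: "nat list"
 assumes "b = b1 @ [0, 1] @ b2" and "b' = b1 @ [1, 0] @ b2"
  and "is_01_seq m n b" and "is_01_seq m n b'"
  and "\<kappa> = length b1"
 shows
  "(C_completion_U b b' \<kappa> \<subseteq> A_completion (m + n)
   \<and> C_completion_U' b b' \<kappa> \<subseteq> A_completion (m + n)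
   \<and> linear_iso_on (C_completion_U b b' \<kappa>) (C_completion_U' b b' \<kappa>) (R_u \<kappa>))
   \<and> (\<forall>f. length f = m + n -->
     canon_U b \<kappa> f \<in> C_completion_U b b' \<kappa> \<and> canon_U' b' \<kappa> f \<in> C_completion_U' b b' \<kappa>)
   \<and> (\<forall>f. length f = m + n -->
     R_u \<kappa> (unit_fvec f) = unit_fvec (fU \<kappa> f)
     \<and> R_u \<kappa> (canon_U b \<kappa> f) = canon_U' b' \<kappa> (fU \<kappa> f)
     \<and> canon_T b f \<in> expand_U \<kappa> ` B_completion b
     \<and> canon_T b' (fU \<kappa> f) \<in> expand_U' \<kappa> ` B_completion b'
     \<and> R_u \<kappa> (coord_U b \<kappa> (canon_T b f)) = coord_U' b' \<kappa> (canon_T b' (fU \<kappa> f)))"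
proof -
 have "set b1 \<subseteq> {0, 1}" "set b2 \<subseteq> {0, 1}" using assms(1,3) by (auto simp: is_01_seq_def)
 then interpret X: adjacent b1 b2 by unfold_locales
 note b = assms(1) and b' = assms(2) and \<kappa> = assms(5)
 have mn: "m + n = \<kappa> + 2 + length b2"
  using length_01[of b] assms(3) unfolding is_01_seq_def by (simp add: b \<kappa>)
 have C: "C_completion_U b b' \<kappa> = completion (length X.b) X.CV" "C_completion_U' b b' \<kappa> = completion (length X.b') X.CW"
  unfolding C_completion_U_def C_completion_U'_def b b' \<kappa> by (rule refl)+
 \<comment> \<open>One vector serves both sides: \<open>canonical\<close> is applied to x for b and
   to its relabelling \<open>R_u \<kappa> x\<close> for b'.\<close>
 have main: "\<exists>x. canon_U b \<kappa> f = x \<and> canon_U' b' \<kappa> (fU \<kappa> f) = R_u \<kappa> x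
   \<and> x \<in> C_completion_U b b' \<kappa> \<and> R_u \<kappa> x \<in> C_completion_U' b b' \<kappa>
   \<and> canon_T b f \<in> expand_U \<kappa> ` B_completion b \<and> canon_T b' (fU \<kappa> f) \<in> expand_U' \<kappa> ` B_completion b'
   \<and> coord_U b \<kappa> (canon_T b f) = x \<and> coord_U' b' \<kappa> (canon_T b' (fU \<kappa> f)) = R_u \<kappa> x"
  if f: "length f = m + n" for f
 proof -
  have lf: "length f = length b1 + 2 + length b2" using f mn by (simp add: \<kappa>)
  obtain x where x: "x f = 1" "\<And>g. x g \<noteq> 0 ==> X.leC g f" "\<And>g. g \<noteq> f ==> x g \<in> qZq"
   "bar_T X.b (X.V.ex x) = X.V.ex x"
   "bar_T X.b' (X.W.ex (\<lambda>g. x (fL (length b1) g))) = X.W.ex (\<lambda>g. x (fL (length b1) g))"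
   by (rule X.canonical_C[OF lf]) blast
  let ?x = "\<lambda>g. x (fL (length b1) g)" and ?f = "fU (length b1) f"
  have C1: "x \<in> unitriangular X.CV f"
   using x(1) x(2) X.leC_CV(1)[of _ f] by (auto simp: unitriangular_def)
  have V1: "x \<in> unitriangular (bruhat_less X.b) f" using C1 by (auto simp: unitriangular_def)
  have C2: "x \<in> completion (length X.b) X.CV" by (rule X.completion_unit[OF _ C1]) (use lf in simp)
  have R: "R_u \<kappa> x = ?x" using X.R_u_eq C2 X.C_A(1) unfolding \<kappa> by blast
  have fUf: "fL (length b1) ?f = f" by (rule X.fUL(1)[OF lf])
  have C3: "?x \<in> completion (length X.b') X.CW" by (rule X.C_map(1)[OF C2])
  have supp: "g = ?f \<or> X.CW g ?f" if "?x g \<noteq> 0" for g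
  proof -
   have le: "X.leC (fL (length b1) g) f" using x(2)[OF that] .
   then have lg: "length g = length b1 + 2 + length b2" using X.leC_len[OF le] by (simp add: X.fUL_length)
   show ?thesis using X.leC_CV(2)[OF le] X.fUL(2)[OF lg] fUf by (cases "fL (length b1) g = f") auto
  qed
  have W1: "?x \<in> unitriangular (bruhat_less X.b') ?f"
   using supp fUf x(1) by (auto simp: unitriangular_def)
  have W2: "?x g \<in> qZq" if "g \<noteq> ?f" for g
  proof (cases "?x g = 0")
   case False
   then have "fL (length b1) g \<noteq> f"
    using x(2)[OF False] X.leC_len[of "fL (length b1) g" f] X.fUL(2)[of g] that by (auto simp: X.fUL_length)
   then show ?thesis by (rule x(3))
  qed (simp add: qZq_0)
  have l: "length f = length X.b" "length ?f = length X.b'" using lf by (simp_all add: X.fUL_length)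
  note V = X.V.canonical[OF l(1) V1 _ x(4)] and W = X.W.canonical[OF l(2) W1 _ x(5)]
  have "canon_U b \<kappa> f = x" "coord_U b \<kappa> (canon_T b f) = x" "canon_T b f \<in> expand_U \<kappa> ` B_completion b"
   unfolding canon_U_def coord_U_def b \<kappa> by (rule V; erule x(3) X.expand_eq)+
  moreover have "canon_U' b' \<kappa> (fU \<kappa> f) = R_u \<kappa> x" "coord_U' b' \<kappa> (canon_T b' (fU \<kappa> f)) = R_u \<kappa> x"
   "canon_T b' (fU \<kappa> f) \<in> expand_U' \<kappa> ` B_completion b'"
   unfolding R unfolding canon_U'_def coord_U'_def b' \<kappa> by (rule W; erule W2 X.expand_eq)+
  moreover have "x \<in> C_completion_U b b' \<kappa>" "R_u \<kappa> x \<in> C_completion_U' b b' \<kappa>"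
   unfolding R C by (rule C2 C3)+
  ultimately show ?thesis by blast
 qed
 \<comment> \<open>The results for b' are indexed by images under \<open>fU\<close>; every index is
   such an image.\<close>
 have surj: "\<exists>h. length h = m + n \<and> f = fU \<kappa> h" if "length f = m + n" for f
  using X.fUL(2)[of f] X.fUL_length(2)[of f] that mn unfolding \<kappa> by metis
 have unit: "R_u \<kappa> (unit_fvec f) = unit_fvec (fU \<kappa> f)" if f: "length f = m + n" for f
 proof -
  have lf: "length f = length b1 + 2 + length b2" using f mn by (simp add: \<kappa>)
  have "unit_fvec f \<in> A_completion (length b1 + 2 + length b2)"
   using lf by (auto simp: unit_fvec_def A_completion_def)
  then have "R_u \<kappa> (unit_fvec f) = (\<lambda>g. unit_fvec f (fL \<kappa> g))" unfolding \<kappa> by (rule X.R_u_eq)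
  also have "\<dots> = unit_fvec (fU \<kappa> f)"
  proof
   fix g
   have "fL \<kappa> g = f \<longleftrightarrow> g = fU \<kappa> f"
    using X.fUL(1)[OF lf] X.fUL(2)[of g] X.fUL_length(2)[of g] lf unfolding \<kappa> by metis
   then show "unit_fvec f (fL \<kappa> g) = unit_fvec (fU \<kappa> f) g" by (simp add: unit_fvec_def)
  qed
  finally show ?thesis .
 qed
 show ?thesis
 proof (intro conjI allI impI)
  show "C_completion_U b b' \<kappa> \<subseteq> A_completion (m + n)" "C_completion_U' b b' \<kappa> \<subseteq> A_completion (m + n)"
   using X.C_A unfolding C unfolding mn \<kappa> by blast+
  show "linear_iso_on (C_completion_U b b' \<kappa>) (C_completion_U' b b' \<kappa>) (R_u \<kappa>)"
   using X.R_u_iso unfolding C unfolding \<kappa> by blast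
  fix f :: "int list" assume f: "length f = m + n"
  show "canon_U b \<kappa> f \<in> C_completion_U b b' \<kappa>" "R_u \<kappa> (canon_U b \<kappa> f) = canon_U' b' \<kappa> (fU \<kappa> f)"
   "canon_T b f \<in> expand_U \<kappa> ` B_completion b" "canon_T b' (fU \<kappa> f) \<in> expand_U' \<kappa> ` B_completion b'"
   "R_u \<kappa> (coord_U b \<kappa> (canon_T b f)) = coord_U' b' \<kappa> (canon_T b' (fU \<kappa> f))"
   using main[OF f] by metis+
  show "canon_U' b' \<kappa> f \<in> C_completion_U' b b' \<kappa>" using surj[OF f] main by metis
  show "R_u \<kappa> (unit_fvec f) = unit_fvec (fU \<kappa> f)" by (rule unit[OF f])
 qed
qed

end
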